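(* Let $m\ge 4$ be an even integer, let $\gamma>0$, let $a_4,\dots,a_m$ be nonzero real numbers, and let $A_m,L_m$ be the real $m\times m$ matrices of Model II defined in the context. Let $u=u(t,x)\in\mathbb{R}^m$ be the solution of the Cauchy problem $$u_t+A_m u_x+L_m u=0\quad (t>0,\ x\in\mathbb{R}),\qquad u|_{t=0}=u_0 .$$ Then there are positive constants $C$ and $c$ such that the Fourier image $\hat u$ of $u$ satisfies the pointwise estimate $$|\hat u(t,\xi)|\le C e^{-c\lambda(\xi)t}\,|\hat u_0(\xi)|\qquad (t\ge 0,\ \xi\in\mathbb{R}),\qquad \lambda(\xi):=\frac{\xi^{3m-10}}{(1+\xi^2)^{2(m-3)}} .$$ Furthermore, let $s\ge 0$ be an integer and suppose that the initial data $u_0$ belong to $H^s\cap L^1$. Then the solution $u$ satisfies the decay estimate $$\|\partial_x^k u(t)\|_{L^2}\le C(1+t)^{-\frac{1}{3m-10}\left(\frac12+k\right)}\|u_0\|_{L^1}+C(1+t)^{-\frac{\ell}{m-2}}\|\partial_x^{k+\ell}u_0\|_{L^2}\qquad (t\ge 0)$$ for all nonnegative integers $k,\ell$ with $k+\ell\le s$, where $C$ is a positive constant.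
   Context: Model II matrices. $A_m$ is the real symmetric $m\times m$ matrix whose only nonzero entries are $(A_m)_{1,2}=(A_m)_{2,1}=1$ and $(A_m)_{2j-1,2j}=(A_m)_{2j,2j-1}=a_{2j}$ for $2\le j\le m/2$. $L_m$ is the $m\times m$ matrix whose only nonzero entries are $(L_m)_{2,2}=\gamma$, $(L_m)_{2,3}=1$, $(L_m)_{3,2}=-1$, and $(L_m)_{2j,2j+1}=a_{2j+1}$, $(L_m)_{2j+1,2j}=-a_{2j+1}$ for $2\le j\le m/2-1$ (the last family being empty when $m=4$). The hat denotes the Fourier transform in $x\in\mathbb{R}$ with frequency variable $\xi\in\mathbb{R}$, so that $\hat u$ satisfies $\hat u_t+i\xi A_m\hat u+L_m\hat u=0$, $\hat u(0,\xi)=\hat u_0(\xi)$. The initial datum $u_0=u_0(x)\in\mathbb{R}^m$ is a given function of $x\in\mathbb{R}$. $L^p=L^p(\mathbb{R})$ and $H^s=H^s(\mathbb{R})$ are the usual ($\mathbb{R}^m$-valued) Lebesgue and $L^2$-based Sobolev spaces. $C$ and $c$ denote generic positive constants, independent of $t$, $\xi$ and $u_0$. *)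

theory Defs
  imports "HOL-Analysis.Analysis"
begin

(* Vectors in R^m are of type real^'n with CARD('n) = m; the coordinates are numbered 1, ..., m
   along the linear order of the index type. *)
definition pos :: "'n::{finite,linorder} \<Rightarrow> nat" where
  "pos i = card {j. j \<le> i}"

definition entryA :: "nat \<Rightarrow> (nat \<Rightarrow> real) \<Rightarrow> nat \<Rightarrow> nat \<Rightarrow> real" where
  "entryA m a p q =
    (if {p, q} = {1, 2} then 1
     else if \<exists>j. 2 \<le> j \<and> 2 * j \<le> m \<and> {p, q} = {2 * j - 1, 2 * j} then a (max p q)
     else 0)"

(* j + 1 <= m / 2 is written 2 * j + 2 <= m. *)
definition entryL :: "nat \<Rightarrow> real \<Rightarrow> (nat \<Rightarrow> real) \<Rightarrow> nat \<Rightarrow> nat \<Rightarrow> real" where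
  "entryL m \<gamma> a p q =
    (if p = 2 \<and> q = 2 then \<gamma>
     else if p = 2 \<and> q = 3 then 1
     else if p = 3 \<and> q = 2 then - 1
     else if \<exists>j. 2 \<le> j \<and> 2 * j + 2 \<le> m \<and> p = 2 * j \<and> q = 2 * j + 1 then a q
     else if \<exists>j. 2 \<le> j \<and> 2 * j + 2 \<le> m \<and> p = 2 * j + 1 \<and> q = 2 * j then - a p
     else 0)"

definition matA :: "(nat \<Rightarrow> real) \<Rightarrow> ((real, 'n::{finite,linorder}) vec, 'n) vec" where
  "matA a = (\<chi> i j. entryA CARD('n) a (pos i) (pos j))"

definition matL :: "real \<Rightarrow> (nat \<Rightarrow> real) \<Rightarrow> ((real, 'n::{finite,linorder}) vec, 'n) vec" where
  "matL \<gamma> a = (\<chi> i j. entryL CARD('n) \<gamma> a (pos i) (pos j))"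

definition rate :: "nat \<Rightarrow> real \<Rightarrow> real" where
  "rate m \<xi> = \<xi> ^ (3 * m - 10) / (1 + \<xi>\<^sup>2) ^ (2 * (m - 3))"

(* Functions are taken as Borel representatives of their almost-everywhere classes. *)
definition in_Lp :: "real \<Rightarrow> (real \<Rightarrow> 'a::euclidean_space) \<Rightarrow> bool" where
  "in_Lp p f \<longleftrightarrow> f \<in> borel_measurable lborel \<and> integrable lborel (\<lambda>x. norm (f x) powr p)"

definition Lp_norm :: "real \<Rightarrow> (real \<Rightarrow> 'a::euclidean_space) \<Rightarrow> real" where
  "Lp_norm p f = (\<integral>x. norm (f x) powr p \<partial>lborel) powr (1 / p)"

(* Weak derivatives and Sobolev spaces on the line follow Brezis, Functional Analysis, Sobolev
   Spaces and PDE, Ch. 8: the test functions are the C^1 functions with compact support, and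
   the higher-order spaces are obtained inductively from the first-order one. *)
definition test_fun :: "(real \<Rightarrow> real) \<Rightarrow> bool" where
  "test_fun \<phi> \<longleftrightarrow> \<phi> C1_differentiable_on UNIV \<and> (\<exists>R. \<forall>x. \<bar>x\<bar> > R \<longrightarrow> \<phi> x = 0)"

definition has_weak_deriv :: "(real \<Rightarrow> 'a::euclidean_space) \<Rightarrow> (real \<Rightarrow> 'a) \<Rightarrow> bool" where
  "has_weak_deriv f g \<longleftrightarrow>
    (\<forall>\<phi>. test_fun \<phi> \<longrightarrow>
      (\<integral>x. deriv \<phi> x *\<^sub>R f x \<partial>lborel) = - (\<integral>x. \<phi> x *\<^sub>R g x \<partial>lborel))"

primrec sobolev :: "nat \<Rightarrow> (real \<Rightarrow> 'a::euclidean_space) \<Rightarrow> bool" where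
  "sobolev 0 f \<longleftrightarrow> in_Lp 2 f"
| "sobolev (Suc s) f \<longleftrightarrow> in_Lp 2 f \<and> (\<exists>g. has_weak_deriv f g \<and> sobolev s g)"

(* A representative of the weak derivative, which is unique almost everywhere;
   meaningful for f in H^1. *)
definition weak_deriv :: "(real \<Rightarrow> 'a::euclidean_space) \<Rightarrow> (real \<Rightarrow> 'a)" where
  "weak_deriv f = (SOME g. in_Lp 2 g \<and> has_weak_deriv f g)"

(* The Fourier transform of an integrable function; the value of the constant factor is
   immaterial for estimates that are homogeneous in the transform. *)
definition fourier :: "(real \<Rightarrow> real^'n) \<Rightarrow> real \<Rightarrow> complex^'n" where
  "fourier f \<xi> = (\<chi> i. \<integral>x. cis (- (x * \<xi>)) * complex_of_real (f x $ i) \<partial>lborel)"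

(* The Fourier-Plancherel transform on L^2: a representative of the L^2 limit of the transforms
   of the truncations. *)
definition fourier_L2 :: "(real \<Rightarrow> real^'n) \<Rightarrow> real \<Rightarrow> complex^'n" where
  "fourier_L2 f = (SOME g. in_Lp 2 g \<and>
    ((\<lambda>R. Lp_norm 2 (\<lambda>\<xi>. fourier (\<lambda>x. indicator {-R..R} x *\<^sub>R f x) \<xi> - g \<xi>)) \<longlongrightarrow> 0) at_top)"

(* u in C([0,oo); L^p) is the weak solution of u_t + A u_x + L u = 0, u(0) = u0: the x-derivative
   is moved onto the test function, and d/dt is taken of the tested solution (one-sided at 0).
   Values u t x with t < 0 play no role. *)
definition cauchy_solution ::
  "real \<Rightarrow> real^'n^'n \<Rightarrow> real^'n^'n \<Rightarrow> (real \<Rightarrow> real^'n) \<Rightarrow> (real \<Rightarrow> real \<Rightarrow> real^'n) \<Rightarrow> bool" where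
  "cauchy_solution p A L u0 u \<longleftrightarrow>
    in_Lp p u0 \<and>
    (\<forall>t\<ge>0. in_Lp p (u t)) \<and>
    (\<forall>t\<ge>0. ((\<lambda>r. Lp_norm p (\<lambda>x. u r x - u t x)) \<longlongrightarrow> 0) (at t within {0..})) \<and>
    (AE x in lborel. u 0 x = u0 x) \<and>
    (\<forall>\<phi>. test_fun \<phi> \<longrightarrow> (\<forall>t\<ge>0.
      ((\<lambda>r. \<integral>x. \<phi> x *\<^sub>R u r x \<partial>lborel) has_vector_derivative
        (A *v (\<integral>x. deriv \<phi> x *\<^sub>R u t x \<partial>lborel) - L *v (\<integral>x. \<phi> x *\<^sub>R u t x \<partial>lborel)))
      (at t within {0..})))"

end

theory Submission
  imports Defs "HOL-Probability.Probability"
begin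

text \<open>
  In frequency space the system is, for each \<open>\<xi>\<close>, an ordinary differential equation
  \<open>y' = - (i \<xi> A + L) y\<close>.  Multiplying the \<open>j\<close>-th coordinate by the power \<open>i^(j div 2)\<close> of the
  imaginary unit turns it into a chain of \<open>m\<close> nodes with real couplings,
  \<open>w_j' = b_(j-1) w_(j-1) - b_j w_(j+1)\<close>, where \<open>b_j\<close> is a constant multiple of \<open>\<xi>\<close> for odd \<open>j\<close> and a
  constant for even \<open>j\<close>, and where only node 2 carries the damping \<open>- \<gamma> w_2\<close>
  (lemma \<open>chain_of_model\<close>).  The coupling is skew, so \<open>|w|^2\<close> only loses the square of \<open>w_2\<close>.  The
  dissipation of the other nodes is recovered by adding to \<open>|w|^2\<close> a small multiple of products
  of components: one group produces \<open>- \<xi>^2 |w_1|^2 - |w_3|^2\<close>, another one passes the dissipation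
  of node \<open>j\<close> on to node \<open>j + 1\<close> for \<open>j \<ge> 3\<close>.  Every passage costs a factor
  \<open>\<xi>^2 / (1 + \<xi>^2)\<close> (\<open>j\<close> odd) or \<open>1 / (1 + \<xi>^2)\<close> (\<open>j\<close> even), and the first group needs the factor
  \<open>(\<xi>^2 / (1 + \<xi>^2))^(m-4) / (1 + \<xi>^2)\<close>.  The product of all factors is exactly \<open>rate m \<xi>\<close>, whence
  a quadratic form equivalent to \<open>|w|^2\<close>, uniformly in \<open>\<xi>\<close>, that decays at a rate proportional to
  \<open>rate m \<xi>\<close> (theorem \<open>chain_lyapunov\<close>).

  A Cauchy solution is only a weak solution, continuous in time with values in \<open>L^p\<close>.  Testing
  it with \<open>cutoff \<delta> x * cos (x \<xi>)\<close> and \<open>cutoff \<delta> x * sin (x \<xi>)\<close> shows that the transform of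
  \<open>cutoff \<delta> * u\<close> solves the equation above for each fixed \<open>\<xi>\<close>, up to a forcing term that comes from
  the derivative of the cut-off function and is of size \<open>\<delta>\<close> (lemma \<open>truncated_ode\<close>).  The Lyapunov
  form gives a bound with an error that vanishes as \<open>\<delta>\<close> tends to 0: for each \<open>\<xi>\<close> if \<open>p = 1\<close>, and
  in \<open>L^1\<close> with respect to \<open>\<xi>\<close> if \<open>p = 2\<close>, by the Plancherel identity.  This proves the pointwise
  estimates (theorems \<open>pointwise_L1\<close> and \<open>pointwise_L2\<close>).

  For the decay estimate, a weak derivative corresponds to multiplication of the transform by
  \<open>i \<xi>\<close>, so that Sobolev norms are moments of the transform (theorem \<open>sobolev_iff_fourier\<close>).  For
  \<open>|\<xi>| \<le> 1\<close> the transform of the datum is bounded by its \<open>L^1\<close> norm, the rate is at least a multiple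
  of \<open>|\<xi>|^(3 m - 10)\<close>, and scaling gives the powers of \<open>1 + t\<close>.  For \<open>|\<xi>| \<ge> 1\<close> the rate is at least
  a multiple of \<open>|\<xi>|^(- (m - 2))\<close>; each factor \<open>(1 + t)^(- 1 / (m - 2))\<close> in the norm is paid for by
  one derivative of the datum.
\<close>

section \<open>Bilinear forms on finite families of vectors\<close>

text \<open>
  Bilinear forms in the inner products of the nodes \<open>1, \<dots>, m\<close>.  Only the
  bound on the coefficients is recorded, because the coefficients of the Lyapunov form depend on
  \<open>\<xi>\<close> while its bound must not.
\<close>

definition bform :: "nat \<Rightarrow> real \<Rightarrow> ((nat \<Rightarrow> 'h::real_inner) \<Rightarrow> (nat \<Rightarrow> 'h) \<Rightarrow> real) \<Rightarrow> bool" where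
  "bform m c B \<longleftrightarrow> (\<exists>M. (\<forall>j k. \<bar>M j k\<bar> \<le> c) \<and>
     B = (\<lambda>w v. \<Sum>j=1..m. \<Sum>k=1..m. M j k * (w j \<bullet> v k)))"

lemma bform_single:
  assumes "j \<in> {1..m}" "k \<in> {1..m}" "\<bar>a\<bar> \<le> c"
  shows "bform m c (\<lambda>w v. a * (w j \<bullet> v k))"
proof -
  have "(\<lambda>w v. a * (w j \<bullet> v k)) = (\<lambda>w v. \<Sum>j'=1..m. \<Sum>k'=1..m.
     (if j' = j \<and> k' = k then a else 0) * ((w::nat \<Rightarrow> 'a) j' \<bullet> v k'))" (is "_ = ?R")
  proof (intro ext)
    fix w v :: "nat \<Rightarrow> 'a"
    have i: "(\<Sum>k'=1..m. (if j' = j \<and> k' = k then a else 0) * (w j' \<bullet> v k'))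
        = (if j' = j then (\<Sum>k'=1..m. if k' = k then a * (w j' \<bullet> v k') else 0) else 0)" for j'
    proof (cases "j' = j")
      case True
      show ?thesis unfolding True simp_thms if_True by (intro sum.cong refl) auto
    qed simp
    have "?R w v = (\<Sum>j'=1..m. if j' = j then (\<Sum>k'=1..m. if k' = k then a * (w j' \<bullet> v k') else 0) else 0)"
      by (intro sum.cong refl i)
    also have "\<dots> = a * (w j \<bullet> v k)" using assms by (simp add: sum.delta)
    finally show "a * (w j \<bullet> v k) = ?R w v" by simp
  qed
  moreover have "0 \<le> c" using assms by linarith
  ultimately show ?thesis unfolding bform_def using assms(3)
    by (intro exI[of _ "\<lambda>j' k'. if j' = j \<and> k' = k then a else 0"]) auto
qed

lemma bform_add:
  assumes "bform m c B" "bform m c' B'"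
  shows "bform m (c + c') (\<lambda>w v. B w v + B' w v)"
proof -
  obtain M where M: "\<And>j k. \<bar>M j k\<bar> \<le> c" "B = (\<lambda>w v. \<Sum>j=1..m. \<Sum>k=1..m. M j k * (w j \<bullet> v k))"
    using assms(1) unfolding bform_def by blast
  obtain M' where M': "\<And>j k. \<bar>M' j k\<bar> \<le> c'" "B' = (\<lambda>w v. \<Sum>j=1..m. \<Sum>k=1..m. M' j k * (w j \<bullet> v k))"
    using assms(2) unfolding bform_def by blast
  have "\<bar>M j k + M' j k\<bar> \<le> c + c'" for j k
    using M(1)[of j k] M'(1)[of j k] by linarith
  then show ?thesis unfolding bform_def
    by (intro exI[of _ "\<lambda>j k. M j k + M' j k"]) (auto simp: M(2) M'(2) distrib_right sum.distrib)
qed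

lemma bform_sum:
  assumes "finite S" "\<And>i. i \<in> S \<Longrightarrow> bform m c (B i)"
  shows "bform m (real (card S) * c) (\<lambda>w v. \<Sum>i\<in>S. B i w v)"
  using assms
proof (induction S)
  case empty
  then show ?case unfolding bform_def by (intro exI[of _ "\<lambda>j k. 0"]) auto
next
  case (insert i S)
  have "bform m (c + real (card S) * c) (\<lambda>w v. B i w v + (\<Sum>i\<in>S. B i w v))"
    by (rule bform_add) (use insert in auto)
  then show ?case using insert by (simp add: algebra_simps)
qed

lemma bform_scale:
  assumes "bform m c B"
  shows "bform m (\<bar>a\<bar> * c) (\<lambda>w v. a * B w v)"
proof -
  obtain M where M: "\<And>j k. \<bar>M j k\<bar> \<le> c" "B = (\<lambda>w v. \<Sum>j=1..m. \<Sum>k=1..m. M j k * (w j \<bullet> v k))"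
    using assms(1) unfolding bform_def by blast
  have "\<bar>a * M j k\<bar> \<le> \<bar>a\<bar> * c" for j k
    using mult_left_mono[OF M(1)[of j k], of "\<bar>a\<bar>"] by (simp add: abs_mult)
  then show ?thesis unfolding bform_def
    by (intro exI[of _ "\<lambda>j k. a * M j k"]) (auto simp: M(2) sum_distrib_left mult.assoc)
qed

lemma bform_mono: "bform m c B \<Longrightarrow> c \<le> c' \<Longrightarrow> bform m c' B"
  unfolding bform_def by (elim exE conjE, rule_tac x=M in exI) (blast intro: order_trans)

lemma bform_add_right:
  assumes "bform m c B"
  shows "B w (\<lambda>j. v j + v' j) = B w v + B w v'"
  using assms unfolding bform_def
  by (auto simp: inner_add_right distrib_left sum.distrib)

lemma bform_add_left:
  assumes "bform m c B"
  shows "B (\<lambda>j. v j + v' j) w = B v w + B v' w"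
  using assms unfolding bform_def
  by (auto simp: inner_add_left distrib_left sum.distrib)

text \<open>
  The discriminant form of Young's inequality; all absorptions of cross terms below are
  instances.
\<close>

lemma young_inner:
  fixes u v :: "'h::real_inner"
  assumes "c\<^sup>2 \<le> 4 * A * B" "0 \<le> A" "0 \<le> B"
  shows "c * (u \<bullet> v) \<le> A * (u \<bullet> u) + B * (v \<bullet> v)"
proof -
  have a: "\<bar>c\<bar> \<le> 2 * (sqrt A * sqrt B)"
  proof (rule power2_le_imp_le)
    show "\<bar>c\<bar>\<^sup>2 \<le> (2 * (sqrt A * sqrt B))\<^sup>2"
      using assms by (simp add: power_mult_distrib)
  qed (use assms in auto)
  have "c * (u \<bullet> v) \<le> \<bar>c\<bar> * (norm u * norm v)"
    by (metis Cauchy_Schwarz_ineq2 abs_ge_self abs_ge_zero abs_mult dual_order.trans mult_left_mono)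
  also have "\<dots> \<le> 2 * (sqrt A * sqrt B) * (norm u * norm v)"
    by (intro mult_right_mono a) auto
  also have "\<dots> \<le> (sqrt A * norm u)\<^sup>2 + (sqrt B * norm v)\<^sup>2"
    using sum_squares_bound[of "sqrt A * norm u" "sqrt B * norm v"] by (simp add: algebra_simps)
  also have "\<dots> = A * (u \<bullet> u) + B * (v \<bullet> v)"
    using assms by (simp add: power_mult_distrib power2_norm_eq_inner)
  finally show ?thesis .
qed

text \<open>
  The free parameter \<open>\<delta>\<close> allows a small first argument to be traded against
  a large second one.
\<close>

lemma bform_bound:
  assumes "bform m c B" "\<delta> > 0"
  shows "\<bar>B w v\<bar> \<le> c * real m * (\<delta> * (\<Sum>j=1..m. (norm (w j))\<^sup>2) + (\<Sum>j=1..m. (norm (v j))\<^sup>2) / \<delta>)"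
proof -
  obtain M where M: "\<And>j k. \<bar>M j k\<bar> \<le> c" "B = (\<lambda>w v. \<Sum>j=1..m. \<Sum>k=1..m. M j k * (w j \<bullet> v k))"
    using assms(1) unfolding bform_def by blast
  have c0: "0 \<le> c" using M(1)[of 0 0] by linarith
  have y: "\<bar>M j k * (w j \<bullet> v k)\<bar> \<le> c * \<delta> * (norm (w j))\<^sup>2 + c / \<delta> * (norm (v k))\<^sup>2" for j k
  proof -
    have "(M j k)\<^sup>2 \<le> c\<^sup>2" using M(1)[of j k] by (simp add: abs_le_square_iff[symmetric])
    also have "c\<^sup>2 \<le> 4 * c\<^sup>2" by simp
    also have "\<dots> = 4 * (c * \<delta>) * (c / \<delta>)" using assms(2) by (simp add: power2_eq_square)
    finally have *: "(M j k)\<^sup>2 \<le> 4 * (c * \<delta>) * (c / \<delta>)" .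
    show ?thesis
      using young_inner[OF *, of "w j" "v k"] young_inner[of "- M j k" "c * \<delta>" "c / \<delta>" "w j" "v k"] *
        assms(2) c0
      by (simp add: power2_norm_eq_inner abs_le_iff)
  qed
  have "\<bar>B w v\<bar> \<le> (\<Sum>j=1..m. \<Sum>k=1..m. \<bar>M j k * (w j \<bullet> v k)\<bar>)"
    unfolding M(2) by (rule order_trans[OF sum_abs]) (intro sum_mono sum_abs)
  also have "\<dots> \<le> (\<Sum>j=1..m. \<Sum>k=1..m. c * \<delta> * (norm (w j))\<^sup>2 + c / \<delta> * (norm (v k))\<^sup>2)"
    by (intro sum_mono y)
  also have "\<dots> = c * real m * (\<delta> * (\<Sum>j=1..m. (norm (w j))\<^sup>2) + (\<Sum>j=1..m. (norm (v j))\<^sup>2) / \<delta>)"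
    by (simp add: sum.distrib sum_distrib_left sum_distrib_right algebra_simps sum_divide_distrib)
  finally show ?thesis .
qed

lemma bform_has_derivative:
  assumes "bform m c B"
    and "\<And>j. j \<in> {1..m} \<Longrightarrow> ((\<lambda>t. w t j) has_vector_derivative w' j) (at t within S)"
  shows "((\<lambda>t. B (w t) (w t)) has_real_derivative (B w' (w t) + B (w t) w')) (at t within S)"
proof -
  obtain M where M: "\<And>j k. \<bar>M j k\<bar> \<le> c" "B = (\<lambda>w v. \<Sum>j=1..m. \<Sum>k=1..m. M j k * (w j \<bullet> v k))"
    using assms(1) unfolding bform_def by blast
  have d: "((\<lambda>t. w t j \<bullet> w t k) has_real_derivative (w' j \<bullet> w t k + w t j \<bullet> w' k)) (at t within S)"
    if "j \<in> {1..m}" "k \<in> {1..m}" for j k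
    using bounded_bilinear.has_vector_derivative[OF bounded_bilinear_inner assms(2)[OF that(1)] assms(2)[OF that(2)]]
    by (simp add: has_real_derivative_iff_has_vector_derivative add.commute)
  have "((\<lambda>t. \<Sum>j=1..m. \<Sum>k=1..m. M j k * (w t j \<bullet> w t k)) has_real_derivative
     (\<Sum>j=1..m. \<Sum>k=1..m. M j k * (w' j \<bullet> w t k + w t j \<bullet> w' k))) (at t within S)"
    by (intro DERIV_sum DERIV_cmult d)
  then show ?thesis by (simp add: M(2) sum.distrib distrib_left)
qed

section \<open>A Lyapunov form for a damped chain\<close>

text \<open>
  The coupling is skew-adjoint and node 2 alone is damped; the nodes \<open>0\<close> and
  \<open>m + 1\<close> are cut off by requiring \<open>b 0 = 0\<close> and
  \<open>b m = 0\<close>.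
\<close>

definition chain :: "(nat \<Rightarrow> real) \<Rightarrow> real \<Rightarrow> (nat \<Rightarrow> 'h::real_inner) \<Rightarrow> nat \<Rightarrow> 'h" where
  "chain b \<gamma> w j = b (j - 1) *\<^sub>R w (j - 1) - b j *\<^sub>R w (j + 1) - (if j = 2 then \<gamma> *\<^sub>R w 2 else 0)"

text \<open>
  The coupling terms telescope, so the damping of node 2 is all that is left.
\<close>

lemma chain_energy:
  fixes w :: "nat \<Rightarrow> 'h::real_inner"
  assumes "b 0 = 0" "b m = 0" "m \<ge> 2"
  shows "(\<Sum>j=1..m. chain b \<gamma> w j \<bullet> w j) = - \<gamma> * (w 2 \<bullet> w 2)"
proof -
  have t: "(\<Sum>j=1..k. b (j - 1) * (w (j - 1) \<bullet> w j) - b j * (w j \<bullet> w (j + 1)))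
     = b 0 * (w 0 \<bullet> w 1) - b k * (w k \<bullet> w (k + 1))" for k
    by (induction k) auto
  have c: "chain b \<gamma> w j \<bullet> w j = (b (j - 1) * (w (j - 1) \<bullet> w j) - b j * (w j \<bullet> w (j + 1)))
      + (if j = 2 then - \<gamma> * (w 2 \<bullet> w 2) else 0)" for j
    unfolding chain_def inner_diff_left inner_commute[of "w j" "w (j + 1)"] by auto
  have "(\<Sum>j=1..m. chain b \<gamma> w j \<bullet> w j)
     = (\<Sum>j=1..m. (b (j - 1) * (w (j - 1) \<bullet> w j) - b j * (w j \<bullet> w (j + 1)))
          + (if j = 2 then - \<gamma> * (w 2 \<bullet> w 2) else 0))"
    by (intro sum.cong refl c)
  also have "\<dots> = - \<gamma> * (w 2 \<bullet> w 2)"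
    using assms t[of m] unfolding sum.distrib by (simp add: sum.delta)
  finally show ?thesis .
qed

text \<open>
  A chain at a fixed frequency \<open>\<xi> \<noteq> 0\<close>.  The bounds \<open>K\<close> and
  \<open>\<eta>\<close> are parameters, chosen independently of \<open>\<xi>\<close>, so that
  constants built from them are uniform in the frequency.
\<close>

locale damped_chain =
  fixes n m :: nat and \<xi> K \<gamma> \<eta> :: real and \<alpha> b :: "nat \<Rightarrow> real"
  assumes m: "m = 2 * n" and n: "n \<ge> 2" and \<xi>: "\<xi> \<noteq> 0"
    and K: "K \<ge> 1" and \<gamma>: "\<gamma> > 0"
    and \<eta>: "0 < \<eta>" "\<eta> * (1 + 4 * K\<^sup>2) \<le> 1 / 8"
    and \<alpha>: "\<And>j. 1 \<le> j \<Longrightarrow> j < m \<Longrightarrow> 1 / K \<le> \<bar>\<alpha> j\<bar> \<and> \<bar>\<alpha> j\<bar> \<le> K" "\<alpha> 1 = 1" "\<alpha> 2 = 1"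
    and b: "\<And>j. b j = (if 1 \<le> j \<and> j < m then (if odd j then \<xi> else 1) * \<alpha> j else 0)"
begin

text \<open>
  The weights \<open>p\<close> and \<open>q\<close> are the losses at odd and even nodes.  The weight \<open>d j\<close> is the
  coefficient with which the dissipation of node \<open>j\<close> is recovered; it starts with \<open>d 3 = \<omega>\<close>.  The
  exponents of \<open>\<eta>\<close> decrease by 2 along the chain, so that each weight lies below the geometric
  mean of its two neighbours by the factor \<open>\<eta>\<close>, up to factors \<open>\<beta>\<close> that match the couplings;
  this is what Young's inequality asks for.
\<close>

definition "p = \<xi>\<^sup>2 / (1 + \<xi>\<^sup>2)"
definition "q = 1 / (1 + \<xi>\<^sup>2)"
definition "\<omega> = p ^ (m - 4) * q"
definition "\<beta> j = (if odd j then p else q)" for j :: nat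
definition "d j = \<omega> * (\<Prod>i=3..<j. \<eta> ^ (2 * (m - i)) * \<beta> i)" for j
definition "r k = 1 / b 3 * (\<Prod>i=2..<k. b (2 * i) / b (2 * i + 1))" for k

lemma pq: "0 < p" "p < 1" "0 < q" "q \<le> 1" "q * \<xi>\<^sup>2 = p" "p + q = 1" "p \<le> \<xi>\<^sup>2"
proof -
  have s: "0 < \<xi>\<^sup>2" "0 < 1 + \<xi>\<^sup>2" using \<xi> by (auto simp: add_pos_nonneg)
  show "0 < p" "p < 1" "0 < q" "q \<le> 1" "q * \<xi>\<^sup>2 = p" "p + q = 1" "p \<le> \<xi>\<^sup>2"
    using s by (simp_all add: p_def q_def divide_simps) (simp add: algebra_simps)?
qed

lemma \<eta>1: "\<eta> \<le> 1 / 8" "\<eta> < 1"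
proof -
  have "\<eta> * 1 \<le> \<eta> * (1 + 4 * K\<^sup>2)" using \<eta>(1) by (intro mult_left_mono) auto
  then show "\<eta> \<le> 1 / 8" "\<eta> < 1" using \<eta>(2) by auto
qed

lemma \<beta>: "0 < \<beta> j" "\<beta> j \<le> 1"
  using pq by (auto simp: \<beta>_def)

lemma \<omega>: "0 < \<omega>" "\<omega> \<le> q" "\<omega> \<le> 1" "\<omega> * \<xi>\<^sup>2 = p ^ (m - 4) * p" "\<omega> * (1 + \<xi>\<^sup>2) \<le> 1" "\<omega> * \<xi>\<^sup>2 \<le> p"
proof -
  have pp: "0 < p ^ (m - 4)" "p ^ (m - 4) \<le> 1" using pq by (auto intro: power_le_one)
  show "0 < \<omega>" using pp pq by (simp add: \<omega>_def)
  show "\<omega> \<le> q" using pp pq by (simp add: \<omega>_def mult_left_le_one_le)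
  then show "\<omega> \<le> 1" using pq by simp
  show e: "\<omega> * \<xi>\<^sup>2 = p ^ (m - 4) * p" using pq(5) by (simp add: \<omega>_def mult.assoc)
  show "\<omega> * \<xi>\<^sup>2 \<le> p" unfolding e using pp pq by (simp add: mult_left_le_one_le)
  have "\<omega> * (1 + \<xi>\<^sup>2) \<le> q * (1 + \<xi>\<^sup>2)" using \<open>\<omega> \<le> q\<close> by (intro mult_right_mono) auto
  also have "q * (1 + \<xi>\<^sup>2) = 1" using pq by (simp add: algebra_simps)
  finally show "\<omega> * (1 + \<xi>\<^sup>2) \<le> 1" .
qed

lemma d_3: "d 3 = \<omega>" by (simp add: d_def)

lemma d_Suc: "j \<ge> 3 \<Longrightarrow> d (Suc j) = \<eta> ^ (2 * (m - j)) * \<beta> j * d j"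
  by (simp add: d_def mult_ac)

lemma d_pos: "0 < d j"
  unfolding d_def by (intro mult_pos_pos prod_pos ballI conjI zero_less_power \<omega>(1) \<eta>(1) \<beta>(1))

lemma d_Suc_le:
  assumes "3 \<le> j" "j < m"
  shows "d (Suc j) \<le> \<eta> * d j" "d (Suc j) \<le> d j" "d (Suc j) \<le> \<beta> j * d j"
proof -
  have e: "\<eta> ^ (2 * (m - j)) \<le> \<eta>"
    using power_decreasing[of 1 "2 * (m - j)" \<eta>] \<eta> \<eta>1 assms by auto
  have "\<eta> ^ (2 * (m - j)) * \<beta> j \<le> \<eta> * 1"
    using e \<beta>[of j] \<eta> by (intro mult_mono) auto
  then show 1: "d (Suc j) \<le> \<eta> * d j"
    using d_pos[of j] assms by (simp add: d_Suc)
  have "\<eta> * d j \<le> 1 * d j" using \<eta>1 d_pos[of j] by (intro mult_right_mono) auto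
  with 1 show "d (Suc j) \<le> d j" by simp
  have "\<eta> ^ (2 * (m - j)) * (\<beta> j * d j) \<le> 1 * (\<beta> j * d j)"
    using e \<eta>1 \<beta>[of j] d_pos[of j] by (intro mult_right_mono) auto
  then show "d (Suc j) \<le> \<beta> j * d j" using assms by (simp add: d_Suc mult.assoc)
qed

lemma d_antimono:
  assumes "3 \<le> i" "i \<le> j" "j \<le> m"
  shows "d j \<le> d i"
  using assms(2,3)
proof (induction j rule: dec_induct)
  case (step k)
  then show ?case using d_Suc_le(2)[of k] assms(1) by auto
qed simp

lemma b_sq:
  assumes "1 \<le> j" "j < m"
  shows "b j \<noteq> 0" "(b j)\<^sup>2 \<le> K\<^sup>2 * (\<beta> j / q)" "\<beta> j / q \<le> K\<^sup>2 * (b j)\<^sup>2"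
proof -
  have pq': "p / q = \<xi>\<^sup>2" using pq by (simp add: field_simps)
  have a: "1 / K \<le> \<bar>\<alpha> j\<bar>" "\<bar>\<alpha> j\<bar> \<le> K" using \<alpha>(1) assms by auto
  have a0: "0 < \<bar>\<alpha> j\<bar>" using a K by (smt (verit) divide_pos_pos)
  then show "b j \<noteq> 0" using assms \<xi> by (auto simp: b)
  have 1: "(\<alpha> j)\<^sup>2 \<le> K\<^sup>2" using a(2) K by (simp add: abs_le_square_iff[symmetric])
  have "1 \<le> K * \<bar>\<alpha> j\<bar>" using a(1) K by (simp add: field_simps)
  then have "1\<^sup>2 \<le> (K * \<bar>\<alpha> j\<bar>)\<^sup>2" by (rule power_mono) simp
  then have 2: "1 \<le> K\<^sup>2 * (\<alpha> j)\<^sup>2" by (simp add: power_mult_distrib)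
  have "\<beta> j / q = (if odd j then \<xi>\<^sup>2 else 1)" using pq' pq(3) by (simp add: \<beta>_def)
  then have e: "(b j)\<^sup>2 = (\<beta> j / q) * (\<alpha> j)\<^sup>2"
    using assms by (simp add: b power_mult_distrib)
  have g: "0 < \<beta> j / q" using \<beta> pq by simp
  show "(b j)\<^sup>2 \<le> K\<^sup>2 * (\<beta> j / q)"
    using mult_left_mono[OF 1, of "\<beta> j / q"] g by (simp add: e mult.commute)
  show "\<beta> j / q \<le> K\<^sup>2 * (b j)\<^sup>2"
    using mult_left_mono[OF 2, of "\<beta> j / q"] g by (simp add: e algebra_simps)
qed

lemma b_ratio:
  assumes "1 \<le> i" "i < m" "1 \<le> j" "j < m"
  shows "(b i / b j)\<^sup>2 \<le> K ^ 4 * (\<beta> i / \<beta> j)"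
proof -
  have "(b i)\<^sup>2 * (\<beta> j / q) \<le> (K\<^sup>2 * (\<beta> i / q)) * (K\<^sup>2 * (b j)\<^sup>2)"
    using b_sq[OF assms(1,2)] b_sq[OF assms(3,4)] \<beta> pq by (intro mult_mono) (auto simp: less_imp_le)
  also have "\<dots> = K ^ 4 * (\<beta> i / q) * (b j)\<^sup>2" by (simp add: power_numeral_reduce)
  finally have "(b i)\<^sup>2 * \<beta> j \<le> K ^ 4 * \<beta> i * (b j)\<^sup>2"
    using pq by (simp add: divide_simps)
  moreover have "0 < (b j)\<^sup>2" using b_sq(1)[OF assms(3,4)] by simp
  ultimately show ?thesis using \<beta>[of j]
    by (simp add: power_divide divide_simps mult.commute)
qed

end

context damped_chain
begin

lemma d_Suc_ge:
  assumes "3 \<le> j"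
  shows "\<eta> ^ (2 * m) * \<beta> j * d j \<le> d (Suc j)"
proof -
  have "\<eta> ^ (2 * m) \<le> \<eta> ^ (2 * (m - j))"
    using \<eta> \<eta>1 by (intro power_decreasing) auto
  then show ?thesis unfolding d_Suc[OF assms]
    using \<beta>[of j] d_pos[of j] by (intro mult_right_mono) auto
qed

definition "G = K ^ 4 / \<eta> ^ (4 * m)"

lemma G: "1 \<le> G" "K\<^sup>2 / \<eta> ^ (2 * m) \<le> G"
proof -
  have e: "\<eta> ^ (4 * m) \<le> \<eta> ^ (2 * m)" "\<eta> ^ (4 * m) \<le> 1" "0 < \<eta> ^ (4 * m)"
    using \<eta> \<eta>1 by (auto intro: power_decreasing power_le_one)
  have k: "1 \<le> K ^ 4" "K\<^sup>2 \<le> K ^ 4"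
    using K by (auto intro: one_le_power power_increasing)
  show "1 \<le> G" unfolding G_def using e k by (simp add: le_divide_eq)
  show "K\<^sup>2 / \<eta> ^ (2 * m) \<le> G" unfolding G_def using e k by (intro frac_le) auto
qed

lemma r_2: "r 2 = 1 / b 3" by (simp add: r_def)

lemma r_Suc: "2 \<le> k \<Longrightarrow> r (Suc k) = r k * (b (2 * k) / b (2 * k + 1))"
  by (simp add: r_def)

lemma b_12: "b 0 = 0" "b m = 0" "b 1 = \<xi>" "b (Suc 0) = \<xi>" "b 2 = 1"
  using m n \<alpha>(2,3) by (auto simp: b)

lemma b3_sq: "(b 3)\<^sup>2 \<le> K\<^sup>2 * \<xi>\<^sup>2" "p \<le> K\<^sup>2 * (b 3)\<^sup>2 * q" "b 3 \<noteq> 0"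
proof -
  have "p / q = \<xi>\<^sup>2" using pq by (simp add: field_simps)
  then show "(b 3)\<^sup>2 \<le> K\<^sup>2 * \<xi>\<^sup>2" "b 3 \<noteq> 0"
    using b_sq[of 3] m n by (simp_all add: \<beta>_def)
  show "p \<le> K\<^sup>2 * (b 3)\<^sup>2 * q"
    using b_sq(3)[of 3] m n pq by (simp add: \<beta>_def divide_simps)
qed

text \<open>
  Young's inequality will absorb the product of \<open>w 2\<close> and \<open>w (2 * k)\<close>
  only if the square of its coefficient is at most a constant times \<open>d (2 * k)\<close>.  A
  step of the induction multiplies the square by \<open>q / p\<close> but
  \<open>d (2 * k)\<close> by \<open>p * q\<close>; the factor \<open>p ^ (m - 4)\<close> in
  \<open>\<omega>\<close> pays for the difference \<open>p\<^sup>2\<close>, and the remaining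
  power \<open>p ^ (m - 2 * k)\<close> keeps the account.
\<close>

lemma r_sq:
  assumes "2 \<le> k" "2 * k \<le> m"
  shows "(\<omega> * \<xi>\<^sup>2 * r k)\<^sup>2 \<le> G ^ k * d (2 * k) * p ^ (m - 2 * k)"
  using assms
proof (induction k rule: dec_induct)
  case base
  have d4: "\<eta> ^ (2 * m) * p * \<omega> \<le> d 4"
    using d_Suc_ge[of 3] d_3 by (simp add: \<beta>_def)
  have "(\<omega> * \<xi>\<^sup>2 * r 2)\<^sup>2 = (\<omega> * \<xi>\<^sup>2)\<^sup>2 / (b 3)\<^sup>2" by (simp add: r_2 power_divide)
  also have "\<dots> \<le> (\<omega> * \<xi>\<^sup>2)\<^sup>2 * (K\<^sup>2 * q / p)"
  proof -
    have "1 / (b 3)\<^sup>2 \<le> K\<^sup>2 * q / p" using b3_sq(2,3) pq by (simp add: field_simps)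
    then show ?thesis using mult_left_mono[of "1 / (b 3)\<^sup>2" "K\<^sup>2 * q / p" "(\<omega> * \<xi>\<^sup>2)\<^sup>2"] by simp
  qed
  also have "\<dots> = \<omega> * (\<omega> * \<xi>\<^sup>2) * (\<xi>\<^sup>2 * q) * (K\<^sup>2 / p)" by (simp add: power2_eq_square)
  also have "\<dots> = K\<^sup>2 * (p * \<omega>) * p ^ (m - 4)"
    using pq by (simp add: \<omega>(4) mult.commute[of "\<xi>\<^sup>2"])
  also have "\<dots> = (K\<^sup>2 / \<eta> ^ (2 * m)) * (\<eta> ^ (2 * m) * p * \<omega>) * p ^ (m - 4)"
    using \<eta> by simp
  also have "\<dots> \<le> G\<^sup>2 * d 4 * p ^ (m - 4)"
  proof (intro mult_mono d4)
    have "K\<^sup>2 / \<eta> ^ (2 * m) \<le> G" by (rule G)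
    also have "G \<le> G\<^sup>2" using G(1) by (simp add: power2_eq_square)
    finally show "K\<^sup>2 / \<eta> ^ (2 * m) \<le> G\<^sup>2" .
  qed (use pq \<omega> \<eta> d_pos[of 4] in \<open>auto intro!: mult_nonneg_nonneg simp: less_imp_le\<close>)
  finally show ?case by simp
next
  case (step k)
  then have k: "2 \<le> k" "2 * k + 2 \<le> m" by auto
  have IH: "(\<omega> * \<xi>\<^sup>2 * r k)\<^sup>2 \<le> G ^ k * d (2 * k) * p ^ (m - 2 * k)" using step by auto
  have be: "\<beta> (2 * k) = q" "\<beta> (2 * k + 1) = p" by (auto simp: \<beta>_def)
  have dd: "\<eta> ^ (4 * m) * p * q * d (2 * k) \<le> d (2 * k + 2)"
  proof -
    have "\<eta> ^ (2 * m) * p * (\<eta> ^ (2 * m) * q * d (2 * k)) \<le> \<eta> ^ (2 * m) * p * d (2 * k + 1)"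
      using d_Suc_ge[of "2 * k"] k be pq \<eta> by (intro mult_left_mono) auto
    also have "\<dots> \<le> d (2 * k + 2)" using d_Suc_ge[of "2 * k + 1"] k be by simp
    moreover have "\<eta> ^ (4 * m) = \<eta> ^ (2 * m) * \<eta> ^ (2 * m)" by (simp flip: power_add)
    ultimately show ?thesis by (simp add: mult_ac)
  qed
  have pm: "p ^ (m - 2 * k) = p * p * p ^ (m - 2 * Suc k)"
  proof -
    have "m - 2 * k = Suc (Suc (m - 2 * Suc k))" using k by simp
    then show ?thesis by simp
  qed
  have "(\<omega> * \<xi>\<^sup>2 * r (Suc k))\<^sup>2 = (\<omega> * \<xi>\<^sup>2 * r k)\<^sup>2 * (b (2 * k) / b (2 * k + 1))\<^sup>2"
    using k by (simp add: r_Suc power_mult_distrib power_divide)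
  also have "\<dots> \<le> (G ^ k * d (2 * k) * p ^ (m - 2 * k)) * (K ^ 4 * (q / p))"
    using IH b_ratio[of "2 * k" "2 * k + 1"] k be order_trans[OF zero_le_power2 IH] by (intro mult_mono) auto
  also have "\<dots> = G ^ k * (K ^ 4 / \<eta> ^ (4 * m)) * (\<eta> ^ (4 * m) * p * q * d (2 * k)) * p ^ (m - 2 * Suc k)"
    unfolding pm using pq(1) \<eta>(1) by (simp add: field_simps)
  also have "\<dots> \<le> G ^ k * (K ^ 4 / \<eta> ^ (4 * m)) * d (2 * k + 2) * p ^ (m - 2 * Suc k)"
    using dd pq G K \<eta> by (intro mult_right_mono mult_left_mono) auto
  also have "\<dots> = G ^ Suc k * d (2 * Suc k) * p ^ (m - 2 * Suc k)" by (simp add: G_def)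
  finally show ?case .
qed

lemma r_sq':
  assumes "k \<in> {2..n}"
  shows "(\<omega> * \<xi>\<^sup>2 * r k)\<^sup>2 \<le> G ^ m * d (2 * k)"
proof -
  have "(\<omega> * \<xi>\<^sup>2 * r k)\<^sup>2 \<le> G ^ k * d (2 * k) * p ^ (m - 2 * k)" using assms m by (intro r_sq) auto
  also have "\<dots> \<le> G ^ m * d (2 * k) * 1"
    using G assms m d_pos[of "2 * k"] pq by (intro mult_mono power_increasing power_le_one mult_nonneg_nonneg) auto
  finally show ?thesis by simp
qed

text \<open>
  The weights \<open>r\<close> are chosen for this cancellation: the sum ends at node
  \<open>2 * n = m\<close>, where the chain is cut off.
\<close>

lemma chain_telescope:
  fixes w :: "nat \<Rightarrow> 'h::real_inner"
  shows "(\<Sum>k=2..n. r k *\<^sub>R chain b \<gamma> w (2 * k)) = w 3"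
proof -
  have "(\<Sum>i=2..k. r i *\<^sub>R chain b \<gamma> w (2 * i)) = w 3 - (r k * b (2 * k)) *\<^sub>R w (2 * k + 1)"
    if "2 \<le> k" "k \<le> n" for k
    using that
  proof (induction k rule: dec_induct)
    case base
    then show ?case using b3_sq(3) by (simp add: chain_def r_2 algebra_simps)
  next
    case (step k)
    have nz: "b (2 * k + 1) \<noteq> 0" using step m by (intro b_sq) auto
    have "chain b \<gamma> w (2 * Suc k) = b (2 * k + 1) *\<^sub>R w (2 * k + 1) - b (2 * Suc k) *\<^sub>R w (2 * Suc k + 1)"
      using step by (simp add: chain_def)
    moreover have "r (Suc k) * b (2 * k + 1) = r k * b (2 * k)"
      using nz step by (simp add: r_Suc)
    ultimately have "r (Suc k) *\<^sub>R chain b \<gamma> w (2 * Suc k)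
        = (r k * b (2 * k)) *\<^sub>R w (2 * k + 1) - (r (Suc k) * b (2 * Suc k)) *\<^sub>R w (2 * Suc k + 1)"
      by (simp add: scaleR_diff_right)
    then show ?case using step by simp
  qed
  from this[of n] show ?thesis using n b_12(2) m by simp
qed

text \<open>
  The first two products yield \<open>- \<xi>\<^sup>2 |w 1|\<^sup>2 - |w 3|\<^sup>2\<close>, but
  also the cross term \<open>2 \<xi> w 1 \<bullet> w 3\<close>, which can just consume both.
  The sum removes it by \<open>chain_telescope\<close>, and leaves only products with the damped
  node \<open>w 2\<close>.
\<close>

definition F :: "(nat \<Rightarrow> 'h::real_inner) \<Rightarrow> (nat \<Rightarrow> 'h) \<Rightarrow> real" where
  "F w v = - \<xi> * (w 1 \<bullet> v 2) + w 2 \<bullet> v 3 + (\<Sum>k=2..n. (- 2 * \<xi> * r k) * (w 1 \<bullet> v (2 * k)))"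

text \<open>
  Differentiating \<open>w j \<bullet> w (Suc j)\<close> along the chain gives
  \<open>- b j |w (Suc j)|\<^sup>2\<close>; this form therefore transports dissipation along the
  chain from node 3 to node \<open>m\<close>.
\<close>

definition T :: "(nat \<Rightarrow> 'h::real_inner) \<Rightarrow> (nat \<Rightarrow> 'h) \<Rightarrow> real" where
  "T w v = (\<Sum>j=3..<m. d (Suc j) / b j * (w j \<bullet> v (Suc j)))"

lemma F_chain:
  fixes w :: "nat \<Rightarrow> 'h::real_inner"
  defines "g \<equiv> chain b \<gamma> w"
  shows "F g w + F w g = - \<xi>\<^sup>2 * (w 1 \<bullet> w 1) - w 3 \<bullet> w 3 + (1 + \<xi>\<^sup>2) * (w 2 \<bullet> w 2)
     + \<gamma> * \<xi> * (w 1 \<bullet> w 2) - \<gamma> * (w 2 \<bullet> w 3) - b 3 * (w 2 \<bullet> w 4)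
     + (\<Sum>k=2..n. 2 * \<xi>\<^sup>2 * r k * (w 2 \<bullet> w (2 * k)))"
proof -
  define \<psi> where "\<psi> = (\<Sum>k=2..n. r k *\<^sub>R w (2 * k))"
  have g: "g 1 = - \<xi> *\<^sub>R w 2" "g 2 = \<xi> *\<^sub>R w 1 - w 3 - \<gamma> *\<^sub>R w 2" "g 3 = w 2 - b 3 *\<^sub>R w 4"
    using b_12 by (simp_all add: g_def chain_def flip: numeral_2_eq_2)
  have s1: "(\<Sum>k=2..n. (- 2 * \<xi> * r k) * (u \<bullet> v k)) = - 2 * \<xi> * (u \<bullet> (\<Sum>k=2..n. r k *\<^sub>R v k))"
    for u :: 'h and v by (simp add: inner_sum_right sum_distrib_left mult.assoc)
  have s2: "(\<Sum>k=2..n. 2 * \<xi>\<^sup>2 * r k * (w 2 \<bullet> w (2 * k))) = 2 * \<xi>\<^sup>2 * (w 2 \<bullet> \<psi>)"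
    by (simp add: \<psi>_def inner_sum_right sum_distrib_left mult.assoc)
  have c: "(\<Sum>k=2..n. r k *\<^sub>R g (2 * k)) = w 3" unfolding g_def by (rule chain_telescope)
  have cm: "w 2 \<bullet> w 1 = w 1 \<bullet> w 2" "w 3 \<bullet> w 1 = w 1 \<bullet> w 3" "w 3 \<bullet> w 2 = w 2 \<bullet> w 3" "w 4 \<bullet> w 2 = w 2 \<bullet> w 4"
    by (auto simp: inner_commute)
  have "F g w = - \<xi> * (g 1 \<bullet> w 2) + g 2 \<bullet> w 3 - 2 * \<xi> * (g 1 \<bullet> \<psi>)"
    unfolding F_def s1 \<psi>_def by simp
  also have "\<dots> = \<xi>\<^sup>2 * (w 2 \<bullet> w 2) + \<xi> * (w 1 \<bullet> w 3) - w 3 \<bullet> w 3 - \<gamma> * (w 2 \<bullet> w 3) + 2 * \<xi>\<^sup>2 * (w 2 \<bullet> \<psi>)"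
    unfolding g inner_diff_left inner_diff_right inner_scaleR_left inner_scaleR_right cm power2_eq_square
    by (simp only: algebra_simps) simp?
  finally have 1: "F g w = \<dots>" .
  have "F w g = - \<xi> * (w 1 \<bullet> g 2) + w 2 \<bullet> g 3 - 2 * \<xi> * (w 1 \<bullet> w 3)"
    unfolding F_def s1 c by simp
  also have "\<dots> = - \<xi>\<^sup>2 * (w 1 \<bullet> w 1) - \<xi> * (w 1 \<bullet> w 3) + \<gamma> * \<xi> * (w 1 \<bullet> w 2) + w 2 \<bullet> w 2 - b 3 * (w 2 \<bullet> w 4)"
    unfolding g inner_diff_left inner_diff_right inner_scaleR_left inner_scaleR_right cm power2_eq_square
    by (simp only: algebra_simps) simp?
  finally have 2: "F w g = \<dots>" .
  show ?thesis unfolding 1 2 s2 by (simp only: algebra_simps) simp?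
qed

definition "A\<^sub>0 = 1 + 3 * \<gamma>\<^sup>2 + 2 * G + 8 * real n * G ^ m + 2 * K\<^sup>2"

lemma mult_reorder: "x * (y * z * (k * u * v)) = y * k * v * (z * u * x)" for x y z k u v :: real
  by (simp add: mult_ac)

text \<open>
  In the derivative of the transport form, the good term at node \<open>j\<close> has weight
  \<open>d j\<close>, and the bad terms carry an additional factor \<open>\<eta>\<close> because
  the weights \<open>d\<close> decrease fast; they are absorbed since
  \<open>\<eta> * (1 + 4 * K\<^sup>2)\<close> is small.  All products with \<open>w 2\<close>
  are paid for by the damping.
\<close>

lemma lyapunov_dissipation:
  fixes w :: "nat \<Rightarrow> 'h::real_inner"
  defines "g \<equiv> chain b \<gamma> w"
  shows "\<omega> * (F g w + F w g) + (T g w + T w g)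
    \<le> - (\<omega> * \<xi>\<^sup>2 / 2 * (w 1 \<bullet> w 1)) - 3 / 8 * (\<Sum>j=3..m. d j * (w j \<bullet> w j)) + A\<^sub>0 * (w 2 \<bullet> w 2)"
proof -
  define e where "e j = (if 3 \<le> j \<and> j \<le> m then d j * (w j \<bullet> w j) else 0)" for j
  define S where "S = (\<Sum>j=3..m. d j * (w j \<bullet> w j))"
  define N1 where "N1 = w 1 \<bullet> w 1"
  define N2 where "N2 = w 2 \<bullet> w 2"
  define N where "N = 2 * K\<^sup>2 * N2 + e 4 / 8"
  have N1: "0 \<le> N1" and N2: "0 \<le> N2" by (auto simp: N1_def N2_def)
  have dn: "0 \<le> d j" for j using d_pos[of j] by simp
  have e0: "0 \<le> e j" for j using dn by (simp add: e_def)
  have m4: "m \<ge> 4" using m n by simp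
  have S: "S = (\<Sum>j=3..m. e j)" by (simp add: S_def e_def)
  have sum_e: "(\<Sum>i\<in>I. e (h i)) \<le> S" if "finite I" "inj_on h I" for h and I :: "nat set"
  proof -
    have "(\<Sum>i\<in>I. e (h i)) = (\<Sum>j\<in>h ` I. e j)" using that by (simp add: sum.reindex)
    also have "\<dots> = (\<Sum>j\<in>h ` I \<inter> {3..m}. e j)"
      using that by (intro sum.mono_neutral_right) (auto simp: e_def)
    also have "\<dots> \<le> S" unfolding S using e0 by (intro sum_mono2) auto
    finally show ?thesis .
  qed
  have e_le: "e j \<le> S" for j using sum_e[of "{j}" id] by simp
  have S0: "0 \<le> S" using e0[of 3] e_le[of 3] by linarith
  have Tj: "d (Suc j) / b j * (g j \<bullet> w (Suc j) + w j \<bullet> g (Suc j))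
      \<le> - e (j + 1) + \<eta> * e j + \<eta> * K\<^sup>2 * (e (j - 1) + e (j + 1)) + \<eta> * K\<^sup>2 * (e j + e (j + 2))
         + (if j = 3 then N else 0)" if j: "j \<in> {3..<m}" for j
  proof -
    have bj: "b j \<noteq> 0" using b_sq(1)[of j] j by auto
    have ej: "e j = d j * (w j \<bullet> w j)" "e (j + 1) = d (j + 1) * (w (j + 1) \<bullet> w (j + 1))"
      using j by (auto simp: e_def)
    have gj: "g j = b (j - 1) *\<^sub>R w (j - 1) - b j *\<^sub>R w (j + 1)"
      "g (Suc j) = b j *\<^sub>R w j - b (Suc j) *\<^sub>R w (j + 2)"
      using j by (simp_all add: g_def chain_def)
    have expand: "d (Suc j) / b j * (g j \<bullet> w (Suc j) + w j \<bullet> g (Suc j))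
       = - d (Suc j) * (w (j + 1) \<bullet> w (j + 1)) + d (Suc j) * (w j \<bullet> w j)
         + (d (Suc j) * (b (j - 1) / b j)) * (w (j - 1) \<bullet> w (j + 1))
         + (- (d (Suc j) * (b (Suc j) / b j))) * (w j \<bullet> w (j + 2))"
      unfolding gj using bj by (simp add: inner_diff_left inner_diff_right field_simps)
    have 1: "d (Suc j) * (w j \<bullet> w j) \<le> \<eta> * e j"
      using mult_right_mono[OF d_Suc_le(1)[of j], of "w j \<bullet> w j"] j by (simp add: ej)
    have 2: "(d (Suc j) * (b (j - 1) / b j)) * (w (j - 1) \<bullet> w (j + 1))
       \<le> \<eta> * K\<^sup>2 * (e (j - 1) + e (j + 1)) + (if j = 3 then N else 0)"
    proof (cases "j = 3")
      case True
      have "(d 4 / b 3)\<^sup>2 \<le> 4 * (2 * K\<^sup>2) * (d 4 / 8)"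
      proof -
        have "d 4 \<le> p * \<omega>" using d_Suc_le(3)[of 3] m4 d_3 by (simp add: \<beta>_def)
        also have "\<dots> \<le> p * 1" using \<omega>(3) pq(1) by (intro mult_left_mono) auto
        also have "\<dots> \<le> K\<^sup>2 * (b 3)\<^sup>2 * 1"
          using b3_sq(2) pq by (intro order_trans[OF _ mult_left_mono[of q 1]]) auto
        finally have "d 4 * d 4 \<le> (K\<^sup>2 * (b 3)\<^sup>2) * d 4" using dn[of 4] by (intro mult_right_mono) auto
        then show ?thesis using b3_sq(3)
          by (simp add: power_divide divide_simps power2_eq_square[of "d 4"]) (simp add: mult_ac)
      qed
      then have "(d 4 / b 3) * (w 2 \<bullet> w 4) \<le> 2 * K\<^sup>2 * (w 2 \<bullet> w 2) + d 4 / 8 * (w 4 \<bullet> w 4)"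
        using dn[of 4] by (intro young_inner) auto
      then have "(d 4 / b 3) * (w 2 \<bullet> w 4) \<le> N" using m4 by (simp add: N_def e_def N2_def)
      moreover have "0 \<le> \<eta> * K\<^sup>2 * (e 2 + e 4)" using e0 \<eta> by simp
      moreover have "b (Suc (Suc 0)) = 1" using b_12 by (simp flip: numeral_2_eq_2)
      ultimately show ?thesis using True by (simp add: b_12)
    next
      case False
      then have j4: "j \<ge> 4" using j by simp
      then have dj: "d j = \<eta> ^ (2 * (m - (j - 1))) * \<beta> (j - 1) * d (j - 1)"
        using d_Suc[of "j - 1"] by simp
      have "(d (Suc j) * (b (j - 1) / b j))\<^sup>2 \<le> 4 * (\<eta> * K\<^sup>2 * d (j - 1)) * (\<eta> * K\<^sup>2 * d (j + 1))"
      proof -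
        have "(d (Suc j) * (b (j - 1) / b j))\<^sup>2 \<le> (d (Suc j))\<^sup>2 * (K ^ 4 * (\<beta> (j - 1) / \<beta> j))"
          unfolding power_mult_distrib using j j4 by (intro mult_left_mono b_ratio) auto
        also have "\<dots> = d (Suc j) * (\<eta> ^ (2 * (m - j)) * (K ^ 4 * \<beta> (j - 1) * d j))"
          using j \<beta>[of j] by (simp add: power2_eq_square d_Suc)
        also have "\<dots> \<le> d (Suc j) * (\<eta>\<^sup>2 * (K ^ 4 * 1 * d (j - 1)))"
        proof (intro mult_mono mult_left_mono)
          show "\<eta> ^ (2 * (m - j)) \<le> \<eta>\<^sup>2" using \<eta> \<eta>1 j by (intro power_decreasing) auto
          show "d j \<le> d (j - 1)" using d_antimono[of "j - 1" j] j j4 by simp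
        qed (use \<beta>[of "j - 1"] dn[of j] dn[of "j - 1"] dn[of "Suc j"] in simp_all)
        also have "\<dots> \<le> 4 * (\<eta> * K\<^sup>2 * d (j - 1)) * (\<eta> * K\<^sup>2 * d (j + 1))"
        proof -
          have "0 \<le> \<eta>\<^sup>2 * K ^ 4 * (d (j - 1) * d (Suc j))" using dn by simp
          then show ?thesis by (simp add: power2_eq_square power_numeral_reduce mult_ac)
        qed
        finally show ?thesis .
      qed
      then have "(d (Suc j) * (b (j - 1) / b j)) * (w (j - 1) \<bullet> w (j + 1))
        \<le> (\<eta> * K\<^sup>2 * d (j - 1)) * (w (j - 1) \<bullet> w (j - 1)) + (\<eta> * K\<^sup>2 * d (j + 1)) * (w (j + 1) \<bullet> w (j + 1))"
        using dn \<eta> by (intro young_inner) auto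
      also have "\<dots> = \<eta> * K\<^sup>2 * (e (j - 1) + e (j + 1))"
      proof -
        have "3 \<le> j - 1" "j - 1 \<le> m" "3 \<le> j + 1" "j + 1 \<le> m" using j j4 by auto
        then show ?thesis by (simp only: e_def if_True simp_thms distrib_left mult.assoc)
      qed
      finally show ?thesis using False by simp
    qed
    have 3: "(- (d (Suc j) * (b (Suc j) / b j))) * (w j \<bullet> w (j + 2)) \<le> \<eta> * K\<^sup>2 * (e j + e (j + 2))"
    proof (cases "Suc j = m")
      case True
      then have "b (Suc j) = 0" using b_12(2) by simp
      moreover have "0 \<le> \<eta> * K\<^sup>2 * (e j + e (j + 2))" using e0[of j] e0[of "j + 2"] \<eta> by simp
      ultimately show ?thesis by simp
    next
      case False
      then have j2: "j + 2 \<le> m" "Suc j < m" using j by auto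
      have "(- (d (Suc j) * (b (Suc j) / b j)))\<^sup>2 \<le> 4 * (\<eta> * K\<^sup>2 * d j) * (\<eta> * K\<^sup>2 * d (j + 2))"
      proof -
        have "(- (d (Suc j) * (b (Suc j) / b j)))\<^sup>2 \<le> (d (Suc j))\<^sup>2 * (K ^ 4 * (\<beta> (Suc j) / \<beta> j))"
          unfolding power2_minus power_mult_distrib using j j2 by (intro mult_left_mono b_ratio) auto
        also have "\<dots> = d (Suc j) * (\<eta> ^ (2 * (m - j)) * (K ^ 4 * \<beta> (Suc j) * d j))"
          using j \<beta>[of j] by (simp add: power2_eq_square d_Suc)
        also have "2 * (m - j) = 2 + 2 * (m - Suc j)" using j by (auto simp flip: Suc_diff_Suc)
        also have "d (Suc j) * (\<eta> ^ (2 + 2 * (m - Suc j)) * (K ^ 4 * \<beta> (Suc j) * d j))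
           = \<eta>\<^sup>2 * K ^ 4 * d j * d (Suc (Suc j))"
        proof -
          have dd: "d (Suc (Suc j)) = \<eta> ^ (2 * (m - Suc j)) * \<beta> (Suc j) * d (Suc j)"
            using j by (intro d_Suc) simp
          show ?thesis unfolding dd power_add by (rule mult_reorder)
        qed
        also have "\<dots> \<le> 4 * (\<eta> * K\<^sup>2 * d j) * (\<eta> * K\<^sup>2 * d (j + 2))"
        proof -
          have "0 \<le> \<eta>\<^sup>2 * K ^ 4 * (d j * d (Suc (Suc j)))" using dn by simp
          then show ?thesis by (simp add: power2_eq_square power_numeral_reduce mult_ac)
        qed
        finally show ?thesis .
      qed
      then have "(- (d (Suc j) * (b (Suc j) / b j))) * (w j \<bullet> w (j + 2))
        \<le> (\<eta> * K\<^sup>2 * d j) * (w j \<bullet> w j) + (\<eta> * K\<^sup>2 * d (j + 2)) * (w (j + 2) \<bullet> w (j + 2))"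
        using dn \<eta> by (intro young_inner) auto
      also have "\<dots> = \<eta> * K\<^sup>2 * (e j + e (j + 2))" using j j2 by (simp add: e_def algebra_simps)
      finally show ?thesis .
    qed
    show ?thesis unfolding expand using 1 2 3 ej by simp
  qed
  have T': "T g w + T w g \<le> - S + e 3 + S / 4 + 2 * K\<^sup>2 * N2"
  proof -
    have "T g w + T w g = (\<Sum>j=3..<m. d (Suc j) / b j * (g j \<bullet> w (Suc j) + w j \<bullet> g (Suc j)))"
      by (simp add: T_def sum.distrib distrib_left)
    also have "\<dots> \<le> (\<Sum>j=3..<m. - e (j + 1) + \<eta> * e j + \<eta> * K\<^sup>2 * (e (j - 1) + e (j + 1)) + \<eta> * K\<^sup>2 * (e j + e (j + 2))
         + (if j = 3 then N else 0))" by (intro sum_mono Tj)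
    also have "\<dots> = - (\<Sum>j=3..<m. e (j + 1)) + \<eta> * (\<Sum>j=3..<m. e j)
        + \<eta> * K\<^sup>2 * ((\<Sum>j=3..<m. e (j - 1)) + (\<Sum>j=3..<m. e (j + 1)) + (\<Sum>j=3..<m. e j) + (\<Sum>j=3..<m. e (j + 2)))
        + (\<Sum>j=3..<m. if j = 3 then N else 0)"
      by (simp only: sum.distrib sum_negf sum_distrib_left distrib_left)
    also have "(\<Sum>j=3..<m. if j = 3 then N else 0) = N" using m4 by (simp add: sum.delta)
    also have "(\<Sum>j=3..<m. e (j + 1)) = S - e 3"
    proof -
      have "S = e 3 + (\<Sum>j=Suc 3..m. e j)" unfolding S using m4 by (intro sum.atLeast_Suc_atMost) simp
      also have "(\<Sum>j=Suc 3..m. e j) = (\<Sum>j\<in>{Suc 3..<Suc m}. e j)" by (intro sum.cong) auto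
      also have "\<dots> = (\<Sum>j=3..<m. e (j + 1))" by (simp only: sum.shift_bounds_Suc_ivl) simp
      finally show ?thesis by simp
    qed
    also have "- (S - e 3) + \<eta> * (\<Sum>j=3..<m. e j)
        + \<eta> * K\<^sup>2 * ((\<Sum>j=3..<m. e (j - 1)) + (S - e 3) + (\<Sum>j=3..<m. e j) + (\<Sum>j=3..<m. e (j + 2))) + N
       \<le> - (S - e 3) + \<eta> * S + \<eta> * K\<^sup>2 * (S + S + S + S) + N"
    proof -
      have "(\<Sum>j=3..<m. e j) \<le> S" "(\<Sum>j=3..<m. e (j - 1)) \<le> S" "(\<Sum>j=3..<m. e (j + 2)) \<le> S"
        by (rule sum_e[of _ "\<lambda>j. j"] sum_e; auto simp: inj_on_def)+
      then have "(\<Sum>j=3..<m. e (j - 1)) + (S - e 3) + (\<Sum>j=3..<m. e j) + (\<Sum>j=3..<m. e (j + 2)) \<le> S + S + S + S"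
        and "\<eta> * (\<Sum>j=3..<m. e j) \<le> \<eta> * S"
        using e0[of 3] \<eta> by (linarith, intro mult_left_mono) auto
      moreover have "0 \<le> \<eta> * K\<^sup>2" using \<eta> by simp
      ultimately show ?thesis using mult_left_mono[of "(\<Sum>j=3..<m. e (j - 1)) + (S - e 3) + (\<Sum>j=3..<m. e j) + (\<Sum>j=3..<m. e (j + 2))" "S + S + S + S" "\<eta> * K\<^sup>2"]
        by linarith
    qed
    also have "\<dots> = - S + e 3 + \<eta> * (1 + 4 * K\<^sup>2) * S + N" by (simp add: algebra_simps)
    also have "\<dots> \<le> - S + e 3 + 1 / 8 * S + N" using mult_right_mono[OF \<eta>(2) S0] by simp
    also have "\<dots> \<le> - S + e 3 + S / 4 + 2 * K\<^sup>2 * N2" using e_le[of 4] by (simp add: N_def)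
    finally show ?thesis .
  qed
  have F1: "\<omega> * ((1 + \<xi>\<^sup>2) * N2) \<le> N2"
    using mult_right_mono[OF \<omega>(5) N2] by (simp add: mult.assoc)
  have F2: "\<omega> * \<gamma> * \<xi> * (w 1 \<bullet> w 2) \<le> \<omega> * \<xi>\<^sup>2 / 2 * (w 1 \<bullet> w 1) + \<gamma>\<^sup>2 * (w 2 \<bullet> w 2)"
  proof (rule young_inner)
    have "\<omega> * (\<omega> * (\<gamma>\<^sup>2 * \<xi>\<^sup>2)) \<le> 2 * (\<omega> * (\<gamma>\<^sup>2 * \<xi>\<^sup>2))"
      using \<omega>(1,3) by (intro mult_right_mono) auto
    then show "(\<omega> * \<gamma> * \<xi>)\<^sup>2 \<le> 4 * (\<omega> * \<xi>\<^sup>2 / 2) * \<gamma>\<^sup>2"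
      by (simp add: power_mult_distrib power2_eq_square[of \<omega>] mult_ac)
  qed (use \<omega>(1) in auto)
  have F3: "- (\<omega> * \<gamma>) * (w 2 \<bullet> w 3) \<le> 2 * \<gamma>\<^sup>2 * (w 2 \<bullet> w 2) + \<omega> / 8 * (w 3 \<bullet> w 3)"
  proof (rule young_inner)
    have "\<omega> * (\<omega> * \<gamma>\<^sup>2) \<le> 1 * (\<omega> * \<gamma>\<^sup>2)" using \<omega>(1,3) by (intro mult_right_mono) auto
    then show "(- (\<omega> * \<gamma>))\<^sup>2 \<le> 4 * (2 * \<gamma>\<^sup>2) * (\<omega> / 8)"
      by (simp add: power_mult_distrib power2_eq_square[of \<omega>] mult_ac)
  qed (use \<omega>(1) in auto)
  have F4: "- (\<omega> * b 3) * (w 2 \<bullet> w 4) \<le> 2 * G * (w 2 \<bullet> w 2) + d 4 / 8 * (w 4 \<bullet> w 4)"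
  proof (rule young_inner)
    have d4: "\<eta> ^ (2 * m) * p * \<omega> \<le> d 4"
      using d_Suc_ge[of 3] d_3 by (simp add: \<beta>_def)
    have "(- (\<omega> * b 3))\<^sup>2 = \<omega>\<^sup>2 * (b 3)\<^sup>2" by (simp add: power_mult_distrib)
    also have "\<dots> \<le> \<omega>\<^sup>2 * (K\<^sup>2 * \<xi>\<^sup>2)" by (intro mult_left_mono b3_sq) auto
    also have "\<dots> = K\<^sup>2 * \<omega> * (\<omega> * \<xi>\<^sup>2)" by (simp add: power2_eq_square)
    also have "\<dots> \<le> K\<^sup>2 * \<omega> * p" using \<omega>(1,6) by (intro mult_left_mono) auto
    also have "\<dots> = (K\<^sup>2 / \<eta> ^ (2 * m)) * (\<eta> ^ (2 * m) * p * \<omega>)" using \<eta> by simp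
    also have "\<dots> \<le> G * d 4" using G d4 \<omega>(1) pq(1) \<eta>(1) by (intro mult_mono) auto
    finally show "(- (\<omega> * b 3))\<^sup>2 \<le> 4 * (2 * G) * (d 4 / 8)" by simp
  qed (use G dn in auto)
  have F5: "(\<Sum>k=2..n. 2 * \<omega> * \<xi>\<^sup>2 * r k * (w 2 \<bullet> w (2 * k))) \<le> 8 * real n * G ^ m * N2 + S / 8"
  proof -
    have "(\<Sum>k=2..n. 2 * \<omega> * \<xi>\<^sup>2 * r k * (w 2 \<bullet> w (2 * k)))
       \<le> (\<Sum>k=2..n. 8 * G ^ m * (w 2 \<bullet> w 2) + d (2 * k) / 8 * (w (2 * k) \<bullet> w (2 * k)))"
    proof (intro sum_mono young_inner)
      fix k assume "k \<in> {2..n}"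
      from r_sq'[OF this] show "(2 * \<omega> * \<xi>\<^sup>2 * r k)\<^sup>2 \<le> 4 * (8 * G ^ m) * (d (2 * k) / 8)"
        by (simp add: power_mult_distrib)
    qed (use G dn in auto)
    also have "\<dots> = 8 * G ^ m * N2 * real (card {2..n}) + (\<Sum>k=2..n. e (2 * k)) / 8"
      using m by (simp add: sum.distrib N2_def e_def sum_divide_distrib)
    also have "\<dots> \<le> 8 * G ^ m * N2 * real n + S / 8"
      using G N2 sum_e[of "{2..n}" "\<lambda>k. 2 * k"] by (intro add_mono mult_left_mono) (auto simp: inj_on_def)
    finally show ?thesis by (simp add: mult_ac)
  qed
  have e34: "e 3 = \<omega> * (w 3 \<bullet> w 3)" "e 4 = d 4 * (w 4 \<bullet> w 4)" using m4 d_3 by (simp_all add: e_def)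
  define P where "P = (\<Sum>k=2..n. 2 * \<xi>\<^sup>2 * r k * (w 2 \<bullet> w (2 * k)))"
  have P: "\<omega> * P = (\<Sum>k=2..n. 2 * \<omega> * \<xi>\<^sup>2 * r k * (w 2 \<bullet> w (2 * k)))"
    unfolding P_def sum_distrib_left by (intro sum.cong refl) simp
  have "\<omega> * (F g w + F w g) = - (\<omega> * \<xi>\<^sup>2 * N1) - e 3 + \<omega> * ((1 + \<xi>\<^sup>2) * N2)
     + \<omega> * \<gamma> * \<xi> * (w 1 \<bullet> w 2) + - (\<omega> * \<gamma>) * (w 2 \<bullet> w 3) + - (\<omega> * b 3) * (w 2 \<bullet> w 4) + \<omega> * P"
    unfolding g_def F_chain P_def[symmetric] e34 N1_def N2_def by (simp add: algebra_simps)
  also have "\<dots> \<le> - (\<omega> * \<xi>\<^sup>2 * N1) - e 3 + N2 + (\<omega> * \<xi>\<^sup>2 / 2 * N1 + \<gamma>\<^sup>2 * N2)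
     + (2 * \<gamma>\<^sup>2 * N2 + \<omega> / 8 * (w 3 \<bullet> w 3)) + (2 * G * N2 + d 4 / 8 * (w 4 \<bullet> w 4)) + (8 * real n * G ^ m * N2 + S / 8)"
    using F2 F3 F4 unfolding N1_def[symmetric] N2_def[symmetric]
    by (intro add_mono order_refl F1 F5[folded P])
  also have "\<omega> / 8 * (w 3 \<bullet> w 3) = e 3 / 8" unfolding e34 by simp
  also have "d 4 / 8 * (w 4 \<bullet> w 4) = e 4 / 8" unfolding e34 by simp
  also have "\<omega> * \<xi>\<^sup>2 / 2 * N1 = (\<omega> * \<xi>\<^sup>2 * N1) / 2" by simp
  finally have "\<omega> * (F g w + F w g) + (T g w + T w g)
    \<le> - (\<omega> * \<xi>\<^sup>2 * N1) / 2 - 3 / 8 * S + (N2 + 3 * (\<gamma>\<^sup>2 * N2) + 2 * G * N2 + 8 * real n * G ^ m * N2 + 2 * K\<^sup>2 * N2)"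
    using T' e_le[of 3] e_le[of 4] by linarith
  also have "N2 + 3 * (\<gamma>\<^sup>2 * N2) + 2 * G * N2 + 8 * real n * G ^ m * N2 + 2 * K\<^sup>2 * N2 = A\<^sub>0 * N2"
    by (simp add: A\<^sub>0_def algebra_simps)
  also have "- (\<omega> * \<xi>\<^sup>2 * N1) / 2 = - (\<omega> * \<xi>\<^sup>2 / 2 * N1)" by simp
  finally show ?thesis unfolding N1_def N2_def S_def .
qed

end

context damped_chain
begin

definition "D\<^sub>0 = (\<Prod>i=3..<m. \<eta> ^ (2 * (m - i)))"

lemma D\<^sub>0: "0 < D\<^sub>0" unfolding D\<^sub>0_def using \<eta> by (intro prod_pos) auto

text \<open>
  This identity explains the decay rate of the theorem: it is the weight with which dissipation
  arrives at the last node.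
\<close>

lemma d_m: "d m = D\<^sub>0 * rate m \<xi>"
proof -
  have s: "1 + \<xi>\<^sup>2 \<noteq> 0" by (smt (verit) zero_le_power2)
  have pb: "(\<Prod>i=3..<2 * k. \<beta> i) = p ^ (k - 1) * q ^ (k - 2)" if "2 \<le> k" for k
    using that
  proof (induction k rule: dec_induct)
    case base
    have "{3..<4} = {3::nat}" by auto
    then show ?case by (simp add: \<beta>_def)
  next
    case (step k)
    obtain i where i: "k = i + 2" using step by (metis add.commute le_Suc_ex)
    have "(\<Prod>i=3..<2 * Suc k. \<beta> i) = (\<Prod>i=3..<2 * k. \<beta> i) * \<beta> (2 * k) * \<beta> (2 * k + 1)"
      using step by simp
    moreover have "\<beta> (2 * k) = q" "\<beta> (2 * k + 1) = p" by (auto simp: \<beta>_def)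
    ultimately show ?case using step by (simp add: i)
  qed
  obtain k where k: "n = k + 2" using n by (metis add.commute le_Suc_ex)
  have "\<omega> * (\<Prod>i=3..<m. \<beta> i) = p ^ (3 * k + 1) * q ^ (k + 1)"
  proof -
    have e: "m - 4 = 2 * k" "n - 1 = k + 1" "n - 2 = k" using m k by auto
    have "p ^ (2 * k) * q * (p ^ (k + 1) * q ^ k) = p ^ (2 * k + (k + 1)) * q ^ (k + 1)"
      by (simp only: power_add) simp
    moreover have "2 * k + (k + 1) = 3 * k + 1" by simp
    ultimately show ?thesis using pb[OF n] unfolding \<omega>_def m[symmetric] e by simp
  qed
  also have "\<dots> = \<xi> ^ (6 * k + 2) / (1 + \<xi>\<^sup>2) ^ (4 * k + 2)"
  proof -
    have "p ^ (3 * k + 1) = (\<xi> ^ 2) ^ (3 * k + 1) / (1 + \<xi>\<^sup>2) ^ (3 * k + 1)" by (simp add: p_def power_divide)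
    moreover have "(\<xi> ^ 2) ^ (3 * k + 1) = \<xi> ^ (6 * k + 2)"
      by (simp only: power_mult[symmetric] distrib_left) simp
    moreover have "q ^ (k + 1) = 1 / (1 + \<xi>\<^sup>2) ^ (k + 1)" by (simp add: q_def power_divide)
    moreover have "(1 + \<xi>\<^sup>2) ^ (4 * k + 2) = (1 + \<xi>\<^sup>2) ^ (3 * k + 1) * (1 + \<xi>\<^sup>2) ^ (k + 1)"
      by (simp only: power_add[symmetric]) simp
    ultimately show ?thesis by (simp only: times_divide_times_eq mult_1_right)
  qed
  also have "\<dots> = rate m \<xi>"

  proof -
    have "3 * m - 10 = 6 * k + 2" "2 * (m - 3) = 4 * k + 2" using m k by auto
    then show ?thesis by (simp only: rate_def)
  qed
  finally show ?thesis by (simp add: d_def D\<^sub>0_def prod.distrib mult_ac)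
qed

definition "C\<^sub>1 = 2 + real n * (2 * G ^ m) + real m * K"

text \<open>
  The bound does not involve \<open>\<xi>\<close>: although \<open>r k\<close> and
  \<open>1 / b j\<close> are unbounded in \<open>\<xi>\<close>, the weights
  \<open>\<omega>\<close> and \<open>d\<close> compensate for this.
\<close>

lemma bform_lyapunov: "bform m C\<^sub>1 (\<lambda>w v :: nat \<Rightarrow> 'h::real_inner. \<omega> * F w v + T w v)"
proof -
  have m4: "m \<ge> 4" using m n by simp
  have \<omega>\<xi>: "\<bar>\<omega> * \<xi>\<bar> \<le> 1"
  proof -
    have "(\<omega> * \<xi>)\<^sup>2 = \<omega> * (\<omega> * \<xi>\<^sup>2)" by (simp add: power2_eq_square)
    also have "\<dots> \<le> 1 * 1" using \<omega>(1,3,6) pq(2) by (intro mult_mono) auto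
    finally show ?thesis by (simp add: abs_square_le_1)
  qed
  have Gm: "1 \<le> G ^ m" using G(1) by (rule one_le_power)
  have r: "\<bar>\<omega> * (- 2 * \<xi> * r k)\<bar> \<le> 2 * G ^ m" if k: "k \<in> {2..n}" for k
  proof -
    have "\<xi>\<^sup>2 * (\<omega> * \<xi> * r k)\<^sup>2 = (\<omega> * \<xi>\<^sup>2 * r k)\<^sup>2" by (simp add: power2_eq_square)
    also have "\<dots> \<le> G ^ m * d (2 * k)" using r_sq'[OF k] .
    also have "\<dots> \<le> G ^ m * \<xi>\<^sup>2"
    proof (intro mult_left_mono)
      have "d (2 * k) \<le> d 4" using d_antimono[of 4 "2 * k"] k m by simp
      also have "\<dots> \<le> p * \<omega>" using d_Suc_le(3)[of 3] m4 d_3 by (simp add: \<beta>_def)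
      also have "\<dots> \<le> p * 1" using \<omega>(3) pq(1) by (intro mult_left_mono) auto
      finally show "d (2 * k) \<le> \<xi>\<^sup>2" using pq(7) by simp
    qed (use Gm in simp)
    finally have "(\<omega> * \<xi> * r k)\<^sup>2 \<le> G ^ m" using \<xi> by (simp add: mult.commute)
    also have "\<dots> \<le> (G ^ m)\<^sup>2" using Gm by (simp add: power2_eq_square)
    finally have "\<bar>\<omega> * \<xi> * r k\<bar> \<le> G ^ m" using Gm by (simp add: abs_le_square_iff[symmetric])
    then show ?thesis by (simp add: abs_mult)
  qed
  have t: "\<bar>d (Suc j) / b j\<bar> \<le> K" if j: "j \<in> {3..<m}" for j
  proof -
    have bj: "b j \<noteq> 0" "\<beta> j / q \<le> K\<^sup>2 * (b j)\<^sup>2" using b_sq[of j] j by auto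
    have "d (Suc j) \<le> \<beta> j * d j" using d_Suc_le(3)[of j] j by auto
    also have "\<dots> \<le> \<beta> j * 1"
      using d_antimono[of 3 j] d_3 \<omega>(3) \<beta>(1)[of j] j by (intro mult_left_mono) auto
    finally have dj: "d (Suc j) \<le> \<beta> j" by simp
    then have "(d (Suc j))\<^sup>2 \<le> (\<beta> j)\<^sup>2" using d_pos[of "Suc j"] by (intro power_mono) auto
    also have "\<dots> \<le> \<beta> j / q"
    proof -
      have "\<beta> j * \<beta> j \<le> \<beta> j * 1" using \<beta>[of j] by (intro mult_left_mono) auto
      also have "\<dots> \<le> \<beta> j / q" using pq(3,4) \<beta>[of j] by (simp add: le_divide_eq mult_left_le)
      finally show ?thesis by (simp add: power2_eq_square)
    qed
    also have "\<dots> \<le> (K * b j)\<^sup>2" using bj by (simp add: power_mult_distrib)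
    finally have "\<bar>d (Suc j)\<bar> \<le> \<bar>K * b j\<bar>" by (simp add: abs_le_square_iff)
    then show ?thesis using bj(1) K by (simp add: abs_mult divide_le_eq)
  qed
  have eq: "(\<lambda>w v :: nat \<Rightarrow> 'h. \<omega> * F w v + T w v) = (\<lambda>w v. (- (\<omega> * \<xi>)) * (w 1 \<bullet> v 2) + \<omega> * (w 2 \<bullet> v 3)
       + (\<Sum>k=2..n. (\<omega> * (- 2 * \<xi> * r k)) * (w 1 \<bullet> v (2 * k)))
       + (\<Sum>j=3..<m. d (Suc j) / b j * (w j \<bullet> v (Suc j))))"
    unfolding F_def T_def distrib_left sum_distrib_left by (simp add: mult.assoc)
  have "bform m (1 + 1 + real (card {2..n}) * (2 * G ^ m) + real (card {3..<m}) * K)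
    (\<lambda>w v :: nat \<Rightarrow> 'h. \<omega> * F w v + T w v)"
    unfolding eq by (intro bform_add bform_sum bform_single r t) (use m4 m \<omega>(1,3) \<omega>\<xi> in auto)
  moreover have "1 + 1 + real (card {2..n}) * (2 * G ^ m) + real (card {3..<m}) * K \<le> C\<^sub>1"
    unfolding C\<^sub>1_def using Gm K by (intro add_mono mult_right_mono) auto
  ultimately show ?thesis by (rule bform_mono)
qed

definition "\<kappa> = min (1 / (4 * C\<^sub>1 * real m)) (\<gamma> / A\<^sub>0)"

lemma const_bounds: "1 \<le> C\<^sub>1" "0 < A\<^sub>0" "0 < \<kappa>" "\<kappa> * (C\<^sub>1 * real m) \<le> 1 / 4" "\<kappa> * A\<^sub>0 \<le> \<gamma>"
proof -
  have Gm: "1 \<le> G ^ m" using G(1) by (rule one_le_power)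
  have "0 \<le> real n * (2 * G ^ m)" "0 \<le> real m * K" using Gm K by auto
  then show c: "1 \<le> C\<^sub>1" unfolding C\<^sub>1_def by linarith
  have "0 \<le> 8 * real n * G ^ m" "0 \<le> \<gamma>\<^sup>2" "0 \<le> K\<^sup>2" using Gm by auto
  then show a: "0 < A\<^sub>0" unfolding A\<^sub>0_def using G(1) by linarith
  have m0: "0 < C\<^sub>1 * real m" using c m n by simp
  then have "0 < 4 * C\<^sub>1 * real m" by (simp add: mult.assoc)
  then show "0 < \<kappa>" using a \<gamma> unfolding \<kappa>_def min_less_iff_conj by (intro conjI divide_pos_pos) auto
  have "\<kappa> \<le> 1 / (4 * C\<^sub>1 * real m)" "\<kappa> \<le> \<gamma> / A\<^sub>0" by (auto simp: \<kappa>_def)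
  then show "\<kappa> * (C\<^sub>1 * real m) \<le> 1 / 4" "\<kappa> * A\<^sub>0 \<le> \<gamma>"
    using m0 a by (auto simp: field_simps)
qed

definition E :: "(nat \<Rightarrow> 'h::real_inner) \<Rightarrow> (nat \<Rightarrow> 'h) \<Rightarrow> real" where
  "E w v = (\<Sum>j=1..m. 1 * (w j \<bullet> v j)) + \<kappa> * (\<omega> * F w v + T w v)"

lemma bform_E: "bform m (real m + \<kappa> * C\<^sub>1) (E :: (nat \<Rightarrow> 'h::real_inner) \<Rightarrow> _)"
proof -
  have E: "E = (\<lambda>w v :: nat \<Rightarrow> 'h. (\<Sum>j=1..m. 1 * (w j \<bullet> v j)) + \<kappa> * (\<omega> * F w v + T w v))"
    unfolding E_def[abs_def] ..
  have "bform m (real (card {1..m}) * 1 + \<bar>\<kappa>\<bar> * C\<^sub>1) (E :: (nat \<Rightarrow> 'h) \<Rightarrow> _)"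
    unfolding E by (intro bform_add bform_sum bform_single bform_scale bform_lyapunov) auto
  then show ?thesis using const_bounds(3) by simp
qed

lemma E_equiv:
  fixes w :: "nat \<Rightarrow> 'h::real_inner"
  defines "N \<equiv> \<Sum>j=1..m. (norm (w j))\<^sup>2"
  shows "N / 2 \<le> E w w" "E w w \<le> 2 * N"
proof -
  have N0: "0 \<le> N" unfolding N_def by (intro sum_nonneg) auto
  have "\<bar>\<kappa> * (\<omega> * F w w + T w w)\<bar> \<le> \<kappa> * (C\<^sub>1 * real m * (1 * N + N / 1))"
    unfolding abs_mult N_def using const_bounds(3) bform_bound[OF bform_lyapunov, of 1 w w]
    by (simp add: mult_left_mono)
  also have "\<dots> = (\<kappa> * (C\<^sub>1 * real m)) * (2 * N)" by simp
  also have "\<dots> \<le> 1 / 4 * (2 * N)" using const_bounds(4) N0 by (intro mult_right_mono) auto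
  finally have "\<bar>\<kappa> * (\<omega> * F w w + T w w)\<bar> \<le> N / 2" by simp
  moreover have "E w w = N + \<kappa> * (\<omega> * F w w + T w w)"
    unfolding E_def N_def by (simp add: power2_norm_eq_inner)
  ultimately show "N / 2 \<le> E w w" "E w w \<le> 2 * N" using N0 by linarith+
qed

text \<open>
  All weights are at least \<open>d m\<close>, so the dissipation dominates \<open>d m\<close>
  times the full energy.
\<close>

lemma E_decay:
  fixes w :: "nat \<Rightarrow> 'h::real_inner"
  shows "E (chain b \<gamma> w) w + E w (chain b \<gamma> w)
    \<le> - (min \<gamma> (3 / 8 * \<kappa>) * D\<^sub>0) * rate m \<xi> * (\<Sum>j=1..m. (norm (w j))\<^sup>2)"
proof -
  define g where "g = chain b \<gamma> w"
  define c where "c = min \<gamma> (3 / 8 * \<kappa>)"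
  define N1 where "N1 = w 1 \<bullet> w 1"
  define N2 where "N2 = w 2 \<bullet> w 2"
  define S where "S = (\<Sum>j=3..m. d j * (w j \<bullet> w j))"
  define R where "R = (\<Sum>j=3..m. w j \<bullet> w j)"
  have m4: "m \<ge> 4" using m n by simp
  have nn: "0 \<le> N1" "0 \<le> N2" "0 \<le> R" by (auto simp: N1_def N2_def R_def intro: sum_nonneg)
  have en: "(\<Sum>j=1..m. g j \<bullet> w j) = - \<gamma> * N2" "(\<Sum>j=1..m. w j \<bullet> g j) = - \<gamma> * N2"
    using chain_energy[OF b_12(1,2), of \<gamma> w] m4 unfolding g_def N2_def by (simp_all add: inner_commute)
  have dm: "0 < d m" "d m \<le> 1" "d m \<le> \<omega> * \<xi>\<^sup>2"
  proof -
    show "0 < d m" by (rule d_pos)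
    show "d m \<le> 1" using d_antimono[of 3 m] d_3 \<omega>(3) m4 by simp
    have "d m \<le> d 4" using d_antimono[of 4 m] m4 by simp
    also have "\<dots> \<le> p * \<omega>" using d_Suc_le(3)[of 3] m4 d_3 by (simp add: \<beta>_def)
    also have "\<dots> \<le> \<xi>\<^sup>2 * \<omega>" using pq(7) \<omega>(1) by (intro mult_right_mono) auto
    finally show "d m \<le> \<omega> * \<xi>\<^sup>2" by (simp add: mult.commute)
  qed
  have SR: "d m * R \<le> S" unfolding S_def R_def sum_distrib_left
    by (intro sum_mono mult_right_mono d_antimono) auto
  have N: "(\<Sum>j=1..m. (norm (w j))\<^sup>2) = N1 + N2 + R"
  proof -
    have "(\<Sum>j=1..m. w j \<bullet> w j) = w 1 \<bullet> w 1 + (\<Sum>j=2..m. w j \<bullet> w j)"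
      using m4 sum.atLeast_Suc_atMost[of 1 m "\<lambda>j. w j \<bullet> w j"] by (simp add: numeral_2_eq_2)
    also have "(\<Sum>j=2..m. w j \<bullet> w j) = w 2 \<bullet> w 2 + (\<Sum>j=3..m. w j \<bullet> w j)"
      using m4 sum.atLeast_Suc_atMost[of 2 m "\<lambda>j. w j \<bullet> w j"] by simp
    finally show ?thesis by (simp add: power2_norm_eq_inner N1_def N2_def R_def)
  qed
  have c: "0 < c" "c \<le> \<gamma>" "c \<le> 3 / 8 * \<kappa>" using \<gamma> const_bounds(3) by (auto simp: c_def)
  have "E g w + E w g = - 2 * \<gamma> * N2 + \<kappa> * (\<omega> * (F g w + F w g) + (T g w + T w g))"
    unfolding E_def mult_1 en by (simp add: algebra_simps)
  also have "\<dots> \<le> - 2 * \<gamma> * N2 + \<kappa> * (- (\<omega> * \<xi>\<^sup>2 / 2 * N1) - 3 / 8 * S + A\<^sub>0 * N2)"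
    using lyapunov_dissipation[of w] const_bounds(3) unfolding g_def N1_def N2_def S_def
    by (intro add_left_mono mult_left_mono) auto
  also have "\<dots> = - 2 * \<gamma> * N2 + (\<kappa> * A\<^sub>0) * N2 - \<kappa> / 2 * (\<omega> * \<xi>\<^sup>2 * N1) - 3 / 8 * \<kappa> * S"
    by (simp add: algebra_simps)
  also have "\<dots> \<le> - 2 * \<gamma> * N2 + \<gamma> * N2 - c * (\<omega> * \<xi>\<^sup>2 * N1) - c * S"
  proof -
    have "(\<kappa> * A\<^sub>0) * N2 \<le> \<gamma> * N2" using const_bounds(5) nn by (intro mult_right_mono) auto
    moreover have "c * (\<omega> * \<xi>\<^sup>2 * N1) \<le> \<kappa> / 2 * (\<omega> * \<xi>\<^sup>2 * N1)"
      using c const_bounds(3) \<omega>(1) nn by (intro mult_right_mono) auto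
    moreover have "c * S \<le> 3 / 8 * \<kappa> * S"
      using c SR dm(1) nn by (intro mult_right_mono) (auto intro: order_trans[OF _ SR])
    ultimately show ?thesis by linarith
  qed
  also have "\<dots> \<le> - (c * (d m * N2)) - c * (d m * N1) - c * (d m * R)"
  proof -
    have "c * (d m * N2) \<le> \<gamma> * (1 * N2)" using c dm nn by (intro mult_mono) auto
    then have "c * (d m * N2) \<le> \<gamma> * N2" by simp
    moreover have "c * (d m * N1) \<le> c * (\<omega> * \<xi>\<^sup>2 * N1)" using c dm nn by (intro mult_left_mono mult_right_mono) auto
    moreover have "c * (d m * R) \<le> c * S" using c SR by (intro mult_left_mono) auto
    ultimately show ?thesis by linarith
  qed
  also have "\<dots> = - (c * D\<^sub>0) * rate m \<xi> * (\<Sum>j=1..m. (norm (w j))\<^sup>2)"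
    unfolding N d_m by (simp add: algebra_simps)
  finally show ?thesis unfolding g_def c_def .
qed

end

definition chain_coeff :: "nat \<Rightarrow> (nat \<Rightarrow> real) \<Rightarrow> real \<Rightarrow> nat \<Rightarrow> real" where
  "chain_coeff m \<alpha> \<xi> j = (if 1 \<le> j \<and> j < m then (if odd j then \<xi> else 1) * \<alpha> j else 0)"

text \<open>
  The constants \<open>\<kappa>\<close>, \<open>C\<^sub>1\<close> and \<open>D\<^sub>0\<close>
  of the locale do not mention \<open>\<xi>\<close>, so they may be read off at
  \<open>\<xi> = 1\<close>.  At \<open>\<xi> = 0\<close> the rate vanishes and the plain energy
  serves.
\<close>

theorem chain_lyapunov:
  fixes m :: nat and \<gamma> :: real and \<alpha> :: "nat \<Rightarrow> real"
  assumes "even m" "m \<ge> 4" "\<gamma> > 0" "\<And>j. 1 \<le> j \<Longrightarrow> j < m \<Longrightarrow> \<alpha> j \<noteq> 0" "\<alpha> 1 = 1" "\<alpha> 2 = 1"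
  shows "\<exists>C>0. \<exists>c>0. \<forall>\<xi>. \<exists>B :: (nat \<Rightarrow> 'h::real_inner) \<Rightarrow> (nat \<Rightarrow> 'h) \<Rightarrow> real. bform m C B \<and>
     (\<forall>w. (\<Sum>j=1..m. (norm (w j))\<^sup>2) / 2 \<le> B w w \<and> B w w \<le> 2 * (\<Sum>j=1..m. (norm (w j))\<^sup>2) \<and>
       B (chain (chain_coeff m \<alpha> \<xi>) \<gamma> w) w + B w (chain (chain_coeff m \<alpha> \<xi>) \<gamma> w)
         \<le> - c * rate m \<xi> * (\<Sum>j=1..m. (norm (w j))\<^sup>2))"
proof -
  obtain n where n: "m = 2 * n" "n \<ge> 2" using assms(1,2) by auto
  obtain K where K: "K \<ge> 1" "\<And>j. 1 \<le> j \<Longrightarrow> j < m \<Longrightarrow> 1 / K \<le> \<bar>\<alpha> j\<bar> \<and> \<bar>\<alpha> j\<bar> \<le> K"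
  proof
    define K where "K = 1 + (\<Sum>j\<in>{1..<m}. \<bar>\<alpha> j\<bar> + 1 / \<bar>\<alpha> j\<bar>)"
    show K1: "K \<ge> 1" unfolding K_def by (simp add: sum_nonneg)
    fix j assume j: "1 \<le> j" "j < m"
    have "\<bar>\<alpha> j\<bar> + 1 / \<bar>\<alpha> j\<bar> \<le> (\<Sum>j\<in>{1..<m}. \<bar>\<alpha> j\<bar> + 1 / \<bar>\<alpha> j\<bar>)"
      using j by (intro member_le_sum) auto
    then have "\<bar>\<alpha> j\<bar> + 1 / \<bar>\<alpha> j\<bar> \<le> K" unfolding K_def by simp
    moreover have "0 < \<bar>\<alpha> j\<bar>" using assms(4)[OF j] by simp
    moreover from this have "0 < 1 / \<bar>\<alpha> j\<bar>" by simp
    ultimately have "\<bar>\<alpha> j\<bar> \<le> K" "1 / \<bar>\<alpha> j\<bar> \<le> K" by linarith+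
    then show "1 / K \<le> \<bar>\<alpha> j\<bar> \<and> \<bar>\<alpha> j\<bar> \<le> K"
      using \<open>0 < \<bar>\<alpha> j\<bar>\<close> K1 by (simp add: field_simps)
  qed
  \<comment> \<open>makes the smallness condition on \<open>\<eta>\<close> an equality\<close>
  define \<eta> where "\<eta> = 1 / (8 * (1 + 4 * K\<^sup>2))"
  have k: "0 < 1 + 4 * K\<^sup>2" by (intro add_pos_nonneg) auto
  have \<eta>: "0 < \<eta>" "\<eta> * (1 + 4 * K\<^sup>2) \<le> 1 / 8" using k by (simp_all add: \<eta>_def)
  have loc: "damped_chain n m \<xi> K \<gamma> \<eta> \<alpha> (chain_coeff m \<alpha> \<xi>)" if "\<xi> \<noteq> 0" for \<xi>
    by (intro damped_chain.intro n K \<eta> that assms(3,5,6)) (auto simp: chain_coeff_def)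
  interpret one: damped_chain n m 1 K \<gamma> \<eta> \<alpha> "chain_coeff m \<alpha> 1" by (rule loc) simp
  \<comment> \<open>the constants do not depend on the frequency\<close>
  define C where "C = real m + one.\<kappa> * one.C\<^sub>1"
  define c where "c = min \<gamma> (3 / 8 * one.\<kappa>) * one.D\<^sub>0"
  have "0 < one.\<kappa> * one.C\<^sub>1" using one.const_bounds(1,3) by simp
  then have C: "0 < C" "real m \<le> C" by (auto simp: C_def)
  have c: "0 < c" using assms(3) one.const_bounds one.D\<^sub>0 by (simp add: c_def)
  have "\<exists>B :: (nat \<Rightarrow> 'h) \<Rightarrow> (nat \<Rightarrow> 'h) \<Rightarrow> real. bform m C B \<and>
     (\<forall>w. (\<Sum>j=1..m. (norm (w j))\<^sup>2) / 2 \<le> B w w \<and> B w w \<le> 2 * (\<Sum>j=1..m. (norm (w j))\<^sup>2) \<and>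
       B (chain (chain_coeff m \<alpha> \<xi>) \<gamma> w) w + B w (chain (chain_coeff m \<alpha> \<xi>) \<gamma> w)
         \<le> - c * rate m \<xi> * (\<Sum>j=1..m. (norm (w j))\<^sup>2))" for \<xi>
  proof (cases "\<xi> = 0")
    case True
    define B :: "(nat \<Rightarrow> 'h) \<Rightarrow> (nat \<Rightarrow> 'h) \<Rightarrow> real" where "B = (\<lambda>w v. \<Sum>j=1..m. 1 * (w j \<bullet> v j))"
    have "bform m (real (card {1..m}) * 1) B"
      unfolding B_def by (intro bform_sum bform_single) auto
    then have bB: "bform m C B" using C(2) by (intro bform_mono[of m _ B C]) auto
    have BB: "B w w = (\<Sum>j=1..m. (norm (w j))\<^sup>2)" for w
      by (simp add: B_def power2_norm_eq_inner)
    have "chain_coeff m \<alpha> \<xi> 0 = 0" "chain_coeff m \<alpha> \<xi> m = 0" by (simp_all add: chain_coeff_def)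
    then have ce: "B (chain (chain_coeff m \<alpha> \<xi>) \<gamma> w) w = - \<gamma> * (w 2 \<bullet> w 2)" for w :: "nat \<Rightarrow> 'h"
      using chain_energy[of "chain_coeff m \<alpha> \<xi>" m \<gamma> w] assms(2) by (simp add: B_def)
    have cs: "B w v = B v w" for w v by (simp add: B_def inner_commute)
    have r0: "rate m \<xi> = 0" using True assms(2) by (simp add: rate_def)
    show ?thesis
    proof (intro exI[of _ B] conjI allI bB)
      fix w :: "nat \<Rightarrow> 'h"
      have "0 \<le> (\<Sum>j=1..m. (norm (w j))\<^sup>2)" by (intro sum_nonneg) auto
      then show "(\<Sum>j=1..m. (norm (w j))\<^sup>2) / 2 \<le> B w w" "B w w \<le> 2 * (\<Sum>j=1..m. (norm (w j))\<^sup>2)"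
        unfolding BB by linarith+
      have "0 \<le> \<gamma> * (w 2 \<bullet> w 2)" using assms(3) by simp
      then show "B (chain (chain_coeff m \<alpha> \<xi>) \<gamma> w) w + B w (chain (chain_coeff m \<alpha> \<xi>) \<gamma> w)
         \<le> - c * rate m \<xi> * (\<Sum>j=1..m. (norm (w j))\<^sup>2)"
        unfolding cs[of w] ce r0 by simp
    qed
  next
    case False
    interpret damped_chain n m \<xi> K \<gamma> \<eta> \<alpha> "chain_coeff m \<alpha> \<xi>" by (rule loc) fact
    show ?thesis
    proof (intro exI[of _ E] conjI allI)
      show "bform m C (E :: (nat \<Rightarrow> 'h) \<Rightarrow> _)" using bform_E unfolding C_def .
      fix w :: "nat \<Rightarrow> 'h"
      show "(\<Sum>j=1..m. (norm (w j))\<^sup>2) / 2 \<le> E w w" "E w w \<le> 2 * (\<Sum>j=1..m. (norm (w j))\<^sup>2)"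
        by (rule E_equiv)+
      show "E (chain (chain_coeff m \<alpha> \<xi>) \<gamma> w) w + E w (chain (chain_coeff m \<alpha> \<xi>) \<gamma> w)
         \<le> - c * rate m \<xi> * (\<Sum>j=1..m. (norm (w j))\<^sup>2)"
        using E_decay[of w] unfolding c_def .
    qed
  qed
  then show ?thesis by (intro exI[of _ C] exI[of _ c] conjI allI C(1) c)
qed

section \<open>Square-integrable functions\<close>

lemma in_L2_iff:
  "in_Lp 2 f \<longleftrightarrow> f \<in> borel_measurable lborel \<and> integrable lborel (\<lambda>x. (norm (f x))\<^sup>2)"
  unfolding in_Lp_def by (simp add: powr_numeral)

lemma Lp_norm_2: "Lp_norm 2 f = sqrt (\<integral>x. (norm (f x))\<^sup>2 \<partial>lborel)"
  unfolding Lp_norm_def by (simp add: powr_numeral powr_half_sqrt)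

lemma Lp_norm_2_sq: "(Lp_norm 2 f)\<^sup>2 = (\<integral>x. (norm (f x))\<^sup>2 \<partial>lborel)"
  unfolding Lp_norm_2 by simp

lemma Lp_norm_nonneg [simp]: "0 \<le> Lp_norm p f"
  unfolding Lp_norm_def by simp

lemma in_L1_iff: "in_Lp 1 f \<longleftrightarrow> integrable lborel f"
  unfolding in_Lp_def by (auto simp: integrable_norm_iff)

lemma Lp_norm_1: "Lp_norm 1 f = (\<integral>x. norm (f x) \<partial>lborel)"
  unfolding Lp_norm_def by (simp add: powr_one)

lemma L2_measurable: "in_Lp 2 f \<Longrightarrow> f \<in> borel_measurable lborel"
  by (simp add: in_L2_iff)

lemma norm_add_sq_le:
  fixes u v :: "'a::real_normed_vector"
  assumes "\<delta> > 0"
  shows "(norm (u + v))\<^sup>2 \<le> (1 + \<delta>) * (norm u)\<^sup>2 + (1 + 1 / \<delta>) * (norm v)\<^sup>2"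
proof -
  have "2 * norm u * norm v \<le> \<delta> * (norm u)\<^sup>2 + (norm v)\<^sup>2 / \<delta>"
    using sum_squares_bound[of "sqrt \<delta> * norm u" "norm v / sqrt \<delta>"] assms
    by (simp add: power_mult_distrib power_divide)
  moreover have "(norm (u + v))\<^sup>2 \<le> (norm u + norm v)\<^sup>2"
    by (intro power_mono norm_triangle_ineq) auto
  ultimately show ?thesis by (simp add: power2_sum algebra_simps)
qed

lemma norm_add_sq_le2:
  fixes u v :: "'a::real_normed_vector"
  shows "(norm (u + v))\<^sup>2 \<le> 2 * (norm u)\<^sup>2 + 2 * (norm v)\<^sup>2"
  using norm_add_sq_le[of 1 u v] by simp

lemma L2_add:
  assumes "in_Lp 2 f" "in_Lp 2 g"
  shows "in_Lp 2 (\<lambda>x. f x + g x)"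
proof -
  have [measurable]: "f \<in> borel_measurable lborel" "g \<in> borel_measurable lborel"
    using assms by (auto simp: in_L2_iff)
  have "integrable lborel (\<lambda>x. (norm (f x + g x))\<^sup>2)"
  proof (rule Bochner_Integration.integrable_bound)
    show "integrable lborel (\<lambda>x. 2 * (norm (f x))\<^sup>2 + 2 * (norm (g x))\<^sup>2)"
      using assms by (simp add: in_L2_iff)
    show "AE x in lborel. norm ((norm (f x + g x))\<^sup>2) \<le> norm (2 * (norm (f x))\<^sup>2 + 2 * (norm (g x))\<^sup>2)"
      using norm_add_sq_le2 by (intro AE_I2) auto
  qed simp
  then show ?thesis by (simp add: in_L2_iff)
qed

lemma L2_bounded_mult:
  fixes f :: "real \<Rightarrow> 'a::euclidean_space" and g :: "real \<Rightarrow> 'b::euclidean_space"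
  assumes "in_Lp 2 f" "g \<in> borel_measurable lborel" "\<And>x. norm (g x) \<le> c * norm (f x)"
  shows "in_Lp 2 g"
proof -
  have [measurable]: "g \<in> borel_measurable lborel" by fact
  have "integrable lborel (\<lambda>x. (norm (g x))\<^sup>2)"
  proof (rule Bochner_Integration.integrable_bound)
    show "integrable lborel (\<lambda>x. c\<^sup>2 * (norm (f x))\<^sup>2)" using assms by (simp add: in_L2_iff)
    show "AE x in lborel. norm ((norm (g x))\<^sup>2) \<le> norm (c\<^sup>2 * (norm (f x))\<^sup>2)"
    proof (intro AE_I2)
      show "norm ((norm (g x))\<^sup>2) \<le> norm (c\<^sup>2 * (norm (f x))\<^sup>2)" for x
        using power_mono[OF assms(3)[of x], of 2] by (simp add: power_mult_distrib)
    qed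
  qed simp
  then show ?thesis using assms by (simp add: in_L2_iff)
qed

lemma L2_minus: "in_Lp 2 f \<Longrightarrow> in_Lp 2 (\<lambda>x. - f x)"
  by (auto simp: in_L2_iff)

lemma L2_diff: "in_Lp 2 f \<Longrightarrow> in_Lp 2 g \<Longrightarrow> in_Lp 2 (\<lambda>x. f x - g x)"
  using L2_add[of f "\<lambda>x. - g x"] L2_minus[of g] by simp

lemma Lp_norm_2_mono:
  assumes "in_Lp 2 g" "f \<in> borel_measurable lborel" "\<And>x. norm (f x) \<le> norm (g x)"
  shows "Lp_norm 2 f \<le> Lp_norm 2 g"
proof -
  have "in_Lp 2 f" using assms by (intro L2_bounded_mult[of g f 1]) auto
  then show ?thesis unfolding Lp_norm_2 using assms
    by (intro real_sqrt_le_mono integral_mono) (auto simp: in_L2_iff)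
qed

lemma Lp_norm_cong_AE:
  assumes "f \<in> borel_measurable lborel" "g \<in> borel_measurable lborel" "AE x in lborel. f x = g x"
  shows "Lp_norm p f = Lp_norm p g"
proof -
  have [measurable]: "f \<in> borel_measurable lborel" "g \<in> borel_measurable lborel" by fact+
  show ?thesis unfolding Lp_norm_def
    by (intro arg_cong2[where f="(powr)"] refl integral_cong_AE) (use assms(3) in auto)
qed

lemma Lp_norm_2_minus_commute: "Lp_norm 2 (\<lambda>x. f x - g x) = Lp_norm 2 (\<lambda>x. g x - f x)"
  by (simp add: Lp_norm_2 norm_minus_commute)

theorem Minkowski_L2:
  assumes "in_Lp 2 f" "in_Lp 2 g"
  shows "Lp_norm 2 (\<lambda>x. f x + g x) \<le> Lp_norm 2 f + Lp_norm 2 g"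
proof (rule field_le_epsilon)
  fix e :: real assume "e > 0"
  define a where "a = Lp_norm 2 f + e / 2"
  define b where "b = Lp_norm 2 g + e / 2"
  have ab: "0 < a" "0 < b" using \<open>e > 0\<close> by (auto simp: a_def b_def intro: add_nonneg_pos)
  have "(\<integral>x. (norm (f x + g x))\<^sup>2 \<partial>lborel)
     \<le> (\<integral>x. (1 + b / a) * (norm (f x))\<^sup>2 + (1 + 1 / (b / a)) * (norm (g x))\<^sup>2 \<partial>lborel)"
    using assms L2_add[OF assms] ab by (intro integral_mono norm_add_sq_le) (auto simp: in_L2_iff)
  also have "\<dots> = (1 + b / a) * (Lp_norm 2 f)\<^sup>2 + (1 + a / b) * (Lp_norm 2 g)\<^sup>2"
    using assms by (simp add: in_L2_iff Lp_norm_2_sq)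
  also have "\<dots> \<le> (1 + b / a) * a\<^sup>2 + (1 + a / b) * b\<^sup>2"
    using ab \<open>e > 0\<close> by (intro add_mono mult_left_mono power_mono) (auto simp: a_def b_def)
  also have "\<dots> = (a + b)\<^sup>2" using ab by (simp add: field_simps power2_eq_square)
  finally have "Lp_norm 2 (\<lambda>x. f x + g x) \<le> sqrt ((a + b)\<^sup>2)"
    unfolding Lp_norm_2 by (rule real_sqrt_le_mono)
  also have "\<dots> = a + b" using ab by simp
  finally show "Lp_norm 2 (\<lambda>x. f x + g x) \<le> Lp_norm 2 f + Lp_norm 2 g + e"
    by (simp add: a_def b_def)
qed

lemma L2_triangle:
  assumes "in_Lp 2 f" "in_Lp 2 g" "in_Lp 2 h"
  shows "Lp_norm 2 (\<lambda>x. f x - h x) \<le> Lp_norm 2 (\<lambda>x. f x - g x) + Lp_norm 2 (\<lambda>x. g x - h x)"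
  using Minkowski_L2[of "\<lambda>x. f x - g x" "\<lambda>x. g x - h x"] assms by (simp add: L2_diff)

lemma L2_norm_diff:
  assumes "in_Lp 2 f" "in_Lp 2 g"
  shows "\<bar>Lp_norm 2 f - Lp_norm 2 g\<bar> \<le> Lp_norm 2 (\<lambda>x. f x - g x)"
  using Minkowski_L2[of "\<lambda>x. f x - g x" g] Minkowski_L2[of "\<lambda>x. g x - f x" f] assms
    Lp_norm_2_minus_commute[of f g]
  by (simp add: L2_diff abs_le_iff)

lemma L2_norm_tendsto:
  assumes "\<And>n. in_Lp 2 (f n)" "in_Lp 2 g" "((\<lambda>n. Lp_norm 2 (\<lambda>x. f n x - g x)) \<longlongrightarrow> 0) F"
  shows "((\<lambda>n. Lp_norm 2 (f n)) \<longlongrightarrow> Lp_norm 2 g) F"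
proof (rule Lim_null[THEN iffD2], rule Lim_null_comparison[OF always_eventually assms(3)], rule allI)
  show "norm (Lp_norm 2 (f n) - Lp_norm 2 g) \<le> Lp_norm 2 (\<lambda>x. f n x - g x)" for n
    using L2_norm_diff[OF assms(1,2)] by simp
qed

lemma Lp_norm_2_zero_AE:
  assumes "in_Lp 2 f" "Lp_norm 2 f = 0"
  shows "AE x in lborel. f x = 0"
proof -
  have "(\<integral>x. (norm (f x))\<^sup>2 \<partial>lborel) = 0" using assms(2) Lp_norm_2_sq[of f] by simp
  then have "AE x in lborel. (norm (f x))\<^sup>2 = 0"
    using assms by (subst (asm) integral_nonneg_eq_0_iff_AE) (auto simp: in_L2_iff)
  then show ?thesis by simp
qed

lemma L2_limit_unique:
  assumes "\<And>n. in_Lp 2 (f n)" "in_Lp 2 g" "in_Lp 2 h" "F \<noteq> bot"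
    "((\<lambda>n. Lp_norm 2 (\<lambda>x. f n x - g x)) \<longlongrightarrow> 0) F" "((\<lambda>n. Lp_norm 2 (\<lambda>x. f n x - h x)) \<longlongrightarrow> 0) F"
  shows "AE x in lborel. g x = h x"
proof -
  have "((\<lambda>n. Lp_norm 2 (\<lambda>x. f n x - g x) + Lp_norm 2 (\<lambda>x. f n x - h x)) \<longlongrightarrow> 0 + 0) F"
    by (intro tendsto_add assms)
  moreover have "Lp_norm 2 (\<lambda>x. g x - h x) \<le> Lp_norm 2 (\<lambda>x. f n x - g x) + Lp_norm 2 (\<lambda>x. f n x - h x)" for n
    using L2_triangle[OF assms(2) assms(1)[of n] assms(3)] Lp_norm_2_minus_commute[of g "f n"] by simp
  ultimately have "Lp_norm 2 (\<lambda>x. g x - h x) \<le> 0 + 0"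
    using assms(4) by (intro tendsto_lowerbound[of _ _ F]) auto
  then have "Lp_norm 2 (\<lambda>x. g x - h x) = 0" by (simp add: antisym)
  then show ?thesis using Lp_norm_2_zero_AE[OF L2_diff[OF assms(2,3)]] by simp
qed

text \<open>
  Almost everywhere statements about Fourier-Plancherel transforms are obtained through such
  subsequences.
\<close>

lemma L2_AE_subseq:
  fixes f :: "nat \<Rightarrow> real \<Rightarrow> 'a::euclidean_space"
  assumes "\<And>n. in_Lp 2 (f n)" "in_Lp 2 g" "(\<lambda>n. Lp_norm 2 (\<lambda>x. f n x - g x)) \<longlonglongrightarrow> 0"
  obtains r :: "nat \<Rightarrow> nat" where "strict_mono r" "AE x in lborel. (\<lambda>n. f (r n) x) \<longlonglongrightarrow> g x"
proof -
  have "(\<lambda>n. (\<integral>x. norm ((norm (f n x - g x))\<^sup>2) \<partial>lborel)) \<longlonglongrightarrow> 0"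
    using tendsto_power[OF assms(3), of 2] by (simp add: Lp_norm_2_sq)
  moreover have "integrable lborel (\<lambda>x. (norm (f n x - g x))\<^sup>2)" for n
    using L2_diff[OF assms(1,2)] by (simp add: in_L2_iff)
  ultimately obtain r where r: "strict_mono r" "AE x in lborel. (\<lambda>n. (norm (f (r n) x - g x))\<^sup>2) \<longlonglongrightarrow> 0"
    using tendsto_L1_AE_subseq[of lborel "\<lambda>n x. (norm (f n x - g x))\<^sup>2"] by blast
  from r(2) have "AE x in lborel. (\<lambda>n. f (r n) x) \<longlonglongrightarrow> g x"
  proof eventually_elim
    case (elim x)
    from tendsto_real_sqrt[OF this] show ?case by (simp add: tendsto_norm_zero_iff LIM_zero_iff)
  qed
  with r(1) show ?thesis by (rule that)
qed

lemma AE_finite_weighted_sum: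
  fixes \<Delta> :: "nat \<Rightarrow> real \<Rightarrow> 'a::euclidean_space"
  assumes [measurable]: "\<And>k. \<Delta> k \<in> borel_measurable lborel"
  assumes \<Delta>: "\<And>k. (\<integral>\<^sup>+ x. ennreal (4 ^ k * (norm (\<Delta> k x))\<^sup>2) \<partial>lborel) \<le> ennreal ((1 / 4) ^ k)"
  shows "AE x in lborel. (\<Sum>k. ennreal (4 ^ k * (norm (\<Delta> k x))\<^sup>2)) \<noteq> \<infinity>"
proof -
  have a: "(\<integral>\<^sup>+ x. (\<Sum>k. ennreal (4 ^ k * (norm (\<Delta> k x))\<^sup>2)) \<partial>lborel)
      = (\<Sum>k. \<integral>\<^sup>+ x. ennreal (4 ^ k * (norm (\<Delta> k x))\<^sup>2) \<partial>lborel)"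
    by (rule nn_integral_suminf) measurable
  have b: "(\<Sum>k. \<integral>\<^sup>+ x. ennreal (4 ^ k * (norm (\<Delta> k x))\<^sup>2) \<partial>lborel) \<le> (\<Sum>k. ennreal ((1 / 4) ^ k))" by (rule suminf_le[OF \<Delta> summableI summableI])
  have c: "(\<Sum>k. ennreal ((1 / 4) ^ k)) = ennreal (\<Sum>k. (1 / 4) ^ k)"
    by (rule suminf_ennreal2) (auto intro!: summable_geometric)
  have d: "ennreal (\<Sum>k. (1 / 4) ^ k) < \<infinity>" using ennreal_less_top by simp
  have fin: "(\<integral>\<^sup>+ x. (\<Sum>k. ennreal (4 ^ k * (norm (\<Delta> k x))\<^sup>2)) \<partial>lborel) < \<infinity>"
    unfolding a using b d unfolding c by (rule le_less_trans)
  show "AE x in lborel. (\<Sum>k. ennreal (4 ^ k * (norm (\<Delta> k x))\<^sup>2)) \<noteq> \<infinity>"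
    by (rule nn_integral_PInf_AE[OF _ less_imp_neq[OF fin]]) measurable
qed

lemma summable_of_weighted_squares:
  fixes D :: "nat \<Rightarrow> 'a::banach"
  assumes "(\<Sum>k. ennreal (4 ^ k * (norm (D k))\<^sup>2)) \<noteq> \<infinity>"
  shows "summable D"
proof -
  define M where "M = enn2real (\<Sum>k. ennreal (4 ^ k * (norm (D k))\<^sup>2))"
  have "(\<Sum>k. ennreal (4 ^ k * (norm (D k))\<^sup>2)) < top"
    using assms unfolding infinity_ennreal_def less_top .
  then have M: "0 \<le> M" "(\<Sum>k. ennreal (4 ^ k * (norm (D k))\<^sup>2)) = ennreal M"
    unfolding M_def by (simp_all only: enn2real_nonneg ennreal_enn2real)
  have b: "norm (D k) \<le> sqrt M * inverse (2 ^ k)" for k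
  proof -
    have "(\<Sum>i\<in>{k}. ennreal (4 ^ i * (norm (D i))\<^sup>2)) \<le> (\<Sum>k. ennreal (4 ^ k * (norm (D k))\<^sup>2))"
      by (rule sum_le_suminf[OF summableI finite.intros(2)[OF finite.intros(1)] zero_le])
    then have "ennreal (4 ^ k * (norm (D k))\<^sup>2) \<le> ennreal M" unfolding M(2) by simp
    then have "4 ^ k * (norm (D k))\<^sup>2 \<le> M" using M(1) by (simp only: ennreal_le_iff)
    moreover have "4 ^ k * (norm (D k))\<^sup>2 = (2 ^ k * norm (D k))\<^sup>2"
    proof -
      have "(4::real) ^ k = 2 ^ k * 2 ^ k" by (simp flip: power_mult_distrib)
      then show ?thesis by (simp add: power2_eq_square)
    qed
    ultimately have "2 ^ k * norm (D k) \<le> sqrt M" by (intro real_le_rsqrt) simp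
    then have "(2 ^ k * norm (D k)) * inverse (2 ^ k) \<le> sqrt M * inverse (2 ^ k)"
      by (rule mult_right_mono) simp
    moreover have "(2 ^ k * norm (D k)) * inverse (2 ^ k) = norm (D k)" by simp
    ultimately show ?thesis by (simp only:)
  qed
  have "summable (\<lambda>k. inverse 2 ^ k :: real)" by (rule summable_geometric) simp
  then have "summable (\<lambda>k. sqrt M * inverse (2 ^ k))" unfolding power_inverse by (rule summable_mult)
  then show ?thesis by (rule summable_comparison_test'[where N = 0]) (rule b)
qed

text \<open>
  A subsequence with \<open>4 ^ k\<close>-weighted square-summable increments converges almost
  everywhere, by Tonelli and the Cauchy-Schwarz inequality; its limit is the limit in the norm.
\<close>

lemma L2_complete:
  fixes f :: "nat \<Rightarrow> real \<Rightarrow> 'a::euclidean_space"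
  assumes "\<And>n. in_Lp 2 (f n)"
    and "\<And>e. e > 0 \<Longrightarrow> \<exists>N. \<forall>m\<ge>N. \<forall>n\<ge>N. Lp_norm 2 (\<lambda>x. f m x - f n x) < e"
  obtains g where "in_Lp 2 g" "(\<lambda>n. Lp_norm 2 (\<lambda>x. f n x - g x)) \<longlonglongrightarrow> 0"
proof -
  have fm [measurable]: "f n \<in> borel_measurable lborel" for n using assms(1) by (simp add: in_L2_iff)
  have fi: "integrable lborel (\<lambda>x. (norm (f m x - f n x))\<^sup>2)" for m n
    using L2_diff[OF assms(1) assms(1)] by (simp add: in_L2_iff)
  have "\<forall>k. \<exists>N. \<forall>m\<ge>N. \<forall>n\<ge>N. Lp_norm 2 (\<lambda>x. f m x - f n x) < (1 / 4) ^ k"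
    using assms(2) by simp
  then obtain N where N: "\<And>k m n. m \<ge> N k \<Longrightarrow> n \<ge> N k \<Longrightarrow> Lp_norm 2 (\<lambda>x. f m x - f n x) < (1 / 4) ^ k"
    by metis
  define r where "r k = k + (\<Sum>i\<le>k. N i)" for k
  have rN: "N k \<le> r k" "N k \<le> r (Suc k)" "k \<le> r k" for k
  proof -
    have "N k \<le> (\<Sum>i\<le>k. N i)" "N k \<le> (\<Sum>i\<le>Suc k. N i)" by (rule member_le_sum; simp)+
    then show "N k \<le> r k" "N k \<le> r (Suc k)" "k \<le> r k" unfolding r_def by linarith+
  qed
  define \<Delta> where "\<Delta> k x = f (r (Suc k)) x - f (r k) x" for k x
  have [measurable]: "\<Delta> k \<in> borel_measurable lborel" for k unfolding \<Delta>_def by simp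
  have \<Delta>: "(\<integral>\<^sup>+ x. ennreal (4 ^ k * (norm (\<Delta> k x))\<^sup>2) \<partial>lborel) \<le> ennreal ((1 / 4) ^ k)" for k
  proof -
    have "(\<integral>\<^sup>+ x. ennreal (4 ^ k * (norm (\<Delta> k x))\<^sup>2) \<partial>lborel) = ennreal (\<integral>x. 4 ^ k * (norm (\<Delta> k x))\<^sup>2 \<partial>lborel)"
      using fi unfolding \<Delta>_def by (intro nn_integral_eq_integral) auto
    also have "(\<integral>x. 4 ^ k * (norm (\<Delta> k x))\<^sup>2 \<partial>lborel) = 4 ^ k * (Lp_norm 2 (\<lambda>x. f (r (Suc k)) x - f (r k) x))\<^sup>2"
      by (simp add: Lp_norm_2_sq \<Delta>_def)
    also have "\<dots> \<le> 4 ^ k * ((1 / 4) ^ k)\<^sup>2"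
      by (intro mult_left_mono power_mono less_imp_le[OF N[OF rN(2) rN(1)]]) simp_all
    also have "\<dots> = (1 / 4) ^ k" by (simp add: power2_eq_square power_divide)
    finally show ?thesis by (simp add: ennreal_leI)
  qed
  have "AE x in lborel. (\<Sum>k. ennreal (4 ^ k * (norm (\<Delta> k x))\<^sup>2)) \<noteq> \<infinity>"
    by (rule AE_finite_weighted_sum) (use \<Delta> in simp_all)
  then have conv: "AE x in lborel. convergent (\<lambda>k. f (r k) x)"
  proof (rule eventually_mono)
    fix x assume elim: "(\<Sum>k. ennreal (4 ^ k * (norm (\<Delta> k x))\<^sup>2)) \<noteq> \<infinity>"
    have "summable (\<lambda>k. \<Delta> k x)" by (rule summable_of_weighted_squares[OF elim])
    then have "convergent (\<lambda>n. \<Sum>k<n. \<Delta> k x)" unfolding summable_iff_convergent .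
    moreover have "(\<Sum>k<n. \<Delta> k x) = f (r n) x - f (r 0) x" for n
      unfolding \<Delta>_def by (rule sum_lessThan_telescope)
    ultimately have "convergent (\<lambda>n. f (r n) x - f (r 0) x + f (r 0) x)"
      by (intro convergent_add convergent_const) simp
    then show "convergent (\<lambda>k. f (r k) x)" by simp
  qed
  define g where "g x = lim (\<lambda>k. f (r k) x)" for x
  have [measurable]: "g \<in> borel_measurable lborel"
    unfolding g_def by (rule borel_measurable_lim_metric) simp
  have lim: "AE x in lborel. (\<lambda>k. f (r k) x) \<longlonglongrightarrow> g x"
    using conv by eventually_elim (simp add: g_def convergent_LIMSEQ_iff)
  have fatou: "(\<integral>\<^sup>+ x. ennreal ((norm (f n x - g x))\<^sup>2) \<partial>lborel) \<le> ennreal (((1 / 4) ^ j)\<^sup>2)"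
    if n: "n \<ge> N j" for n j
  proof -
    have "(\<integral>\<^sup>+ x. ennreal ((norm (f n x - g x))\<^sup>2) \<partial>lborel)
        = (\<integral>\<^sup>+ x. liminf (\<lambda>k. ennreal ((norm (f n x - f (r k) x))\<^sup>2)) \<partial>lborel)"
    proof (rule nn_integral_cong_AE)
      show "AE x in lborel. ennreal ((norm (f n x - g x))\<^sup>2) = liminf (\<lambda>k. ennreal ((norm (f n x - f (r k) x))\<^sup>2))"
        using lim
      proof eventually_elim
        case (elim x)
        have "(\<lambda>k. ennreal ((norm (f n x - f (r k) x))\<^sup>2)) \<longlonglongrightarrow> ennreal ((norm (f n x - g x))\<^sup>2)"
          by (intro tendsto_ennrealI tendsto_power tendsto_norm tendsto_diff tendsto_const elim)
        then show ?case by (rule lim_imp_Liminf[OF trivial_limit_sequentially, symmetric])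
      qed
    qed
    also have "\<dots> \<le> liminf (\<lambda>k. \<integral>\<^sup>+ x. ennreal ((norm (f n x - f (r k) x))\<^sup>2) \<partial>lborel)"
      by (intro nn_integral_liminf) simp
    also have "\<dots> \<le> ennreal (((1 / 4) ^ j)\<^sup>2)"
    proof (rule Liminf_le[OF sequentially_bot])
      show "\<forall>\<^sub>F k in sequentially. (\<integral>\<^sup>+ x. ennreal ((norm (f n x - f (r k) x))\<^sup>2) \<partial>lborel) \<le> ennreal (((1 / 4) ^ j)\<^sup>2)"
        using eventually_ge_at_top[of "N j"]
      proof eventually_elim
        case (elim k)
        have "(\<integral>\<^sup>+ x. ennreal ((norm (f n x - f (r k) x))\<^sup>2) \<partial>lborel) = ennreal (\<integral>x. (norm (f n x - f (r k) x))\<^sup>2 \<partial>lborel)"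
          using fi by (intro nn_integral_eq_integral) auto
        also have "\<dots> = ennreal ((Lp_norm 2 (\<lambda>x. f n x - f (r k) x))\<^sup>2)" by (simp add: Lp_norm_2_sq)
        also have "\<dots> \<le> ennreal (((1 / 4) ^ j)\<^sup>2)"
        proof (intro ennreal_leI power_mono)
          have "N j \<le> r k" using elim rN(3)[of k] by simp
          then show "Lp_norm 2 (\<lambda>x. f n x - f (r k) x) \<le> (1 / 4) ^ j"
            using N[of j n "r k"] n by simp
        qed simp
        finally show ?case .
      qed
    qed
    finally show ?thesis .
  qed
  have L2d: "in_Lp 2 (\<lambda>x. f n x - g x)" if n: "n \<ge> N 0" for n
  proof -
    have "integrable lborel (\<lambda>x. (norm (f n x - g x))\<^sup>2)"
    proof (rule integrableI_bounded)
      have "norm ((norm (f n x - g x))\<^sup>2) = (norm (f n x - g x))\<^sup>2" for x by simp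
      then show "(\<integral>\<^sup>+ x. ennreal (norm ((norm (f n x - g x))\<^sup>2)) \<partial>lborel) < \<infinity>"
        unfolding infinity_ennreal_def
        by (simp only:) (rule le_less_trans[OF fatou[OF n] ennreal_less_top])
    qed simp
    then show ?thesis by (simp add: in_L2_iff)
  qed
  have "in_Lp 2 (\<lambda>x. f (N 0) x - (f (N 0) x - g x))"
    by (intro L2_diff assms(1) L2d) simp
  then have g: "in_Lp 2 g" by simp
  moreover have "(\<lambda>n. Lp_norm 2 (\<lambda>x. f n x - g x)) \<longlonglongrightarrow> 0"
  proof (rule LIMSEQ_I)
    fix e :: real assume "e > 0"
    obtain j where j: "(1 / 4 :: real) ^ j < e" using real_arch_pow_inv[OF \<open>e > 0\<close>, of "1 / 4"] by auto
    have "norm (Lp_norm 2 (\<lambda>x. f n x - g x) - 0) < e" if "n \<ge> N j" for n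
    proof -
      have "ennreal ((Lp_norm 2 (\<lambda>x. f n x - g x))\<^sup>2) = (\<integral>\<^sup>+ x. ennreal ((norm (f n x - g x))\<^sup>2) \<partial>lborel)"
        unfolding Lp_norm_2_sq using L2_diff[OF assms(1)[of n] g]
        by (intro nn_integral_eq_integral[symmetric]) (auto simp: in_L2_iff)
      also have "\<dots> \<le> ennreal (((1 / 4) ^ j)\<^sup>2)" by (rule fatou[OF that])
      finally have "(Lp_norm 2 (\<lambda>x. f n x - g x))\<^sup>2 \<le> ((1 / 4) ^ j)\<^sup>2"
        by (subst (asm) ennreal_le_iff) auto
      then have "Lp_norm 2 (\<lambda>x. f n x - g x) \<le> (1 / 4) ^ j" by (rule power2_le_imp_le) simp
      then show ?thesis using j by simp
    qed
    then show "\<exists>no. \<forall>n\<ge>no. norm (Lp_norm 2 (\<lambda>x. f n x - g x) - 0) < e" by blast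
  qed
  ultimately show ?thesis by (rule that)
qed

section \<open>The Plancherel identity\<close>

definition ft :: "(real \<Rightarrow> real) \<Rightarrow> real \<Rightarrow> complex" where
  "ft h \<xi> = (\<integral>x. cis (- (x * \<xi>)) * complex_of_real (h x) \<partial>lborel)"

lemma fourier_nth: "fourier f \<xi> $ i = ft (\<lambda>x. f x $ i) \<xi>"
  by (simp add: fourier_def ft_def)

lemma cis_measurable [measurable]: "cis \<in> borel_measurable borel"
  by (intro borel_measurable_continuous_onI continuous_intros continuous_on_cis continuous_on_id)

lemma cnj_measurable [measurable]: "cnj \<in> borel_measurable borel"
  by (intro borel_measurable_continuous_onI continuous_intros)

lemma integrable_cis_mult:
  fixes h :: "real \<Rightarrow> complex"
  assumes "integrable lborel h"
  shows "integrable lborel (\<lambda>x. cis (c * x) * h x)"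
proof (rule Bochner_Integration.integrable_bound[OF assms])
  have [measurable]: "h \<in> borel_measurable lborel" using assms by auto
  show "(\<lambda>x. cis (c * x) * h x) \<in> borel_measurable lborel" by measurable
qed (simp add: norm_mult)

lemma integrable_ft:
  assumes "integrable lborel h"
  shows "integrable lborel (\<lambda>x. cis (- (x * \<xi>)) * complex_of_real (h x))"
  using integrable_cis_mult[of "\<lambda>x. complex_of_real (h x)" "- \<xi>"] assms
  by (simp add: mult.commute[of \<xi>])

lemma ft_measurable [measurable]:
  assumes [measurable]: "h \<in> borel_measurable lborel"
  shows "ft h \<in> borel_measurable lborel"
  unfolding ft_def by measurable

lemma norm_ft_le:
  assumes "integrable lborel h"
  shows "norm (ft h \<xi>) \<le> (\<integral>x. \<bar>h x\<bar> \<partial>lborel)"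
proof -
  have "norm (ft h \<xi>) \<le> (\<integral>x. norm (cis (- (x * \<xi>)) * complex_of_real (h x)) \<partial>lborel)"
    unfolding ft_def by (rule integral_norm_bound)
  then show ?thesis by (simp add: norm_mult)
qed

lemma ft_diff:
  assumes "integrable lborel h" "integrable lborel k"
  shows "ft (\<lambda>x. h x - k x) \<xi> = ft h \<xi> - ft k \<xi>"
proof -
  have "ft (\<lambda>x. h x - k x) \<xi> = (\<integral>x. cis (- (x * \<xi>)) * complex_of_real (h x) - cis (- (x * \<xi>)) * complex_of_real (k x) \<partial>lborel)"
    by (simp add: ft_def right_diff_distrib)
  also have "\<dots> = ft h \<xi> - ft k \<xi>"
    unfolding ft_def by (intro Bochner_Integration.integral_diff integrable_ft assms)
  finally show ?thesis .
qed

text \<open>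
  By Fubini, both sides are the double integral of
  \<open>h x * G \<xi> * cis (- (x * \<xi>))\<close>.
\<close>

lemma multiplication_formula:
  fixes G :: "real \<Rightarrow> complex"
  assumes h: "integrable lborel h" and G: "integrable lborel G"
  shows "(\<integral>\<xi>. ft h \<xi> * G \<xi> \<partial>lborel)
    = (\<integral>x. complex_of_real (h x) * (\<integral>\<xi>. cis (- (x * \<xi>)) * G \<xi> \<partial>lborel) \<partial>lborel)"
proof -
  have [measurable]: "h \<in> borel_measurable lborel" "G \<in> borel_measurable lborel"
    using h G by auto
  define f where "f x \<xi> = cis (- (x * \<xi>)) * complex_of_real (h x) * G \<xi>" for x \<xi>
  have "integrable (lborel \<Otimes>\<^sub>M lborel) (case_prod f)"
  proof (rule lborel_pair.Fubini_integrable)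
    show "case_prod f \<in> borel_measurable (lborel \<Otimes>\<^sub>M lborel)"
      unfolding f_def by measurable
    have "(\<integral>\<xi>. norm (case_prod f (x, \<xi>)) \<partial>lborel) = \<bar>h x\<bar> * (\<integral>\<xi>. norm (G \<xi>) \<partial>lborel)" for x
      by (simp add: f_def norm_mult)
    then show "integrable lborel (\<lambda>x. \<integral>\<xi>. norm (case_prod f (x, \<xi>)) \<partial>lborel)"
      using h by simp
    show "AE x in lborel. integrable lborel (\<lambda>\<xi>. case_prod f (x, \<xi>))"
    proof (rule AE_I2)
      fix x
      have "integrable lborel (\<lambda>\<xi>. complex_of_real (h x) * (cis (- x * \<xi>) * G \<xi>))"
        by (intro integrable_mult_right integrable_cis_mult G)
      then show "integrable lborel (\<lambda>\<xi>. case_prod f (x, \<xi>))"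
        by (simp add: f_def mult_ac)
    qed
  qed
  from lborel_pair.Fubini_integral[OF this]
  have "(\<integral>\<xi>. (\<integral>x. f x \<xi> \<partial>lborel) \<partial>lborel) = (\<integral>x. (\<integral>\<xi>. f x \<xi> \<partial>lborel) \<partial>lborel)" .
  moreover have "(\<integral>x. f x \<xi> \<partial>lborel) = ft h \<xi> * G \<xi>" for \<xi>
    unfolding f_def ft_def by simp
  moreover have "(\<integral>\<xi>. f x \<xi> \<partial>lborel) = complex_of_real (h x) * (\<integral>\<xi>. cis (- (x * \<xi>)) * G \<xi> \<partial>lborel)" for x
    unfolding f_def by (subst integral_mult_right_zero[symmetric]) (simp add: mult_ac)
  ultimately show ?thesis by simp
qed

lemma gaussian_transform:
  assumes "\<epsilon> > 0"
  shows "(\<integral>\<xi>. cis (y * \<xi>) * complex_of_real (std_normal_density (\<epsilon> * \<xi>)) \<partial>lborel)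
     = complex_of_real (exp (- ((y / \<epsilon>)\<^sup>2 / 2)) / \<epsilon>)"
proof -
  have g: "(\<integral>s. cis (t * s) * complex_of_real (std_normal_density s) \<partial>lborel) = complex_of_real (exp (- (t\<^sup>2 / 2)))" for t
  proof -
    have "complex_of_real (exp (- (t\<^sup>2) / 2)) = char std_normal_distribution t"
      by (simp add: char_std_normal_distribution)
    also have "\<dots> = (\<integral>s. std_normal_density s *\<^sub>R iexp (t * s) \<partial>lborel)"
      unfolding char_def by (subst integral_density) (auto simp: normal_density_nonneg)
    also have "\<dots> = (\<integral>s. cis (t * s) * complex_of_real (std_normal_density s) \<partial>lborel)"
      by (intro Bochner_Integration.integral_cong refl) (simp add: cis_conv_exp scaleR_conv_of_real mult.commute)
    finally show ?thesis by simp
  qed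
  have "(\<integral>s. cis (y / \<epsilon> * s) * complex_of_real (std_normal_density s) \<partial>lborel)
    = \<bar>\<epsilon>\<bar> *\<^sub>R (\<integral>\<xi>. cis (y / \<epsilon> * (0 + \<epsilon> * \<xi>)) * complex_of_real (std_normal_density (0 + \<epsilon> * \<xi>)) \<partial>lborel)"
    using assms by (intro lborel_integral_real_affine) simp
  then have "complex_of_real (exp (- ((y / \<epsilon>)\<^sup>2 / 2)))
     = \<epsilon> *\<^sub>R (\<integral>\<xi>. cis (y * \<xi>) * complex_of_real (std_normal_density (\<epsilon> * \<xi>)) \<partial>lborel)"
    using assms unfolding g by simp
  then show ?thesis using assms by (simp add: scaleR_conv_of_real field_simps)
qed

lemma integrable_gauss_scaled:
  assumes "\<epsilon> > 0"
  shows "integrable lborel (\<lambda>\<xi>. std_normal_density (\<epsilon> * \<xi>))"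
  using lborel_integrable_real_affine_iff[of \<epsilon> std_normal_density 0] assms by simp

text \<open>
  Inserting a Gaussian weight makes all integrals absolutely convergent.  The transform of the
  weight is again a Gaussian, which acts on the right-hand side as an average of
  \<open>h\<close> at scale \<open>\<epsilon>\<close>.
\<close>

lemma plancherel_regularised:
  assumes h: "integrable lborel h" and e: "\<epsilon> > 0"
  shows "(\<integral>\<xi>. (norm (ft h \<xi>))\<^sup>2 * std_normal_density (\<epsilon> * \<xi>) \<partial>lborel)
    = (\<integral>x. h x * (\<integral>w. h (x + \<epsilon> * w) * exp (- (w\<^sup>2 / 2)) \<partial>lborel) \<partial>lborel)"
proof -
  have [measurable]: "h \<in> borel_measurable lborel" using h by auto
  let ?g = "\<lambda>\<xi>. complex_of_real (std_normal_density (\<epsilon> * \<xi>))"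
  have gi: "integrable lborel ?g" using integrable_gauss_scaled[OF e] by simp
  define B where "B = (\<integral>x. \<bar>h x\<bar> \<partial>lborel)"
  have Gi: "integrable lborel (\<lambda>\<xi>. ?g \<xi> * cnj (ft h \<xi>))"
  proof (rule Bochner_Integration.integrable_bound)
    show "integrable lborel (\<lambda>\<xi>. B * std_normal_density (\<epsilon> * \<xi>))"
      using integrable_gauss_scaled[OF e] by simp
    show "AE \<xi> in lborel. norm (?g \<xi> * cnj (ft h \<xi>)) \<le> norm (B * std_normal_density (\<epsilon> * \<xi>))"
      using norm_ft_le[OF h] by (intro AE_I2) (auto simp: norm_mult B_def mult.commute intro!: mult_right_mono)
  qed measurable
  have inner: "(\<integral>\<xi>. cis (- (x * \<xi>)) * (?g \<xi> * cnj (ft h \<xi>)) \<partial>lborel)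
     = complex_of_real (\<integral>w. h (x + \<epsilon> * w) * exp (- (w\<^sup>2 / 2)) \<partial>lborel)" for x
  proof -
    have "cnj (\<integral>\<xi>. cis (- (x * \<xi>)) * (?g \<xi> * cnj (ft h \<xi>)) \<partial>lborel)
       = (\<integral>\<xi>. ft h \<xi> * (cis (x * \<xi>) * ?g \<xi>) \<partial>lborel)"
      by (subst Bochner_Integration.integral_cnj[symmetric]) (simp add: cis_cnj mult_ac)
    also have "\<dots> = (\<integral>y. complex_of_real (h y) * (\<integral>\<xi>. cis (- (y * \<xi>)) * (cis (x * \<xi>) * ?g \<xi>) \<partial>lborel) \<partial>lborel)"
      by (intro multiplication_formula h integrable_cis_mult gi)
    also have "\<dots> = (\<integral>y. complex_of_real (h y) * complex_of_real (exp (- (((x - y) / \<epsilon>)\<^sup>2 / 2)) / \<epsilon>) \<partial>lborel)"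
    proof -
      have "cis (- (y * \<xi>)) * (cis (x * \<xi>) * ?g \<xi>) = cis ((x - y) * \<xi>) * ?g \<xi>" for y \<xi>
        by (simp add: mult.assoc[symmetric] cis_mult algebra_simps)
      then show ?thesis by (simp only: gaussian_transform[OF e])
    qed
    also have "\<dots> = complex_of_real (\<integral>y. h y * (exp (- (((x - y) / \<epsilon>)\<^sup>2 / 2)) / \<epsilon>) \<partial>lborel)"
      by (simp only: of_real_mult[symmetric] integral_complex_of_real)
    also have "(\<integral>y. h y * (exp (- (((x - y) / \<epsilon>)\<^sup>2 / 2)) / \<epsilon>) \<partial>lborel)
      = \<bar>\<epsilon>\<bar> *\<^sub>R (\<integral>w. h (x + \<epsilon> * w) * (exp (- (((x - (x + \<epsilon> * w)) / \<epsilon>)\<^sup>2 / 2)) / \<epsilon>) \<partial>lborel)"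
      using e by (intro lborel_integral_real_affine) simp
    also have "\<dots> = (\<integral>w. h (x + \<epsilon> * w) * exp (- (w\<^sup>2 / 2)) \<partial>lborel)"
    proof -
      have "h (x + \<epsilon> * w) * (exp (- (((x - (x + \<epsilon> * w)) / \<epsilon>)\<^sup>2 / 2)) / \<epsilon>)
          = (h (x + \<epsilon> * w) * exp (- (w\<^sup>2 / 2))) / \<epsilon>" for w using e by simp
      then have "(\<integral>w. h (x + \<epsilon> * w) * (exp (- (((x - (x + \<epsilon> * w)) / \<epsilon>)\<^sup>2 / 2)) / \<epsilon>) \<partial>lborel)
          = (\<integral>w. h (x + \<epsilon> * w) * exp (- (w\<^sup>2 / 2)) \<partial>lborel) / \<epsilon>"
        by (simp only: integral_divide_zero)
      then show ?thesis using e by (simp only: real_scaleR_def) simp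
    qed
    finally have "cnj (cnj (\<integral>\<xi>. cis (- (x * \<xi>)) * (?g \<xi> * cnj (ft h \<xi>)) \<partial>lborel))
       = cnj (complex_of_real (\<integral>w. h (x + \<epsilon> * w) * exp (- (w\<^sup>2 / 2)) \<partial>lborel))" by (simp only:)
    then show ?thesis by simp
  qed
  have "complex_of_real (\<integral>\<xi>. (norm (ft h \<xi>))\<^sup>2 * std_normal_density (\<epsilon> * \<xi>) \<partial>lborel)
     = (\<integral>\<xi>. ft h \<xi> * (?g \<xi> * cnj (ft h \<xi>)) \<partial>lborel)"
    unfolding integral_complex_of_real[symmetric]
    by (intro Bochner_Integration.integral_cong refl)
       (simp only: of_real_mult complex_norm_square mult_ac)
  also have "\<dots> = (\<integral>x. complex_of_real (h x) * complex_of_real (\<integral>w. h (x + \<epsilon> * w) * exp (- (w\<^sup>2 / 2)) \<partial>lborel) \<partial>lborel)"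
    unfolding multiplication_formula[OF h Gi] inner ..
  also have "\<dots> = complex_of_real (\<integral>x. h x * (\<integral>w. h (x + \<epsilon> * w) * exp (- (w\<^sup>2 / 2)) \<partial>lborel) \<partial>lborel)"
    by (simp only: of_real_mult[symmetric] integral_complex_of_real)
  finally show ?thesis by (simp only: of_real_eq_iff)
qed

lemma gauss_integral: "integrable lborel (\<lambda>w::real. exp (- (w\<^sup>2 / 2)))"
  "(\<integral>w. exp (- (w\<^sup>2 / 2)) \<partial>lborel) = sqrt (2 * pi)"
proof -
  have e: "exp (- (w\<^sup>2 / 2)) = sqrt (2 * pi) * std_normal_density w" for w :: real
    by (simp add: std_normal_density_def)
  show "integrable lborel (\<lambda>w::real. exp (- (w\<^sup>2 / 2)))" unfolding e by simp
  show "(\<integral>w. exp (- (w\<^sup>2 / 2)) \<partial>lborel) = sqrt (2 * pi)"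
    unfolding e by (simp add: prob_space_normal_density[of 1 0] integral_normal_density)
qed

text \<open>
  Let \<open>\<epsilon>\<close> tend to 0 in the regularised identity: the weight increases to a
  constant on the left (monotone convergence), and the average tends to \<open>h x\<close> on
  the right by continuity (dominated convergence).
\<close>

lemma plancherel_continuous:
  fixes h :: "real \<Rightarrow> real"
  assumes c: "continuous_on UNIV h" and R: "\<And>x. \<bar>x\<bar> > R \<Longrightarrow> h x = 0"
  shows "integrable lborel h" "in_Lp 2 (ft h)"
    "(\<integral>\<xi>. (norm (ft h \<xi>))\<^sup>2 \<partial>lborel) = 2 * pi * (\<integral>x. (h x)\<^sup>2 \<partial>lborel)"
proof -
  have [measurable]: "h \<in> borel_measurable borel" using c by (rule borel_measurable_continuous_onI)
  have "set_integrable lborel {-R..R} h"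
    using c by (intro borel_integrable_atLeastAtMost') (auto intro: continuous_on_subset)
  moreover have "(\<lambda>x. indicator {-R..R} x *\<^sub>R h x) = h"
    using R by (force simp: fun_eq_iff indicator_def not_le abs_le_iff)
  ultimately show hi: "integrable lborel h" by (simp add: set_integrable_def)
  have "bounded (h ` {-R..R})"
    by (intro compact_imp_bounded compact_continuous_image) (auto intro: continuous_on_subset[OF c])
  then obtain B where "B > 0" "\<forall>y\<in>h ` {-R..R}. norm y \<le> B"
    unfolding bounded_pos by blast
  then have B: "\<And>x. x \<in> {-R..R} \<Longrightarrow> \<bar>h x\<bar> \<le> B" "B > 0" by simp_all
  have B': "\<bar>h x\<bar> \<le> B" for x
  proof (cases "x \<in> {-R..R}")
    case False
    then have "h x = 0" by (intro R) auto
    then show ?thesis using B(2) by simp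
  qed (rule B(1))
  define e where "e n = inverse (real (Suc n))" for n
  have e: "e n > 0" "e n \<le> 1" for n by (auto simp: e_def field_simps)
  have e0: "e \<longlonglongrightarrow> 0" unfolding e_def by (rule LIMSEQ_inverse_real_of_nat)
  have dec: "decseq e" by (auto simp: decseq_def e_def field_simps)
  define D where "D = (\<integral>x. \<bar>h x\<bar> \<partial>lborel)"
  let ?u = "\<lambda>\<xi>. (norm (ft h \<xi>))\<^sup>2 * std_normal_density 0"
  let ?f = "\<lambda>n \<xi>. (norm (ft h \<xi>))\<^sup>2 * std_normal_density (e n * \<xi>)"
  have i: "integrable lborel (?f n)" for n
  proof (rule Bochner_Integration.integrable_bound)
    show "integrable lborel (\<lambda>\<xi>. D\<^sup>2 * std_normal_density (e n * \<xi>))"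
      using integrable_gauss_scaled[OF e(1)] by simp
    have "(norm (ft h \<xi>))\<^sup>2 \<le> D\<^sup>2" for \<xi>
      unfolding D_def by (intro power_mono norm_ft_le hi) auto
    then show "AE \<xi> in lborel. norm (?f n \<xi>) \<le> norm (D\<^sup>2 * std_normal_density (e n * \<xi>))"
      by (intro AE_I2) (simp add: mult_right_mono)
  qed measurable
  have m: "mono (\<lambda>n. ?f n \<xi>)" for \<xi>
  proof (rule monoI)
    fix n k :: nat assume "n \<le> k"
    then have "e k \<le> e n" using dec by (simp add: decseq_def)
    then have "(e k * \<xi>)\<^sup>2 \<le> (e n * \<xi>)\<^sup>2"
      unfolding power_mult_distrib using e(1)[of k] by (intro mult_right_mono power_mono) auto
    then have "std_normal_density (e n * \<xi>) \<le> std_normal_density (e k * \<xi>)"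
      unfolding std_normal_density_def by (intro mult_left_mono) auto
    then show "?f n \<xi> \<le> ?f k \<xi>" by (intro mult_left_mono) auto
  qed
  have l: "(\<lambda>n. ?f n \<xi>) \<longlonglongrightarrow> ?u \<xi>" for \<xi>
  proof -
    have "(\<lambda>n. (norm (ft h \<xi>))\<^sup>2 * (1 / sqrt (2 * pi) * exp (- (e n * \<xi>)\<^sup>2 / 2))) \<longlonglongrightarrow>
       (norm (ft h \<xi>))\<^sup>2 * (1 / sqrt (2 * pi) * exp (- (0 * \<xi>)\<^sup>2 / 2))"
      by (intro tendsto_intros e0) auto
    then show ?thesis by (simp add: std_normal_density_def)
  qed
  have I: "(\<lambda>n. integral\<^sup>L lborel (?f n)) \<longlonglongrightarrow> (\<integral>x. h x * (h x * sqrt (2 * pi)) \<partial>lborel)"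
    unfolding plancherel_regularised[OF hi e(1)]
  proof (rule integral_dominated_convergence[where w = "\<lambda>x. \<bar>h x\<bar> * (B * sqrt (2 * pi))"])
    have inner: "(\<lambda>n. (\<integral>w. h (x + e n * w) * exp (- (w\<^sup>2 / 2)) \<partial>lborel)) \<longlonglongrightarrow> (\<integral>w. h x * exp (- (w\<^sup>2 / 2)) \<partial>lborel)" for x
    proof (rule integral_dominated_convergence[where w = "\<lambda>w. B * exp (- (w\<^sup>2 / 2))"])
      show "integrable lborel (\<lambda>w. B * exp (- (w\<^sup>2 / 2)))" using gauss_integral(1) by simp
      show "AE w in lborel. (\<lambda>n. h (x + e n * w) * exp (- (w\<^sup>2 / 2))) \<longlonglongrightarrow> h x * exp (- (w\<^sup>2 / 2))"
      proof (rule AE_I2)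
        fix w
        have "(\<lambda>n. x + e n * w) \<longlonglongrightarrow> x + 0 * w" by (intro tendsto_intros e0)
        then have "(\<lambda>n. h (x + e n * w)) \<longlonglongrightarrow> h x"
          using c by (intro isCont_tendsto_compose[of x h]) (auto simp: continuous_on_eq_continuous_at)
        then show "(\<lambda>n. h (x + e n * w) * exp (- (w\<^sup>2 / 2))) \<longlonglongrightarrow> h x * exp (- (w\<^sup>2 / 2))"
          by (intro tendsto_mult tendsto_const)
      qed
      show "AE w in lborel. norm (h (x + e n * w) * exp (- (w\<^sup>2 / 2))) \<le> B * exp (- (w\<^sup>2 / 2))" for n
        using B' by (intro AE_I2) (simp add: abs_mult mult_right_mono)
    qed measurable
    show "AE x in lborel. (\<lambda>n. h x * (\<integral>w. h (x + e n * w) * exp (- (w\<^sup>2 / 2)) \<partial>lborel)) \<longlonglongrightarrow> h x * (h x * sqrt (2 * pi))"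
    proof (rule AE_I2)
      fix x
      have "(\<integral>w. h x * exp (- (w\<^sup>2 / 2)) \<partial>lborel) = h x * sqrt (2 * pi)"
        by (simp only: integral_mult_right_zero gauss_integral(2))
      with inner[of x] show "(\<lambda>n. h x * (\<integral>w. h (x + e n * w) * exp (- (w\<^sup>2 / 2)) \<partial>lborel)) \<longlonglongrightarrow> h x * (h x * sqrt (2 * pi))"
        by (intro tendsto_mult tendsto_const) (simp only:)
    qed
    show "AE x in lborel. norm (h x * (\<integral>w. h (x + e n * w) * exp (- (w\<^sup>2 / 2)) \<partial>lborel)) \<le> \<bar>h x\<bar> * (B * sqrt (2 * pi))" for n
    proof (rule AE_I2)
      fix x
      have "norm (\<integral>w. h (x + e n * w) * exp (- (w\<^sup>2 / 2)) \<partial>lborel) \<le> (\<integral>w. B * exp (- (w\<^sup>2 / 2)) \<partial>lborel)"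
      proof (rule Bochner_Integration.integral_norm_bound_integral)
        show Bi: "integrable lborel (\<lambda>w. B * exp (- (w\<^sup>2 / 2)))" using gauss_integral(1) by simp
        show b: "norm (h (x + e n * w) * exp (- (w\<^sup>2 / 2))) \<le> B * exp (- (w\<^sup>2 / 2))" for w
          using B' by (simp add: abs_mult mult_right_mono)
        show "integrable lborel (\<lambda>w. h (x + e n * w) * exp (- (w\<^sup>2 / 2)))"
        proof (rule Bochner_Integration.integrable_bound[OF Bi])
          show "AE w in lborel. norm (h (x + e n * w) * exp (- (w\<^sup>2 / 2))) \<le> norm (B * exp (- (w\<^sup>2 / 2)))"
            by (rule AE_I2, rule order_trans[OF b]) simp
        qed measurable
      qed
      also have "\<dots> = B * sqrt (2 * pi)" by (simp only: integral_mult_right_zero gauss_integral(2))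
      finally have "norm (h x) * norm (\<integral>w. h (x + e n * w) * exp (- (w\<^sup>2 / 2)) \<partial>lborel) \<le> norm (h x) * (B * sqrt (2 * pi))"
        by (rule mult_left_mono) (rule norm_ge_zero)
      then show "norm (h x * (\<integral>w. h (x + e n * w) * exp (- (w\<^sup>2 / 2)) \<partial>lborel)) \<le> \<bar>h x\<bar> * (B * sqrt (2 * pi))"
        by (simp only: real_norm_def abs_mult)
    qed
    show "integrable lborel (\<lambda>x. \<bar>h x\<bar> * (B * sqrt (2 * pi)))" using hi by simp
  qed measurable
  have um: "?u \<in> borel_measurable lborel" by measurable
  note mc = i AE_I2[OF m] AE_I2[OF l] I um
  have ui: "integrable lborel ?u" by (rule integrable_monotone_convergence[OF mc])
  have uI: "integral\<^sup>L lborel ?u = (\<integral>x. h x * (h x * sqrt (2 * pi)) \<partial>lborel)"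
    by (rule integral_monotone_convergence[OF mc])
  have s: "std_normal_density 0 = 1 / sqrt (2 * pi)" by (simp add: std_normal_density_def)
  have p: "sqrt (2 * pi) \<noteq> 0" by simp
  have "integrable lborel (\<lambda>\<xi>. sqrt (2 * pi) * ?u \<xi>)" using ui by (rule integrable_mult_right)
  then have "integrable lborel (\<lambda>\<xi>. (norm (ft h \<xi>))\<^sup>2)" unfolding s using p by simp
  then show "in_Lp 2 (ft h)" by (simp add: in_L2_iff)
  have p1: "sqrt (2 * pi) * integral\<^sup>L lborel ?u = (\<integral>\<xi>. (norm (ft h \<xi>))\<^sup>2 \<partial>lborel)"
    unfolding s integral_mult_right_zero[symmetric] using p by simp
  have p2: "sqrt (2 * pi) * (\<integral>x. h x * (h x * sqrt (2 * pi)) \<partial>lborel) = 2 * pi * (\<integral>x. (h x)\<^sup>2 \<partial>lborel)"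
  proof -
    have "(\<integral>x. h x * (h x * sqrt (2 * pi)) \<partial>lborel) = (\<integral>x. sqrt (2 * pi) * (h x)\<^sup>2 \<partial>lborel)"
      by (intro Bochner_Integration.integral_cong refl) (simp add: power2_eq_square)
    then show ?thesis by (simp add: mult.assoc[symmetric])
  qed
  have "sqrt (2 * pi) * integral\<^sup>L lborel ?u = sqrt (2 * pi) * (\<integral>x. h x * (h x * sqrt (2 * pi)) \<partial>lborel)"
    by (rule arg_cong[OF uI])
  then show "(\<integral>\<xi>. (norm (ft h \<xi>))\<^sup>2 \<partial>lborel) = 2 * pi * (\<integral>x. (h x)\<^sup>2 \<partial>lborel)"
    by (rule box_equals[OF _ p1 p2])
qed

text \<open>
  A measurable function is an almost everywhere limit of continuous functions
  \<open>g n\<close>.  Clamping their values to \<open>[-M, M]\<close> and multiplying by a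
  trapezoid supported in \<open>[-(M + 1), M + 1]\<close> makes dominated convergence applicable
  for each \<open>M\<close>; a diagonal choice finishes the argument.  Both norms are controlled
  by the same sequence, which is what the extension of the Plancherel identity needs.
\<close>

lemma L1_L2_dense_continuous:
  fixes h :: "real \<Rightarrow> real"
  assumes h1: "integrable lborel h" and h2: "in_Lp 2 h"
  obtains k :: "nat \<Rightarrow> real \<Rightarrow> real" where "\<And>n. continuous_on UNIV (k n)"
    "\<And>n. \<exists>R. \<forall>x. \<bar>x\<bar> > R \<longrightarrow> k n x = 0"
    "(\<lambda>n. (\<integral>x. \<bar>k n x - h x\<bar> \<partial>lborel)) \<longlonglongrightarrow> 0"
    "(\<lambda>n. Lp_norm 2 (\<lambda>x. k n x - h x)) \<longlonglongrightarrow> 0"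
proof -
  have hm [measurable]: "h \<in> borel_measurable borel" using h1 by auto
  have h2i: "integrable lborel (\<lambda>x. (h x)\<^sup>2)" using h2 by (simp add: in_L2_iff)
  have "h \<in> borel_measurable lebesgue" by (rule measurable_completion) simp
  then have "h measurable_on UNIV" by (intro lebesgue_measurable_imp_measurable_on_real) auto
  then obtain N g where N: "negligible N" and gc: "\<And>n. continuous_on UNIV (g n)"
    and gl: "\<And>x. x \<notin> N \<Longrightarrow> (\<lambda>n. g n x) \<longlonglongrightarrow> h x"
    unfolding measurable_on_def by (auto simp: UNIV_I)
  have [measurable]: "g n \<in> borel_measurable borel" for n using gc by (rule borel_measurable_continuous_onI)
  have "N \<in> null_sets lebesgue" using N by (simp add: negligible_iff_null_sets)
  then have "AE x in lebesgue. x \<notin> N" by (rule AE_not_in)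
  then have N': "AE x in lborel. x \<notin> N" by (simp add: AE_completion_iff)
  define \<theta> where "\<theta> M x = max 0 (min 1 (real M + 1 - \<bar>x\<bar>))" for M :: nat and x :: real
  define cl where "cl M y = max (- real M) (min (real M) y)" for M :: nat and y :: real
  have \<theta>: "0 \<le> \<theta> M x" "\<theta> M x \<le> 1" for M x by (auto simp: \<theta>_def)
  have \<theta>0: "\<theta> M x = 0" if "x \<notin> {- (real M + 1)..real M + 1}" for M x using that by (auto simp: \<theta>_def)
  have cl: "\<bar>cl M y\<bar> \<le> real M" "\<bar>cl M y\<bar> \<le> \<bar>y\<bar>" for M y by (auto simp: cl_def)
  have ccl: "continuous_on UNIV (cl M)" for M unfolding cl_def by (intro continuous_intros)
  have c\<theta>: "continuous_on UNIV (\<theta> M)" for M unfolding \<theta>_def by (intro continuous_intros)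
  have [measurable]: "cl M \<in> borel_measurable borel" "\<theta> M \<in> borel_measurable borel" for M
    using ccl c\<theta> by (auto intro: borel_measurable_continuous_onI)
  define k where "k M n x = \<theta> M x * cl M (g n x)" for M n x
  define hh where "hh M x = \<theta> M x * cl M (h x)" for M x
  have [measurable]: "k M n \<in> borel_measurable borel" "hh M \<in> borel_measurable borel" for M n
    unfolding k_def hh_def by measurable
  have b1: "\<bar>k M n x - hh M x\<bar> \<le> 2 * real M * indicator {- (real M + 1)..real M + 1} x" for M n x
  proof (cases "x \<in> {- (real M + 1)..real M + 1}")
    case True
    have "\<bar>\<theta> M x * (cl M (g n x) - cl M (h x))\<bar> \<le> 1 * (real M + real M)"
      unfolding abs_mult using \<theta>[of M x] cl(1)[of M "g n x"] cl(1)[of M "h x"]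
      by (intro mult_mono) linarith+
    then show ?thesis using True by (simp add: k_def hh_def right_diff_distrib)
  qed (simp add: k_def hh_def \<theta>0)
  have lk: "AE x in lborel. (\<lambda>n. k M n x - hh M x) \<longlonglongrightarrow> 0" for M
    using N'
  proof eventually_elim
    case (elim x)
    have "(\<lambda>n. cl M (g n x)) \<longlonglongrightarrow> cl M (h x)"
      using ccl[of M] gl[OF elim] by (intro isCont_tendsto_compose[of "h x" "cl M"]) (auto simp: continuous_on_eq_continuous_at)
    then have "(\<lambda>n. \<theta> M x * cl M (g n x)) \<longlonglongrightarrow> \<theta> M x * cl M (h x)"
      by (intro tendsto_mult tendsto_const)
    then show ?case unfolding k_def hh_def by (simp add: LIM_zero)
  qed
  have I1: "(\<lambda>n. (\<integral>x. \<bar>k M n x - hh M x\<bar> \<partial>lborel)) \<longlonglongrightarrow> (\<integral>x. 0 \<partial>(lborel :: real measure))" for M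
  proof (rule integral_dominated_convergence[where w = "\<lambda>x. 2 * real M * indicator {- (real M + 1)..real M + 1} x"])
    show "AE x in lborel. (\<lambda>n. \<bar>k M n x - hh M x\<bar>) \<longlonglongrightarrow> 0"
      using lk[of M] by eventually_elim (rule tendsto_rabs_zero)
    show "AE x in lborel. norm \<bar>k M n x - hh M x\<bar> \<le> 2 * real M * indicator {- (real M + 1)..real M + 1} x" for n
      using b1 by (intro AE_I2) simp
  qed (auto intro!: integrable_mult_right integrable_real_indicator simp: emeasure_lborel_Icc_eq)
  have I2: "(\<lambda>n. (\<integral>x. (k M n x - hh M x)\<^sup>2 \<partial>lborel)) \<longlonglongrightarrow> (\<integral>x. 0 \<partial>(lborel :: real measure))" for M
  proof (rule integral_dominated_convergence[where w = "\<lambda>x. (2 * real M)\<^sup>2 * indicator {- (real M + 1)..real M + 1} x"])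
    show "AE x in lborel. (\<lambda>n. (k M n x - hh M x)\<^sup>2) \<longlonglongrightarrow> 0"
      using lk[of M]
    proof eventually_elim
      case (elim x)
      from tendsto_power[OF this, of 2] show ?case by simp
    qed
    show "AE x in lborel. norm ((k M n x - hh M x)\<^sup>2) \<le> (2 * real M)\<^sup>2 * indicator {- (real M + 1)..real M + 1} x" for n
    proof (rule AE_I2)
      fix x
      have "\<bar>k M n x - hh M x\<bar>\<^sup>2 \<le> (2 * real M * indicator {- (real M + 1)..real M + 1} x)\<^sup>2"
        by (intro power_mono b1) simp
      then show "norm ((k M n x - hh M x)\<^sup>2) \<le> (2 * real M)\<^sup>2 * indicator {- (real M + 1)..real M + 1} x"
        by (cases "x \<in> {- (real M + 1)..real M + 1}") (simp_all add: power_mult_distrib)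
    qed
  qed (auto intro!: integrable_mult_right integrable_real_indicator simp: emeasure_lborel_Icc_eq)
  have "\<exists>n. (\<integral>x. \<bar>k M n x - hh M x\<bar> \<partial>lborel) < inverse (real (Suc M)) \<and> (\<integral>x. (k M n x - hh M x)\<^sup>2 \<partial>lborel) < inverse (real (Suc M))" for M
  proof -
    have "0 < inverse (real (Suc M))" by simp
    moreover have "(\<lambda>n. (\<integral>x. \<bar>k M n x - hh M x\<bar> \<partial>lborel)) \<longlonglongrightarrow> 0" "(\<lambda>n. (\<integral>x. (k M n x - hh M x)\<^sup>2 \<partial>lborel)) \<longlonglongrightarrow> 0"
      using I1[of M] I2[of M] by simp_all
    ultimately have "\<forall>\<^sub>F n in sequentially. (\<integral>x. \<bar>k M n x - hh M x\<bar> \<partial>lborel) < inverse (real (Suc M))"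
      "\<forall>\<^sub>F n in sequentially. (\<integral>x. (k M n x - hh M x)\<^sup>2 \<partial>lborel) < inverse (real (Suc M))"
      by (simp_all only: order_tendstoD(2))
    then have "\<forall>\<^sub>F n in sequentially. (\<integral>x. \<bar>k M n x - hh M x\<bar> \<partial>lborel) < inverse (real (Suc M)) \<and> (\<integral>x. (k M n x - hh M x)\<^sup>2 \<partial>lborel) < inverse (real (Suc M))"
      by (rule eventually_conj)
    then show ?thesis by (rule eventually_happens'[OF sequentially_bot])
  qed
  then have "\<exists>r. \<forall>M. (\<integral>x. \<bar>k M (r M) x - hh M x\<bar> \<partial>lborel) < inverse (real (Suc M)) \<and> (\<integral>x. (k M (r M) x - hh M x)\<^sup>2 \<partial>lborel) < inverse (real (Suc M))"
    by (intro choice allI)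
  then obtain r where r: "\<And>M. (\<integral>x. \<bar>k M (r M) x - hh M x\<bar> \<partial>lborel) < inverse (real (Suc M))"
    "\<And>M. (\<integral>x. (k M (r M) x - hh M x)\<^sup>2 \<partial>lborel) < inverse (real (Suc M))" by blast
  have ki1: "integrable lborel (\<lambda>x. \<bar>k M n x - hh M x\<bar>)" for M n
    by (rule Bochner_Integration.integrable_bound[of lborel "\<lambda>x. 2 * real M * indicator {- (real M + 1)..real M + 1} x :: real"])
       (auto intro!: integrable_mult_right integrable_real_indicator AE_I2 order_trans[OF b1] simp: emeasure_lborel_Icc_eq)
  have ki2: "integrable lborel (\<lambda>x. (k M n x - hh M x)\<^sup>2)" for M n
  proof (rule Bochner_Integration.integrable_bound)
    show "integrable lborel (\<lambda>x. 2 * real M * \<bar>k M n x - hh M x\<bar>)" by (intro integrable_mult_right ki1)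
    show "AE x in lborel. norm ((k M n x - hh M x)\<^sup>2) \<le> norm (2 * real M * \<bar>k M n x - hh M x\<bar>)"
    proof (rule AE_I2)
      fix x
      have "\<bar>k M n x - hh M x\<bar> \<le> 2 * real M"
        by (rule order_trans[OF b1]) (simp add: indicator_def)
      then have "\<bar>k M n x - hh M x\<bar> * \<bar>k M n x - hh M x\<bar> \<le> 2 * real M * \<bar>k M n x - hh M x\<bar>"
        by (rule mult_right_mono) simp
      then show "norm ((k M n x - hh M x)\<^sup>2) \<le> norm (2 * real M * \<bar>k M n x - hh M x\<bar>)"
        by (simp add: power2_eq_square abs_mult)
    qed
  qed measurable
  have hb: "\<bar>hh M x\<bar> \<le> \<bar>h x\<bar>" for M x
    unfolding hh_def abs_mult using mult_mono[of "\<bar>\<theta> M x\<bar>" 1 "\<bar>cl M (h x)\<bar>" "\<bar>h x\<bar>"] \<theta>[of M x] cl(2)[of M "h x"] by simp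
  have hb2: "\<bar>hh M x - h x\<bar> \<le> 2 * \<bar>h x\<bar>" for M x using hb[of M x] by linarith
  have lh: "(\<lambda>M. hh M x - h x) \<longlonglongrightarrow> 0" for x
  proof (rule tendsto_eventually)
    have "\<forall>\<^sub>F M in sequentially. \<bar>x\<bar> \<le> real M \<and> \<bar>h x\<bar> \<le> real M"
    proof (rule eventually_sequentiallyI)
      fix M assume "nat \<lceil>\<bar>x\<bar> + \<bar>h x\<bar>\<rceil> \<le> M"
      then have "\<bar>x\<bar> + \<bar>h x\<bar> \<le> real M" by linarith
      then show "\<bar>x\<bar> \<le> real M \<and> \<bar>h x\<bar> \<le> real M" by linarith
    qed
    then show "\<forall>\<^sub>F M in sequentially. hh M x - h x = 0"
      by eventually_elim (auto simp: hh_def \<theta>_def cl_def)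
  qed
  have hi1: "integrable lborel (\<lambda>x. \<bar>hh M x - h x\<bar>)" for M
    by (rule Bochner_Integration.integrable_bound[of lborel "\<lambda>x. 2 * \<bar>h x\<bar>"]) (use h1 hb2 in auto)
  have sqb: "(hh M x - h x)\<^sup>2 \<le> 4 * (h x)\<^sup>2" for M x
  proof -
    have "\<bar>hh M x - h x\<bar>\<^sup>2 \<le> (2 * \<bar>h x\<bar>)\<^sup>2" by (intro power_mono hb2) simp
    then show ?thesis by (simp add: power_mult_distrib)
  qed
  have hi2: "integrable lborel (\<lambda>x. (hh M x - h x)\<^sup>2)" for M
    by (rule Bochner_Integration.integrable_bound[of lborel "\<lambda>x. 4 * (h x)\<^sup>2"]) (use h2i sqb in auto)
  have H1: "(\<lambda>M. (\<integral>x. \<bar>hh M x - h x\<bar> \<partial>lborel)) \<longlonglongrightarrow> (\<integral>x. 0 \<partial>(lborel :: real measure))"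
  proof (rule integral_dominated_convergence[where w = "\<lambda>x. 2 * \<bar>h x\<bar>"])
    show "AE x in lborel. (\<lambda>M. \<bar>hh M x - h x\<bar>) \<longlonglongrightarrow> 0" by (intro AE_I2 tendsto_rabs_zero lh)
  qed (use h1 hb2 in auto)
  have H2: "(\<lambda>M. (\<integral>x. (hh M x - h x)\<^sup>2 \<partial>lborel)) \<longlonglongrightarrow> (\<integral>x. 0 \<partial>(lborel :: real measure))"
  proof (rule integral_dominated_convergence[where w = "\<lambda>x. 4 * (h x)\<^sup>2"])
    show "AE x in lborel. (\<lambda>M. (hh M x - h x)\<^sup>2) \<longlonglongrightarrow> 0"
    proof (rule AE_I2)
      fix x
      show "(\<lambda>M. (hh M x - h x)\<^sup>2) \<longlonglongrightarrow> 0" using tendsto_power[OF lh[of x], of 2] by simp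
    qed
  qed (use h2i sqb in auto)
  have z: "(\<lambda>M. inverse (real (Suc M))) \<longlonglongrightarrow> 0" by (rule LIMSEQ_inverse_real_of_nat)
  show ?thesis
  proof (rule that[of "\<lambda>M. k M (r M)"])
    show "continuous_on UNIV (k M (r M))" for M unfolding k_def
      by (intro continuous_intros c\<theta> continuous_on_compose2[OF ccl gc]) auto
    show "\<exists>R. \<forall>x. \<bar>x\<bar> > R \<longrightarrow> k M (r M) x = 0" for M
      by (rule exI[of _ "real M + 1"]) (auto simp: k_def \<theta>_def)
    have B1: "(\<integral>x. \<bar>k M (r M) x - h x\<bar> \<partial>lborel) \<le> inverse (real (Suc M)) + (\<integral>x. \<bar>hh M x - h x\<bar> \<partial>lborel)" for M
    proof -
      have "(\<integral>x. \<bar>k M (r M) x - h x\<bar> \<partial>lborel) \<le> (\<integral>x. \<bar>k M (r M) x - hh M x\<bar> + \<bar>hh M x - h x\<bar> \<partial>lborel)"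
        by (rule integral_mono_AE') (use ki1 hi1 in \<open>auto intro!: AE_I2\<close>)
      also have "\<dots> = (\<integral>x. \<bar>k M (r M) x - hh M x\<bar> \<partial>lborel) + (\<integral>x. \<bar>hh M x - h x\<bar> \<partial>lborel)"
        by (intro Bochner_Integration.integral_add ki1 hi1)
      finally show ?thesis using r(1)[of M] by linarith
    qed
    show "(\<lambda>M. (\<integral>x. \<bar>k M (r M) x - h x\<bar> \<partial>lborel)) \<longlonglongrightarrow> 0"
    proof (rule tendsto_sandwich[OF _ _ tendsto_const])
      show "(\<lambda>M. inverse (real (Suc M)) + (\<integral>x. \<bar>hh M x - h x\<bar> \<partial>lborel)) \<longlonglongrightarrow> 0"
        using tendsto_add[OF z H1] by simp
    qed (use B1 in auto)
    have B2: "(\<integral>x. (k M (r M) x - h x)\<^sup>2 \<partial>lborel) \<le> 2 * inverse (real (Suc M)) + 2 * (\<integral>x. (hh M x - h x)\<^sup>2 \<partial>lborel)" for M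
    proof -
      have "(\<integral>x. (k M (r M) x - h x)\<^sup>2 \<partial>lborel) \<le> (\<integral>x. 2 * (k M (r M) x - hh M x)\<^sup>2 + 2 * (hh M x - h x)\<^sup>2 \<partial>lborel)"
      proof (rule integral_mono_AE')
        show "AE x in lborel. (k M (r M) x - h x)\<^sup>2 \<le> 2 * (k M (r M) x - hh M x)\<^sup>2 + 2 * (hh M x - h x)\<^sup>2"
        proof (rule AE_I2)
          fix x
          show "(k M (r M) x - h x)\<^sup>2 \<le> 2 * (k M (r M) x - hh M x)\<^sup>2 + 2 * (hh M x - h x)\<^sup>2"
            using norm_add_sq_le2[of "k M (r M) x - hh M x" "hh M x - h x"] by simp
        qed
      qed (use ki2 hi2 in auto)
      also have "\<dots> = 2 * (\<integral>x. (k M (r M) x - hh M x)\<^sup>2 \<partial>lborel) + 2 * (\<integral>x. (hh M x - h x)\<^sup>2 \<partial>lborel)"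
        using ki2 hi2 by simp
      finally show ?thesis using r(2)[of M] by linarith
    qed
    have "(\<lambda>M. (\<integral>x. (k M (r M) x - h x)\<^sup>2 \<partial>lborel)) \<longlonglongrightarrow> 0"
    proof (rule tendsto_sandwich[OF _ _ tendsto_const])
      show "(\<lambda>M. 2 * inverse (real (Suc M)) + 2 * (\<integral>x. (hh M x - h x)\<^sup>2 \<partial>lborel)) \<longlonglongrightarrow> 0"
        using tendsto_add[OF tendsto_mult_left[OF z, of 2] tendsto_mult_left[OF H2, of 2]] by simp
    qed (use B2 in auto)
    from tendsto_real_sqrt[OF this] show "(\<lambda>M. Lp_norm 2 (\<lambda>x. k M (r M) x - h x)) \<longlonglongrightarrow> 0"
      unfolding Lp_norm_2 by simp
  qed
qed

lemma L2_convergent_Cauchy: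
  fixes k :: "nat \<Rightarrow> real \<Rightarrow> 'a::euclidean_space"
  assumes "\<And>n. in_Lp 2 (k n)" "in_Lp 2 h" "(\<lambda>n. Lp_norm 2 (\<lambda>x. k n x - h x)) \<longlonglongrightarrow> 0" "e > 0"
  shows "\<exists>N. \<forall>m\<ge>N. \<forall>n\<ge>N. Lp_norm 2 (\<lambda>x. k m x - k n x) < e"
proof -
  have "\<forall>\<^sub>F n in sequentially. Lp_norm 2 (\<lambda>x. k n x - h x) < e / 2"
    using assms(3,4) by (intro order_tendstoD(2)[OF assms(3)]) simp
  then obtain N where N: "\<And>n. n \<ge> N \<Longrightarrow> Lp_norm 2 (\<lambda>x. k n x - h x) < e / 2"
    unfolding eventually_sequentially by blast
  have "Lp_norm 2 (\<lambda>x. k m x - k n x) < e" if "m \<ge> N" "n \<ge> N" for m n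
    using L2_triangle[OF assms(1)[of m] assms(2) assms(1)[of n]] N[OF that(1)] N[OF that(2)]
      Lp_norm_2_minus_commute[of h "k n"] by simp
  then show ?thesis by blast
qed

lemma L2_cong_AE:
  assumes g: "in_Lp 2 g" and f: "f \<in> borel_measurable lborel" and ae: "AE x in lborel. f x = g x"
  shows "in_Lp 2 f"
proof -
  have [measurable]: "f \<in> borel_measurable lborel" "g \<in> borel_measurable lborel"
    using f g by (simp_all add: in_L2_iff)
  have "AE x in lborel. (norm (f x))\<^sup>2 = (norm (g x))\<^sup>2"
    using ae by (rule eventually_mono) simp
  then have "integrable lborel (\<lambda>x. (norm (f x))\<^sup>2) = integrable lborel (\<lambda>x. (norm (g x))\<^sup>2)"
    by (intro integrable_cong_AE) measurable
  then show ?thesis using g f by (simp add: in_L2_iff)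
qed

text \<open>
  Along the approximating sequence the transforms converge uniformly by the \<open>L^1\<close>
  convergence, and they form a Cauchy sequence in \<open>L^2\<close> by the isometry; the two
  limits agree.
\<close>

lemma plancherel_real:
  fixes h :: "real \<Rightarrow> real"
  assumes h1: "integrable lborel h" and h2: "in_Lp 2 h"
  shows "in_Lp 2 (ft h)" "Lp_norm 2 (ft h) = sqrt (2 * pi) * Lp_norm 2 h"
proof -
  obtain k :: "nat \<Rightarrow> real \<Rightarrow> real" where kc: "\<And>n. continuous_on UNIV (k n)"
    and kR: "\<And>n. \<exists>R. \<forall>x. \<bar>x\<bar> > R \<longrightarrow> k n x = 0"
    and k1: "(\<lambda>n. (\<integral>x. \<bar>k n x - h x\<bar> \<partial>lborel)) \<longlonglongrightarrow> 0"
    and k2: "(\<lambda>n. Lp_norm 2 (\<lambda>x. k n x - h x)) \<longlonglongrightarrow> 0"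
    using L1_L2_dense_continuous[OF h1 h2] by blast
  obtain R where R: "\<And>n x. \<bar>x\<bar> > R n \<Longrightarrow> k n x = 0" using kR by metis
  have ki: "integrable lborel (k n)" for n using plancherel_continuous(1)[OF kc R] .
  have kft: "in_Lp 2 (ft (k n))" for n using plancherel_continuous(2)[OF kc R] .
  have iso: "in_Lp 2 (\<lambda>x. k n x - k m x) \<and> Lp_norm 2 (\<lambda>\<xi>. ft (k n) \<xi> - ft (k m) \<xi>) = sqrt (2 * pi) * Lp_norm 2 (\<lambda>x. k n x - k m x)" for n m
  proof -
    have c: "continuous_on UNIV (\<lambda>x. k n x - k m x)" by (intro continuous_intros kc)
    have r: "k n x - k m x = 0" if "\<bar>x\<bar> > max (R n) (R m)" for x using R[of n x] R[of m x] that by simp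
    have "(\<lambda>\<xi>. ft (k n) \<xi> - ft (k m) \<xi>) = ft (\<lambda>x. k n x - k m x)"
      by (rule ext) (simp add: ft_diff ki)
    moreover have "integrable lborel (\<lambda>x. (k n x - k m x)\<^sup>2)"
      using kc[of n] kc[of m] r
      by (intro plancherel_continuous(1)[of _ "max (R n) (R m)"]) (auto intro!: continuous_intros)
    moreover have "(\<lambda>x. k n x - k m x) \<in> borel_measurable lborel" using ki[of n] ki[of m] by auto
    ultimately show ?thesis using plancherel_continuous(3)[OF c, of "max (R n) (R m)", OF r]
      by (simp add: Lp_norm_2 real_sqrt_mult in_L2_iff)
  qed
  have kL2: "in_Lp 2 (k n)" for n
  proof -
    have "integrable lborel (\<lambda>x. (k n x)\<^sup>2)"
      using kc[of n] R[where n = n]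
      by (intro plancherel_continuous(1)[of _ "R n"]) (auto intro!: continuous_intros)
    then show ?thesis using ki[of n] by (auto simp: in_L2_iff)
  qed
  have isoz: "Lp_norm 2 (ft (k n)) = sqrt (2 * pi) * Lp_norm 2 (k n)" for n
    using plancherel_continuous(3)[OF kc[of n] R[where n = n]] by (simp add: Lp_norm_2 real_sqrt_mult)
  have "\<exists>N. \<forall>m\<ge>N. \<forall>n\<ge>N. Lp_norm 2 (\<lambda>\<xi>. ft (k m) \<xi> - ft (k n) \<xi>) < e" if "e > 0" for e
  proof -
    have "e / sqrt (2 * pi) > 0" using that by simp
    from L2_convergent_Cauchy[OF kL2 h2 k2 this] show ?thesis
      using iso by (simp add: pos_less_divide_eq mult.commute)
  qed
  from L2_complete[OF kft this] obtain g where g: "in_Lp 2 g" "(\<lambda>n. Lp_norm 2 (\<lambda>\<xi>. ft (k n) \<xi> - g \<xi>)) \<longlonglongrightarrow> 0"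
    by blast
  obtain r where r: "strict_mono r" "AE \<xi> in lborel. (\<lambda>n. ft (k (r n)) \<xi>) \<longlonglongrightarrow> g \<xi>"
    using L2_AE_subseq[OF kft g] by blast
  have "(\<lambda>n. ft (k n) \<xi>) \<longlonglongrightarrow> ft h \<xi>" for \<xi>
  proof (rule Lim_null[THEN iffD2], rule Lim_null_comparison[OF always_eventually k1], rule allI)
    fix n
    have "norm (ft (\<lambda>x. k n x - h x) \<xi>) \<le> (\<integral>x. \<bar>k n x - h x\<bar> \<partial>lborel)"
      by (intro norm_ft_le Bochner_Integration.integrable_diff ki h1)
    then show "norm (ft (k n) \<xi> - ft h \<xi>) \<le> (\<integral>x. \<bar>k n x - h x\<bar> \<partial>lborel)"
      by (simp add: ft_diff ki h1)
  qed
  from LIMSEQ_subseq_LIMSEQ[OF this r(1)] have sub: "(\<lambda>n. ft (k (r n)) \<xi>) \<longlonglongrightarrow> ft h \<xi>" for \<xi>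
    unfolding o_def .
  from r(2) have ae: "AE \<xi> in lborel. ft h \<xi> = g \<xi>"
    by (rule eventually_mono) (rule LIMSEQ_unique[OF sub])
  have hm: "h \<in> borel_measurable lborel" using h1 by auto
  have gm: "g \<in> borel_measurable lborel" using g(1) by (simp add: in_L2_iff)
  have fm: "ft h \<in> borel_measurable lborel" by (rule ft_measurable[OF hm])
  show "in_Lp 2 (ft h)" by (rule L2_cong_AE[OF g(1) fm ae])
  have "(\<lambda>n. Lp_norm 2 (ft (k n))) \<longlonglongrightarrow> Lp_norm 2 g" by (rule L2_norm_tendsto[OF kft g])
  moreover have "(\<lambda>n. Lp_norm 2 (ft (k n))) \<longlonglongrightarrow> sqrt (2 * pi) * Lp_norm 2 h"
    unfolding isoz by (intro tendsto_mult tendsto_const L2_norm_tendsto[OF kL2 h2 k2])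
  ultimately have "Lp_norm 2 g = sqrt (2 * pi) * Lp_norm 2 h" by (rule LIMSEQ_unique)
  then show "Lp_norm 2 (ft h) = sqrt (2 * pi) * Lp_norm 2 h"
    using Lp_norm_cong_AE[OF fm gm ae, of 2] by simp
qed

lemma norm_vec_sq: "(norm x)\<^sup>2 = (\<Sum>i\<in>UNIV. (norm (x $ i))\<^sup>2)" for x :: "'a::real_normed_vector ^ 'n::finite"
  unfolding norm_vec_def L2_set_def by (simp add: sum_nonneg)

lemma borel_measurable_vec_componentwise:
  fixes f :: "'b \<Rightarrow> 'a::euclidean_space ^ 'n::finite"
  assumes "\<And>i. (\<lambda>x. f x $ i) \<in> borel_measurable M"
  shows "f \<in> borel_measurable M"
proof (subst borel_measurable_euclidean_space, rule ballI)
  fix b :: "'a ^ 'n" assume "b \<in> Basis"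
  then obtain i u where b: "b = axis i u" by (auto simp: Basis_vec_def)
  have "(\<lambda>x. f x \<bullet> b) = (\<lambda>x. f x $ i \<bullet> u)" by (simp add: b inner_axis)
  also have "\<dots> \<in> borel_measurable M" using assms[of i] by simp
  finally show "(\<lambda>x. f x \<bullet> b) \<in> borel_measurable M" .
qed

lemma component_integrable:
  fixes f :: "real \<Rightarrow> real ^ 'n"
  shows "integrable M f \<Longrightarrow> integrable M (\<lambda>x. f x $ i)"
  by (rule integrable_bounded_linear[OF bounded_linear_vec_nth])

lemma component_measurable:
  fixes f :: "'b \<Rightarrow> 'a::real_normed_vector ^ 'n"
  assumes "f \<in> borel_measurable M"
  shows "(\<lambda>x. f x $ i) \<in> borel_measurable M"
  using measurable_compose[OF assms, of "\<lambda>v. v $ i" borel]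
  by (simp add: borel_measurable_continuous_onI continuous_on_component continuous_on_id)

lemma component_L2:
  fixes f :: "real \<Rightarrow> real ^ 'n"
  assumes "in_Lp 2 f"
  shows "in_Lp 2 (\<lambda>x. f x $ i)"
  using component_measurable[of f lborel i] assms component_le_norm_cart
  by (intro L2_bounded_mult[OF assms, of _ 1]) (auto simp: in_L2_iff)

lemma fourier_measurable:
  fixes f :: "real \<Rightarrow> real ^ 'n"
  assumes "f \<in> borel_measurable lborel"
  shows "fourier f \<in> borel_measurable lborel"
  by (rule borel_measurable_vec_componentwise, unfold fourier_nth, rule ft_measurable, rule component_measurable[OF assms])

lemma fourier_diff:
  fixes f g :: "real \<Rightarrow> real ^ 'n"
  assumes "integrable lborel f" "integrable lborel g"
  shows "fourier (\<lambda>x. f x - g x) \<xi> = fourier f \<xi> - fourier g \<xi>"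
  by (simp add: vec_eq_iff fourier_nth ft_diff component_integrable assms)

lemma plancherel:
  fixes f :: "real \<Rightarrow> real ^ 'n"
  assumes f1: "integrable lborel f" and f2: "in_Lp 2 f"
  shows "in_Lp 2 (fourier f)" "Lp_norm 2 (fourier f) = sqrt (2 * pi) * Lp_norm 2 f"
proof -
  have fm: "f \<in> borel_measurable lborel" using f1 by auto
  note c = plancherel_real[OF component_integrable[OF f1] component_L2[OF f2]]
  have i: "integrable lborel (\<lambda>\<xi>. (norm (fourier f \<xi> $ i))\<^sup>2)" for i
    using c(1)[of i] by (simp add: in_L2_iff fourier_nth)
  have "integrable lborel (\<lambda>\<xi>. (norm (fourier f \<xi>))\<^sup>2)"
    unfolding norm_vec_sq by (intro Bochner_Integration.integrable_sum i)
  then show "in_Lp 2 (fourier f)" using fourier_measurable[OF fm] by (simp add: in_L2_iff)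
  have "(\<integral>\<xi>. (norm (fourier f \<xi>))\<^sup>2 \<partial>lborel) = (\<Sum>i\<in>UNIV. (\<integral>\<xi>. (norm (fourier f \<xi> $ i))\<^sup>2 \<partial>lborel))"
    unfolding norm_vec_sq by (intro Bochner_Integration.integral_sum i)
  also have "\<dots> = (\<Sum>i\<in>UNIV. (Lp_norm 2 (ft (\<lambda>x. f x $ i)))\<^sup>2)"
    by (simp add: Lp_norm_2_sq fourier_nth)
  also have "\<dots> = (\<Sum>i\<in>UNIV. 2 * pi * (\<integral>x. (norm (f x $ i))\<^sup>2 \<partial>lborel))"
    by (simp add: c(2) power_mult_distrib Lp_norm_2_sq)
  also have "\<dots> = 2 * pi * (\<Sum>i\<in>UNIV. (\<integral>x. (norm (f x $ i))\<^sup>2 \<partial>lborel))"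
    by (rule sum_distrib_left[symmetric])
  also have "(\<Sum>i\<in>UNIV. (\<integral>x. (norm (f x $ i))\<^sup>2 \<partial>lborel)) = (\<integral>x. (norm (f x))\<^sup>2 \<partial>lborel)"
    unfolding norm_vec_sq using component_L2[OF f2]
    by (intro Bochner_Integration.integral_sum[symmetric]) (simp add: in_L2_iff)
  finally show "Lp_norm 2 (fourier f) = sqrt (2 * pi) * Lp_norm 2 f"
    by (simp add: Lp_norm_2 real_sqrt_mult)
qed

text \<open>
  The factor \<open>CARD('n)\<close> comes from summing over the components.
\<close>

lemma norm_fourier_le:
  fixes f :: "real \<Rightarrow> real ^ 'n"
  assumes f1: "integrable lborel f"
  shows "norm (fourier f \<xi>) \<le> real CARD('n) * (\<integral>x. norm (f x) \<partial>lborel)"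
proof -
  have "norm (fourier f \<xi>) \<le> (\<Sum>i\<in>UNIV. norm (fourier f \<xi> $ i))"
    unfolding norm_vec_def by (rule L2_set_le_sum) simp
  also have "\<dots> \<le> (\<Sum>i\<in>(UNIV::'n set). (\<integral>x. norm (f x) \<partial>lborel))"
  proof (rule sum_mono)
    fix i
    have "norm (fourier f \<xi> $ i) \<le> (\<integral>x. \<bar>f x $ i\<bar> \<partial>lborel)"
      unfolding fourier_nth by (rule norm_ft_le[OF component_integrable[OF f1]])
    also have "\<dots> \<le> (\<integral>x. norm (f x) \<partial>lborel)"
      using component_integrable[OF f1, of i] f1 component_le_norm_cart by (intro integral_mono) auto
    finally show "norm (fourier f \<xi> $ i) \<le> (\<integral>x. norm (f x) \<partial>lborel)" .
  qed
  finally show ?thesis by simp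
qed

section \<open>The Fourier transform of square-integrable functions\<close>

lemma truncation:
  fixes f :: "real \<Rightarrow> 'a::euclidean_space"
  assumes "in_Lp 2 f"
  shows "integrable lborel (\<lambda>x. indicator {-R..R} x *\<^sub>R f x)" "in_Lp 2 (\<lambda>x. indicator {-R..R} x *\<^sub>R f x)"
proof -
  have [measurable]: "f \<in> borel_measurable lborel" using assms by (simp add: in_L2_iff)
  show "in_Lp 2 (\<lambda>x. indicator {-R..R} x *\<^sub>R f x)"
    by (rule L2_bounded_mult[OF assms, of _ 1]) (auto simp: indicator_def)
  show "integrable lborel (\<lambda>x. indicator {-R..R} x *\<^sub>R f x)"
  proof (rule Bochner_Integration.integrable_bound)
    show "integrable lborel (\<lambda>x. indicator {-R..R} x + (norm (f x))\<^sup>2)"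
      using assms by (intro Bochner_Integration.integrable_add integrable_real_indicator)
        (auto simp: in_L2_iff emeasure_lborel_Icc_eq)
    show "AE x in lborel. norm (indicator {-R..R} x *\<^sub>R f x) \<le> norm (indicator {-R..R} x + (norm (f x))\<^sup>2)"
    proof (rule AE_I2)
      fix x
      have "norm (f x) \<le> 1 + (norm (f x))\<^sup>2"
        using sum_squares_bound[of 1 "norm (f x)"] norm_ge_zero[of "f x"] by (simp del: norm_ge_zero)
      then show "norm (indicator {-R..R} x *\<^sub>R f x) \<le> norm (indicator {-R..R} x + (norm (f x))\<^sup>2)"
        by (simp add: indicator_def)
    qed
  qed measurable
qed

lemma truncation_tendsto:
  fixes f :: "real \<Rightarrow> 'a::euclidean_space"
  assumes "in_Lp 2 f"
  shows "((\<lambda>R. Lp_norm 2 (\<lambda>x. indicator {-R..R} x *\<^sub>R f x - f x)) \<longlongrightarrow> 0) at_top"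
proof -
  have [measurable]: "f \<in> borel_measurable lborel" using assms by (simp add: in_L2_iff)
  have "((\<lambda>R. \<integral>x. (norm (indicator {-R..R} x *\<^sub>R f x - f x))\<^sup>2 \<partial>lborel) \<longlongrightarrow> (\<integral>x. 0 \<partial>(lborel :: real measure))) at_top"
  proof (rule integral_dominated_convergence_at_top[where w = "\<lambda>x. (norm (f x))\<^sup>2"])
    show "AE x in lborel. ((\<lambda>R. (norm (indicator {-R..R} x *\<^sub>R f x - f x))\<^sup>2) \<longlongrightarrow> 0) at_top"
    proof (rule AE_I2, rule tendsto_eventually)
      fix x :: real
      show "\<forall>\<^sub>F R in at_top. (norm (indicator {-R..R} x *\<^sub>R f x - f x))\<^sup>2 = 0"
        using eventually_ge_at_top[of "\<bar>x\<bar>"] by eventually_elim (auto simp: indicator_def abs_le_iff)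
    qed
    show "\<forall>\<^sub>F R in at_top. AE x in lborel. norm ((norm (indicator {-R..R} x *\<^sub>R f x - f x))\<^sup>2) \<le> (norm (f x))\<^sup>2"
      by (intro always_eventually allI AE_I2) (simp add: indicator_def)
    show "integrable lborel (\<lambda>x. (norm (f x))\<^sup>2)" using assms by (simp add: in_L2_iff)
  qed measurable
  from tendsto_real_sqrt[OF this] show ?thesis unfolding Lp_norm_2 by simp
qed

text \<open>
  The truncations converge in \<open>L^2\<close>, so by the isometry their transforms form a
  Cauchy sequence; completeness provides the limit.
\<close>

lemma fourier_L2_exists:
  fixes f :: "real \<Rightarrow> real ^ 'n"
  assumes f: "in_Lp 2 f"
  shows "\<exists>g. in_Lp 2 g \<and>
    ((\<lambda>R. Lp_norm 2 (\<lambda>\<xi>. fourier (\<lambda>x. indicator {-R..R} x *\<^sub>R f x) \<xi> - g \<xi>)) \<longlongrightarrow> 0) at_top"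
proof -
  define T where "T R = (\<lambda>x. indicator {-R..R} x *\<^sub>R f x)" for R :: real
  have T: "integrable lborel (T R)" "in_Lp 2 (T R)" for R unfolding T_def by (rule truncation[OF f])+
  have lim: "((\<lambda>R. Lp_norm 2 (\<lambda>x. T R x - f x)) \<longlongrightarrow> 0) at_top" unfolding T_def by (rule truncation_tendsto[OF f])
  then have limn: "(\<lambda>n. Lp_norm 2 (\<lambda>x. T (real n) x - f x)) \<longlonglongrightarrow> 0"
    by (rule filterlim_compose[OF _ filterlim_real_sequentially])
  have FT: "in_Lp 2 (fourier (T R))" for R by (rule plancherel(1)[OF T])
  have iso: "Lp_norm 2 (\<lambda>\<xi>. fourier (T R) \<xi> - fourier (T S) \<xi>) = sqrt (2 * pi) * Lp_norm 2 (\<lambda>x. T R x - T S x)" for R S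
    using plancherel(2)[OF Bochner_Integration.integrable_diff[OF T(1)[of R] T(1)[of S]] L2_diff[OF T(2)[of R] T(2)[of S]]]
    by (simp add: fourier_diff[OF T(1) T(1), abs_def])
  have "\<exists>N. \<forall>m\<ge>N. \<forall>n\<ge>N. Lp_norm 2 (\<lambda>\<xi>. fourier (T (real m)) \<xi> - fourier (T (real n)) \<xi>) < e" if "e > 0" for e
  proof -
    have "e / sqrt (2 * pi) > 0" using that by simp
    from L2_convergent_Cauchy[OF T(2) f limn this] show ?thesis
      by (simp add: iso pos_less_divide_eq mult.commute)
  qed
  from L2_complete[OF FT this] obtain g where g: "in_Lp 2 g" "(\<lambda>n. Lp_norm 2 (\<lambda>\<xi>. fourier (T (real n)) \<xi> - g \<xi>)) \<longlonglongrightarrow> 0"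
    by blast
  have b: "Lp_norm 2 (\<lambda>\<xi>. fourier (T R) \<xi> - g \<xi>) \<le> sqrt (2 * pi) * Lp_norm 2 (\<lambda>x. T R x - f x)" for R
  proof (rule tendsto_le[OF sequentially_bot _ tendsto_const])
    show "(\<lambda>n. sqrt (2 * pi) * (Lp_norm 2 (\<lambda>x. T R x - f x) + Lp_norm 2 (\<lambda>x. T (real n) x - f x)) + Lp_norm 2 (\<lambda>\<xi>. fourier (T (real n)) \<xi> - g \<xi>))
       \<longlonglongrightarrow> sqrt (2 * pi) * Lp_norm 2 (\<lambda>x. T R x - f x)"
      using tendsto_add[OF tendsto_mult[OF tendsto_const tendsto_add[OF tendsto_const limn]] g(2)] by simp
    show "\<forall>\<^sub>F n in sequentially. Lp_norm 2 (\<lambda>\<xi>. fourier (T R) \<xi> - g \<xi>)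
       \<le> sqrt (2 * pi) * (Lp_norm 2 (\<lambda>x. T R x - f x) + Lp_norm 2 (\<lambda>x. T (real n) x - f x)) + Lp_norm 2 (\<lambda>\<xi>. fourier (T (real n)) \<xi> - g \<xi>)"
    proof (intro always_eventually allI)
      fix n
      have "Lp_norm 2 (\<lambda>x. T R x - T (real n) x) \<le> Lp_norm 2 (\<lambda>x. T R x - f x) + Lp_norm 2 (\<lambda>x. T (real n) x - f x)"
        using L2_triangle[OF T(2)[of R] f T(2)[of "real n"]] Lp_norm_2_minus_commute[of f "T (real n)"] by simp
      then have "sqrt (2 * pi) * Lp_norm 2 (\<lambda>x. T R x - T (real n) x) \<le> sqrt (2 * pi) * (Lp_norm 2 (\<lambda>x. T R x - f x) + Lp_norm 2 (\<lambda>x. T (real n) x - f x))"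
        by (rule mult_left_mono) simp
      then show "Lp_norm 2 (\<lambda>\<xi>. fourier (T R) \<xi> - g \<xi>)
       \<le> sqrt (2 * pi) * (Lp_norm 2 (\<lambda>x. T R x - f x) + Lp_norm 2 (\<lambda>x. T (real n) x - f x)) + Lp_norm 2 (\<lambda>\<xi>. fourier (T (real n)) \<xi> - g \<xi>)"
        using L2_triangle[OF FT[of R] FT[of "real n"] g(1)] unfolding iso by linarith
    qed
  qed
  have "((\<lambda>R. Lp_norm 2 (\<lambda>\<xi>. fourier (T R) \<xi> - g \<xi>)) \<longlongrightarrow> 0) at_top"
  proof (rule tendsto_sandwich[OF _ _ tendsto_const])
    show "((\<lambda>R. sqrt (2 * pi) * Lp_norm 2 (\<lambda>x. T R x - f x)) \<longlongrightarrow> 0) at_top"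
      using tendsto_mult[OF tendsto_const lim] by simp
  qed (auto intro: always_eventually b)
  with g(1) show ?thesis unfolding T_def by blast
qed

lemma fourier_L2:
  fixes f :: "real \<Rightarrow> real ^ 'n"
  assumes f: "in_Lp 2 f"
  shows "in_Lp 2 (fourier_L2 f)"
    "((\<lambda>R. Lp_norm 2 (\<lambda>\<xi>. fourier (\<lambda>x. indicator {-R..R} x *\<^sub>R f x) \<xi> - fourier_L2 f \<xi>)) \<longlongrightarrow> 0) at_top"
  using someI_ex[OF fourier_L2_exists[OF f]] unfolding fourier_L2_def by blast+

text \<open>
  Any integrable and square-integrable approximation may replace the truncations of the
  definition.  In particular \<open>f\<close> may be multiplied by a continuously differentiable
  cut-off function.
\<close>

lemma fourier_L2_dist_fourier:
  fixes f h :: "real \<Rightarrow> real ^ 'n"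
  assumes f: "in_Lp 2 f" and h: "integrable lborel h" "in_Lp 2 h"
  shows "Lp_norm 2 (\<lambda>\<xi>. fourier h \<xi> - fourier_L2 f \<xi>) = sqrt (2 * pi) * Lp_norm 2 (\<lambda>x. h x - f x)"
proof -
  define T where "T R = (\<lambda>x. indicator {-R..R} x *\<^sub>R f x)" for R :: real
  have T: "integrable lborel (T R)" "in_Lp 2 (T R)" for R unfolding T_def by (rule truncation[OF f])+
  have FT: "in_Lp 2 (fourier (T R))" for R by (rule plancherel(1)[OF T])
  have Fh: "in_Lp 2 (fourier h)" by (rule plancherel(1)[OF h])
  have iso: "Lp_norm 2 (\<lambda>\<xi>. fourier h \<xi> - fourier (T R) \<xi>) = sqrt (2 * pi) * Lp_norm 2 (\<lambda>x. h x - T R x)" for R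
    using plancherel(2)[OF Bochner_Integration.integrable_diff[OF h(1) T(1)[of R]] L2_diff[OF h(2) T(2)[of R]]]
    by (simp add: fourier_diff[OF h(1) T(1), abs_def])
  have "((\<lambda>R. Lp_norm 2 (\<lambda>\<xi>. fourier h \<xi> - fourier (T R) \<xi>)) \<longlongrightarrow> Lp_norm 2 (\<lambda>\<xi>. fourier h \<xi> - fourier_L2 f \<xi>)) at_top"
  proof (rule L2_norm_tendsto)
    have e: "(\<lambda>\<xi>. fourier h \<xi> - fourier (T R) \<xi> - (fourier h \<xi> - fourier_L2 f \<xi>)) = (\<lambda>\<xi>. fourier_L2 f \<xi> - fourier (T R) \<xi>)" for R
      by (simp add: algebra_simps)
    show "((\<lambda>R. Lp_norm 2 (\<lambda>\<xi>. fourier h \<xi> - fourier (T R) \<xi> - (fourier h \<xi> - fourier_L2 f \<xi>))) \<longlongrightarrow> 0) at_top"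
      unfolding e using fourier_L2(2)[OF f] Lp_norm_2_minus_commute[of "fourier_L2 f"] by (simp add: T_def)
  qed (intro L2_diff Fh FT fourier_L2(1) f)+
  moreover have "((\<lambda>R. sqrt (2 * pi) * Lp_norm 2 (\<lambda>x. h x - T R x)) \<longlongrightarrow> sqrt (2 * pi) * Lp_norm 2 (\<lambda>x. h x - f x)) at_top"
  proof (intro tendsto_mult tendsto_const L2_norm_tendsto)
    have e: "(\<lambda>x. h x - T R x - (h x - f x)) = (\<lambda>x. f x - T R x)" for R by (simp add: algebra_simps)
    show "((\<lambda>R. Lp_norm 2 (\<lambda>x. h x - T R x - (h x - f x))) \<longlongrightarrow> 0) at_top"
      unfolding e using truncation_tendsto[OF f] Lp_norm_2_minus_commute[of f] by (simp add: T_def)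
  qed (intro L2_diff h T f)+
  ultimately show ?thesis unfolding iso
    by (rule tendsto_unique[OF trivial_limit_at_top_linorder])
qed

lemma fourier_L2_norm:
  fixes f :: "real \<Rightarrow> real ^ 'n"
  assumes f: "in_Lp 2 f"
  shows "Lp_norm 2 (fourier_L2 f) = sqrt (2 * pi) * Lp_norm 2 f"
proof -
  have z: "fourier (\<lambda>x. 0 :: real ^ 'n) = (\<lambda>\<xi>. 0)"
    by (rule ext) (simp add: vec_eq_iff fourier_nth ft_def)
  have "in_Lp 2 (\<lambda>x::real. 0 :: real ^ 'n)" by (simp add: in_L2_iff)
  then show ?thesis using fourier_L2_dist_fourier[OF f, of "\<lambda>x. 0"] unfolding z
    using Lp_norm_2_minus_commute[of "\<lambda>x. 0" "fourier_L2 f"] Lp_norm_2_minus_commute[of "\<lambda>x. 0" f] by simp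
qed

lemma fourier_L2_eq_fourier:
  fixes h :: "real \<Rightarrow> real ^ 'n"
  assumes h: "integrable lborel h" "in_Lp 2 h"
  shows "AE \<xi> in lborel. fourier h \<xi> = fourier_L2 h \<xi>"
proof -
  have "Lp_norm 2 (\<lambda>\<xi>. fourier h \<xi> - fourier_L2 h \<xi>) = 0"
    using fourier_L2_dist_fourier[OF h(2) h] by (simp add: Lp_norm_2)
  then have "AE \<xi> in lborel. fourier h \<xi> - fourier_L2 h \<xi> = 0"
    by (intro Lp_norm_2_zero_AE L2_diff plancherel(1)[OF h] fourier_L2(1) h(2))
  then show ?thesis by simp
qed

section \<open>Cut-off functions and weak derivatives\<close>

text \<open>
  A continuously differentiable bump, supported in \<open>[-1/\<delta>, 1/\<delta>]\<close> and
  tending to 1 as \<open>\<delta>\<close> tends to 0.  It is a test function whose derivative is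
  of size \<open>\<delta>\<close> uniformly in \<open>x\<close>.
\<close>

definition cutoff :: "real \<Rightarrow> real \<Rightarrow> real" where
  "cutoff \<delta> x = (max 0 (1 - (\<delta> * x)\<^sup>2))\<^sup>2"

definition cutoff' :: "real \<Rightarrow> real \<Rightarrow> real" where
  "cutoff' \<delta> x = - 4 * \<delta>\<^sup>2 * x * max 0 (1 - (\<delta> * x)\<^sup>2)"

lemma max_0_sq_derivative:
  "((\<lambda>y::real. (max 0 y)\<^sup>2) has_real_derivative 2 * max 0 y) (at y)"
proof (cases y "0 :: real" rule: linorder_cases)
  case less
  have "((\<lambda>y. 0::real) has_real_derivative 0) (at y)" by simp
  then have "((\<lambda>y::real. (max 0 y)\<^sup>2) has_real_derivative 0) (at y)"
    by (rule has_field_derivative_transform_within_open[of _ _ _ "{..<0}"]) (use less in auto)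
  then show ?thesis using less by simp
next
  case equal
  have "(\<lambda>h. ((max 0 (0 + h))\<^sup>2 - (max 0 0)\<^sup>2) / h) \<midarrow>0\<rightarrow> (0::real)"
  proof (rule Lim_null_comparison[OF always_eventually], rule allI)
    show "norm (((max 0 (0 + h))\<^sup>2 - (max 0 0)\<^sup>2) / h) \<le> \<bar>h\<bar>" for h :: real
      by (cases "h = 0") (auto simp: max_def power2_eq_square abs_mult)
    show "((\<lambda>h::real. \<bar>h\<bar>) \<longlongrightarrow> 0) (at 0)" by (rule tendsto_rabs_zero) (rule tendsto_ident_at)
  qed
  then show ?thesis using equal by (simp add: DERIV_def)
next
  case greater
  have "((\<lambda>y. y\<^sup>2) has_real_derivative 2 * y) (at y)"
    by (auto intro!: derivative_eq_intros)
  then have "((\<lambda>y::real. (max 0 y)\<^sup>2) has_real_derivative 2 * y) (at y)"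
    by (rule has_field_derivative_transform_within_open[of _ _ _ "{0<..}"]) (use greater in auto)
  then show ?thesis using greater by simp
qed

lemma cutoff_derivative: "(cutoff \<delta> has_real_derivative cutoff' \<delta> x) (at x)"
proof -
  have "((\<lambda>x. 1 - (\<delta> * x)\<^sup>2) has_real_derivative (- 2 * \<delta>\<^sup>2 * x)) (at x)"
    by (auto intro!: derivative_eq_intros simp: power2_eq_square)
  from DERIV_chain2[OF max_0_sq_derivative this] show ?thesis
    unfolding cutoff_def[abs_def] cutoff'_def by (simp add: mult_ac)
qed

lemma cutoff_bounds: "0 \<le> cutoff \<delta> x" "cutoff \<delta> x \<le> 1" "\<bar>cutoff \<delta> x\<bar> \<le> 1"
proof -
  have "(max 0 (1 - (\<delta> * x)\<^sup>2))\<^sup>2 \<le> 1\<^sup>2" by (rule power_mono) auto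
  then show "0 \<le> cutoff \<delta> x" "cutoff \<delta> x \<le> 1" "\<bar>cutoff \<delta> x\<bar> \<le> 1" by (auto simp: cutoff_def)
qed

lemma outside_support:
  fixes \<delta> x :: real
  assumes "\<delta> > 0" "1 / \<delta> < \<bar>x\<bar>"
  shows "1 < (\<delta> * x)\<^sup>2"
proof -
  have "1 < \<bar>\<delta> * x\<bar>"
    using assms pos_divide_less_eq[OF assms(1), of 1 "\<bar>x\<bar>"] by (simp add: abs_mult mult.commute)
  then have "1\<^sup>2 < \<bar>\<delta> * x\<bar>\<^sup>2" by (rule power_strict_mono) auto
  then show ?thesis by simp
qed

lemma cutoff_zero: "\<delta> > 0 \<Longrightarrow> 1 / \<delta> < \<bar>x\<bar> \<Longrightarrow> cutoff \<delta> x = 0"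
  and cutoff'_zero: "\<delta> > 0 \<Longrightarrow> 1 / \<delta> < \<bar>x\<bar> \<Longrightarrow> cutoff' \<delta> x = 0"
  using outside_support[of \<delta> x] by (auto simp: cutoff_def cutoff'_def)

lemma cutoff'_bound:
  assumes "\<delta> > 0"
  shows "\<bar>cutoff' \<delta> x\<bar> \<le> 4 * \<delta>"
proof (cases "1 / \<delta> < \<bar>x\<bar>")
  case True
  then show ?thesis using cutoff'_zero[OF assms] assms by simp
next
  case False
  then have "\<delta> * \<bar>x\<bar> \<le> 1" using assms by (simp add: field_simps)
  moreover have "\<bar>max 0 (1 - (\<delta> * x)\<^sup>2)\<bar> \<le> 1" by auto
  ultimately have "4 * \<delta> * ((\<delta> * \<bar>x\<bar>) * \<bar>max 0 (1 - (\<delta> * x)\<^sup>2)\<bar>) \<le> 4 * \<delta> * (1 * 1)"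
    using assms by (intro mult_left_mono mult_mono) auto
  moreover have "\<bar>cutoff' \<delta> x\<bar> = 4 * \<delta> * ((\<delta> * \<bar>x\<bar>) * \<bar>max 0 (1 - (\<delta> * x)\<^sup>2)\<bar>)"
    using assms by (simp add: cutoff'_def abs_mult power2_eq_square)
  ultimately show ?thesis by simp
qed

lemma continuous_cutoff: "continuous_on UNIV (cutoff \<delta>)" "continuous_on UNIV (cutoff' \<delta>)"
  unfolding cutoff_def[abs_def] cutoff'_def[abs_def] by (intro continuous_intros)+

lemma cutoff_measurable [measurable]:
  "cutoff \<delta> \<in> borel_measurable borel" "cutoff' \<delta> \<in> borel_measurable borel"
  using continuous_cutoff by (auto intro: borel_measurable_continuous_onI)

lemma test_fun_cutoff:
  assumes g: "\<And>x. (g has_real_derivative g' x) (at x)" and g': "continuous_on UNIV g'" and d: "\<delta> > 0"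
  shows "test_fun (\<lambda>x. cutoff \<delta> x * g x)"
    "deriv (\<lambda>x. cutoff \<delta> x * g x) x = cutoff' \<delta> x * g x + cutoff \<delta> x * g' x"
proof -
  have D: "((\<lambda>x. cutoff \<delta> x * g x) has_real_derivative cutoff' \<delta> x * g x + cutoff \<delta> x * g' x) (at x)" for x
    using DERIV_mult[OF cutoff_derivative g] by (simp add: add.commute mult.commute)
  then show "deriv (\<lambda>x. cutoff \<delta> x * g x) x = cutoff' \<delta> x * g x + cutoff \<delta> x * g' x"
    by (rule DERIV_imp_deriv)
  have gc: "continuous_on UNIV g"
    using g by (intro DERIV_continuous_on[of UNIV g g']) (auto intro: has_field_derivative_at_within)
  have "(\<lambda>x. cutoff \<delta> x * g x) C1_differentiable_on UNIV"
    unfolding C1_differentiable_on_def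
  proof (intro exI[of _ "\<lambda>x. cutoff' \<delta> x * g x + cutoff \<delta> x * g' x"] conjI ballI)
    show "continuous_on UNIV (\<lambda>x. cutoff' \<delta> x * g x + cutoff \<delta> x * g' x)"
      by (intro continuous_intros continuous_cutoff gc g')
  qed (use D in \<open>simp add: has_real_derivative_iff_has_vector_derivative\<close>)
  then show "test_fun (\<lambda>x. cutoff \<delta> x * g x)"
    unfolding test_fun_def using cutoff_zero[OF d] by (intro conjI exI[of _ "1 / \<delta>"]) auto
qed

lemma cos_cutoff:
  assumes "\<delta> > 0"
  shows "test_fun (\<lambda>x. cutoff \<delta> x * cos (x * \<xi>))"
    "deriv (\<lambda>x. cutoff \<delta> x * cos (x * \<xi>)) x = cutoff' \<delta> x * cos (x * \<xi>) - \<xi> * (cutoff \<delta> x * sin (x * \<xi>))"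
proof -
  have "((\<lambda>x. cos (x * \<xi>)) has_real_derivative - (\<xi> * sin (x * \<xi>))) (at x)" for x
    by (auto intro!: derivative_eq_intros)
  moreover have "continuous_on UNIV (\<lambda>x. - (\<xi> * sin (x * \<xi>)))" by (intro continuous_intros)
  ultimately show "test_fun (\<lambda>x. cutoff \<delta> x * cos (x * \<xi>))"
    "deriv (\<lambda>x. cutoff \<delta> x * cos (x * \<xi>)) x = cutoff' \<delta> x * cos (x * \<xi>) - \<xi> * (cutoff \<delta> x * sin (x * \<xi>))"
    using test_fun_cutoff[OF _ _ assms, of "\<lambda>x. cos (x * \<xi>)" "\<lambda>x. - (\<xi> * sin (x * \<xi>))"] by simp_all
qed

lemma sin_cutoff:
  assumes "\<delta> > 0"
  shows "test_fun (\<lambda>x. cutoff \<delta> x * sin (x * \<xi>))"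
    "deriv (\<lambda>x. cutoff \<delta> x * sin (x * \<xi>)) x = cutoff' \<delta> x * sin (x * \<xi>) + \<xi> * (cutoff \<delta> x * cos (x * \<xi>))"
proof -
  have "((\<lambda>x. sin (x * \<xi>)) has_real_derivative \<xi> * cos (x * \<xi>)) (at x)" for x
    by (auto intro!: derivative_eq_intros)
  moreover have "continuous_on UNIV (\<lambda>x. \<xi> * cos (x * \<xi>))" by (intro continuous_intros)
  ultimately show "test_fun (\<lambda>x. cutoff \<delta> x * sin (x * \<xi>))"
    "deriv (\<lambda>x. cutoff \<delta> x * sin (x * \<xi>)) x = cutoff' \<delta> x * sin (x * \<xi>) + \<xi> * (cutoff \<delta> x * cos (x * \<xi>))"
    using test_fun_cutoff[OF _ _ assms, of "\<lambda>x. sin (x * \<xi>)" "\<lambda>x. \<xi> * cos (x * \<xi>)"] by simp_all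
qed

text \<open>
  On a set of finite measure the \<open>L^2\<close> norm controls the \<open>L^1\<close> norm.
\<close>

lemma pairing_L2:
  fixes v :: "real \<Rightarrow> 'a::euclidean_space"
  assumes v: "in_Lp 2 v" and [measurable]: "\<phi> \<in> borel_measurable borel"
    and B: "\<And>x. \<bar>\<phi> x\<bar> \<le> B" and R: "\<And>x. \<bar>x\<bar> > R \<Longrightarrow> \<phi> x = 0" and R0: "0 \<le> R"
  shows "integrable lborel (\<lambda>x. \<phi> x *\<^sub>R v x)"
    "(\<integral>x. norm (\<phi> x *\<^sub>R v x) \<partial>lborel) \<le> B * (R + 1) * Lp_norm 2 v"
proof -
  have [measurable]: "v \<in> borel_measurable borel" using v by (simp add: in_L2_iff)
  have B0: "0 \<le> B" using B[of 0] by linarith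
  have b: "norm (\<phi> x *\<^sub>R v x) \<le> B * ((t * indicator {-R..R} x + (norm (v x))\<^sup>2 / t) / 2)" if "t > 0" for t x
  proof (cases "x \<in> {-R..R}")
    case True
    have "2 * norm (v x) \<le> t + (norm (v x))\<^sup>2 / t"
      using sum_squares_bound[of "sqrt t" "norm (v x) / sqrt t"] that by (simp add: power_divide)
    then have "norm (v x) \<le> (t * indicator {-R..R} x + (norm (v x))\<^sup>2 / t) / 2" using True by simp
    then show ?thesis unfolding norm_scaleR by (rule mult_mono[OF B _ B0 norm_ge_zero])
  next
    case False
    then have "\<phi> x = 0" by (intro R) auto
    then show ?thesis using B0 that by simp
  qed
  have i: "integrable lborel (\<lambda>x. B * ((t * indicator {-R..R} x + (norm (v x))\<^sup>2 / t) / 2))" for t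
    using v by (intro integrable_mult_right integrable_divide Bochner_Integration.integrable_add integrable_real_indicator)
      (auto simp: in_L2_iff emeasure_lborel_Icc_eq)
  show int: "integrable lborel (\<lambda>x. \<phi> x *\<^sub>R v x)"
  proof (rule Bochner_Integration.integrable_bound[OF i[of 1]])
    show "AE x in lborel. norm (\<phi> x *\<^sub>R v x) \<le> norm (B * ((1 * indicator {-R..R} x + (norm (v x))\<^sup>2 / 1) / 2))"
      by (rule AE_I2, rule order_trans[OF b[OF zero_less_one]]) (simp only: real_norm_def abs_ge_self)
  qed measurable
  show "(\<integral>x. norm (\<phi> x *\<^sub>R v x) \<partial>lborel) \<le> B * (R + 1) * Lp_norm 2 v"
  proof (rule field_le_epsilon)
    fix e :: real assume e: "e > 0"
    define t where "t = Lp_norm 2 v + e / (B * (R + 1) + 1)"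
    have den: "0 < B * (R + 1) + 1" using B0 R0 by (intro add_nonneg_pos) auto
    have t: "t > 0" "Lp_norm 2 v \<le> t" unfolding t_def using e den by (auto intro: add_nonneg_pos)
    have "(\<integral>x. norm (\<phi> x *\<^sub>R v x) \<partial>lborel) \<le> (\<integral>x. B * ((t * indicator {-R..R} x + (norm (v x))\<^sup>2 / t) / 2) \<partial>lborel)"
      by (intro integral_mono integrable_norm int i b t)
    also have "\<dots> = B * ((t * (2 * R) + (Lp_norm 2 v)\<^sup>2 / t) / 2)"
      using v R0 by (simp add: Lp_norm_2_sq in_L2_iff emeasure_lborel_Icc_eq)
    also have "\<dots> \<le> B * ((t * (2 * R) + t\<^sup>2 / t) / 2)"
      using t B0 by (intro mult_left_mono divide_right_mono add_left_mono power_mono) auto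
    also have "\<dots> \<le> B * (R + 1) * t"
    proof -
      have "t\<^sup>2 / t = t" using t by (simp add: power2_eq_square)
      then have "(t * (2 * R) + t\<^sup>2 / t) / 2 \<le> (R + 1) * t" using t by (simp add: algebra_simps)
      from mult_left_mono[OF this B0] show ?thesis by (simp add: mult.assoc)
    qed
    also have "\<dots> \<le> B * (R + 1) * Lp_norm 2 v + e"
    proof -
      have "B * (R + 1) * (e / (B * (R + 1) + 1)) \<le> e" using e den by (simp add: field_simps)
      then show ?thesis unfolding t_def by (simp add: distrib_left)
    qed
    finally show "(\<integral>x. norm (\<phi> x *\<^sub>R v x) \<partial>lborel) \<le> B * (R + 1) * Lp_norm 2 v + e" .
  qed
qed

lemma test_fun_facts:
  assumes "test_fun \<phi>"
  obtains R B where "R \<ge> 0" "\<And>x. (\<phi> has_real_derivative deriv \<phi> x) (at x)" "continuous_on UNIV \<phi>" "continuous_on UNIV (deriv \<phi>)"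
    "\<And>x. \<bar>x\<bar> > R \<Longrightarrow> \<phi> x = 0" "\<And>x. \<bar>x\<bar> > R \<Longrightarrow> deriv \<phi> x = 0"
    "\<And>x. \<bar>\<phi> x\<bar> \<le> B" "\<And>x. \<bar>deriv \<phi> x\<bar> \<le> B"
proof -
  obtain D where D: "\<And>x. (\<phi> has_real_derivative D x) (at x)" "continuous_on UNIV D"
    using assms unfolding test_fun_def C1_differentiable_on_def has_real_derivative_iff_has_vector_derivative[symmetric] by blast
  have d: "deriv \<phi> = D" using D(1) by (auto intro: DERIV_imp_deriv)
  obtain R0 where R0: "\<And>x. \<bar>x\<bar> > R0 \<Longrightarrow> \<phi> x = 0" using assms unfolding test_fun_def by blast
  define R where "R = \<bar>R0\<bar> + 1"
  have R: "\<phi> x = 0" if "\<bar>x\<bar> > R" for x using R0 that by (simp add: R_def)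
  have RD: "D x = 0" if x: "\<bar>x\<bar> > R" for x
  proof -
    have "((\<lambda>x. 0::real) has_real_derivative 0) (at x)" by simp
    then have "(\<phi> has_real_derivative 0) (at x)"
    proof (rule has_field_derivative_transform_within_open[where S = "{y. R < \<bar>y\<bar>}"])
      show "open {y::real. R < \<bar>y\<bar>}" by (intro open_Collect_less continuous_intros)
    qed (use x R in auto)
    then show ?thesis using D(1) DERIV_unique by blast
  qed
  have pc: "continuous_on UNIV \<phi>"
    using D(1) by (intro DERIV_continuous_on[of UNIV \<phi> D]) (auto intro: has_field_derivative_at_within)
  have "compact (\<phi> ` {-R..R})" "compact (D ` {-R..R})"
    by (auto intro!: compact_continuous_image intro: continuous_on_subset[OF pc] continuous_on_subset[OF D(2)])
  then have "bounded (\<phi> ` {-R..R})" "bounded (D ` {-R..R})" by (auto intro: compact_imp_bounded)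
  then obtain B1 B2 where B: "B1 > 0" "\<forall>y\<in>\<phi> ` {-R..R}. norm y \<le> B1" "B2 > 0" "\<forall>y\<in>D ` {-R..R}. norm y \<le> B2"
    unfolding bounded_pos by blast
  have b1: "\<bar>\<phi> x\<bar> \<le> max B1 B2" for x
  proof (cases "\<bar>x\<bar> > R")
    case False
    then have "\<phi> x \<in> \<phi> ` {-R..R}" by (intro imageI) auto
    from bspec[OF B(2) this] show ?thesis by simp
  qed (use R[of x] B(1) in simp)
  have b2: "\<bar>D x\<bar> \<le> max B1 B2" for x
  proof (cases "\<bar>x\<bar> > R")
    case False
    then have "D x \<in> D ` {-R..R}" by (intro imageI) auto
    from bspec[OF B(4) this] show ?thesis by simp
  qed (use RD[of x] B(3) in simp)
  show ?thesis
    by (rule that[of R "max B1 B2"]) (use D pc R RD b1 b2 in \<open>auto simp: d R_def\<close>)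
qed

lemma ft_cos_sin:
  assumes "integrable lborel h"
  shows "ft h \<xi> = complex_of_real (\<integral>x. cos (x * \<xi>) * h x \<partial>lborel) - \<i> * complex_of_real (\<integral>x. sin (x * \<xi>) * h x \<partial>lborel)"
proof -
  have [measurable]: "h \<in> borel_measurable lborel" using assms by auto
  have i: "integrable lborel (\<lambda>x. cos (x * \<xi>) * h x)" "integrable lborel (\<lambda>x. sin (x * \<xi>) * h x)"
    by (rule Bochner_Integration.integrable_bound[OF assms]; simp add: abs_mult mult_left_le_one_le)+
  have "ft h \<xi> = (\<integral>x. complex_of_real (cos (x * \<xi>) * h x) - \<i> * complex_of_real (sin (x * \<xi>) * h x) \<partial>lborel)"
    unfolding ft_def by (intro Bochner_Integration.integral_cong refl) (simp add: complex_eq_iff)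
  also have "\<dots> = (\<integral>x. complex_of_real (cos (x * \<xi>) * h x) \<partial>lborel) - (\<integral>x. \<i> * complex_of_real (sin (x * \<xi>) * h x) \<partial>lborel)"
    using i by (intro Bochner_Integration.integral_diff integrable_mult_right integrable_of_real)
  also have "\<dots> = complex_of_real (\<integral>x. cos (x * \<xi>) * h x \<partial>lborel) - \<i> * complex_of_real (\<integral>x. sin (x * \<xi>) * h x \<partial>lborel)"
    by (simp only: integral_mult_right_zero integral_complex_of_real)
  finally show ?thesis .
qed

lemma cutoff_L2:
  fixes v :: "real \<Rightarrow> 'a::euclidean_space"
  assumes "in_Lp 2 v" "\<delta> > 0"
  shows "integrable lborel (\<lambda>x. cutoff \<delta> x *\<^sub>R v x)" "integrable lborel (\<lambda>x. cutoff' \<delta> x *\<^sub>R v x)"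
    "in_Lp 2 (\<lambda>x. cutoff \<delta> x *\<^sub>R v x)" "in_Lp 2 (\<lambda>x. cutoff' \<delta> x *\<^sub>R v x)"
proof -
  have [measurable]: "v \<in> borel_measurable borel" using assms by (simp add: in_L2_iff)
  show "integrable lborel (\<lambda>x. cutoff \<delta> x *\<^sub>R v x)"
    by (rule pairing_L2(1)[OF assms(1), of _ 1 "1 / \<delta>"]) (use assms cutoff_bounds cutoff_zero in auto)
  show "integrable lborel (\<lambda>x. cutoff' \<delta> x *\<^sub>R v x)"
    by (rule pairing_L2(1)[OF assms(1), of _ "4 * \<delta>" "1 / \<delta>"]) (use assms cutoff'_bound cutoff'_zero in auto)
  show "in_Lp 2 (\<lambda>x. cutoff \<delta> x *\<^sub>R v x)"
    by (rule L2_bounded_mult[OF assms(1), of _ 1]) (auto simp: cutoff_bounds mult_left_le_one_le)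
  show "in_Lp 2 (\<lambda>x. cutoff' \<delta> x *\<^sub>R v x)"
    by (rule L2_bounded_mult[OF assms(1), of _ "4 * \<delta>"]) (auto intro!: mult_right_mono cutoff'_bound assms)
qed

lemma cutoff_L2_tendsto:
  fixes v :: "real \<Rightarrow> 'a::euclidean_space"
  assumes v: "in_Lp 2 v" and d: "d \<longlonglongrightarrow> 0"
  shows "(\<lambda>n. Lp_norm 2 (\<lambda>x. cutoff (d n) x *\<^sub>R v x - v x)) \<longlonglongrightarrow> 0"
proof -
  have [measurable]: "v \<in> borel_measurable borel" using v by (simp add: in_L2_iff)
  have "(\<lambda>n. \<integral>x. (norm (cutoff (d n) x *\<^sub>R v x - v x))\<^sup>2 \<partial>lborel) \<longlonglongrightarrow> (\<integral>x. 0 \<partial>(lborel :: real measure))"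
  proof (rule integral_dominated_convergence[where w = "\<lambda>x. (norm (v x))\<^sup>2"])
    show "AE x in lborel. (\<lambda>n. (norm (cutoff (d n) x *\<^sub>R v x - v x))\<^sup>2) \<longlonglongrightarrow> 0"
    proof (rule AE_I2)
      fix x
      have "(\<lambda>n. (norm (((max 0 (1 - (d n * x)\<^sup>2))\<^sup>2) *\<^sub>R v x - v x))\<^sup>2) \<longlonglongrightarrow> (norm (((max 0 (1 - (0 * x)\<^sup>2))\<^sup>2) *\<^sub>R v x - v x))\<^sup>2"
        by (intro tendsto_intros d)
      then show "(\<lambda>n. (norm (cutoff (d n) x *\<^sub>R v x - v x))\<^sup>2) \<longlonglongrightarrow> 0"
        by (simp add: cutoff_def)
    qed
    show "AE x in lborel. norm ((norm (cutoff (d n) x *\<^sub>R v x - v x))\<^sup>2) \<le> (norm (v x))\<^sup>2" for n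
    proof (rule AE_I2)
      fix x
      have "cutoff (d n) x *\<^sub>R v x - v x = (cutoff (d n) x - 1) *\<^sub>R v x" by (simp add: scaleR_diff_left)
      moreover have "\<bar>cutoff (d n) x - 1\<bar> \<le> 1" using cutoff_bounds[of "d n" x] by auto
      ultimately have "norm (cutoff (d n) x *\<^sub>R v x - v x) \<le> norm (v x)"
        by (simp add: mult_left_le_one_le)
      then show "norm ((norm (cutoff (d n) x *\<^sub>R v x - v x))\<^sup>2) \<le> (norm (v x))\<^sup>2"
        by (simp add: power_mono)
    qed
    show "integrable lborel (\<lambda>x. (norm (v x))\<^sup>2)" using v by (simp add: in_L2_iff)
  qed measurable
  from tendsto_real_sqrt[OF this] show ?thesis unfolding Lp_norm_2 by simp
qed

lemma cutoff'_L2_norm: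
  fixes v :: "real \<Rightarrow> 'a::euclidean_space"
  assumes v: "in_Lp 2 v" and d: "\<delta> > 0"
  shows "Lp_norm 2 (\<lambda>x. cutoff' \<delta> x *\<^sub>R v x) \<le> 4 * \<delta> * Lp_norm 2 v"
proof -
  have i: "integrable lborel (\<lambda>x. (norm (v x))\<^sup>2)" using v by (simp add: in_L2_iff)
  have "(\<integral>x. (norm (cutoff' \<delta> x *\<^sub>R v x))\<^sup>2 \<partial>lborel) \<le> (\<integral>x. (4 * \<delta>)\<^sup>2 * (norm (v x))\<^sup>2 \<partial>lborel)"
  proof (rule integral_mono)
    fix x
    have "\<bar>cutoff' \<delta> x\<bar>\<^sup>2 \<le> (4 * \<delta>)\<^sup>2" by (intro power_mono cutoff'_bound d) auto
    then show "(norm (cutoff' \<delta> x *\<^sub>R v x))\<^sup>2 \<le> (4 * \<delta>)\<^sup>2 * (norm (v x))\<^sup>2"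
      unfolding norm_scaleR power_mult_distrib by (rule mult_right_mono) simp
  qed (use i cutoff_L2(4)[OF v d] in \<open>auto simp: in_L2_iff\<close>)
  also have "\<dots> = (4 * \<delta>)\<^sup>2 * (Lp_norm 2 v)\<^sup>2" by (simp add: Lp_norm_2_sq)
  finally have "Lp_norm 2 (\<lambda>x. cutoff' \<delta> x *\<^sub>R v x) \<le> sqrt ((4 * \<delta>)\<^sup>2 * (Lp_norm 2 v)\<^sup>2)"
    unfolding Lp_norm_2[of "\<lambda>x. cutoff' \<delta> x *\<^sub>R v x"] by (rule real_sqrt_le_mono)
  also have "\<dots> = 4 * \<delta> * Lp_norm 2 v" using d by (simp add: real_sqrt_mult)
  finally show ?thesis .
qed

lemma integral_nth:
  fixes f :: "real \<Rightarrow> real ^ 'n"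
  assumes "integrable M f"
  shows "(\<integral>x. f x \<partial>M) $ i = (\<integral>x. f x $ i \<partial>M)"
  by (rule integral_bounded_linear[OF bounded_linear_vec_nth assms, symmetric])

lemma fourier_cos_sin:
  fixes v :: "real \<Rightarrow> real ^ 'n"
  assumes \<theta>: "\<theta> \<in> borel_measurable borel" and i: "integrable lborel (\<lambda>x. \<theta> x *\<^sub>R v x)"
  shows "fourier (\<lambda>x. \<theta> x *\<^sub>R v x) \<xi> $ i =
    complex_of_real ((\<integral>x. (\<theta> x * cos (x * \<xi>)) *\<^sub>R v x \<partial>lborel) $ i)
    - \<i> * complex_of_real ((\<integral>x. (\<theta> x * sin (x * \<xi>)) *\<^sub>R v x \<partial>lborel) $ i)"
    "integrable lborel (\<lambda>x. (\<theta> x * cos (x * \<xi>)) *\<^sub>R v x)" "integrable lborel (\<lambda>x. (\<theta> x * sin (x * \<xi>)) *\<^sub>R v x)"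
proof -
  have m [measurable]: "(\<lambda>x. \<theta> x *\<^sub>R v x) \<in> borel_measurable borel" using i by auto
  have c: "integrable lborel (\<lambda>x. cos (x * \<xi>) *\<^sub>R (\<theta> x *\<^sub>R v x))"
  proof (rule Bochner_Integration.integrable_bound[OF i])
    show "(\<lambda>x. cos (x * \<xi>) *\<^sub>R (\<theta> x *\<^sub>R v x)) \<in> borel_measurable lborel"
      by (rule borel_measurable_scaleR[OF _ borel_measurable_integrable[OF i]]) simp
    show "AE x in lborel. norm (cos (x * \<xi>) *\<^sub>R (\<theta> x *\<^sub>R v x)) \<le> norm (\<theta> x *\<^sub>R v x)"
      unfolding norm_scaleR[of "cos _"] by (intro AE_I2 mult_left_le_one_le) auto
  qed
  have s: "integrable lborel (\<lambda>x. sin (x * \<xi>) *\<^sub>R (\<theta> x *\<^sub>R v x))"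
  proof (rule Bochner_Integration.integrable_bound[OF i])
    show "(\<lambda>x. sin (x * \<xi>) *\<^sub>R (\<theta> x *\<^sub>R v x)) \<in> borel_measurable lborel"
      by (rule borel_measurable_scaleR[OF _ borel_measurable_integrable[OF i]]) simp
    show "AE x in lborel. norm (sin (x * \<xi>) *\<^sub>R (\<theta> x *\<^sub>R v x)) \<le> norm (\<theta> x *\<^sub>R v x)"
      unfolding norm_scaleR[of "sin _"] by (intro AE_I2 mult_left_le_one_le) auto
  qed
  show c': "integrable lborel (\<lambda>x. (\<theta> x * cos (x * \<xi>)) *\<^sub>R v x)" using c by (simp add: mult.commute)
  show s': "integrable lborel (\<lambda>x. (\<theta> x * sin (x * \<xi>)) *\<^sub>R v x)" using s by (simp add: mult.commute)
  have "integrable lborel (\<lambda>x. (\<theta> x *\<^sub>R v x) $ i)" by (rule component_integrable[OF i])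
  from ft_cos_sin[OF this, of \<xi>]
  show "fourier (\<lambda>x. \<theta> x *\<^sub>R v x) \<xi> $ i =
    complex_of_real ((\<integral>x. (\<theta> x * cos (x * \<xi>)) *\<^sub>R v x \<partial>lborel) $ i)
    - \<i> * complex_of_real ((\<integral>x. (\<theta> x * sin (x * \<xi>)) *\<^sub>R v x \<partial>lborel) $ i)"
    unfolding fourier_nth integral_nth[OF c'] integral_nth[OF s'] by (simp add: mult_ac)
qed

text \<open>
  Test the definition of the weak derivative with the real and imaginary parts of
  \<open>cutoff \<delta> x * exp (- i x \<xi>)\<close>.
\<close>

lemma weak_deriv_fourier_cutoff:
  fixes f g :: "real \<Rightarrow> real ^ 'n"
  assumes f: "in_Lp 2 f" and g: "in_Lp 2 g" and w: "has_weak_deriv f g" and d: "\<delta> > 0"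
  shows "fourier (\<lambda>x. cutoff \<delta> x *\<^sub>R g x) \<xi> $ i
    = \<i> * complex_of_real \<xi> * fourier (\<lambda>x. cutoff \<delta> x *\<^sub>R f x) \<xi> $ i - fourier (\<lambda>x. cutoff' \<delta> x *\<^sub>R f x) \<xi> $ i"
proof -
  note fi = cutoff_L2(1,2)[OF f d]
  note gi = cutoff_L2(1)[OF g d]
  note Ff = fourier_cos_sin[OF cutoff_measurable(1) fi(1), where \<xi> = \<xi>]
  note Ff' = fourier_cos_sin[OF cutoff_measurable(2) fi(2), where \<xi> = \<xi>]
  note Fg = fourier_cos_sin[OF cutoff_measurable(1) gi, where \<xi> = \<xi>]
  have c: "(\<integral>x. (cutoff \<delta> x * cos (x * \<xi>)) *\<^sub>R g x \<partial>lborel)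
     = \<xi> *\<^sub>R (\<integral>x. (cutoff \<delta> x * sin (x * \<xi>)) *\<^sub>R f x \<partial>lborel) - (\<integral>x. (cutoff' \<delta> x * cos (x * \<xi>)) *\<^sub>R f x \<partial>lborel)"
  proof -
    have "(\<integral>x. (cutoff \<delta> x * cos (x * \<xi>)) *\<^sub>R g x \<partial>lborel)
      = - (\<integral>x. (cutoff' \<delta> x * cos (x * \<xi>) - \<xi> * (cutoff \<delta> x * sin (x * \<xi>))) *\<^sub>R f x \<partial>lborel)"
      using w[unfolded has_weak_deriv_def, rule_format, OF cos_cutoff(1)[OF d]] unfolding cos_cutoff(2)[OF d] by simp
    also have "(\<integral>x. (cutoff' \<delta> x * cos (x * \<xi>) - \<xi> * (cutoff \<delta> x * sin (x * \<xi>))) *\<^sub>R f x \<partial>lborel)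
       = (\<integral>x. (cutoff' \<delta> x * cos (x * \<xi>)) *\<^sub>R f x - \<xi> *\<^sub>R ((cutoff \<delta> x * sin (x * \<xi>)) *\<^sub>R f x) \<partial>lborel)"
      by (simp add: scaleR_diff_left)
    also have "\<dots> = (\<integral>x. (cutoff' \<delta> x * cos (x * \<xi>)) *\<^sub>R f x \<partial>lborel) - (\<integral>x. \<xi> *\<^sub>R ((cutoff \<delta> x * sin (x * \<xi>)) *\<^sub>R f x) \<partial>lborel)"
      by (intro Bochner_Integration.integral_diff integrable_scaleR_right Ff Ff')
    finally show ?thesis unfolding integral_scaleR_right by simp
  qed
  have s: "(\<integral>x. (cutoff \<delta> x * sin (x * \<xi>)) *\<^sub>R g x \<partial>lborel)
     = - (\<xi> *\<^sub>R (\<integral>x. (cutoff \<delta> x * cos (x * \<xi>)) *\<^sub>R f x \<partial>lborel)) - (\<integral>x. (cutoff' \<delta> x * sin (x * \<xi>)) *\<^sub>R f x \<partial>lborel)"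
  proof -
    have "(\<integral>x. (cutoff \<delta> x * sin (x * \<xi>)) *\<^sub>R g x \<partial>lborel)
      = - (\<integral>x. (cutoff' \<delta> x * sin (x * \<xi>) + \<xi> * (cutoff \<delta> x * cos (x * \<xi>))) *\<^sub>R f x \<partial>lborel)"
      using w[unfolded has_weak_deriv_def, rule_format, OF sin_cutoff(1)[OF d]] unfolding sin_cutoff(2)[OF d] by simp
    also have "(\<integral>x. (cutoff' \<delta> x * sin (x * \<xi>) + \<xi> * (cutoff \<delta> x * cos (x * \<xi>))) *\<^sub>R f x \<partial>lborel)
       = (\<integral>x. (cutoff' \<delta> x * sin (x * \<xi>)) *\<^sub>R f x + \<xi> *\<^sub>R ((cutoff \<delta> x * cos (x * \<xi>)) *\<^sub>R f x) \<partial>lborel)"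
      by (simp add: scaleR_add_left)
    also have "\<dots> = (\<integral>x. (cutoff' \<delta> x * sin (x * \<xi>)) *\<^sub>R f x \<partial>lborel) + (\<integral>x. \<xi> *\<^sub>R ((cutoff \<delta> x * cos (x * \<xi>)) *\<^sub>R f x) \<partial>lborel)"
      by (intro Bochner_Integration.integral_add integrable_scaleR_right Ff Ff')
    finally show ?thesis unfolding integral_scaleR_right by simp
  qed
  show ?thesis unfolding Fg(1) Ff(1) Ff'(1) c s by (simp add: complex_eq_iff)
qed

definition cvec :: "complex \<Rightarrow> complex ^ 'n \<Rightarrow> complex ^ 'n" where
  "cvec c v = (\<chi> i. c * v $ i)"

lemma cvec_nth [simp]: "cvec c v $ i = c * v $ i" by (simp add: cvec_def)

lemma norm_cvec: "norm (cvec c v) = norm c * norm v"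
proof -
  have "(norm (cvec c v))\<^sup>2 = (norm c * norm v)\<^sup>2"
    by (simp add: norm_vec_sq norm_mult power_mult_distrib sum_distrib_left)
  then show ?thesis by (rule power2_eq_imp_eq) auto
qed

lemma cvec_diff: "cvec c v - cvec c w = cvec c (v - w)"
  by (simp add: vec_eq_iff right_diff_distrib)

lemma cvec_measurable:
  fixes v :: "real \<Rightarrow> complex ^ 'n"
  assumes c: "c \<in> borel_measurable borel" and v: "v \<in> borel_measurable lborel"
  shows "(\<lambda>\<xi>. cvec (c \<xi>) (v \<xi>)) \<in> borel_measurable lborel"
proof (rule borel_measurable_vec_componentwise)
  fix i
  have [measurable]: "(\<lambda>\<xi>. v \<xi> $ i) \<in> borel_measurable lborel" by (rule component_measurable[OF v])
  have [measurable]: "c \<in> borel_measurable lborel" using c by simp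
  show "(\<lambda>\<xi>. cvec (c \<xi>) (v \<xi>) $ i) \<in> borel_measurable lborel" unfolding cvec_nth by measurable
qed

text \<open>
  Let \<open>\<delta>\<close> tend to 0 in \<open>weak_deriv_fourier_cutoff\<close>.  The term
  with the derivative of the cut-off function is of size \<open>\<delta>\<close> in
  \<open>L^2\<close> and disappears.
\<close>

theorem weak_deriv_fourier:
  fixes f g :: "real \<Rightarrow> real ^ 'n"
  assumes f: "in_Lp 2 f" and g: "in_Lp 2 g" and w: "has_weak_deriv f g"
  shows "AE \<xi> in lborel. norm (fourier_L2 g \<xi>) = \<bar>\<xi>\<bar> * norm (fourier_L2 f \<xi>)"
proof -
  define d where "d n = inverse (real (Suc n))" for n
  have d: "d n > 0" for n by (simp add: d_def)
  have d0: "d \<longlonglongrightarrow> 0" unfolding d_def by (rule LIMSEQ_inverse_real_of_nat)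
  define G where "G n = fourier (\<lambda>x. cutoff (d n) x *\<^sub>R g x)" for n
  define H where "H n = fourier (\<lambda>x. cutoff (d n) x *\<^sub>R f x)" for n
  define J where "J n = fourier (\<lambda>x. cutoff' (d n) x *\<^sub>R f x)" for n
  have L2: "in_Lp 2 (G n)" "in_Lp 2 (H n)" "in_Lp 2 (J n)" for n
    unfolding G_def H_def J_def using cutoff_L2[OF f d] cutoff_L2[OF g d]
    by (auto intro: plancherel(1))
  have "(\<lambda>n. sqrt (2 * pi) * Lp_norm 2 (\<lambda>x. cutoff (d n) x *\<^sub>R g x - g x)) \<longlonglongrightarrow> sqrt (2 * pi) * 0"
    by (intro tendsto_mult tendsto_const cutoff_L2_tendsto g d0)
  then have G: "(\<lambda>n. Lp_norm 2 (\<lambda>\<xi>. G n \<xi> - fourier_L2 g \<xi>)) \<longlonglongrightarrow> 0"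
    unfolding G_def using fourier_L2_dist_fourier[OF g cutoff_L2(1,3)[OF g d]] by simp
  have "(\<lambda>n. sqrt (2 * pi) * Lp_norm 2 (\<lambda>x. cutoff (d n) x *\<^sub>R f x - f x)) \<longlonglongrightarrow> sqrt (2 * pi) * 0"
    by (intro tendsto_mult tendsto_const cutoff_L2_tendsto f d0)
  then have H: "(\<lambda>n. Lp_norm 2 (\<lambda>\<xi>. H n \<xi> - fourier_L2 f \<xi>)) \<longlonglongrightarrow> 0"
    unfolding H_def using fourier_L2_dist_fourier[OF f cutoff_L2(1,3)[OF f d]] by simp
  have J: "(\<lambda>n. Lp_norm 2 (\<lambda>\<xi>. J n \<xi> - 0)) \<longlonglongrightarrow> 0"
  proof (rule tendsto_sandwich[OF _ _ tendsto_const])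
    have "(\<lambda>n. sqrt (2 * pi) * (4 * d n * Lp_norm 2 f)) \<longlonglongrightarrow> sqrt (2 * pi) * (4 * 0 * Lp_norm 2 f)"
      by (intro tendsto_intros d0)
    then show "(\<lambda>n. sqrt (2 * pi) * (4 * d n * Lp_norm 2 f)) \<longlonglongrightarrow> 0" by simp
    have "Lp_norm 2 (J n) \<le> sqrt (2 * pi) * (4 * d n * Lp_norm 2 f)" for n
      unfolding J_def plancherel(2)[OF cutoff_L2(2,4)[OF f d]]
      by (intro mult_left_mono cutoff'_L2_norm f d) simp
    then show "\<forall>\<^sub>F n in sequentially. Lp_norm 2 (\<lambda>\<xi>. J n \<xi> - 0) \<le> sqrt (2 * pi) * (4 * d n * Lp_norm 2 f)"
      by (intro always_eventually allI) simp
  qed (intro always_eventually allI Lp_norm_nonneg)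
  have z: "in_Lp 2 (\<lambda>\<xi>::real. 0 :: complex ^ 'n)" by (simp add: in_L2_iff)
  obtain r where r: "strict_mono r" "AE \<xi> in lborel. (\<lambda>n. G (r n) \<xi>) \<longlonglongrightarrow> fourier_L2 g \<xi>"
    by (rule L2_AE_subseq[OF L2(1) fourier_L2(1)[OF g] G])
  have H': "(\<lambda>n. Lp_norm 2 (\<lambda>\<xi>. H (r n) \<xi> - fourier_L2 f \<xi>)) \<longlonglongrightarrow> 0"
    using LIMSEQ_subseq_LIMSEQ[OF H r(1)] unfolding o_def .
  have J': "(\<lambda>n. Lp_norm 2 (\<lambda>\<xi>. J (r n) \<xi> - 0)) \<longlonglongrightarrow> 0"
    using LIMSEQ_subseq_LIMSEQ[OF J r(1)] unfolding o_def .
  obtain s where s: "strict_mono s" "AE \<xi> in lborel. (\<lambda>n. H (r (s n)) \<xi>) \<longlonglongrightarrow> fourier_L2 f \<xi>"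
    by (rule L2_AE_subseq[OF L2(2) fourier_L2(1)[OF f] H'])
  have J'': "(\<lambda>n. Lp_norm 2 (\<lambda>\<xi>. J (r (s n)) \<xi> - 0)) \<longlonglongrightarrow> 0"
    using LIMSEQ_subseq_LIMSEQ[OF J' s(1)] unfolding o_def .
  obtain q where q: "strict_mono q" "AE \<xi> in lborel. (\<lambda>n. J (r (s (q n))) \<xi>) \<longlonglongrightarrow> 0"
    by (rule L2_AE_subseq[OF L2(3) z J''])
  from r(2) s(2) q(2) show ?thesis
  proof eventually_elim
    case (elim \<xi>)
    define k where "k n = r (s (q n))" for n
    have sm: "strict_mono (\<lambda>n. s (q n))" using s(1) q(1) by (simp add: strict_mono_def)
    have 1: "(\<lambda>n. G (k n) \<xi>) \<longlonglongrightarrow> fourier_L2 g \<xi>"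
      using LIMSEQ_subseq_LIMSEQ[OF elim(1) sm] unfolding o_def k_def .
    have 2: "(\<lambda>n. H (k n) \<xi>) \<longlonglongrightarrow> fourier_L2 f \<xi>"
      using LIMSEQ_subseq_LIMSEQ[OF elim(2) q(1)] unfolding o_def k_def .
    have 3: "(\<lambda>n. J (k n) \<xi>) \<longlonglongrightarrow> 0" using elim(3) unfolding k_def .
    have "fourier_L2 g \<xi> $ i = \<i> * complex_of_real \<xi> * fourier_L2 f \<xi> $ i" for i
    proof (rule LIMSEQ_unique)
      show "(\<lambda>n. G (k n) \<xi> $ i) \<longlonglongrightarrow> fourier_L2 g \<xi> $ i" by (rule tendsto_vec_nth[OF 1])
      have "(\<lambda>n. \<i> * complex_of_real \<xi> * H (k n) \<xi> $ i - J (k n) \<xi> $ i) \<longlonglongrightarrow> \<i> * complex_of_real \<xi> * fourier_L2 f \<xi> $ i - 0 $ i"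
        by (intro tendsto_diff tendsto_mult tendsto_const tendsto_vec_nth 2 3)
      then show "(\<lambda>n. G (k n) \<xi> $ i) \<longlonglongrightarrow> \<i> * complex_of_real \<xi> * fourier_L2 f \<xi> $ i"
        unfolding G_def H_def J_def weak_deriv_fourier_cutoff[OF f g w d] by simp
    qed
    then have "fourier_L2 g \<xi> = cvec (\<i> * complex_of_real \<xi>) (fourier_L2 f \<xi>)" by (simp add: vec_eq_iff)
    then show ?case by (simp add: norm_cvec norm_mult)
  qed
qed

section \<open>Difference quotients\<close>

lemma translate_integrable:
  fixes f :: "real \<Rightarrow> 'a::euclidean_space"
  assumes "integrable lborel f"
  shows "integrable lborel (\<lambda>x. f (x + h))" "(\<integral>x. f (x + h) \<partial>lborel) = (\<integral>x. f x \<partial>lborel)"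
  using lborel_integrable_real_affine[OF assms, of 1 h] lborel_integral_real_affine[of 1 f h]
  by (simp_all add: add.commute)

lemma translate_L2:
  fixes f :: "real \<Rightarrow> 'a::euclidean_space"
  assumes "in_Lp 2 f"
  shows "in_Lp 2 (\<lambda>x. f (x + h))" "Lp_norm 2 (\<lambda>x. f (x + h)) = Lp_norm 2 f"
proof -
  have [measurable]: "f \<in> borel_measurable borel" and i: "integrable lborel (\<lambda>x. (norm (f x))\<^sup>2)"
    using assms by (simp_all add: in_L2_iff)
  show "in_Lp 2 (\<lambda>x. f (x + h))" using translate_integrable(1)[OF i, of h] by (simp add: in_L2_iff)
  show "Lp_norm 2 (\<lambda>x. f (x + h)) = Lp_norm 2 f"
    using translate_integrable(2)[OF i, of h] by (simp add: Lp_norm_2)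
qed

lemma ft_translate:
  assumes "integrable lborel k"
  shows "ft (\<lambda>x. k (x + h)) \<xi> = cis (h * \<xi>) * ft k \<xi>"
proof -
  have "ft k \<xi> = (\<integral>x. cis (- ((x + h) * \<xi>)) * complex_of_real (k (x + h)) \<partial>lborel)"
    unfolding ft_def by (rule translate_integrable(2)[OF integrable_ft[OF assms], symmetric])
  also have "\<dots> = (\<integral>x. cis (- (h * \<xi>)) * (cis (- (x * \<xi>)) * complex_of_real (k (x + h))) \<partial>lborel)"
    by (intro Bochner_Integration.integral_cong refl) (simp add: mult.assoc[symmetric] cis_mult algebra_simps)
  also have "\<dots> = cis (- (h * \<xi>)) * ft (\<lambda>x. k (x + h)) \<xi>" by (simp add: ft_def)
  finally have "cis (h * \<xi>) * ft k \<xi> = (cis (h * \<xi>) * cis (- (h * \<xi>))) * ft (\<lambda>x. k (x + h)) \<xi>"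
    by (simp only: mult.assoc)
  then show ?thesis by (simp add: cis_mult)
qed

lemma ft_scale: "ft (\<lambda>x. c * k x) \<xi> = complex_of_real c * ft k \<xi>"
proof -
  have "ft (\<lambda>x. c * k x) \<xi> = (\<integral>x. complex_of_real c * (cis (- (x * \<xi>)) * complex_of_real (k x)) \<partial>lborel)"
    unfolding ft_def by (intro Bochner_Integration.integral_cong refl) simp
  then show ?thesis by (simp add: ft_def)
qed

definition diffquot :: "real \<Rightarrow> (real \<Rightarrow> 'a::real_vector) \<Rightarrow> real \<Rightarrow> 'a" where
  "diffquot h f x = (1 / h) *\<^sub>R (f (x + h) - f x)"

lemma diffquot_integrable:
  fixes f :: "real \<Rightarrow> 'a::euclidean_space"
  shows "integrable lborel f \<Longrightarrow> integrable lborel (diffquot h f)"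
  unfolding diffquot_def[abs_def]
  by (intro integrable_scaleR_right Bochner_Integration.integrable_diff translate_integrable(1))

lemma diffquot_L2:
  fixes f :: "real \<Rightarrow> 'a::euclidean_space"
  assumes "in_Lp 2 f"
  shows "in_Lp 2 (diffquot h f)" "Lp_norm 2 (diffquot h f) \<le> 2 / \<bar>h\<bar> * Lp_norm 2 f"
proof -
  have d: "in_Lp 2 (\<lambda>x. f (x + h) - f x)" by (intro L2_diff translate_L2(1) assms)
  have [measurable]: "f \<in> borel_measurable borel" using assms by (simp add: in_L2_iff)
  show "in_Lp 2 (diffquot h f)"
    by (rule L2_bounded_mult[OF d, of _ "\<bar>1 / h\<bar>"]) (auto simp: diffquot_def[abs_def])
  have "Lp_norm 2 (\<lambda>x. f (x + h) - f x) \<le> Lp_norm 2 (\<lambda>x. f (x + h)) + Lp_norm 2 f"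
    using L2_triangle[OF translate_L2(1)[OF assms, of h], of "\<lambda>x. 0" f] assms
      Lp_norm_2_minus_commute[of "\<lambda>x. 0" f] by (simp add: in_L2_iff)
  then have b: "Lp_norm 2 (\<lambda>x. f (x + h) - f x) \<le> 2 * Lp_norm 2 f" by (simp add: translate_L2(2)[OF assms])
  have "Lp_norm 2 (diffquot h f) = \<bar>1 / h\<bar> * Lp_norm 2 (\<lambda>x. f (x + h) - f x)"
    by (simp add: Lp_norm_2 diffquot_def power_mult_distrib power_divide real_sqrt_mult real_sqrt_divide)
  also have "\<dots> \<le> \<bar>1 / h\<bar> * (2 * Lp_norm 2 f)" by (rule mult_left_mono[OF b]) simp
  finally show "Lp_norm 2 (diffquot h f) \<le> 2 / \<bar>h\<bar> * Lp_norm 2 f" by simp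
qed

lemma diffquot_diff: "diffquot h f x - diffquot h g x = diffquot h (\<lambda>x. f x - g x) x"
  unfolding diffquot_def scaleR_diff_right[symmetric]
  by (rule arg_cong[of _ _ "(*\<^sub>R) (1 / h)"]) simp

text \<open>
  The multiplier by which a difference quotient acts on the transform.
\<close>

definition dqsymbol :: "real \<Rightarrow> real \<Rightarrow> complex" where
  "dqsymbol h \<xi> = (cis (h * \<xi>) - 1) / complex_of_real h"

lemma cis_approx: "norm (cis y - 1) \<le> \<bar>y\<bar>" "norm (cis y - (1 + \<i> * complex_of_real y)) \<le> y\<^sup>2 / 2"
  using iexp_approx1[of y 0] iexp_approx1[of y 1] by (simp_all add: cis_conv_exp power2_eq_square)

lemma dqsymbol_bounds:
  assumes "h > 0"
  shows "norm (dqsymbol h \<xi>) \<le> \<bar>\<xi>\<bar>" "norm (dqsymbol h \<xi> - \<i> * complex_of_real \<xi>) \<le> h * \<xi>\<^sup>2 / 2"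
    "norm (dqsymbol h \<xi>) \<le> 2 / h"
proof -
  have "norm (dqsymbol h \<xi>) = norm (cis (h * \<xi>) - 1) / h" using assms by (simp add: dqsymbol_def norm_divide)
  also have "\<dots> \<le> \<bar>h * \<xi>\<bar> / h" using assms by (intro divide_right_mono cis_approx) auto
  also have "\<dots> = \<bar>\<xi>\<bar>" using assms by (simp add: abs_mult)
  finally show "norm (dqsymbol h \<xi>) \<le> \<bar>\<xi>\<bar>" .
  have "dqsymbol h \<xi> - \<i> * complex_of_real \<xi> = (cis (h * \<xi>) - (1 + \<i> * complex_of_real (h * \<xi>))) / complex_of_real h"
    using assms by (simp add: dqsymbol_def field_simps)
  then have "norm (dqsymbol h \<xi> - \<i> * complex_of_real \<xi>) = norm (cis (h * \<xi>) - (1 + \<i> * complex_of_real (h * \<xi>))) / h"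
    using assms by (simp add: norm_divide)
  also have "\<dots> \<le> ((h * \<xi>)\<^sup>2 / 2) / h" using assms by (intro divide_right_mono cis_approx) auto
  also have "\<dots> = h * \<xi>\<^sup>2 / 2" using assms by (simp add: power2_eq_square)
  finally show "norm (dqsymbol h \<xi> - \<i> * complex_of_real \<xi>) \<le> h * \<xi>\<^sup>2 / 2" .
  have "norm (cis (h * \<xi>) - 1) \<le> 2" using norm_triangle_ineq4[of "cis (h * \<xi>)" 1] by simp
  then show "norm (dqsymbol h \<xi>) \<le> 2 / h" using assms by (simp add: dqsymbol_def norm_divide divide_right_mono)
qed

lemma dqsymbol_measurable [measurable]: "dqsymbol h \<in> borel_measurable borel"
  unfolding dqsymbol_def[abs_def] by measurable

lemma fourier_diffquot:
  fixes f :: "real \<Rightarrow> real ^ 'n"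
  assumes "integrable lborel f"
  shows "fourier (diffquot h f) \<xi> = cvec (dqsymbol h \<xi>) (fourier f \<xi>)"
proof -
  have "ft (\<lambda>x. diffquot h f x $ i) \<xi> = dqsymbol h \<xi> * ft (\<lambda>x. f x $ i) \<xi>" for i
  proof -
    have k: "integrable lborel (\<lambda>x. f x $ i)" by (rule component_integrable[OF assms])
    have "ft (\<lambda>x. diffquot h f x $ i) \<xi> = ft (\<lambda>x. 1 / h * (f (x + h) $ i - f x $ i)) \<xi>"
      by (simp add: diffquot_def)
    also have "\<dots> = complex_of_real (1 / h) * (ft (\<lambda>x. f (x + h) $ i) \<xi> - ft (\<lambda>x. f x $ i) \<xi>)"
      unfolding ft_scale by (subst ft_diff[OF translate_integrable(1)[OF k] k]) simp
    also have "\<dots> = dqsymbol h \<xi> * ft (\<lambda>x. f x $ i) \<xi>"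
      unfolding ft_translate[OF k] dqsymbol_def by (simp add: algebra_simps diff_divide_distrib)
    finally show ?thesis .
  qed
  then show ?thesis by (simp add: vec_eq_iff fourier_nth)
qed

lemma fourier_L2_dist:
  fixes f g :: "real \<Rightarrow> real ^ 'n"
  assumes f: "in_Lp 2 f" and g: "in_Lp 2 g"
  shows "Lp_norm 2 (\<lambda>\<xi>. fourier_L2 f \<xi> - fourier_L2 g \<xi>) = sqrt (2 * pi) * Lp_norm 2 (\<lambda>x. f x - g x)"
proof -
  define T where "T R = (\<lambda>x. indicator {-R..R} x *\<^sub>R f x)" for R :: real
  have T: "integrable lborel (T R)" "in_Lp 2 (T R)" for R unfolding T_def by (rule truncation[OF f])+
  have FT: "in_Lp 2 (fourier (T R))" for R by (rule plancherel(1)[OF T])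
  have "((\<lambda>R. Lp_norm 2 (\<lambda>\<xi>. fourier (T R) \<xi> - fourier_L2 g \<xi>)) \<longlongrightarrow> Lp_norm 2 (\<lambda>\<xi>. fourier_L2 f \<xi> - fourier_L2 g \<xi>)) at_top"
  proof (rule L2_norm_tendsto)
    have e: "(\<lambda>\<xi>. fourier (T R) \<xi> - fourier_L2 g \<xi> - (fourier_L2 f \<xi> - fourier_L2 g \<xi>)) = (\<lambda>\<xi>. fourier (T R) \<xi> - fourier_L2 f \<xi>)" for R
      by (simp add: algebra_simps)
    show "((\<lambda>R. Lp_norm 2 (\<lambda>\<xi>. fourier (T R) \<xi> - fourier_L2 g \<xi> - (fourier_L2 f \<xi> - fourier_L2 g \<xi>))) \<longlongrightarrow> 0) at_top"
      unfolding e using fourier_L2(2)[OF f] by (simp add: T_def)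
  qed (intro L2_diff FT fourier_L2(1) f g)+
  moreover have "((\<lambda>R. sqrt (2 * pi) * Lp_norm 2 (\<lambda>x. T R x - g x)) \<longlongrightarrow> sqrt (2 * pi) * Lp_norm 2 (\<lambda>x. f x - g x)) at_top"
  proof (intro tendsto_mult tendsto_const L2_norm_tendsto)
    have e: "(\<lambda>x. T R x - g x - (f x - g x)) = (\<lambda>x. T R x - f x)" for R by (simp add: algebra_simps)
    show "((\<lambda>R. Lp_norm 2 (\<lambda>x. T R x - g x - (f x - g x))) \<longlongrightarrow> 0) at_top"
      unfolding e using truncation_tendsto[OF f] by (simp add: T_def)
  qed (intro L2_diff g T f)+
  ultimately show ?thesis unfolding fourier_L2_dist_fourier[OF g T]
    by (rule tendsto_unique[OF trivial_limit_at_top_linorder])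
qed

lemma fourier_L2_diffquot:
  fixes f :: "real \<Rightarrow> real ^ 'n"
  assumes f: "in_Lp 2 f" and h: "h > 0"
  shows "AE \<xi> in lborel. fourier_L2 (diffquot h f) \<xi> = cvec (dqsymbol h \<xi>) (fourier_L2 f \<xi>)"
proof -
  define T where "T R = (\<lambda>x. indicator {-R..R} x *\<^sub>R f x)" for R :: real
  have T: "integrable lborel (T R)" "in_Lp 2 (T R)" for R unfolding T_def by (rule truncation[OF f])+
  have FT: "in_Lp 2 (fourier (T R))" for R by (rule plancherel(1)[OF T])
  have lim: "((\<lambda>R. Lp_norm 2 (\<lambda>x. T R x - f x)) \<longlongrightarrow> 0) at_top" unfolding T_def by (rule truncation_tendsto[OF f])
  note dT = diffquot_integrable[OF T(1), of h] diffquot_L2(1)[OF T(2), of h]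
  have cv: "in_Lp 2 (\<lambda>\<xi>. cvec (dqsymbol h \<xi>) (v \<xi>)) \<and> Lp_norm 2 (\<lambda>\<xi>. cvec (dqsymbol h \<xi>) (v \<xi>)) \<le> 2 / h * Lp_norm 2 v"
    if v: "in_Lp 2 v" for v :: "real \<Rightarrow> complex ^ 'n"
  proof -
    have vm: "v \<in> borel_measurable lborel" using v by (simp add: in_L2_iff)
    have b: "norm (cvec (dqsymbol h \<xi>) (v \<xi>)) \<le> 2 / h * norm (v \<xi>)" for \<xi>
      unfolding norm_cvec by (rule mult_right_mono[OF dqsymbol_bounds(3)[OF h]]) simp
    have m: "(\<lambda>\<xi>. cvec (dqsymbol h \<xi>) (v \<xi>)) \<in> borel_measurable lborel"
      by (intro cvec_measurable vm) measurable
    have s: "in_Lp 2 (\<lambda>\<xi>. (2 / h) *\<^sub>R v \<xi>)"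
      by (rule L2_bounded_mult[OF v, of _ "2 / h"]) (use vm h in auto)
    have "Lp_norm 2 (\<lambda>\<xi>. cvec (dqsymbol h \<xi>) (v \<xi>)) \<le> Lp_norm 2 (\<lambda>\<xi>. (2 / h) *\<^sub>R v \<xi>)"
      by (rule Lp_norm_2_mono[OF s m]) (use b h in simp)
    also have "\<dots> = 2 / h * Lp_norm 2 v"
      using h by (simp add: Lp_norm_2 power_mult_distrib power_divide real_sqrt_mult real_sqrt_divide)
    finally show ?thesis using L2_bounded_mult[OF v m b] by simp
  qed
  show ?thesis
  proof (rule L2_limit_unique[where F = "at_top :: real filter" and f = "\<lambda>R. fourier (diffquot h (T R))"])
    show "in_Lp 2 (fourier (diffquot h (T R)))" for R by (rule plancherel(1)[OF dT])
    show "in_Lp 2 (fourier_L2 (diffquot h f))" by (intro fourier_L2(1) diffquot_L2(1) f)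
    show "in_Lp 2 (\<lambda>\<xi>. cvec (dqsymbol h \<xi>) (fourier_L2 f \<xi>))" using cv[OF fourier_L2(1)[OF f]] ..
    show "((\<lambda>R. Lp_norm 2 (\<lambda>\<xi>. fourier (diffquot h (T R)) \<xi> - fourier_L2 (diffquot h f) \<xi>)) \<longlongrightarrow> 0) at_top"
    proof (rule tendsto_sandwich[OF _ _ tendsto_const])
      have "((\<lambda>R. sqrt (2 * pi) * (2 / \<bar>h\<bar> * Lp_norm 2 (\<lambda>x. T R x - f x))) \<longlongrightarrow> sqrt (2 * pi) * (2 / \<bar>h\<bar> * 0)) at_top"
        by (intro tendsto_mult tendsto_const lim)
      then show "((\<lambda>R. sqrt (2 * pi) * (2 / \<bar>h\<bar> * Lp_norm 2 (\<lambda>x. T R x - f x))) \<longlongrightarrow> 0) at_top" by simp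
      show "\<forall>\<^sub>F R in at_top. Lp_norm 2 (\<lambda>\<xi>. fourier (diffquot h (T R)) \<xi> - fourier_L2 (diffquot h f) \<xi>)
         \<le> sqrt (2 * pi) * (2 / \<bar>h\<bar> * Lp_norm 2 (\<lambda>x. T R x - f x))"
        unfolding fourier_L2_dist_fourier[OF diffquot_L2(1)[OF f] dT] diffquot_diff
        by (intro always_eventually allI mult_left_mono diffquot_L2(2) L2_diff T f) simp
    qed (intro always_eventually allI Lp_norm_nonneg)
    show "((\<lambda>R. Lp_norm 2 (\<lambda>\<xi>. fourier (diffquot h (T R)) \<xi> - cvec (dqsymbol h \<xi>) (fourier_L2 f \<xi>))) \<longlongrightarrow> 0) at_top"
    proof (rule tendsto_sandwich[OF _ _ tendsto_const])
      have "((\<lambda>R. 2 / h * Lp_norm 2 (\<lambda>\<xi>. fourier (T R) \<xi> - fourier_L2 f \<xi>)) \<longlongrightarrow> 2 / h * 0) at_top"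
        using fourier_L2(2)[OF f] by (intro tendsto_mult tendsto_const) (simp add: T_def)
      then show "((\<lambda>R. 2 / h * Lp_norm 2 (\<lambda>\<xi>. fourier (T R) \<xi> - fourier_L2 f \<xi>)) \<longlongrightarrow> 0) at_top" by simp
      show "\<forall>\<^sub>F R in at_top. Lp_norm 2 (\<lambda>\<xi>. fourier (diffquot h (T R)) \<xi> - cvec (dqsymbol h \<xi>) (fourier_L2 f \<xi>))
         \<le> 2 / h * Lp_norm 2 (\<lambda>\<xi>. fourier (T R) \<xi> - fourier_L2 f \<xi>)"
        unfolding fourier_diffquot[OF T(1)] cvec_diff
        using cv[OF L2_diff[OF FT fourier_L2(1)[OF f]]] by (intro always_eventually allI) blast
    qed (intro always_eventually allI Lp_norm_nonneg)
  qed simp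
qed

text \<open>
  The difference quotients of \<open>f\<close> have transforms \<open>dqsymbol h \<xi>\<close>
  times that of \<open>f\<close>.  As \<open>|dqsymbol h \<xi>| \<le> |\<xi>|\<close> and
  \<open>dqsymbol h \<xi>\<close> tends to \<open>i \<xi>\<close>, they form a Cauchy sequence
  in \<open>L^2\<close>, by dominated convergence and the isometry.  Moving the difference
  quotient to the test function identifies the limit as the weak derivative.
\<close>

theorem weak_deriv_exists:
  fixes f :: "real \<Rightarrow> real ^ 'n"
  assumes f: "in_Lp 2 f" and i: "integrable lborel (\<lambda>\<xi>. \<xi>\<^sup>2 * (norm (fourier_L2 f \<xi>))\<^sup>2)"
  shows "\<exists>g. in_Lp 2 g \<and> has_weak_deriv f g"
proof -
  define e where "e n = inverse (real (Suc n))" for n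
  have e: "e n > 0" "e n \<le> 1" for n by (auto simp: e_def field_simps)
  have e0: "e \<longlonglongrightarrow> 0" unfolding e_def by (rule LIMSEQ_inverse_real_of_nat)
  define G where "G \<xi> = cvec (\<i> * complex_of_real \<xi>) (fourier_L2 f \<xi>)" for \<xi>
  define M where "M n \<xi> = cvec (dqsymbol (e n) \<xi>) (fourier_L2 f \<xi>)" for n \<xi>
  have Fm: "fourier_L2 f \<in> borel_measurable lborel" using fourier_L2(1)[OF f] by (simp add: in_L2_iff)
  have Gm: "G \<in> borel_measurable lborel" unfolding G_def[abs_def] by (intro cvec_measurable Fm) measurable
  have Mm: "M n \<in> borel_measurable lborel" for n unfolding M_def[abs_def] by (intro cvec_measurable Fm) measurable
  have G2: "in_Lp 2 G"
    using i Gm by (simp add: in_L2_iff G_def norm_cvec norm_mult power_mult_distrib)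
  have [measurable]: "G \<in> borel_measurable borel" "M n \<in> borel_measurable borel" for n using Gm Mm by simp_all
  have "(\<lambda>n. \<integral>\<xi>. (norm (M n \<xi> - G \<xi>))\<^sup>2 \<partial>lborel) \<longlonglongrightarrow> (\<integral>\<xi>. 0 \<partial>(lborel :: real measure))"
  proof (rule integral_dominated_convergence[where w = "\<lambda>\<xi>. 4 * (\<xi>\<^sup>2 * (norm (fourier_L2 f \<xi>))\<^sup>2)"])
    have d: "norm (M n \<xi> - G \<xi>) = norm (dqsymbol (e n) \<xi> - \<i> * complex_of_real \<xi>) * norm (fourier_L2 f \<xi>)" for n \<xi>
      unfolding norm_cvec[symmetric] M_def G_def by (rule arg_cong[of _ _ norm]) (simp add: vec_eq_iff left_diff_distrib)
    show "AE \<xi> in lborel. (\<lambda>n. (norm (M n \<xi> - G \<xi>))\<^sup>2) \<longlonglongrightarrow> 0"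
    proof (rule AE_I2)
      fix \<xi>
      have "(\<lambda>n. norm (dqsymbol (e n) \<xi> - \<i> * complex_of_real \<xi>)) \<longlonglongrightarrow> 0"
      proof (rule tendsto_sandwich[OF _ _ tendsto_const])
        have "(\<lambda>n. e n * \<xi>\<^sup>2 / 2) \<longlonglongrightarrow> 0 * \<xi>\<^sup>2 / 2" by (intro tendsto_intros e0) simp
        then show "(\<lambda>n. e n * \<xi>\<^sup>2 / 2) \<longlonglongrightarrow> 0" by simp
        show "\<forall>\<^sub>F n in sequentially. norm (dqsymbol (e n) \<xi> - \<i> * complex_of_real \<xi>) \<le> e n * \<xi>\<^sup>2 / 2"
          by (intro always_eventually allI dqsymbol_bounds(2) e)
      qed (intro always_eventually allI norm_ge_zero)
      then have "(\<lambda>n. (norm (dqsymbol (e n) \<xi> - \<i> * complex_of_real \<xi>) * norm (fourier_L2 f \<xi>))\<^sup>2) \<longlonglongrightarrow> (0 * norm (fourier_L2 f \<xi>))\<^sup>2"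
        by (intro tendsto_power tendsto_mult tendsto_const)
      then show "(\<lambda>n. (norm (M n \<xi> - G \<xi>))\<^sup>2) \<longlonglongrightarrow> 0" unfolding d by simp
    qed
    show "AE \<xi> in lborel. norm ((norm (M n \<xi> - G \<xi>))\<^sup>2) \<le> 4 * (\<xi>\<^sup>2 * (norm (fourier_L2 f \<xi>))\<^sup>2)" for n
    proof (rule AE_I2)
      fix \<xi>
      have "norm (dqsymbol (e n) \<xi> - \<i> * complex_of_real \<xi>) \<le> norm (dqsymbol (e n) \<xi>) + norm (\<i> * complex_of_real \<xi>)"
        by (rule norm_triangle_ineq4)
      also have "\<dots> \<le> \<bar>\<xi>\<bar> + \<bar>\<xi>\<bar>" using dqsymbol_bounds(1)[OF e(1)[of n], of \<xi>] by (simp add: norm_mult)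
      finally have "norm (dqsymbol (e n) \<xi> - \<i> * complex_of_real \<xi>) * norm (fourier_L2 f \<xi>) \<le> (2 * \<bar>\<xi>\<bar>) * norm (fourier_L2 f \<xi>)"
        by (intro mult_right_mono) auto
      then have "(norm (M n \<xi> - G \<xi>))\<^sup>2 \<le> ((2 * \<bar>\<xi>\<bar>) * norm (fourier_L2 f \<xi>))\<^sup>2"
        unfolding d by (rule power_mono) simp
      then show "norm ((norm (M n \<xi> - G \<xi>))\<^sup>2) \<le> 4 * (\<xi>\<^sup>2 * (norm (fourier_L2 f \<xi>))\<^sup>2)"
        by (simp add: power_mult_distrib)
    qed
    show "integrable lborel (\<lambda>\<xi>. 4 * (\<xi>\<^sup>2 * (norm (fourier_L2 f \<xi>))\<^sup>2))" using i by simp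
  qed measurable
  from tendsto_real_sqrt[OF this] have Mlim: "(\<lambda>n. Lp_norm 2 (\<lambda>\<xi>. M n \<xi> - G \<xi>)) \<longlonglongrightarrow> 0" unfolding Lp_norm_2 by simp
  define Q where "Q n = diffquot (e n) f" for n
  have Q2: "in_Lp 2 (Q n)" for n unfolding Q_def by (rule diffquot_L2(1)[OF f])
  have FQ2: "in_Lp 2 (fourier_L2 (Q n))" for n by (rule fourier_L2(1)[OF Q2])
  have "Lp_norm 2 (\<lambda>\<xi>. fourier_L2 (Q n) \<xi> - G \<xi>) = Lp_norm 2 (\<lambda>\<xi>. M n \<xi> - G \<xi>)" for n
  proof (rule Lp_norm_cong_AE)
    show "(\<lambda>\<xi>. fourier_L2 (Q n) \<xi> - G \<xi>) \<in> borel_measurable lborel"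
      using FQ2 Gm by (intro borel_measurable_diff) (simp_all add: in_L2_iff)
    show "AE \<xi> in lborel. fourier_L2 (Q n) \<xi> - G \<xi> = M n \<xi> - G \<xi>"
      using fourier_L2_diffquot[OF f e(1)[of n]] unfolding Q_def M_def by (rule eventually_mono) simp
  qed measurable
  with Mlim have FL: "(\<lambda>n. Lp_norm 2 (\<lambda>\<xi>. fourier_L2 (Q n) \<xi> - G \<xi>)) \<longlonglongrightarrow> 0" by simp
  have "\<exists>N. \<forall>m\<ge>N. \<forall>n\<ge>N. Lp_norm 2 (\<lambda>x. Q m x - Q n x) < \<epsilon>" if "\<epsilon> > 0" for \<epsilon>
  proof -
    have "sqrt (2 * pi) * \<epsilon> > 0" using that by simp
    from L2_convergent_Cauchy[OF FQ2 G2 FL this] show ?thesis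
      unfolding fourier_L2_dist[OF Q2 Q2] by simp
  qed
  from L2_complete[OF Q2 this] obtain g where g: "in_Lp 2 g" "(\<lambda>n. Lp_norm 2 (\<lambda>x. Q n x - g x)) \<longlonglongrightarrow> 0" by blast
  have "has_weak_deriv f g" unfolding has_weak_deriv_def
  proof (intro allI impI)
    fix \<phi> assume tf: "test_fun \<phi>"
    obtain R B where R: "R \<ge> 0" and D: "\<And>x. (\<phi> has_real_derivative deriv \<phi> x) (at x)"
      and c: "continuous_on UNIV \<phi>" "continuous_on UNIV (deriv \<phi>)"
      and z: "\<And>x. \<bar>x\<bar> > R \<Longrightarrow> \<phi> x = 0" and "\<And>x. \<bar>x\<bar> > R \<Longrightarrow> deriv \<phi> x = 0"
      and B: "\<And>x. \<bar>\<phi> x\<bar> \<le> B" "\<And>x. \<bar>deriv \<phi> x\<bar> \<le> B"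
      by (rule test_fun_facts[OF tf]) blast
    have m [measurable]: "\<phi> \<in> borel_measurable borel" "deriv \<phi> \<in> borel_measurable borel"
      using c by (auto intro: borel_measurable_continuous_onI)
    have fm [measurable]: "f \<in> borel_measurable borel" using f by (simp add: in_L2_iff)
    note pair = pairing_L2[OF _ m(1) B(1) z R]
    have lim1: "(\<lambda>n. \<integral>x. \<phi> x *\<^sub>R Q n x \<partial>lborel) \<longlonglongrightarrow> (\<integral>x. \<phi> x *\<^sub>R g x \<partial>lborel)"
    proof (rule Lim_null[THEN iffD2], rule Lim_null_comparison)
      show "\<forall>\<^sub>F n in sequentially. norm ((\<integral>x. \<phi> x *\<^sub>R Q n x \<partial>lborel) - (\<integral>x. \<phi> x *\<^sub>R g x \<partial>lborel)) \<le> B * (R + 1) * Lp_norm 2 (\<lambda>x. Q n x - g x)"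
      proof (intro always_eventually allI)
        fix n
        have "(\<integral>x. \<phi> x *\<^sub>R Q n x \<partial>lborel) - (\<integral>x. \<phi> x *\<^sub>R g x \<partial>lborel) = (\<integral>x. \<phi> x *\<^sub>R (Q n x - g x) \<partial>lborel)"
          using pair(1)[OF Q2[of n]] pair(1)[OF g(1)] by (simp add: scaleR_diff_right)
        also have "norm \<dots> \<le> (\<integral>x. norm (\<phi> x *\<^sub>R (Q n x - g x)) \<partial>lborel)" by (rule integral_norm_bound)
        also have "\<dots> \<le> B * (R + 1) * Lp_norm 2 (\<lambda>x. Q n x - g x)" by (rule pair(2)[OF L2_diff[OF Q2 g(1)]])
        finally show "norm ((\<integral>x. \<phi> x *\<^sub>R Q n x \<partial>lborel) - (\<integral>x. \<phi> x *\<^sub>R g x \<partial>lborel)) \<le> B * (R + 1) * Lp_norm 2 (\<lambda>x. Q n x - g x)" .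
      qed
      show "(\<lambda>n. B * (R + 1) * Lp_norm 2 (\<lambda>x. Q n x - g x)) \<longlonglongrightarrow> 0"
        using tendsto_mult[OF tendsto_const g(2), of "B * (R + 1)"] by simp
    qed
    have shift: "(\<integral>x. \<phi> x *\<^sub>R Q n x \<partial>lborel) = (\<integral>x. ((\<phi> (x - e n) - \<phi> x) / e n) *\<^sub>R f x \<partial>lborel)" for n
    proof -
      have i1: "integrable lborel (\<lambda>x. \<phi> x *\<^sub>R f (x + e n))" by (rule pair(1)[OF translate_L2(1)[OF f]])
      have i2: "integrable lborel (\<lambda>x. \<phi> x *\<^sub>R f x)" by (rule pair(1)[OF f])
      have s: "integrable lborel (\<lambda>x. \<phi> (x - e n) *\<^sub>R f x)" "(\<integral>x. \<phi> x *\<^sub>R f (x + e n) \<partial>lborel) = (\<integral>x. \<phi> (x - e n) *\<^sub>R f x \<partial>lborel)"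
        using translate_integrable[OF i1, of "- e n"] by simp_all
      have "(\<integral>x. \<phi> x *\<^sub>R Q n x \<partial>lborel) = (\<integral>x. (1 / e n) *\<^sub>R (\<phi> x *\<^sub>R f (x + e n) - \<phi> x *\<^sub>R f x) \<partial>lborel)"
        unfolding Q_def diffquot_def by (intro Bochner_Integration.integral_cong refl) (simp add: scaleR_diff_right)
      also have "\<dots> = (1 / e n) *\<^sub>R ((\<integral>x. \<phi> x *\<^sub>R f (x + e n) \<partial>lborel) - (\<integral>x. \<phi> x *\<^sub>R f x \<partial>lborel))"
        unfolding integral_scaleR_right by (subst Bochner_Integration.integral_diff[OF i1 i2]) (rule refl)
      also have "\<dots> = (1 / e n) *\<^sub>R (\<integral>x. \<phi> (x - e n) *\<^sub>R f x - \<phi> x *\<^sub>R f x \<partial>lborel)"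
        unfolding s(2) by (subst Bochner_Integration.integral_diff[OF s(1) i2]) (rule refl)
      also have "\<dots> = (\<integral>x. (1 / e n) *\<^sub>R (\<phi> (x - e n) *\<^sub>R f x - \<phi> x *\<^sub>R f x) \<partial>lborel)"
        by (rule integral_scaleR_right[symmetric])
      also have "\<dots> = (\<integral>x. ((\<phi> (x - e n) - \<phi> x) / e n) *\<^sub>R f x \<partial>lborel)"
        by (intro Bochner_Integration.integral_cong refl)
           (simp add: scaleR_diff_left[symmetric] del: scaleR_diff_left)
      finally show ?thesis .
    qed
    have lim2: "(\<lambda>n. \<integral>x. ((\<phi> (x - e n) - \<phi> x) / e n) *\<^sub>R f x \<partial>lborel) \<longlonglongrightarrow> (\<integral>x. (- deriv \<phi> x) *\<^sub>R f x \<partial>lborel)"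
    proof (rule integral_dominated_convergence[where w = "\<lambda>x. norm ((B * indicator {-(R+1)..R+1} x) *\<^sub>R f x)"])
      have B0: "0 \<le> B" using B(1)[of 0] by linarith
      show "integrable lborel (\<lambda>x. norm ((B * indicator {-(R+1)..R+1} x) *\<^sub>R f x))"
        by (intro integrable_norm pairing_L2(1)[OF f, of _ B "R + 1"]) (use R B0 in \<open>auto simp: indicator_def\<close>)
      show "AE x in lborel. (\<lambda>n. ((\<phi> (x - e n) - \<phi> x) / e n) *\<^sub>R f x) \<longlonglongrightarrow> (- deriv \<phi> x) *\<^sub>R f x"
      proof (rule AE_I2)
        fix x
        have me: "filterlim (\<lambda>n. - e n) (at 0) sequentially"
        proof (rule filterlim_atI)
          show "(\<lambda>n. - e n) \<longlonglongrightarrow> 0" using tendsto_minus[OF e0] by simp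
          have "- e n \<noteq> 0" for n using e(1)[of n] by simp
          then show "\<forall>\<^sub>F n in sequentially. - e n \<noteq> 0" by (intro always_eventually allI)
        qed
        have "((\<lambda>h. (\<phi> (x + h) - \<phi> x) / h) \<longlongrightarrow> deriv \<phi> x) (at 0)" using D[of x] by (simp add: DERIV_def)
        from filterlim_compose[OF this me] have "(\<lambda>n. (\<phi> (x - e n) - \<phi> x) / - e n) \<longlonglongrightarrow> deriv \<phi> x" by simp
        from tendsto_minus[OF this] have "(\<lambda>n. (\<phi> (x - e n) - \<phi> x) / e n) \<longlonglongrightarrow> - deriv \<phi> x" by simp
        then show "(\<lambda>n. ((\<phi> (x - e n) - \<phi> x) / e n) *\<^sub>R f x) \<longlonglongrightarrow> (- deriv \<phi> x) *\<^sub>R f x"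
          by (intro tendsto_scaleR tendsto_const)
      qed
      show "AE x in lborel. norm (((\<phi> (x - e n) - \<phi> x) / e n) *\<^sub>R f x) \<le> norm ((B * indicator {-(R+1)..R+1} x) *\<^sub>R f x)" for n
      proof (rule AE_I2)
        fix x
        have "\<bar>(\<phi> (x - e n) - \<phi> x) / e n\<bar> \<le> B * indicator {-(R+1)..R+1} x"
        proof (cases "x \<in> {-(R+1)..R+1}")
          case True
          obtain y where "\<phi> x - \<phi> (x - e n) = (x - (x - e n)) * deriv \<phi> y"
            using MVT2[of "x - e n" x \<phi> "deriv \<phi>"] D e(1)[of n] by auto
          then have "(\<phi> (x - e n) - \<phi> x) / e n = - deriv \<phi> y" using e(1)[of n] by (simp add: field_simps)
          then show ?thesis using True B(2)[of y] by simp
        next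
          case False
          then have "\<phi> x = 0" "\<phi> (x - e n) = 0" using e[of n] by (auto intro!: z)
          then show ?thesis using False by simp
        qed
        also have "\<dots> \<le> \<bar>B * indicator {-(R+1)..R+1} x\<bar>" by (rule abs_ge_self)
        finally show "norm (((\<phi> (x - e n) - \<phi> x) / e n) *\<^sub>R f x) \<le> norm ((B * indicator {-(R+1)..R+1} x) *\<^sub>R f x)"
          unfolding norm_scaleR by (rule mult_right_mono) simp
      qed
    qed measurable
    have "(\<integral>x. \<phi> x *\<^sub>R g x \<partial>lborel) = (\<integral>x. (- deriv \<phi> x) *\<^sub>R f x \<partial>lborel)"
      using lim1 lim2 unfolding shift by (rule LIMSEQ_unique)
    then show "(\<integral>x. deriv \<phi> x *\<^sub>R f x \<partial>lborel) = - (\<integral>x. \<phi> x *\<^sub>R g x \<partial>lborel)" by simp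
  qed
  with g(1) show ?thesis by blast
qed

section \<open>Sobolev spaces on the Fourier side\<close>

text \<open>
  For a function in \<open>H^s\<close>, the integral over \<open>\<xi>\<close> is
  \<open>2 * pi\<close> times the squared norm of the \<open>s\<close>-th weak derivative.
\<close>

definition fourier_moment :: "nat \<Rightarrow> (real \<Rightarrow> real ^ 'n) \<Rightarrow> real \<Rightarrow> real" where
  "fourier_moment s f \<xi> = \<bar>\<xi>\<bar> ^ (2 * s) * (norm (fourier_L2 f \<xi>))\<^sup>2"

lemma fourier_moment_measurable:
  fixes f :: "real \<Rightarrow> real ^ 'n"
  assumes "in_Lp 2 f"
  shows "fourier_moment s f \<in> borel_measurable lborel"
proof -
  have [measurable]: "fourier_L2 f \<in> borel_measurable borel"
    using fourier_L2(1)[OF assms] by (simp add: in_L2_iff)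
  show ?thesis unfolding fourier_moment_def[abs_def] by measurable
qed

lemma fourier_moment_interpolate:
  fixes f :: "real \<Rightarrow> real ^ 'n"
  assumes f: "in_Lp 2 f" and i: "integrable lborel (fourier_moment s f)" and k: "k \<le> s"
  shows "integrable lborel (fourier_moment k f)"
proof (rule Bochner_Integration.integrable_bound)
  have i0: "integrable lborel (\<lambda>\<xi>. (norm (fourier_L2 f \<xi>))\<^sup>2)"
    using fourier_L2(1)[OF f] by (simp add: in_L2_iff)
  show "integrable lborel (\<lambda>\<xi>. (norm (fourier_L2 f \<xi>))\<^sup>2 + fourier_moment s f \<xi>)"
    by (rule Bochner_Integration.integrable_add[OF i0 i])
  show "fourier_moment k f \<in> borel_measurable lborel" by (rule fourier_moment_measurable[OF f])
  show "AE \<xi> in lborel. norm (fourier_moment k f \<xi>) \<le> norm ((norm (fourier_L2 f \<xi>))\<^sup>2 + fourier_moment s f \<xi>)"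
  proof (rule AE_I2)
    fix \<xi> :: real
    have "\<bar>\<xi>\<bar> ^ (2 * k) \<le> 1 + \<bar>\<xi>\<bar> ^ (2 * s)"
    proof (cases "\<bar>\<xi>\<bar> \<le> 1")
      case True
      then have "\<bar>\<xi>\<bar> ^ (2 * k) \<le> 1" by (intro power_le_one) auto
      moreover have "0 \<le> \<bar>\<xi>\<bar> ^ (2 * s)" by simp
      ultimately show ?thesis by linarith
    next
      case False
      then have "\<bar>\<xi>\<bar> ^ (2 * k) \<le> \<bar>\<xi>\<bar> ^ (2 * s)" using k by (intro power_increasing) auto
      then show ?thesis by linarith
    qed
    then have "fourier_moment k f \<xi> \<le> (1 + \<bar>\<xi>\<bar> ^ (2 * s)) * (norm (fourier_L2 f \<xi>))\<^sup>2"
      unfolding fourier_moment_def by (rule mult_right_mono) simp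
    moreover have "0 \<le> fourier_moment k f \<xi>" by (simp add: fourier_moment_def)
    moreover have "(1 + \<bar>\<xi>\<bar> ^ (2 * s)) * (norm (fourier_L2 f \<xi>))\<^sup>2 = (norm (fourier_L2 f \<xi>))\<^sup>2 + fourier_moment s f \<xi>"
      by (simp only: fourier_moment_def distrib_right mult_1)
    ultimately show "norm (fourier_moment k f \<xi>) \<le> norm ((norm (fourier_L2 f \<xi>))\<^sup>2 + fourier_moment s f \<xi>)"
      unfolding real_norm_def by linarith
  qed
qed

lemma fourier_moment_shift:
  fixes f g :: "real \<Rightarrow> real ^ 'n"
  assumes f: "in_Lp 2 f" and g: "in_Lp 2 g"
    and ae: "AE \<xi> in lborel. norm (fourier_L2 g \<xi>) = \<bar>\<xi>\<bar> ^ k * norm (fourier_L2 f \<xi>)"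
  shows "AE \<xi> in lborel. fourier_moment s g \<xi> = fourier_moment (s + k) f \<xi>"
    "integrable lborel (fourier_moment s g) \<longleftrightarrow> integrable lborel (fourier_moment (s + k) f)"
    "(\<integral>\<xi>. fourier_moment s g \<xi> \<partial>lborel) = (\<integral>\<xi>. fourier_moment (s + k) f \<xi> \<partial>lborel)"
proof -
  show ae': "AE \<xi> in lborel. fourier_moment s g \<xi> = fourier_moment (s + k) f \<xi>"
    using ae
  proof (rule eventually_mono)
    fix \<xi> assume e: "norm (fourier_L2 g \<xi>) = \<bar>\<xi>\<bar> ^ k * norm (fourier_L2 f \<xi>)"
    have "\<bar>\<xi>\<bar> ^ (2 * (s + k)) = \<bar>\<xi>\<bar> ^ (2 * s) * (\<bar>\<xi>\<bar> ^ k)\<^sup>2"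
      by (simp only: distrib_left power_add power_mult[symmetric] mult.commute[of 2 k])
    then show "fourier_moment s g \<xi> = fourier_moment (s + k) f \<xi>"
      unfolding fourier_moment_def e power_mult_distrib by (simp only: mult.assoc)
  qed
  show "integrable lborel (fourier_moment s g) \<longleftrightarrow> integrable lborel (fourier_moment (s + k) f)"
    by (rule integrable_cong_AE[OF fourier_moment_measurable[OF g] fourier_moment_measurable[OF f] ae'])
  show "(\<integral>\<xi>. fourier_moment s g \<xi> \<partial>lborel) = (\<integral>\<xi>. fourier_moment (s + k) f \<xi> \<partial>lborel)"
    by (rule integral_cong_AE[OF fourier_moment_measurable[OF g] fourier_moment_measurable[OF f] ae'])
qed

text \<open>
  By induction on \<open>s\<close>: passing from \<open>f\<close> to a weak derivative of
  \<open>f\<close> shifts the order of the moment by one.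
\<close>

theorem sobolev_iff_fourier:
  fixes f :: "real \<Rightarrow> real ^ 'n"
  shows "sobolev s f \<longleftrightarrow> in_Lp 2 f \<and> integrable lborel (fourier_moment s f)"
proof (induction s arbitrary: f)
  case 0
  show ?case using fourier_L2(1)[of f] by (auto simp: in_L2_iff fourier_moment_def[abs_def])
next
  case (Suc s)
  show ?case
  proof
    assume "sobolev (Suc s) f"
    then obtain g where f: "in_Lp 2 f" and w: "has_weak_deriv f g" and "sobolev s g" by auto
    then have g: "in_Lp 2 g" "integrable lborel (fourier_moment s g)" using Suc.IH by simp_all
    have "AE \<xi> in lborel. norm (fourier_L2 g \<xi>) = \<bar>\<xi>\<bar> ^ 1 * norm (fourier_L2 f \<xi>)"
      using weak_deriv_fourier[OF f g(1) w] by simp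
    from fourier_moment_shift(2)[OF f g(1) this, of s] g(2) f
    show "in_Lp 2 f \<and> integrable lborel (fourier_moment (Suc s) f)" by simp
  next
    assume "in_Lp 2 f \<and> integrable lborel (fourier_moment (Suc s) f)"
    then have f: "in_Lp 2 f" and i: "integrable lborel (fourier_moment (Suc s) f)" by simp_all
    have "integrable lborel (fourier_moment 1 f)" by (rule fourier_moment_interpolate[OF f i]) simp
    then have "integrable lborel (\<lambda>\<xi>. \<xi>\<^sup>2 * (norm (fourier_L2 f \<xi>))\<^sup>2)"
      by (simp add: fourier_moment_def[abs_def])
    from weak_deriv_exists[OF f this] obtain g where g: "in_Lp 2 g" "has_weak_deriv f g" by blast
    have "AE \<xi> in lborel. norm (fourier_L2 g \<xi>) = \<bar>\<xi>\<bar> ^ 1 * norm (fourier_L2 f \<xi>)"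
      using weak_deriv_fourier[OF f g] by simp
    from fourier_moment_shift(2)[OF f g(1) this, of s] i
    have "integrable lborel (fourier_moment s g)" by simp
    then have "sobolev s g" using g(1) Suc.IH by simp
    then show "sobolev (Suc s) f" using f g(2) by auto
  qed
qed

lemma iterated_weak_deriv:
  fixes f :: "real \<Rightarrow> real ^ 'n"
  assumes s: "sobolev s f" and k: "k \<le> s"
  shows "in_Lp 2 ((weak_deriv ^^ k) f) \<and>
    (AE \<xi> in lborel. norm (fourier_L2 ((weak_deriv ^^ k) f) \<xi>) = \<bar>\<xi>\<bar> ^ k * norm (fourier_L2 f \<xi>))"
  using k
proof (induction k)
  case 0
  then show ?case using s by (simp add: sobolev_iff_fourier)
next
  case (Suc k)
  define h where "h = (weak_deriv ^^ k) f"
  have f: "in_Lp 2 f" "integrable lborel (fourier_moment s f)" using s by (simp_all add: sobolev_iff_fourier)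
  have h: "in_Lp 2 h" and hae: "AE \<xi> in lborel. norm (fourier_L2 h \<xi>) = \<bar>\<xi>\<bar> ^ k * norm (fourier_L2 f \<xi>)"
    using Suc unfolding h_def by simp_all
  have "integrable lborel (fourier_moment (1 + k) f)"
    by (rule fourier_moment_interpolate[OF f]) (use Suc in simp)
  then have "integrable lborel (fourier_moment 1 h)" using fourier_moment_shift(2)[OF f(1) h hae] by simp
  then have "integrable lborel (\<lambda>\<xi>. \<xi>\<^sup>2 * (norm (fourier_L2 h \<xi>))\<^sup>2)"
    by (simp add: fourier_moment_def[abs_def])
  from weak_deriv_exists[OF h this] have "\<exists>g. in_Lp 2 g \<and> has_weak_deriv h g" .
  from someI_ex[OF this] have w: "in_Lp 2 (weak_deriv h)" "has_weak_deriv h (weak_deriv h)"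
    unfolding weak_deriv_def by simp_all
  have "AE \<xi> in lborel. norm (fourier_L2 (weak_deriv h) \<xi>) = \<bar>\<xi>\<bar> ^ Suc k * norm (fourier_L2 f \<xi>)"
    using weak_deriv_fourier[OF h w] hae
  proof eventually_elim
    case (elim \<xi>)
    then show ?case by simp
  qed
  then show ?case using w(1) by (simp add: h_def)
qed

lemma iterated_weak_deriv_norm:
  fixes f :: "real \<Rightarrow> real ^ 'n"
  assumes "sobolev s f" "k \<le> s"
  shows "2 * pi * (Lp_norm 2 ((weak_deriv ^^ k) f))\<^sup>2 = (\<integral>\<xi>. fourier_moment k f \<xi> \<partial>lborel)"
proof -
  note w = iterated_weak_deriv[OF assms]
  have f: "in_Lp 2 f" using assms(1) by (simp add: sobolev_iff_fourier)
  have "2 * pi * (Lp_norm 2 ((weak_deriv ^^ k) f))\<^sup>2 = (Lp_norm 2 (fourier_L2 ((weak_deriv ^^ k) f)))\<^sup>2"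
    by (simp add: fourier_L2_norm[OF conjunct1[OF w]] power_mult_distrib)
  also have "\<dots> = (\<integral>\<xi>. fourier_moment 0 ((weak_deriv ^^ k) f) \<xi> \<partial>lborel)"
    by (simp add: Lp_norm_2_sq fourier_moment_def)
  also have "\<dots> = (\<integral>\<xi>. fourier_moment (0 + k) f \<xi> \<partial>lborel)"
    by (rule fourier_moment_shift(3)[OF f conjunct1[OF w] conjunct2[OF w]])
  finally show ?thesis by simp
qed

section \<open>Model II as a chain\<close>

lemma pos_bij: "bij_betw (pos :: 'n::{finite,linorder} \<Rightarrow> nat) UNIV {1..CARD('n)}"
proof -
  have sm: "pos i < pos j" if "i < j" for i j :: 'n
    unfolding pos_def
  proof (rule psubset_card_mono)
    have "j \<in> {x. x \<le> j} - {x. x \<le> i}" using that by auto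
    moreover have "{x. x \<le> i} \<subseteq> {x. x \<le> j}" using that by auto
    ultimately show "{x. x \<le> i} \<subset> {x. x \<le> j}" by blast
  qed simp
  have inj: "inj (pos :: 'n \<Rightarrow> nat)"
  proof (rule injI, rule ccontr)
    fix i j :: 'n assume "pos i = pos j" "i \<noteq> j"
    then show False using sm[of i j] sm[of j i] by (cases i j rule: linorder_cases) auto
  qed
  have "pos i \<in> {1..CARD('n)}" for i :: 'n
  proof -
    have "card {j. j \<le> i} \<le> CARD('n)" by (intro card_mono) auto
    moreover have "0 < card {j. j \<le> i}" by (subst card_gt_0_iff) auto
    ultimately show ?thesis by (simp add: pos_def)
  qed
  then have sub: "range (pos :: 'n \<Rightarrow> nat) \<subseteq> {1..CARD('n)}" by auto
  moreover have "card (range (pos :: 'n \<Rightarrow> nat)) = card {1..CARD('n)}" using inj by (simp add: card_image)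
  ultimately have "range (pos :: 'n \<Rightarrow> nat) = {1..CARD('n)}" by (intro card_subset_eq) auto
  with inj show ?thesis by (simp add: bij_betw_def)
qed

definition node :: "nat \<Rightarrow> 'n::{finite,linorder}" where
  "node = inv_into UNIV pos"

lemma pos_node: "j \<in> {1..CARD('n)} \<Longrightarrow> pos (node j :: 'n::{finite,linorder}) = j"
  unfolding node_def using bij_betw_inv_into_right[OF pos_bij] by blast

lemma node_pos: "node (pos i) = (i :: 'n::{finite,linorder})"
  unfolding node_def using bij_betw_inv_into_left[OF pos_bij, of i] by simp

lemma sum_node:
  fixes g :: "'n::{finite,linorder} \<Rightarrow> 'b::comm_monoid_add"
  shows "(\<Sum>i\<in>UNIV. g i) = (\<Sum>j=1..CARD('n). g (node j))"
  using sum.reindex_bij_betw[OF pos_bij[where 'n = 'n], of "\<lambda>j. g (node j)"] by (simp add: node_pos)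

lemma entryA_odd:
  assumes "even m" "p \<in> {1..m}" "odd p"
  shows "entryA m a p q = (if q = p + 1 then (if p = 1 then 1 else a (p + 1)) else 0)"
proof -
  obtain k where p: "p = 2 * k + 1" using assms(3) by (elim oddE)
  have pm: "p + 1 \<le> m" using assms by (metis Suc_eq_plus1 Suc_leI atLeastAtMost_iff le_neq_implies_less)
  show ?thesis
  proof (cases "q = p + 1")
    case True
    show ?thesis
    proof (cases "p = 1")
      case False
      then have "\<exists>j. 2 \<le> j \<and> 2 * j \<le> m \<and> {p, q} = {2 * j - 1, 2 * j}"
        using p pm True by (intro exI[of _ "k + 1"]) auto
      moreover have "{p, q} \<noteq> {1, 2}" using False True by (auto simp: doubleton_eq_iff)
      ultimately show ?thesis using True False by (simp add: entryA_def)
    qed (use True in \<open>simp add: entryA_def numeral_2_eq_2\<close>)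
  next
    case False
    have "{p, q} \<noteq> {1, 2}" using False p by (auto simp: doubleton_eq_iff)
    moreover have "{p, q} \<noteq> {2 * j - 1, 2 * j}" if "2 \<le> j" for j
      using False p that by (auto simp: doubleton_eq_iff) presburger+
    ultimately show ?thesis using False by (auto simp: entryA_def)
  qed
qed

lemma entryA_even:
  assumes "p \<in> {1..m}" "even p"
  shows "entryA m a p q = (if q = p - 1 then (if p = 2 then 1 else a p) else 0)"
proof -
  obtain k where p: "p = 2 * k" using assms(2) by (elim evenE)
  have p0: "p \<ge> 2" using assms p by auto
  show ?thesis
  proof (cases "q = p - 1")
    case True
    show ?thesis
    proof (cases "p = 2")
      case False
      then have "\<exists>j. 2 \<le> j \<and> 2 * j \<le> m \<and> {p, q} = {2 * j - 1, 2 * j}"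
        using p p0 assms True by (intro exI[of _ k]) auto
      moreover have "{p, q} \<noteq> {1, 2}" using False p0 True by (auto simp: doubleton_eq_iff)
      ultimately show ?thesis using True False by (simp add: entryA_def)
    qed (use True in \<open>simp add: entryA_def insert_commute\<close>)
  next
    case False
    have "{p, q} \<noteq> {1, 2}" using False p by (auto simp: doubleton_eq_iff)
    moreover have "{p, q} \<noteq> {2 * j - 1, 2 * j}" if "2 \<le> j" for j
      using False p that by (auto simp: doubleton_eq_iff) presburger+
    ultimately show ?thesis using False by (auto simp: entryA_def)
  qed
qed

lemma entryL_odd:
  assumes "odd p" "even m" "m \<ge> 4"
  shows "entryL m \<gamma> a p q = (if 3 \<le> p \<and> p < m \<and> even m \<and> q = p - 1 then (if p = 3 then - 1 else - a p) else 0)"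
proof -
  obtain k where p: "p = 2 * k + 1" using assms by (elim oddE)
  have e: "(\<exists>j. 2 \<le> j \<and> 2 * j + 2 \<le> m \<and> p = 2 * j + 1 \<and> q = 2 * j) \<longleftrightarrow> 5 \<le> p \<and> p < m \<and> q = p - 1"
  proof
    assume "5 \<le> p \<and> p < m \<and> q = p - 1"
    then show "\<exists>j. 2 \<le> j \<and> 2 * j + 2 \<le> m \<and> p = 2 * j + 1 \<and> q = 2 * j"
      using p assms by (intro exI[of _ k]) auto
  qed (use assms in auto)
  have o: "\<not> (\<exists>j. 2 \<le> j \<and> 2 * j + 2 \<le> m \<and> p = 2 * j \<and> q = 2 * j + 1)" using assms by auto
  have p2: "p \<noteq> 2" using assms by auto
  show ?thesis unfolding entryL_def e using o p2 p assms by auto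
qed

lemma entryL_even:
  assumes "even p" "p \<in> {1..m}" "even m" "m \<ge> 4"
  shows "entryL m \<gamma> a p q = (if q = p + 1 \<and> p < m then (if p = 2 then 1 else a (p + 1)) else 0) + (if p = 2 \<and> q = 2 then \<gamma> else 0)"
proof -
  obtain k where p: "p = 2 * k" using assms(1) by (elim evenE)
  have e: "(\<exists>j. 2 \<le> j \<and> 2 * j + 2 \<le> m \<and> p = 2 * j \<and> q = 2 * j + 1) \<longleftrightarrow> 4 \<le> p \<and> p < m \<and> q = p + 1"
  proof
    assume "4 \<le> p \<and> p < m \<and> q = p + 1"
    then show "\<exists>j. 2 \<le> j \<and> 2 * j + 2 \<le> m \<and> p = 2 * j \<and> q = 2 * j + 1"
      using p assms by (intro exI[of _ k]) auto
  qed (use assms in auto)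
  have o: "\<not> (\<exists>j. 2 \<le> j \<and> 2 * j + 2 \<le> m \<and> p = 2 * j + 1 \<and> q = 2 * j)" using assms by auto
  have p3: "p \<noteq> 3" "p \<noteq> 0" using assms by auto
  show ?thesis unfolding entryL_def e using o p3 p assms by auto
qed

text \<open>
  The label of the coupling between the nodes \<open>j\<close> and \<open>j + 1\<close>; the
  first two couplings of the model are normalised to 1.
\<close>

definition edge :: "(nat \<Rightarrow> real) \<Rightarrow> nat \<Rightarrow> real" where
  "edge a j = (if j = 1 \<or> j = 2 then 1 else a (j + 1))"

text \<open>
  Since \<open>A\<close> couples the pairs \<open>2 k - 1, 2 k\<close> with a factor
  \<open>i\<close> and \<open>L\<close> couples the pairs \<open>2 k, 2 k + 1\<close> by real
  skew entries, a phase that advances by \<open>i\<close> from each odd node to the next makes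
  all couplings real and skew.
\<close>

definition phase :: "nat \<Rightarrow> complex" where "phase j = \<i> ^ (j div 2)"

definition to_chain :: "complex ^ 'n::{finite,linorder} \<Rightarrow> nat \<Rightarrow> complex" where
  "to_chain z j = phase j * z $ node j"

definition mat_app :: "real ^ 'n ^ 'n \<Rightarrow> complex ^ 'n \<Rightarrow> complex ^ 'n" where
  "mat_app A z = (\<chi> i. \<Sum>k\<in>UNIV. complex_of_real (A $ i $ k) * z $ k)"

lemma norm_phase [simp]: "norm (phase j) = 1" by (simp add: phase_def norm_power)

lemma norm_to_chain: "(\<Sum>j=1..CARD('n). (norm (to_chain z j))\<^sup>2) = (norm z)\<^sup>2" for z :: "complex ^ 'n::{finite,linorder}"
  by (simp add: norm_vec_sq sum_node to_chain_def norm_mult)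

lemma chain_of_model:
  fixes z :: "complex ^ 'n::{finite,linorder}"
  assumes m: "m = CARD('n)" and ev: "even m" and m4: "m \<ge> 4" and j: "j \<in> {1..m}"
  shows "to_chain (- cvec (\<i> * complex_of_real \<xi>) (mat_app (matA a) z) - mat_app (matL \<gamma> a) z) j
    = chain (chain_coeff m (edge a) \<xi>) \<gamma> (to_chain z) j"
proof -
  define Z where "Z q = z $ (node q :: 'n)" for q
  define RA where "RA = (\<Sum>q=1..m. complex_of_real (entryA m a j q) * Z q)"
  define RL where "RL = (\<Sum>q=1..m. complex_of_real (entryL m \<gamma> a j q) * Z q)"
  have A: "mat_app (matA a) z $ (node j :: 'n) = RA"
    unfolding mat_app_def RA_def Z_def vec_lambda_beta sum_node matA_def m
    by (intro sum.cong refl) (use j m in \<open>simp add: pos_node\<close>)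
  have L: "mat_app (matL \<gamma> a) z $ (node j :: 'n) = RL"
    unfolding mat_app_def RL_def Z_def vec_lambda_beta sum_node matL_def m
    by (intro sum.cong refl) (use j m in \<open>simp add: pos_node\<close>)
  have lhs: "to_chain (- cvec (\<i> * complex_of_real \<xi>) (mat_app (matA a) z) - mat_app (matL \<gamma> a) z) j
     = phase j * (- (\<i> * complex_of_real \<xi> * RA) - RL)"
    by (simp add: to_chain_def A L)
  let ?b = "chain_coeff m (edge a) \<xi>"
  have rhs: "chain ?b \<gamma> (to_chain z) j = complex_of_real (?b (j - 1)) * (phase (j - 1) * Z (j - 1))
     - complex_of_real (?b j) * (phase (j + 1) * Z (j + 1)) - (if j = 2 then complex_of_real \<gamma> * (phase 2 * Z 2) else 0)"
    by (simp add: chain_def to_chain_def Z_def scaleR_conv_of_real)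
  have pick: "(\<Sum>q=1..m. complex_of_real (if q = c then v else 0) * Z q) = (if c \<in> {1..m} then complex_of_real v * Z c else 0)" for c v
  proof -
    have "(\<Sum>q=1..m. complex_of_real (if q = c then v else 0) * Z q) = (\<Sum>q=1..m. if q = c then complex_of_real v * Z q else 0)"
      by (intro sum.cong refl) simp
    then show ?thesis by (simp add: sum.delta)
  qed
  show ?thesis
  proof (cases "odd j")
    case True
    then obtain k where k: "j = 2 * k + 1" by (elim oddE)
    have jm: "j < m" using True ev j by (cases "j = m") auto
    have RA: "RA = complex_of_real (edge a j) * Z (j + 1)"
      unfolding RA_def entryA_odd[OF ev j True] pick using jm \<open>odd j\<close> by (cases "j = 2") (simp_all add: edge_def)
    have RL: "RL = (if 3 \<le> j then - complex_of_real (edge a (j - 1)) * Z (j - 1) else 0)"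
    proof (cases "3 \<le> j")
      case True
      have "entryL m \<gamma> a j q = (if q = j - 1 then - edge a (j - 1) else 0)" for q
        using entryL_odd[OF \<open>odd j\<close> ev m4, of \<gamma> a q] True jm ev k by (simp add: edge_def)
      then have "RL = (if j - 1 \<in> {1..m} then complex_of_real (- edge a (j - 1)) * Z (j - 1) else 0)"
        unfolding RL_def by (simp only: pick)
      moreover have "j - 1 \<in> {1..m}" using True jm by auto
      ultimately show ?thesis using True by simp
    next
      case False
      have "entryL m \<gamma> a j q = 0" for q
        using entryL_odd[OF \<open>odd j\<close> ev m4, of \<gamma> a q] False by simp
      then show ?thesis unfolding RL_def using False by simp
    qed
    have ph: "phase (j + 1) = \<i> * phase j" "phase (j - 1) = phase j" by (simp_all add: phase_def k)
    have bj: "?b j = \<xi> * edge a j" using True jm j by (simp add: chain_coeff_def)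
    have bj': "?b (j - 1) = (if 3 \<le> j then edge a (j - 1) else 0)" using k jm by (auto simp: chain_coeff_def)
    show ?thesis unfolding lhs rhs RA RL ph bj bj' using k by (auto simp: algebra_simps)
  next
    case False
    then obtain k where k: "j = 2 * k" by (auto elim: evenE)
    have k0: "k \<ge> 1" using k j by simp
    have RA: "RA = complex_of_real (edge a (j - 1)) * Z (j - 1)"
    proof -
      have "entryA m a j q = (if q = j - 1 then edge a (j - 1) else 0)" for q
        using entryA_even[of j m a q] j False k k0 by (auto simp: edge_def)
      then have "RA = (if j - 1 \<in> {1..m} then complex_of_real (edge a (j - 1)) * Z (j - 1) else 0)"
        unfolding RA_def by (simp only: pick)
      moreover have "j - 1 \<in> {1..m}" using j k k0 by auto
      ultimately show ?thesis by simp
    qed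
    have RL: "RL = (if j < m then complex_of_real (edge a j) * Z (j + 1) else 0) + (if j = 2 then complex_of_real \<gamma> * Z 2 else 0)"
    proof -
      have "entryL m \<gamma> a j q = (if q = j + 1 then (if j < m then edge a j else 0) else 0) + (if q = 2 then (if j = 2 then \<gamma> else 0) else 0)" for q
        using entryL_even[of j m \<gamma> a q] j False ev m4 k by (auto simp: edge_def)
      then have "RL = (\<Sum>q=1..m. complex_of_real (if q = j + 1 then (if j < m then edge a j else 0) else 0) * Z q)
         + (\<Sum>q=1..m. complex_of_real (if q = 2 then (if j = 2 then \<gamma> else 0) else 0) * Z q)"
        unfolding RL_def by (simp only: of_real_add distrib_right sum.distrib)
      then show ?thesis unfolding pick using j m4 by auto
    qed
    have ph: "phase j = \<i> * phase (j - 1)" "phase (j + 1) = phase j"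
    proof -
      have "(2 * k - 1) div 2 = k - 1" "k = Suc (k - 1)" using k0 by auto
      then show "phase j = \<i> * phase (j - 1)" unfolding phase_def k by (metis nonzero_mult_div_cancel_left power_Suc zero_neq_numeral)
      show "phase (j + 1) = phase j" by (simp add: phase_def k)
    qed
    have bj: "?b j = (if j < m then edge a j else 0)" using False j by (auto simp: chain_coeff_def)
    have bj': "?b (j - 1) = \<xi> * edge a (j - 1)" using k k0 j by (auto simp: chain_coeff_def)
    show ?thesis unfolding lhs rhs RA RL bj bj' using ph by (auto simp: algebra_simps numeral_3_eq_3 numeral_2_eq_2)
  qed
qed

section \<open>The frequency-side energy estimate\<close>

lemma bform_cong:
  assumes "bform m C B" "\<And>j. j \<in> {1..m} \<Longrightarrow> w j = w' j" "\<And>j. j \<in> {1..m} \<Longrightarrow> v j = v' j"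
  shows "B w v = B w' v'"
  using assms(1) unfolding bform_def by (elim exE conjE) (simp add: assms(2,3))

text \<open>
  A bound for the operator norm of a matrix, also for its action on complex vectors.
\<close>

definition entry_sum :: "real ^ 'n ^ 'n \<Rightarrow> real" where
  "entry_sum A = (\<Sum>i\<in>UNIV. \<Sum>k\<in>UNIV. \<bar>A $ i $ k\<bar>)"

lemma norm_mat_app_le: "norm (mat_app A z) \<le> entry_sum A * norm z"
proof -
  have "norm (mat_app A z) \<le> (\<Sum>i\<in>UNIV. norm (mat_app A z $ i))"
    unfolding norm_vec_def by (rule L2_set_le_sum) simp
  also have "\<dots> \<le> (\<Sum>i\<in>UNIV. \<Sum>k\<in>UNIV. \<bar>A $ i $ k\<bar> * norm z)"
  proof (rule sum_mono)
    fix i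
    have "norm (mat_app A z $ i) \<le> (\<Sum>k\<in>UNIV. norm (complex_of_real (A $ i $ k) * z $ k))"
      unfolding mat_app_def vec_lambda_beta by (rule norm_sum)
    also have "\<dots> \<le> (\<Sum>k\<in>UNIV. \<bar>A $ i $ k\<bar> * norm z)"
      by (intro sum_mono) (simp add: norm_mult mult_left_mono Finite_Cartesian_Product.norm_nth_le)
    finally show "norm (mat_app A z $ i) \<le> (\<Sum>k\<in>UNIV. \<bar>A $ i $ k\<bar> * norm z)" .
  qed
  also have "\<dots> = entry_sum A * norm z" by (simp add: entry_sum_def sum_distrib_right)
  finally show ?thesis .
qed

lemma to_chain_add: "to_chain (z + w) j = to_chain z j + to_chain w j"
  by (simp add: to_chain_def algebra_simps)

lemma to_chain_derivative:
  fixes y :: "real \<Rightarrow> complex ^ 'n::{finite,linorder}"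
  assumes "(y has_vector_derivative y') F"
  shows "((\<lambda>t. to_chain (y t) j) has_vector_derivative to_chain y' j) F"
proof -
  have "bounded_linear (\<lambda>z :: (complex, 'n) vec. phase j * z $ node j)"
    by (intro bounded_linear_mult_right[THEN bounded_linear_compose] bounded_linear_vec_nth)
  from bounded_linear.has_vector_derivative[OF this assms] show ?thesis by (simp add: to_chain_def)
qed

lemma rate_nonneg:
  assumes "even m"
  shows "0 \<le> rate m \<xi>"
proof -
  have "even (3 * m - 10)" using assms by simp
  then show ?thesis unfolding rate_def by (intro divide_nonneg_nonneg zero_le_even_power zero_le_power add_nonneg_nonneg) auto
qed

text \<open>
  Gronwall's inequality for the Lyapunov form.  The forcing term \<open>e\<close> is paired with
  \<open>y\<close> by Young's inequality with the weight \<open>\<delta>\<close>: for the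
  truncated solutions \<open>e\<close> is of size \<open>\<delta>\<close>, so that the whole
  error is of size \<open>\<delta>\<close>.
\<close>

theorem forced_energy_estimate:
  fixes m :: nat and \<gamma> :: real and a :: "nat \<Rightarrow> real"
  assumes m: "m = CARD('n::{finite,linorder})" and ev: "even m" and m4: "m \<ge> 4" and \<gamma>: "\<gamma> > 0"
    and a: "\<And>i. 4 \<le> i \<Longrightarrow> i \<le> m \<Longrightarrow> a i \<noteq> 0"
  shows "\<exists>C>0. \<exists>c>0. \<forall>\<xi> \<delta> t (y :: real \<Rightarrow> (complex, 'n) vec) e. \<delta> > 0 \<longrightarrow> t \<ge> 0 \<longrightarrow>
     (\<forall>s\<ge>0. (y has_vector_derivative (- cvec (\<i> * complex_of_real \<xi>) (mat_app (matA a) (y s)) - mat_app (matL \<gamma> a) (y s)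
        + mat_app (matA a) (e s))) (at s within {0..})) \<longrightarrow>
     continuous_on {0..} e \<longrightarrow>
     (norm (y t))\<^sup>2 \<le> 4 * exp (- c * rate m \<xi> * t) * (norm (y 0))\<^sup>2
        + C * integral {0..t} (\<lambda>s. \<delta> * (norm (y s))\<^sup>2 + (norm (e s))\<^sup>2 / \<delta>)"
proof -
  have nz: "edge a j \<noteq> 0" if "1 \<le> j" "j < m" for j using a that by (simp add: edge_def)
  have "\<exists>C>0. \<exists>c>0. \<forall>\<xi>. \<exists>B :: (nat \<Rightarrow> complex) \<Rightarrow> (nat \<Rightarrow> complex) \<Rightarrow> real. bform m C B \<and>
     (\<forall>w. (\<Sum>j=1..m. (norm (w j))\<^sup>2) / 2 \<le> B w w \<and> B w w \<le> 2 * (\<Sum>j=1..m. (norm (w j))\<^sup>2) \<and>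
       B (chain (chain_coeff m (edge a) \<xi>) \<gamma> w) w + B w (chain (chain_coeff m (edge a) \<xi>) \<gamma> w)
         \<le> - c * rate m \<xi> * (\<Sum>j=1..m. (norm (w j))\<^sup>2))"
    by (rule chain_lyapunov[OF ev m4 \<gamma>]) (simp_all add: nz, simp_all add: edge_def)
  then obtain C c where C: "C > 0" and c: "c > 0" and lyap: "\<forall>\<xi>. \<exists>B :: (nat \<Rightarrow> complex) \<Rightarrow> (nat \<Rightarrow> complex) \<Rightarrow> real. bform m C B \<and>
     (\<forall>w. (\<Sum>j=1..m. (norm (w j))\<^sup>2) / 2 \<le> B w w \<and> B w w \<le> 2 * (\<Sum>j=1..m. (norm (w j))\<^sup>2) \<and>
       B (chain (chain_coeff m (edge a) \<xi>) \<gamma> w) w + B w (chain (chain_coeff m (edge a) \<xi>) \<gamma> w)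
         \<le> - c * rate m \<xi> * (\<Sum>j=1..m. (norm (w j))\<^sup>2))"
    by blast
  define A :: "((real, 'n) vec, 'n) vec" where "A = matA a"
  define L :: "((real, 'n) vec, 'n) vec" where "L = matL \<gamma> a"
  define k where "k = 1 + (entry_sum A)\<^sup>2"
  have k: "k \<ge> 1" by (simp add: k_def)
  define C' where "C' = 4 * (C * real m) * k"
  have C': "C' > 0" using C k m4 by (simp add: C'_def)
  have "\<forall>\<xi> \<delta> t (y :: real \<Rightarrow> (complex, 'n) vec) e. \<delta> > 0 \<longrightarrow> t \<ge> 0 \<longrightarrow>
     (\<forall>s\<ge>0. (y has_vector_derivative (- cvec (\<i> * complex_of_real \<xi>) (mat_app (matA a) (y s)) - mat_app (matL \<gamma> a) (y s)
        + mat_app (matA a) (e s))) (at s within {0..})) \<longrightarrow>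
     continuous_on {0..} e \<longrightarrow>
     (norm (y t))\<^sup>2 \<le> 4 * exp (- (c / 2) * rate m \<xi> * t) * (norm (y 0))\<^sup>2
        + C' * integral {0..t} (\<lambda>s. \<delta> * (norm (y s))\<^sup>2 + (norm (e s))\<^sup>2 / \<delta>)"
  proof (intro allI impI)
    fix \<xi> \<delta> t :: real and y e :: "real \<Rightarrow> (complex, 'n) vec"
    assume \<delta>: "\<delta> > 0" and t: "t \<ge> 0" and ce: "continuous_on {0..} e"
      and "\<forall>s\<ge>0. (y has_vector_derivative (- cvec (\<i> * complex_of_real \<xi>) (mat_app (matA a) (y s)) - mat_app (matL \<gamma> a) (y s)
        + mat_app (matA a) (e s))) (at s within {0..})"
    then have y: "\<And>s. s \<ge> 0 \<Longrightarrow> (y has_vector_derivative (- cvec (\<i> * complex_of_real \<xi>) (mat_app A (y s)) - mat_app L (y s)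
        + mat_app A (e s))) (at s within {0..})" by (simp add: A_def L_def)
    obtain B :: "(nat \<Rightarrow> complex) \<Rightarrow> (nat \<Rightarrow> complex) \<Rightarrow> real" where B: "bform m C B"
      and B1: "\<And>w. (\<Sum>j=1..m. (norm (w j))\<^sup>2) / 2 \<le> B w w" and B2: "\<And>w. B w w \<le> 2 * (\<Sum>j=1..m. (norm (w j))\<^sup>2)"
      and B3: "\<And>w. B (chain (chain_coeff m (edge a) \<xi>) \<gamma> w) w + B w (chain (chain_coeff m (edge a) \<xi>) \<gamma> w)
         \<le> - c * rate m \<xi> * (\<Sum>j=1..m. (norm (w j))\<^sup>2)"
      using lyap[rule_format, of \<xi>] by (elim exE conjE) simp
    \<comment> \<open>half of the rate, because the form is at most twice the energy\<close>
    define \<mu> where "\<mu> = c / 2 * rate m \<xi>"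
    have \<mu>: "0 \<le> \<mu>" using c rate_nonneg[OF ev, of \<xi>] by (simp add: \<mu>_def)
    define w where "w s = to_chain (y s)" for s
    define g where "g s = to_chain (- cvec (\<i> * complex_of_real \<xi>) (mat_app A (y s)) - mat_app L (y s) + mat_app A (e s))" for s
    define h where "h s = to_chain (mat_app A (e s))" for s
    define ch where "ch s = chain (chain_coeff m (edge a) \<xi>) \<gamma> (w s)" for s
    have N: "(\<Sum>j=1..m. (norm (w s j))\<^sup>2) = (norm (y s))\<^sup>2" for s unfolding w_def m by (rule norm_to_chain)
    have Nh: "(\<Sum>j=1..m. (norm (h s j))\<^sup>2) \<le> k * (norm (e s))\<^sup>2" for s
    proof -
      have "(\<Sum>j=1..m. (norm (h s j))\<^sup>2) = (norm (mat_app A (e s)))\<^sup>2" unfolding h_def m by (rule norm_to_chain)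
      also have "\<dots> \<le> (entry_sum A * norm (e s))\<^sup>2" by (intro power_mono norm_mat_app_le) simp
      also have "\<dots> \<le> k * (norm (e s))\<^sup>2" unfolding power_mult_distrib k_def by (intro mult_right_mono) auto
      finally show ?thesis .
    qed
    have gs: "g s j = ch s j + h s j" if "j \<in> {1..m}" for s j
      using chain_of_model[OF m ev m4 that, of \<xi> a "y s" \<gamma>]
      unfolding g_def h_def ch_def w_def to_chain_add A_def L_def by simp
    define H where "H s = \<delta> * (norm (y s))\<^sup>2 + (norm (e s))\<^sup>2 / \<delta>" for s
    have H0: "0 \<le> H s" for s using \<delta> by (simp add: H_def)
    have dE: "((\<lambda>s. B (w s) (w s)) has_real_derivative (B (g s) (w s) + B (w s) (g s))) (at s within {0..})" if "s \<ge> 0" for s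
      unfolding w_def g_def by (rule bform_has_derivative[OF B to_chain_derivative[OF y[OF that]]])
    have est: "B (g s) (w s) + B (w s) (g s) \<le> - \<mu> * B (w s) (w s) + 2 * (C * real m) * k * H s" for s
    proof -
      have "B (g s) (w s) + B (w s) (g s) = B (\<lambda>j. ch s j + h s j) (w s) + B (w s) (\<lambda>j. ch s j + h s j)"
        by (intro arg_cong2[where f = "(+)"] bform_cong[OF B] gs refl)
      also have "\<dots> = (B (ch s) (w s) + B (w s) (ch s)) + B (h s) (w s) + B (w s) (h s)"
        unfolding bform_add_left[OF B] bform_add_right[OF B] by simp
      also have "B (ch s) (w s) + B (w s) (ch s) \<le> - c * rate m \<xi> * (norm (y s))\<^sup>2"
        unfolding ch_def using B3[of "w s"] unfolding N .
      also have "- c * rate m \<xi> * (norm (y s))\<^sup>2 \<le> - \<mu> * B (w s) (w s)"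
        using mult_left_mono[OF B2[of "w s", unfolded N] \<mu>] by (simp add: \<mu>_def)
      also have "B (h s) (w s) \<le> C * real m * (k * H s)"
      proof -
        have i\<delta>: "1 / \<delta> > 0" using \<delta> by simp
        have "B (h s) (w s) \<le> C * real m * (1 / \<delta> * (\<Sum>j=1..m. (norm (h s j))\<^sup>2) + (norm (y s))\<^sup>2 / (1 / \<delta>))"
          using bform_bound[OF B i\<delta>, of "h s" "w s"] unfolding N by simp
        also have "\<dots> \<le> C * real m * (k * H s)"
        proof (intro mult_left_mono)
          have "1 / \<delta> * (\<Sum>j=1..m. (norm (h s j))\<^sup>2) \<le> 1 / \<delta> * (k * (norm (e s))\<^sup>2)"
            using \<delta> by (intro mult_left_mono Nh) simp
          moreover have "\<delta> * (norm (y s))\<^sup>2 \<le> k * (\<delta> * (norm (y s))\<^sup>2)"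
            using mult_right_mono[OF k, of "\<delta> * (norm (y s))\<^sup>2"] \<delta> by simp
          moreover have "k * H s = k * (\<delta> * (norm (y s))\<^sup>2) + 1 / \<delta> * (k * (norm (e s))\<^sup>2)"
            by (simp add: H_def distrib_left)
          moreover have "(norm (y s))\<^sup>2 / (1 / \<delta>) = \<delta> * (norm (y s))\<^sup>2" by simp
          ultimately show "1 / \<delta> * (\<Sum>j=1..m. (norm (h s j))\<^sup>2) + (norm (y s))\<^sup>2 / (1 / \<delta>) \<le> k * H s" by linarith
        qed (use C in simp)
        finally show ?thesis .
      qed
      also have "B (w s) (h s) \<le> C * real m * (k * H s)"
      proof -
        have "B (w s) (h s) \<le> C * real m * (\<delta> * (norm (y s))\<^sup>2 + (\<Sum>j=1..m. (norm (h s j))\<^sup>2) / \<delta>)"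
          using bform_bound[OF B \<delta>, of "w s" "h s"] unfolding N by simp
        also have "\<dots> \<le> C * real m * (k * H s)"
        proof (intro mult_left_mono)
          have "(\<Sum>j=1..m. (norm (h s j))\<^sup>2) / \<delta> \<le> (k * (norm (e s))\<^sup>2) / \<delta>"
            using \<delta> by (intro divide_right_mono Nh) simp
          moreover have "\<delta> * (norm (y s))\<^sup>2 \<le> k * (\<delta> * (norm (y s))\<^sup>2)"
            using mult_right_mono[OF k, of "\<delta> * (norm (y s))\<^sup>2"] \<delta> by simp
          moreover have "k * H s = k * (\<delta> * (norm (y s))\<^sup>2) + (k * (norm (e s))\<^sup>2) / \<delta>"
            by (simp add: H_def distrib_left)
          ultimately show "\<delta> * (norm (y s))\<^sup>2 + (\<Sum>j=1..m. (norm (h s j))\<^sup>2) / \<delta> \<le> k * H s" by linarith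
        qed (use C in simp)
        finally show ?thesis .
      qed
      finally show ?thesis by (simp add: algebra_simps)
    qed
    have cy: "continuous_on {0..} y"
      using y by (intro continuous_on_vector_derivative[of "{0..}" y]) auto
    have cH: "continuous_on {0..t} H"
      unfolding H_def using \<delta> by (intro continuous_intros continuous_on_subset[OF cy] continuous_on_subset[OF ce]) auto
    define \<Phi> where "\<Phi> s = exp (\<mu> * s) * B (w s) (w s)" for s
    define \<Phi>' where "\<Phi>' s = exp (\<mu> * s) * (\<mu> * B (w s) (w s) + (B (g s) (w s) + B (w s) (g s)))" for s
    have d\<Phi>: "(\<Phi> has_vector_derivative \<Phi>' s) (at s within {0..t})" if s: "s \<in> {0..t}" for s
    proof -
      have "((\<lambda>s. exp (\<mu> * s)) has_real_derivative exp (\<mu> * s) * \<mu>) (at s within {0..t})"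
        by (auto intro!: derivative_eq_intros)
      moreover have "((\<lambda>s. B (w s) (w s)) has_real_derivative (B (g s) (w s) + B (w s) (g s))) (at s within {0..t})"
        by (rule DERIV_subset[OF dE]) (use s in auto)
      ultimately have "(\<Phi> has_real_derivative exp (\<mu> * s) * \<mu> * B (w s) (w s) + (B (g s) (w s) + B (w s) (g s)) * exp (\<mu> * s)) (at s within {0..t})"
        unfolding \<Phi>_def[abs_def] by (rule DERIV_mult)
      then have "(\<Phi> has_real_derivative \<Phi>' s) (at s within {0..t})"
        unfolding \<Phi>'_def by (simp add: algebra_simps)
      then show ?thesis by (simp add: has_real_derivative_iff_has_vector_derivative)
    qed
    have I1: "(\<Phi>' has_integral (\<Phi> t - \<Phi> 0)) {0..t}"
      using t d\<Phi> by (rule fundamental_theorem_of_calculus)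
    define M where "M = exp (\<mu> * t) * (2 * (C * real m) * k)"
    have I2: "((\<lambda>s. M * H s) has_integral (M * integral {0..t} H)) {0..t}"
      by (intro has_integral_mult_right integrable_integral integrable_continuous_real cH)
    have "\<Phi> t - \<Phi> 0 \<le> M * integral {0..t} H"
    proof (rule has_integral_le[OF I1 I2])
      fix s assume s: "s \<in> {0..t}"
      have "\<Phi>' s \<le> exp (\<mu> * s) * (2 * (C * real m) * k * H s)"
        unfolding \<Phi>'_def using est[of s] by (intro mult_left_mono) auto
      also have "\<dots> \<le> exp (\<mu> * t) * (2 * (C * real m) * k * H s)"
        using s \<mu> C k H0[of s] by (intro mult_right_mono) (auto intro: mult_left_mono)
      also have "\<dots> = M * H s" by (simp add: M_def)
      finally show "\<Phi>' s \<le> M * H s" .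
    qed
    then have "exp (\<mu> * t) * B (w t) (w t) \<le> B (w 0) (w 0) + exp (\<mu> * t) * (2 * (C * real m) * k * integral {0..t} H)"
      by (simp add: \<Phi>_def M_def)
    from mult_left_mono[OF this, of "exp (- (\<mu> * t))"]
    have "B (w t) (w t) \<le> exp (- (\<mu> * t)) * B (w 0) (w 0) + 2 * (C * real m) * k * integral {0..t} H"
      by (simp add: distrib_left mult.assoc[symmetric] exp_minus)
    moreover have "exp (- (\<mu> * t)) * B (w 0) (w 0) \<le> exp (- (\<mu> * t)) * (2 * (norm (y 0))\<^sup>2)"
      using B2[of "w 0"] unfolding N by (intro mult_left_mono) auto
    moreover have "(norm (y t))\<^sup>2 / 2 \<le> B (w t) (w t)" using B1[of "w t"] unfolding N .
    ultimately have "(norm (y t))\<^sup>2 \<le> 4 * (exp (- (\<mu> * t)) * (norm (y 0))\<^sup>2) + C' * integral {0..t} H"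
      unfolding C'_def by linarith
    moreover have "- (\<mu> * t) = - (c / 2) * rate m \<xi> * t" by (simp add: \<mu>_def)
    ultimately show "(norm (y t))\<^sup>2 \<le> 4 * exp (- (c / 2) * rate m \<xi> * t) * (norm (y 0))\<^sup>2
        + C' * integral {0..t} (\<lambda>s. \<delta> * (norm (y s))\<^sup>2 + (norm (e s))\<^sup>2 / \<delta>)"
      unfolding H_def[abs_def] by (simp only: mult.assoc)
  qed
  moreover have "c / 2 > 0" using c by simp
  ultimately show ?thesis using C' by blast
qed

section \<open>Truncated solutions in frequency space\<close>

text \<open>
  Tonelli's theorem, for a kernel whose integral in \<open>\<xi>\<close> is bounded uniformly in
  time.
\<close>

lemma integral_in_parameter_L1:
  fixes k :: "real \<Rightarrow> real \<Rightarrow> real"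
  assumes c: "continuous_on UNIV (\<lambda>z. k (fst z) (snd z))" and k0: "\<And>s \<xi>. 0 \<le> k s \<xi>" and t: "0 \<le> t"
    and i: "\<And>s. s \<in> {0..t} \<Longrightarrow> integrable lborel (k s)" and K: "\<And>s. s \<in> {0..t} \<Longrightarrow> (\<integral>\<xi>. k s \<xi> \<partial>lborel) \<le> K"
  shows "integrable lborel (\<lambda>\<xi>. integral {0..t} (\<lambda>s. k s \<xi>))"
    "(\<integral>\<xi>. integral {0..t} (\<lambda>s. k s \<xi>) \<partial>lborel) \<le> K * t" "0 \<le> integral {0..t} (\<lambda>s. k s \<xi>)"
proof -
  have km: "(\<lambda>z. k (fst z) (snd z)) \<in> borel_measurable borel" using c by (rule borel_measurable_continuous_onI)
  then have km' [measurable]: "(\<lambda>z. k (fst z) (snd z)) \<in> borel_measurable (lborel \<Otimes>\<^sub>M lborel)"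
    by (simp add: lborel_prod)
  have kc: "continuous_on S (\<lambda>s. k s \<xi>)" for S \<xi>
    using continuous_on_compose2[OF c, of S "\<lambda>s. (s, \<xi>)"] by (simp add: continuous_on_Pair continuous_on_id continuous_on_const)
  define I where "I \<xi> = (\<integral>s. indicator {0..t} s * k s \<xi> \<partial>lborel)" for \<xi>
  have si: "integrable lborel (\<lambda>s. indicator {0..t} s * k s \<xi>)" for \<xi>
    using borel_integrable_atLeastAtMost'[OF kc, of 0 t \<xi>] by (simp add: set_integrable_def)
  have I: "integral {0..t} (\<lambda>s. k s \<xi>) = I \<xi>" for \<xi>
    using set_borel_integral_eq_integral(2)[OF borel_integrable_atLeastAtMost'[OF kc], of 0 t \<xi>]
    by (simp add: I_def set_lebesgue_integral_def)
  have I0: "0 \<le> I \<xi>" for \<xi> unfolding I_def by (intro Bochner_Integration.integral_nonneg) (simp add: k0)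
  show "0 \<le> integral {0..t} (\<lambda>s. k s \<xi>)" unfolding I by (rule I0)
  have Im: "I \<in> borel_measurable lborel" unfolding I_def[abs_def]
  proof (rule sigma_finite_measure.borel_measurable_lebesgue_integral[OF sigma_finite_lborel])
    have "(\<lambda>z. indicator {0..t} (snd z) * k (snd z) (fst z)) \<in> borel_measurable (lborel \<Otimes>\<^sub>M lborel)"
      using measurable_compose[OF measurable_pair_swap' km'] by (simp add: case_prod_beta')
    then show "(\<lambda>(\<xi>, s). indicator {0..t} s * k s \<xi>) \<in> borel_measurable (lborel \<Otimes>\<^sub>M lborel)"
      by (simp add: case_prod_beta')
  qed
  have K0: "0 \<le> K"
  proof -
    have "0 \<le> (\<integral>\<xi>. k 0 \<xi> \<partial>lborel)" by (intro Bochner_Integration.integral_nonneg k0)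
    also have "\<dots> \<le> K" by (rule K) (use t in simp)
    finally show ?thesis .
  qed
  have "(\<integral>\<^sup>+ \<xi>. ennreal (I \<xi>) \<partial>lborel) = (\<integral>\<^sup>+ \<xi>. (\<integral>\<^sup>+ s. ennreal (indicator {0..t} s * k s \<xi>) \<partial>lborel) \<partial>lborel)"
    unfolding I_def by (intro nn_integral_cong nn_integral_eq_integral[symmetric] si AE_I2) (simp add: k0)
  also have "\<dots> = (\<integral>\<^sup>+ s. (\<integral>\<^sup>+ \<xi>. ennreal (indicator {0..t} s * k s \<xi>) \<partial>lborel) \<partial>lborel)"
  proof -
    have "(\<lambda>z. ennreal (indicator {0..t} (fst z) * k (fst z) (snd z))) \<in> borel_measurable (lborel \<Otimes>\<^sub>M lborel)"
      by measurable
    from lborel_pair.Fubini'[of "\<lambda>s \<xi>. ennreal (indicator {0..t} s * k s \<xi>)"] this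
    show ?thesis by (simp add: case_prod_beta')
  qed
  also have "\<dots> \<le> (\<integral>\<^sup>+ s. ennreal (K * indicator {0..t} s) \<partial>lborel)"
  proof (rule nn_integral_mono)
    fix s :: real
    show "(\<integral>\<^sup>+ \<xi>. ennreal (indicator {0..t} s * k s \<xi>) \<partial>lborel) \<le> ennreal (K * indicator {0..t} s)"
    proof (cases "s \<in> {0..t}")
      case True
      have "(\<integral>\<^sup>+ \<xi>. ennreal (indicator {0..t} s * k s \<xi>) \<partial>lborel) = (\<integral>\<^sup>+ \<xi>. ennreal (k s \<xi>) \<partial>lborel)"
        using True by simp
      also have "\<dots> = ennreal (\<integral>\<xi>. k s \<xi> \<partial>lborel)"
        by (intro nn_integral_eq_integral i True AE_I2 k0)
      also have "\<dots> \<le> ennreal K" by (intro ennreal_leI K True)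
      finally show ?thesis using True by simp
    qed simp
  qed
  also have "\<dots> = ennreal (\<integral>s. K * indicator {0..t} s \<partial>lborel)"
    using K0 by (intro nn_integral_eq_integral integrable_mult_right integrable_real_indicator AE_I2)
      (auto simp: emeasure_lborel_Icc_eq)
  also have "(\<integral>s. K * indicator {0..t} s \<partial>lborel) = K * t" using t by simp
  finally have nn: "(\<integral>\<^sup>+ \<xi>. ennreal (I \<xi>) \<partial>lborel) \<le> ennreal (K * t)" .
  have Ii: "integrable lborel I"
  proof (rule integrableI_nonneg[OF Im])
    show "AE \<xi> in lborel. 0 \<le> I \<xi>" by (intro AE_I2 I0)
    show "(\<integral>\<^sup>+ \<xi>. ennreal (I \<xi>) \<partial>lborel) < \<infinity>"
      unfolding infinity_ennreal_def by (rule le_less_trans[OF nn ennreal_less_top])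
  qed
  then show "integrable lborel (\<lambda>\<xi>. integral {0..t} (\<lambda>s. k s \<xi>))" unfolding I .
  have "ennreal (\<integral>\<xi>. I \<xi> \<partial>lborel) \<le> ennreal (K * t)"
    using nn nn_integral_eq_integral[OF Ii AE_I2[OF I0]] by (simp only:)
  moreover have "0 \<le> K * t" using K0 t by simp
  ultimately show "(\<integral>\<xi>. integral {0..t} (\<lambda>s. k s \<xi>) \<partial>lborel) \<le> K * t"
    unfolding I by (simp only: ennreal_le_iff)
qed

lemma Lp_diff:
  fixes f g :: "real \<Rightarrow> 'a::euclidean_space"
  assumes p: "p = 1 \<or> p = 2" and f: "in_Lp p f" and g: "in_Lp p g"
  shows "in_Lp p (\<lambda>x. f x - g x)" "\<bar>Lp_norm p f - Lp_norm p g\<bar> \<le> Lp_norm p (\<lambda>x. f x - g x)"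
proof -
  show "in_Lp p (\<lambda>x. f x - g x)"
    using p f g by (auto simp: in_L1_iff intro: L2_diff)
  show "\<bar>Lp_norm p f - Lp_norm p g\<bar> \<le> Lp_norm p (\<lambda>x. f x - g x)"
  proof (cases "p = 2")
    case True
    then show ?thesis using L2_norm_diff[of f g] f g by simp
  next
    case False
    then have i: "p = 1" "integrable lborel f" "integrable lborel g" using p f g by (auto simp: in_L1_iff)
    have "\<bar>(\<integral>x. norm (f x) \<partial>lborel) - (\<integral>x. norm (g x) \<partial>lborel)\<bar> = norm (\<integral>x. norm (f x) - norm (g x) \<partial>lborel)"
      using i by (simp add: Bochner_Integration.integral_diff)
    also have "\<dots> \<le> (\<integral>x. norm (norm (f x) - norm (g x)) \<partial>lborel)" by (rule integral_norm_bound)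
    also have "\<dots> \<le> (\<integral>x. norm (f x - g x) \<partial>lborel)"
      using i by (intro integral_mono) (auto simp: norm_triangle_ineq3)
    finally show ?thesis using i by (simp add: Lp_norm_1)
  qed
qed

lemma pairing_Lp:
  fixes v :: "real \<Rightarrow> 'a::euclidean_space"
  assumes p: "p = 1 \<or> p = 2" and v: "in_Lp p v" and m: "\<phi> \<in> borel_measurable borel"
    and B: "\<And>x. \<bar>\<phi> x\<bar> \<le> B" and R: "\<And>x. \<bar>x\<bar> > R \<Longrightarrow> \<phi> x = 0" and R0: "0 \<le> R"
  shows "integrable lborel (\<lambda>x. \<phi> x *\<^sub>R v x)"
    "(\<integral>x. norm (\<phi> x *\<^sub>R v x) \<partial>lborel) \<le> B * (R + 1) * Lp_norm p v"
proof -
  have "integrable lborel (\<lambda>x. \<phi> x *\<^sub>R v x) \<and> (\<integral>x. norm (\<phi> x *\<^sub>R v x) \<partial>lborel) \<le> B * (R + 1) * Lp_norm p v"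
  proof (cases "p = 2")
    case True
    then show ?thesis using pairing_L2[OF _ m B R R0, of v] v by simp
  next
    case False
    then have p1: "p = 1" and i: "integrable lborel v" using p v by (auto simp: in_L1_iff)
    have [measurable]: "v \<in> borel_measurable borel" "\<phi> \<in> borel_measurable borel" using i m by auto
    have B0: "0 \<le> B" using B[of 0] by linarith
    have iB: "integrable lborel (\<lambda>x. B * norm (v x))" using i by simp
    have b: "norm (\<phi> x *\<^sub>R v x) \<le> B * norm (v x)" for x
      unfolding norm_scaleR by (rule mult_right_mono[OF B]) simp
    have int: "integrable lborel (\<lambda>x. \<phi> x *\<^sub>R v x)"
    proof (rule Bochner_Integration.integrable_bound[OF iB])
      show "AE x in lborel. norm (\<phi> x *\<^sub>R v x) \<le> norm (B * norm (v x))"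
        by (rule AE_I2, rule order_trans[OF b]) (simp only: real_norm_def abs_ge_self)
    qed measurable
    have "(\<integral>x. norm (\<phi> x *\<^sub>R v x) \<partial>lborel) \<le> (\<integral>x. B * norm (v x) \<partial>lborel)"
      by (intro integral_mono integrable_norm int iB b)
    also have "\<dots> = B * 1 * Lp_norm p v" by (simp add: p1 Lp_norm_1)
    also have "\<dots> \<le> B * (R + 1) * Lp_norm p v" using B0 R0 by (intro mult_right_mono mult_left_mono) auto
    finally show ?thesis using int by simp
  qed
  then show "integrable lborel (\<lambda>x. \<phi> x *\<^sub>R v x)"
    "(\<integral>x. norm (\<phi> x *\<^sub>R v x) \<partial>lborel) \<le> B * (R + 1) * Lp_norm p v" by simp_all
qed

lemma cutoff_Lp:
  fixes v :: "real \<Rightarrow> 'a::euclidean_space"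
  assumes p: "p = 1 \<or> p = 2" and v: "in_Lp p v" and d: "\<delta> > 0"
  shows "integrable lborel (\<lambda>x. cutoff \<delta> x *\<^sub>R v x)" "integrable lborel (\<lambda>x. cutoff' \<delta> x *\<^sub>R v x)"
    "(\<integral>x. norm (cutoff \<delta> x *\<^sub>R v x) \<partial>lborel) \<le> 1 * (1 / \<delta> + 1) * Lp_norm p v"
    "(\<integral>x. norm (cutoff' \<delta> x *\<^sub>R v x) \<partial>lborel) \<le> 4 * \<delta> * (1 / \<delta> + 1) * Lp_norm p v"
proof -
  have d0: "0 \<le> 1 / \<delta>" using d by simp
  note c = pairing_Lp[OF p v cutoff_measurable(1) cutoff_bounds(3) cutoff_zero[OF d] d0]
  note c' = pairing_Lp[OF p v cutoff_measurable(2) cutoff'_bound[OF d] cutoff'_zero[OF d] d0]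
  show "integrable lborel (\<lambda>x. cutoff \<delta> x *\<^sub>R v x)" "integrable lborel (\<lambda>x. cutoff' \<delta> x *\<^sub>R v x)"
    "(\<integral>x. norm (cutoff \<delta> x *\<^sub>R v x) \<partial>lborel) \<le> 1 * (1 / \<delta> + 1) * Lp_norm p v"
    "(\<integral>x. norm (cutoff' \<delta> x *\<^sub>R v x) \<partial>lborel) \<le> 4 * \<delta> * (1 / \<delta> + 1) * Lp_norm p v"
    using c c' by simp_all
qed

text \<open>
  The transform at one frequency, assembled from its cosine and sine integrals.
\<close>

definition cplx :: "real ^ 'n \<Rightarrow> real ^ 'n \<Rightarrow> complex ^ 'n" where
  "cplx c s = (\<chi> i. complex_of_real (c $ i) - \<i> * complex_of_real (s $ i))"

lemma cplx_derivative:
  assumes "(c has_vector_derivative c') F" "(s has_vector_derivative s') F"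
  shows "((\<lambda>t. cplx (c t) (s t)) has_vector_derivative cplx c' s') F"
proof -
  have P: "bounded_linear (\<lambda>c :: real ^ 'n. cplx c 0)" "bounded_linear (\<lambda>s :: real ^ 'n. cplx 0 s)"
    unfolding linear_conv_bounded_linear[symmetric]
    by (auto intro!: linearI simp: cplx_def vec_eq_iff complex_eq_iff algebra_simps)
  have e: "cplx c s = cplx c 0 + cplx 0 s" for c s :: "real ^ 'n" by (simp add: cplx_def vec_eq_iff)
  have "((\<lambda>t. cplx (c t) 0 + cplx 0 (s t)) has_vector_derivative cplx c' 0 + cplx 0 s') F"
    by (intro has_vector_derivative_add bounded_linear.has_vector_derivative[OF P(1) assms(1)]
        bounded_linear.has_vector_derivative[OF P(2) assms(2)])
  then show ?thesis by (simp only: e[symmetric])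
qed

lemma mat_app_cplx: "mat_app A (cplx c s) = cplx (A *v c) (A *v s)"
  unfolding mat_app_def cplx_def matrix_vector_mult_def vec_eq_iff vec_lambda_beta
  by (simp add: right_diff_distrib sum_subtractf sum_distrib_left mult.left_commute)

lemma cvec_cplx: "cvec (\<i> * complex_of_real \<xi>) (cplx c s) = cplx (\<xi> *\<^sub>R s) (- (\<xi> *\<^sub>R c))"
  by (simp add: vec_eq_iff cplx_def complex_eq_iff)

lemma cplx_arith: "cplx c s + cplx c' s' = cplx (c + c') (s + s')" "- cplx c s = cplx (- c) (- s)"
  "cplx c s - cplx c' s' = cplx (c - c') (s - s')"
  by (simp_all add: cplx_def vec_eq_iff algebra_simps)

text \<open>
  Test the equation with \<open>cutoff \<delta> x * cos (x * \<xi>)\<close> and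
  \<open>cutoff \<delta> x * sin (x * \<xi>)\<close>.  In the derivatives of these functions,
  the terms with \<open>cutoff'\<close> give the forcing term, and the others exchange the two
  integrals with a factor \<open>\<xi>\<close>, which is the multiplication by
  \<open>i \<xi>\<close>.
\<close>

lemma truncated_ode:
  fixes u0 :: "real \<Rightarrow> real ^ 'n"
  assumes p: "p = 1 \<or> p = 2" and sol: "cauchy_solution p A L u0 u" and d: "\<delta> > 0" and t: "t \<ge> 0"
  shows "((\<lambda>r. fourier (\<lambda>x. cutoff \<delta> x *\<^sub>R u r x) \<xi>) has_vector_derivative
    (- cvec (\<i> * complex_of_real \<xi>) (mat_app A (fourier (\<lambda>x. cutoff \<delta> x *\<^sub>R u t x) \<xi>))
      - mat_app L (fourier (\<lambda>x. cutoff \<delta> x *\<^sub>R u t x) \<xi>)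
      + mat_app A (fourier (\<lambda>x. cutoff' \<delta> x *\<^sub>R u t x) \<xi>))) (at t within {0..})"
proof -
  have uL: "in_Lp p (u r)" if "r \<ge> 0" for r using sol that unfolding cauchy_solution_def by simp
  have weak: "((\<lambda>r. \<integral>x. \<phi> x *\<^sub>R u r x \<partial>lborel) has_vector_derivative
        (A *v (\<integral>x. deriv \<phi> x *\<^sub>R u t x \<partial>lborel) - L *v (\<integral>x. \<phi> x *\<^sub>R u t x \<partial>lborel))) (at t within {0..})"
    if "test_fun \<phi>" for \<phi> using sol that t unfolding cauchy_solution_def by simp
  define c where "c r = (\<integral>x. (cutoff \<delta> x * cos (x * \<xi>)) *\<^sub>R u r x \<partial>lborel)" for r
  define s where "s r = (\<integral>x. (cutoff \<delta> x * sin (x * \<xi>)) *\<^sub>R u r x \<partial>lborel)" for r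
  define ec where "ec = (\<integral>x. (cutoff' \<delta> x * cos (x * \<xi>)) *\<^sub>R u t x \<partial>lborel)"
  define es where "es = (\<integral>x. (cutoff' \<delta> x * sin (x * \<xi>)) *\<^sub>R u t x \<partial>lborel)"
  have Y: "fourier (\<lambda>x. cutoff \<delta> x *\<^sub>R u r x) \<xi> = cplx (c r) (s r)" if "r \<ge> 0" for r
    unfolding vec_eq_iff fourier_cos_sin(1)[OF cutoff_measurable(1) cutoff_Lp(1)[OF p uL[OF that] d]]
    by (simp add: cplx_def c_def s_def)
  have E: "fourier (\<lambda>x. cutoff' \<delta> x *\<^sub>R u t x) \<xi> = cplx ec es"
    unfolding vec_eq_iff fourier_cos_sin(1)[OF cutoff_measurable(2) cutoff_Lp(2)[OF p uL[OF t] d]]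
    by (simp add: cplx_def ec_def es_def)
  note ic = fourier_cos_sin(2,3)[OF cutoff_measurable(1) cutoff_Lp(1)[OF p uL[OF t] d], where \<xi> = \<xi>]
  note ie = fourier_cos_sin(2,3)[OF cutoff_measurable(2) cutoff_Lp(2)[OF p uL[OF t] d], where \<xi> = \<xi>]
  have dc: "(\<integral>x. (cutoff' \<delta> x * cos (x * \<xi>) - \<xi> * (cutoff \<delta> x * sin (x * \<xi>))) *\<^sub>R u t x \<partial>lborel) = ec - \<xi> *\<^sub>R s t"
  proof -
    have "(\<integral>x. (cutoff' \<delta> x * cos (x * \<xi>) - \<xi> * (cutoff \<delta> x * sin (x * \<xi>))) *\<^sub>R u t x \<partial>lborel)
      = (\<integral>x. (cutoff' \<delta> x * cos (x * \<xi>)) *\<^sub>R u t x - \<xi> *\<^sub>R ((cutoff \<delta> x * sin (x * \<xi>)) *\<^sub>R u t x) \<partial>lborel)"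
      by (simp add: scaleR_diff_left)
    also have "\<dots> = ec - (\<integral>x. \<xi> *\<^sub>R ((cutoff \<delta> x * sin (x * \<xi>)) *\<^sub>R u t x) \<partial>lborel)"
      unfolding ec_def by (intro Bochner_Integration.integral_diff integrable_scaleR_right ic ie)
    finally show ?thesis unfolding integral_scaleR_right s_def .
  qed
  have ds: "(\<integral>x. (cutoff' \<delta> x * sin (x * \<xi>) + \<xi> * (cutoff \<delta> x * cos (x * \<xi>))) *\<^sub>R u t x \<partial>lborel) = es + \<xi> *\<^sub>R c t"
  proof -
    have "(\<integral>x. (cutoff' \<delta> x * sin (x * \<xi>) + \<xi> * (cutoff \<delta> x * cos (x * \<xi>))) *\<^sub>R u t x \<partial>lborel)
      = (\<integral>x. (cutoff' \<delta> x * sin (x * \<xi>)) *\<^sub>R u t x + \<xi> *\<^sub>R ((cutoff \<delta> x * cos (x * \<xi>)) *\<^sub>R u t x) \<partial>lborel)"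
      by (simp add: scaleR_add_left)
    also have "\<dots> = es + (\<integral>x. \<xi> *\<^sub>R ((cutoff \<delta> x * cos (x * \<xi>)) *\<^sub>R u t x) \<partial>lborel)"
      unfolding es_def by (intro Bochner_Integration.integral_add integrable_scaleR_right ic ie)
    finally show ?thesis unfolding integral_scaleR_right c_def .
  qed
  have Dc: "(c has_vector_derivative (A *v (ec - \<xi> *\<^sub>R s t) - L *v c t)) (at t within {0..})"
    using weak[OF cos_cutoff(1)[OF d, of \<xi>]] unfolding cos_cutoff(2)[OF d] dc unfolding c_def[symmetric] .
  have Ds: "(s has_vector_derivative (A *v (es + \<xi> *\<^sub>R c t) - L *v s t)) (at t within {0..})"
    using weak[OF sin_cutoff(1)[OF d, of \<xi>]] unfolding sin_cutoff(2)[OF d] ds unfolding s_def[symmetric] .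
  have Dcs: "((\<lambda>r. cplx (c r) (s r)) has_vector_derivative
     cplx (A *v (ec - \<xi> *\<^sub>R s t) - L *v c t) (A *v (es + \<xi> *\<^sub>R c t) - L *v s t)) (at t within {0..})"
    by (rule cplx_derivative[OF Dc Ds])
  have D: "((\<lambda>r. fourier (\<lambda>x. cutoff \<delta> x *\<^sub>R u r x) \<xi>) has_vector_derivative
     cplx (A *v (ec - \<xi> *\<^sub>R s t) - L *v c t) (A *v (es + \<xi> *\<^sub>R c t) - L *v s t)) (at t within {0..})"
  proof (rule has_vector_derivative_transform[OF _ _ Dcs])
    show "t \<in> {0..}" using t by simp
    show "fourier (\<lambda>x. cutoff \<delta> x *\<^sub>R u r x) \<xi> = cplx (c r) (s r)" if "r \<in> {0..}" for r
      by (rule Y) (use that in simp)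
  qed
  have q1: "A *v (ec - \<xi> *\<^sub>R s t) - L *v c t = - (\<xi> *\<^sub>R (A *v s t)) - L *v c t + A *v ec"
    by (simp add: matrix_vector_mult_diff_distrib matrix_vector_mult_scaleR)
  have q2: "A *v (es + \<xi> *\<^sub>R c t) - L *v s t = - (- (\<xi> *\<^sub>R (A *v c t))) - L *v s t + A *v es"
    by (simp add: matrix_vector_right_distrib matrix_vector_mult_scaleR)
  show ?thesis unfolding Y[OF t] E mat_app_cplx cvec_cplx cplx_arith using D unfolding q1 q2 .
qed

section \<open>Pointwise estimates in frequency space\<close>

text \<open>
  The conclusion of \<open>forced_energy_estimate\<close> with the decay rate
  \<open>\<rho>\<close>, which is how the two matrices enter the passage to the limit.
\<close>

definition forced_estimate :: "real ^ 'n ^ 'n \<Rightarrow> real ^ 'n ^ 'n \<Rightarrow> real \<Rightarrow> (real \<Rightarrow> real) \<Rightarrow> bool" where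
  "forced_estimate A L C \<rho> \<longleftrightarrow> (\<forall>\<xi> \<delta> t (y :: real \<Rightarrow> complex ^ 'n) e. \<delta> > 0 \<longrightarrow> t \<ge> 0 \<longrightarrow>
     (\<forall>s\<ge>0. (y has_vector_derivative (- cvec (\<i> * complex_of_real \<xi>) (mat_app A (y s)) - mat_app L (y s)
        + mat_app A (e s))) (at s within {0..})) \<longrightarrow>
     continuous_on {0..} e \<longrightarrow>
     (norm (y t))\<^sup>2 \<le> 4 * exp (- \<rho> \<xi> * t) * (norm (y 0))\<^sup>2
        + C * integral {0..t} (\<lambda>s. \<delta> * (norm (y s))\<^sup>2 + (norm (e s))\<^sup>2 / \<delta>))"

lemma continuous_fourier:
  fixes h :: "real \<Rightarrow> real ^ 'n"
  assumes "integrable lborel h"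
  shows "continuous_on UNIV (fourier h)"
proof -
  have "isCont (ft (\<lambda>x. h x $ i)) \<xi>" for i \<xi>
  proof (rule continuous_at_sequentiallyI)
    fix X :: "nat \<Rightarrow> real" assume X: "X \<longlonglongrightarrow> \<xi>"
    have hi: "integrable lborel (\<lambda>x. h x $ i)" by (rule component_integrable[OF assms])
    show "(\<lambda>n. ft (\<lambda>x. h x $ i) (X n)) \<longlonglongrightarrow> ft (\<lambda>x. h x $ i) \<xi>"
      unfolding ft_def
    proof (rule integral_dominated_convergence[where w = "\<lambda>x. \<bar>h x $ i\<bar>"])
      show "AE x in lborel. (\<lambda>n. cis (- (x * X n)) * complex_of_real (h x $ i)) \<longlonglongrightarrow> cis (- (x * \<xi>)) * complex_of_real (h x $ i)"
      proof (rule AE_I2)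
        fix x
        have c: "isCont cis z" for z :: real unfolding cis_conv_exp by (intro continuous_intros)
        have "(\<lambda>n. - (x * X n)) \<longlonglongrightarrow> - (x * \<xi>)" by (intro tendsto_intros X)
        from isCont_tendsto_compose[OF c this]
        show "(\<lambda>n. cis (- (x * X n)) * complex_of_real (h x $ i)) \<longlonglongrightarrow> cis (- (x * \<xi>)) * complex_of_real (h x $ i)"
          by (intro tendsto_mult tendsto_const)
      qed
    qed (use integrable_ft[OF hi] hi in \<open>auto simp: norm_mult\<close>)
  qed
  then have "continuous_on UNIV (\<lambda>\<xi>. fourier h \<xi> $ i)" for i
    unfolding fourier_nth by (intro continuous_at_imp_continuous_on ballI)
  then show ?thesis
    using continuous_on_vec_lambda[of UNIV "\<lambda>i \<xi>. fourier h \<xi> $ i"] by simp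
qed

text \<open>
  Clamping the time at 0 extends the solution continuously to negative times, so that joint
  continuity in time and frequency can be stated on the whole plane.
\<close>

definition window :: "(real \<Rightarrow> real) \<Rightarrow> (real \<Rightarrow> real \<Rightarrow> real ^ 'n) \<Rightarrow> real \<Rightarrow> real \<Rightarrow> complex ^ 'n" where
  "window \<theta> u s \<xi> = fourier (\<lambda>x. \<theta> x *\<^sub>R u (max 0 s) x) \<xi>"

lemma clamped_continuous:
  assumes sol: "cauchy_solution p A L u0 u"
  shows "isCont (\<lambda>r. Lp_norm p (\<lambda>x. u (max 0 r) x - u (max 0 t) x)) t"
proof -
  define g where "g r = Lp_norm p (\<lambda>x. u r x - u (max 0 t) x)" for r
  have "(g \<longlongrightarrow> 0) (at (max 0 t) within {0..})"
    using sol unfolding cauchy_solution_def g_def[abs_def] by simp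
  moreover have "g (max 0 t) = 0" by (simp add: g_def Lp_norm_def)
  ultimately have "continuous (at (max 0 t) within {0..}) g" by (simp add: continuous_within)
  then have "continuous (at (max 0 t) within range (max 0)) g" by (rule continuous_within_subset) auto
  then have "isCont (\<lambda>r. g (max 0 r)) t"
    by (intro continuous_within_compose2[where f = "max 0" and g = g] continuous_intros)
  then show ?thesis by (simp add: g_def)
qed

text \<open>
  Continuity in time holds uniformly in the frequency, because \<open>L^p\<close> convergence on
  a bounded set implies \<open>L^1\<close> convergence there.
\<close>

lemma window_continuous:
  fixes u :: "real \<Rightarrow> real \<Rightarrow> real ^ 'n"
  assumes p: "p = 1 \<or> p = 2" and sol: "cauchy_solution p A L u0 u"
    and m: "\<theta> \<in> borel_measurable borel"
    and B: "\<And>x. \<bar>\<theta> x\<bar> \<le> B" and R: "\<And>x. \<bar>x\<bar> > R \<Longrightarrow> \<theta> x = 0" and R0: "0 \<le> R"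
  shows "continuous_on UNIV (\<lambda>z. window \<theta> u (fst z) (snd z))"
proof -
  define v where "v s = u (max 0 s)" for s
  have vL: "in_Lp p (v s)" for s using sol unfolding cauchy_solution_def v_def by simp
  have vi: "integrable lborel (\<lambda>x. \<theta> x *\<^sub>R v s x)" for s by (rule pairing_Lp(1)[OF p vL m B R R0])
  have "isCont (\<lambda>z. window \<theta> u (fst z) (snd z)) z0" for z0
  proof -
    define t where "t = fst z0"
    define g where "g r = Lp_norm p (\<lambda>x. v r x - v t x)" for r
    define K where "K = real CARD('n) * (B * (R + 1))"
    have g: "isCont (\<lambda>r. g r) t" unfolding g_def v_def by (rule clamped_continuous[OF sol])
    have "isCont (\<lambda>z. g (fst z)) z0"
      by (rule isCont_o2[where f = fst]) (use g in \<open>simp_all add: t_def\<close>)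
    then have "((\<lambda>z. g (fst z)) \<longlongrightarrow> g t) (at z0)" by (simp add: isCont_def t_def)
    moreover have "g t = 0" by (simp add: g_def Lp_norm_def)
    ultimately have g0: "((\<lambda>z. K * g (fst z)) \<longlongrightarrow> 0) (at z0)" by (auto intro: tendsto_mult_right_zero)
    have b: "norm (window \<theta> u s \<xi> - window \<theta> u t \<xi>) \<le> K * g s" for s \<xi>
    proof -
      have "window \<theta> u s \<xi> - window \<theta> u t \<xi> = fourier (\<lambda>x. \<theta> x *\<^sub>R v s x - \<theta> x *\<^sub>R v t x) \<xi>"
        unfolding window_def v_def[symmetric] by (rule fourier_diff[symmetric, OF vi vi])
      also have "\<dots> = fourier (\<lambda>x. \<theta> x *\<^sub>R (v s x - v t x)) \<xi>" by (simp only: scaleR_diff_right)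
      finally have e: "window \<theta> u s \<xi> - window \<theta> u t \<xi> = fourier (\<lambda>x. \<theta> x *\<^sub>R (v s x - v t x)) \<xi>" .
      note dL = Lp_diff(1)[OF p vL vL]
      have "norm (fourier (\<lambda>x. \<theta> x *\<^sub>R (v s x - v t x)) \<xi>) \<le> real CARD('n) * (\<integral>x. norm (\<theta> x *\<^sub>R (v s x - v t x)) \<partial>lborel)"
        by (rule norm_fourier_le[OF pairing_Lp(1)[OF p dL m B R R0]])
      also have "\<dots> \<le> real CARD('n) * (B * (R + 1) * g s)"
        unfolding g_def by (intro mult_left_mono pairing_Lp(2)[OF p dL m B R R0]) auto
      finally show ?thesis unfolding e K_def by (simp only: mult.assoc)
    qed
    have "((\<lambda>z. window \<theta> u (fst z) (snd z) - window \<theta> u t (snd z)) \<longlongrightarrow> 0) (at z0)"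
      by (rule Lim_null_comparison[OF _ g0]) (simp add: b)
    moreover have "((\<lambda>z. window \<theta> u t (snd z)) \<longlongrightarrow> window \<theta> u t (snd z0)) (at z0)"
    proof -
      have "isCont (fourier (\<lambda>x. \<theta> x *\<^sub>R v t x)) (snd z0)"
        using continuous_fourier[OF vi[of t]] by (simp add: continuous_on_eq_continuous_at)
      then have "isCont (\<lambda>z. fourier (\<lambda>x. \<theta> x *\<^sub>R v t x) (snd z)) z0"
        by (rule isCont_o2[where f = snd, rotated]) simp_all
      then show ?thesis by (simp add: isCont_def window_def v_def)
    qed
    ultimately have "((\<lambda>z. (window \<theta> u (fst z) (snd z) - window \<theta> u t (snd z)) + window \<theta> u t (snd z)) \<longlongrightarrow> 0 + window \<theta> u t (snd z0)) (at z0)"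
      by (rule tendsto_add)
    then show ?thesis by (simp add: isCont_def t_def)
  qed
  then show ?thesis by (intro continuous_at_imp_continuous_on ballI)
qed

text \<open>
  The norm is continuous in time on a compact interval.
\<close>

lemma solution_norm_bounded:
  fixes u :: "real \<Rightarrow> real \<Rightarrow> real ^ 'n"
  assumes p: "p = 1 \<or> p = 2" and sol: "cauchy_solution p A L u0 u"
  obtains S where "S \<ge> 0" "\<And>s. s \<in> {0..t} \<Longrightarrow> Lp_norm p (u s) \<le> S"
proof -
  have vL: "in_Lp p (u (max 0 s))" for s using sol unfolding cauchy_solution_def by simp
  have "isCont (\<lambda>s. Lp_norm p (u (max 0 s))) s" for s
  proof -
    have "((\<lambda>r. Lp_norm p (\<lambda>x. u (max 0 r) x - u (max 0 s) x)) \<longlongrightarrow> Lp_norm p (\<lambda>x. u (max 0 s) x - u (max 0 s) x)) (at s)"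
      using clamped_continuous[OF sol, of s] by (simp only: isCont_def)
    moreover have "Lp_norm p (\<lambda>x. u (max 0 s) x - u (max 0 s) x) = 0" by (simp add: Lp_norm_def)
    ultimately have g: "((\<lambda>r. Lp_norm p (\<lambda>x. u (max 0 r) x - u (max 0 s) x)) \<longlongrightarrow> 0) (at s)" by simp
    have "((\<lambda>r. Lp_norm p (u (max 0 r)) - Lp_norm p (u (max 0 s))) \<longlongrightarrow> 0) (at s)"
      by (rule Lim_null_comparison[OF _ g]) (simp add: Lp_diff(2)[OF p vL vL])
    then show ?thesis unfolding isCont_def by (rule LIM_zero_cancel)
  qed
  then have "continuous_on {0..t} (\<lambda>s. Lp_norm p (u (max 0 s)))" by (intro continuous_at_imp_continuous_on ballI)
  from compact_continuous_image[OF this compact_Icc] have "bounded ((\<lambda>s. Lp_norm p (u (max 0 s))) ` {0..t})"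
    by (rule compact_imp_bounded)
  then obtain S where S: "\<And>s. s \<in> {0..t} \<Longrightarrow> \<bar>Lp_norm p (u (max 0 s))\<bar> \<le> S"
    unfolding bounded_iff real_norm_def by blast
  show ?thesis
  proof
    show "0 \<le> max 0 S" by simp
    show "Lp_norm p (u s) \<le> max 0 S" if "s \<in> {0..t}" for s
    proof -
      have "max 0 s = s" using that by simp
      then show ?thesis using S[OF that] by simp
    qed
  qed
qed

definition remainder :: "real \<Rightarrow> (real \<Rightarrow> real \<Rightarrow> real ^ 'n) \<Rightarrow> real \<Rightarrow> real \<Rightarrow> real" where
  "remainder \<delta> u s \<xi> = \<delta> * (norm (window (cutoff \<delta>) u s \<xi>))\<^sup>2 + (norm (window (cutoff' \<delta>) u s \<xi>))\<^sup>2 / \<delta>"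

lemma windows_continuous:
  fixes u :: "real \<Rightarrow> real \<Rightarrow> real ^ 'n"
  assumes p: "p = 1 \<or> p = 2" and sol: "cauchy_solution p A L u0 u" and d: "\<delta> > 0"
  shows "continuous_on UNIV (\<lambda>z. window (cutoff \<delta>) u (fst z) (snd z))"
    "continuous_on UNIV (\<lambda>z. window (cutoff' \<delta>) u (fst z) (snd z))"
    "continuous_on UNIV (\<lambda>z. remainder \<delta> u (fst z) (snd z))"
    "continuous_on S (\<lambda>s. window (cutoff' \<delta>) u s \<xi>)" "continuous_on S (\<lambda>s. remainder \<delta> u s \<xi>)"
proof -
  have d0: "0 \<le> 1 / \<delta>" using d by simp
  show 1: "continuous_on UNIV (\<lambda>z. window (cutoff \<delta>) u (fst z) (snd z))"
    by (rule window_continuous[OF p sol cutoff_measurable(1) cutoff_bounds(3) cutoff_zero[OF d] d0])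
  show 2: "continuous_on UNIV (\<lambda>z. window (cutoff' \<delta>) u (fst z) (snd z))"
    by (rule window_continuous[OF p sol cutoff_measurable(2) cutoff'_bound[OF d] cutoff'_zero[OF d] d0])
  show 3: "continuous_on UNIV (\<lambda>z. remainder \<delta> u (fst z) (snd z))"
    unfolding remainder_def using d by (intro continuous_intros 1 2) auto
  have l: "continuous_on S (\<lambda>s. (s, \<xi>))" by (intro continuous_intros)
  show "continuous_on S (\<lambda>s. window (cutoff' \<delta>) u s \<xi>)" using continuous_on_compose2[OF 2 l] by simp
  show "continuous_on S (\<lambda>s. remainder \<delta> u s \<xi>)" using continuous_on_compose2[OF 3 l] by simp
qed

lemma remainder_nonneg: "\<delta> > 0 \<Longrightarrow> 0 \<le> remainder \<delta> u s \<xi>" by (simp add: remainder_def)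

lemma truncated_estimate:
  fixes u :: "real \<Rightarrow> real \<Rightarrow> real ^ 'n"
  assumes p: "p = 1 \<or> p = 2" and sol: "cauchy_solution p A L u0 u" and F: "forced_estimate A L C \<rho>"
    and d: "\<delta> > 0" and t: "t \<ge> 0"
  shows "(norm (window (cutoff \<delta>) u t \<xi>))\<^sup>2 \<le> 4 * exp (- \<rho> \<xi> * t) * (norm (window (cutoff \<delta>) u 0 \<xi>))\<^sup>2
    + C * integral {0..t} (\<lambda>s. remainder \<delta> u s \<xi>)"
proof -
  have D: "((\<lambda>r. window (cutoff \<delta>) u r \<xi>) has_vector_derivative
     (- cvec (\<i> * complex_of_real \<xi>) (mat_app A (window (cutoff \<delta>) u s \<xi>)) - mat_app L (window (cutoff \<delta>) u s \<xi>)
        + mat_app A (window (cutoff' \<delta>) u s \<xi>))) (at s within {0..})" if s: "s \<ge> 0" for s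
  proof -
    have m: "max 0 s = s" using s by simp
    show ?thesis unfolding window_def[of _ u s] m
    proof (rule has_vector_derivative_transform[OF _ _ truncated_ode[OF p sol d s]])
      show "s \<in> {0..}" using s by simp
      show "window (cutoff \<delta>) u r \<xi> = fourier (\<lambda>x. cutoff \<delta> x *\<^sub>R u r x) \<xi>" if "r \<in> {0..}" for r
        using that by (simp add: window_def max_def)
    qed
  qed
  show ?thesis
    unfolding remainder_def
    by (rule F[unfolded forced_estimate_def, rule_format, OF d t D windows_continuous(4)[OF p sol d]])
qed

lemma cutoff_tendsto_1: "d \<longlonglongrightarrow> 0 \<Longrightarrow> (\<lambda>n. cutoff (d n) x) \<longlonglongrightarrow> 1"
proof -
  assume d: "d \<longlonglongrightarrow> 0"
  have "(\<lambda>n. (max 0 (1 - (d n * x)\<^sup>2))\<^sup>2) \<longlonglongrightarrow> (max 0 (1 - (0 * x)\<^sup>2))\<^sup>2" by (intro tendsto_intros d)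
  then show ?thesis by (simp add: cutoff_def)
qed

lemma fourier_cutoff_tendsto:
  fixes v :: "real \<Rightarrow> real ^ 'n"
  assumes v: "integrable lborel v" and d: "d \<longlonglongrightarrow> 0"
  shows "(\<lambda>n. fourier (\<lambda>x. cutoff (d n) x *\<^sub>R v x) \<xi>) \<longlonglongrightarrow> fourier v \<xi>"
proof (rule vec_tendstoI)
  fix i
  have vi [measurable]: "integrable lborel (\<lambda>x. v x $ i)" by (rule component_integrable[OF v])
  have [measurable]: "(\<lambda>x. v x $ i) \<in> borel_measurable borel" using vi by auto
  have [measurable]: "(\<lambda>x. cis (- (x * \<xi>))) \<in> borel_measurable borel"
    by (rule measurable_compose[OF _ cis_measurable]) simp
  show "(\<lambda>n. fourier (\<lambda>x. cutoff (d n) x *\<^sub>R v x) \<xi> $ i) \<longlonglongrightarrow> fourier v \<xi> $ i"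
    unfolding fourier_nth ft_def vector_scaleR_component
  proof (rule integral_dominated_convergence[where w = "\<lambda>x. \<bar>v x $ i\<bar>"])
    show "AE x in lborel. (\<lambda>n. cis (- (x * \<xi>)) * complex_of_real (cutoff (d n) x *\<^sub>R v x $ i))
        \<longlonglongrightarrow> cis (- (x * \<xi>)) * complex_of_real (v x $ i)"
    proof (rule AE_I2)
      fix x
      have "(\<lambda>n. cutoff (d n) x *\<^sub>R v x $ i) \<longlonglongrightarrow> 1 *\<^sub>R v x $ i"
        by (intro tendsto_scaleR tendsto_const cutoff_tendsto_1 d)
      then show "(\<lambda>n. cis (- (x * \<xi>)) * complex_of_real (cutoff (d n) x *\<^sub>R v x $ i))
        \<longlonglongrightarrow> cis (- (x * \<xi>)) * complex_of_real (v x $ i)"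
        by (intro tendsto_mult tendsto_const tendsto_of_real) simp
    qed
    show "AE x in lborel. norm (cis (- (x * \<xi>)) * complex_of_real (cutoff (d n) x *\<^sub>R v x $ i)) \<le> \<bar>v x $ i\<bar>" for n
    proof (rule AE_I2)
      fix x
      have "\<bar>cutoff (d n) x\<bar> * \<bar>v x $ i\<bar> \<le> 1 * \<bar>v x $ i\<bar>" by (intro mult_right_mono cutoff_bounds) simp
      then show "norm (cis (- (x * \<xi>)) * complex_of_real (cutoff (d n) x *\<^sub>R v x $ i)) \<le> \<bar>v x $ i\<bar>"
        by (simp add: norm_mult)
    qed
    show "integrable lborel (\<lambda>x. \<bar>v x $ i\<bar>)" using vi by simp
  qed measurable
qed

lemma fourier_cong_AE:
  fixes f g :: "real \<Rightarrow> real ^ 'n"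
  assumes f: "f \<in> borel_measurable lborel" and g: "g \<in> borel_measurable lborel" and ae: "AE x in lborel. f x = g x"
  shows "fourier f \<xi> = fourier g \<xi>"
proof -
  have [measurable]: "(\<lambda>x. cis (- (x * \<xi>))) \<in> borel_measurable borel"
    by (rule measurable_compose[OF _ cis_measurable]) simp
  have "ft (\<lambda>x. f x $ i) \<xi> = ft (\<lambda>x. g x $ i) \<xi>" for i
  proof -
    have [measurable]: "(\<lambda>x. f x $ i) \<in> borel_measurable borel" "(\<lambda>x. g x $ i) \<in> borel_measurable borel"
      using component_measurable[OF f, of i] component_measurable[OF g, of i] by simp_all
    show ?thesis unfolding ft_def
    proof (rule integral_cong_AE)
      show "AE x in lborel. cis (- (x * \<xi>)) * complex_of_real (f x $ i) = cis (- (x * \<xi>)) * complex_of_real (g x $ i)"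
        using ae by eventually_elim simp
    qed measurable
  qed
  then show ?thesis by (simp add: vec_eq_iff fourier_nth)
qed

text \<open>
  At a fixed frequency, the truncated solution is bounded by a constant times the
  \<open>L^1\<close> norm, and the forcing term by \<open>4 \<delta>\<close> times that; so the
  remainder, integrated over \<open>[0, t]\<close>, is of size \<open>\<delta>\<close>.
\<close>

theorem pointwise_L1:
  fixes u :: "real \<Rightarrow> real \<Rightarrow> real ^ 'n"
  assumes sol: "cauchy_solution 1 A L u0 u" and F: "forced_estimate A L C \<rho>" and C: "C > 0" and t: "t \<ge> 0"
  shows "(norm (fourier (u t) \<xi>))\<^sup>2 \<le> 4 * exp (- \<rho> \<xi> * t) * (norm (fourier u0 \<xi>))\<^sup>2"
proof -
  have p: "(1::real) = 1 \<or> (1::real) = 2" by simp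
  have uL: "integrable lborel (u s)" if "s \<ge> 0" for s
    using sol that unfolding cauchy_solution_def by (simp add: in_L1_iff)
  have u0L: "integrable lborel u0" and u00: "AE x in lborel. u 0 x = u0 x"
    using sol unfolding cauchy_solution_def by (simp_all add: in_L1_iff)
  have u00': "fourier (u 0) \<xi> = fourier u0 \<xi>"
    by (rule fourier_cong_AE[OF _ _ u00]) (use uL[of 0] u0L in auto)
  obtain S where S0: "S \<ge> 0" and S: "\<And>s. s \<in> {0..t} \<Longrightarrow> Lp_norm 1 (u s) \<le> S"
    using solution_norm_bounded[OF p sol, of t] by blast
  define d where "d n = 1 / real (Suc n)" for n
  have d: "d n > 0" for n by (simp add: d_def)
  have d0: "d \<longlonglongrightarrow> 0" unfolding d_def[abs_def] by (rule lim_inverse_n'[THEN LIMSEQ_Suc, unfolded One_nat_def])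
  define N where "N = real CARD('n)"
  have N0: "0 \<le> N" by (simp add: N_def)
  have wb: "norm (window \<theta> u s \<xi>) \<le> N * (B * S)"
    if \<theta>: "\<theta> \<in> borel_measurable borel" "\<And>x. \<bar>\<theta> x\<bar> \<le> B" and s: "s \<in> {0..t}" for \<theta> B s
  proof -
    have m: "max 0 s = s" using s by simp
    have us: "integrable lborel (u s)" using s by (intro uL) simp
    have [measurable]: "u s \<in> borel_measurable borel" "\<theta> \<in> borel_measurable borel" using us \<theta> by auto
    have B0: "0 \<le> B" using \<theta>(2)[of 0] by linarith
    have b: "norm (\<theta> x *\<^sub>R u s x) \<le> B * norm (u s x)" for x
      unfolding norm_scaleR by (rule mult_right_mono[OF \<theta>(2)]) simp
    have int: "integrable lborel (\<lambda>x. \<theta> x *\<^sub>R u s x)"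
    proof (rule Bochner_Integration.integrable_bound[where f = "\<lambda>x. B * norm (u s x)"])
      show "integrable lborel (\<lambda>x. B * norm (u s x))" using us by simp
      show "AE x in lborel. norm (\<theta> x *\<^sub>R u s x) \<le> norm (B * norm (u s x))"
        by (rule AE_I2, rule order_trans[OF b]) (simp only: real_norm_def abs_ge_self)
    qed measurable
    have "norm (window \<theta> u s \<xi>) \<le> N * (\<integral>x. norm (\<theta> x *\<^sub>R u s x) \<partial>lborel)"
      unfolding window_def m N_def by (rule norm_fourier_le[OF int])
    also have "\<dots> \<le> N * (\<integral>x. B * norm (u s x) \<partial>lborel)"
      by (intro mult_left_mono integral_mono integrable_norm int b N0) (use us in simp)
    also have "\<dots> = N * (B * Lp_norm 1 (u s))" by (simp add: Lp_norm_1)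
    also have "\<dots> \<le> N * (B * S)" by (intro mult_left_mono S s B0 N0)
    finally show ?thesis .
  qed
  have rb: "integral {0..t} (\<lambda>s. remainder (d n) u s \<xi>) \<le> 17 * (N * S)\<^sup>2 * t * d n" for n
  proof -
    have "remainder (d n) u s \<xi> \<le> 17 * (N * S)\<^sup>2 * d n" if s: "s \<in> {0..t}" for s
    proof -
      have 1: "(norm (window (cutoff (d n)) u s \<xi>))\<^sup>2 \<le> (N * (1 * S))\<^sup>2"
        by (intro power_mono wb cutoff_measurable cutoff_bounds s) simp
      have 2: "(norm (window (cutoff' (d n)) u s \<xi>))\<^sup>2 \<le> (N * (4 * d n * S))\<^sup>2"
        by (intro power_mono wb cutoff_measurable cutoff'_bound d s) simp
      have "remainder (d n) u s \<xi> \<le> d n * (N * (1 * S))\<^sup>2 + (N * (4 * d n * S))\<^sup>2 / d n"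
        unfolding remainder_def using d[of n] by (intro add_mono mult_left_mono divide_right_mono 1 2) auto
      also have "\<dots> = 17 * (N * S)\<^sup>2 * d n" using d[of n] by (simp add: field_simps power2_eq_square)
      finally show ?thesis .
    qed
    then have "integral {0..t} (\<lambda>s. remainder (d n) u s \<xi>) \<le> integral {0..t} (\<lambda>s. 17 * (N * S)\<^sup>2 * d n)"
      by (intro integral_le integrable_continuous_real windows_continuous(5)[OF p sol d] continuous_on_const)
    also have "\<dots> = 17 * (N * S)\<^sup>2 * t * d n" using t by simp
    finally show ?thesis .
  qed
  have b: "(norm (fourier (\<lambda>x. cutoff (d n) x *\<^sub>R u t x) \<xi>))\<^sup>2
     \<le> 4 * exp (- \<rho> \<xi> * t) * (norm (fourier (\<lambda>x. cutoff (d n) x *\<^sub>R u 0 x) \<xi>))\<^sup>2 + C * (17 * (N * S)\<^sup>2 * t * d n)" for n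
  proof -
    have m: "max 0 t = t" "max 0 0 = (0::real)" using t by simp_all
    have "C * integral {0..t} (\<lambda>s. remainder (d n) u s \<xi>) \<le> C * (17 * (N * S)\<^sup>2 * t * d n)"
      using C by (intro mult_left_mono rb) simp
    with truncated_estimate[OF p sol F d[of n] t, of \<xi>] show ?thesis unfolding window_def m by linarith
  qed
  have l1: "(\<lambda>n. (norm (fourier (\<lambda>x. cutoff (d n) x *\<^sub>R u t x) \<xi>))\<^sup>2) \<longlonglongrightarrow> (norm (fourier (u t) \<xi>))\<^sup>2"
    by (intro tendsto_intros fourier_cutoff_tendsto uL t d0)
  have "(\<lambda>n. 4 * exp (- \<rho> \<xi> * t) * (norm (fourier (\<lambda>x. cutoff (d n) x *\<^sub>R u 0 x) \<xi>))\<^sup>2 + C * (17 * (N * S)\<^sup>2 * t * d n))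
     \<longlonglongrightarrow> 4 * exp (- \<rho> \<xi> * t) * (norm (fourier (u 0) \<xi>))\<^sup>2 + C * (17 * (N * S)\<^sup>2 * t * 0)"
    by (intro tendsto_add tendsto_mult tendsto_const tendsto_power tendsto_norm fourier_cutoff_tendsto uL d0) simp
  from LIMSEQ_le[OF l1 this] b u00' show ?thesis by auto
qed

text \<open>
  Here the remainder is of size \<open>\<delta>\<close> after integration in the frequency, by
  the Plancherel identity.  Along a subsequence the remainder, the truncated solution at time
  \<open>t\<close> and the truncated datum converge almost everywhere at once.
\<close>

theorem pointwise_L2:
  fixes u :: "real \<Rightarrow> real \<Rightarrow> real ^ 'n"
  assumes sol: "cauchy_solution 2 A L u0 u" and F: "forced_estimate A L C \<rho>" and C: "C > 0" and t: "t \<ge> 0"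
  shows "AE \<xi> in lborel. (norm (fourier_L2 (u t) \<xi>))\<^sup>2 \<le> 4 * exp (- \<rho> \<xi> * t) * (norm (fourier_L2 u0 \<xi>))\<^sup>2"
proof -
  have p: "(2::real) = 1 \<or> (2::real) = 2" by simp
  have uL: "in_Lp 2 (u s)" if "s \<ge> 0" for s
    using sol that unfolding cauchy_solution_def by simp
  have u0L: "in_Lp 2 u0" and u00: "AE x in lborel. u 0 x = u0 x"
    using sol unfolding cauchy_solution_def by simp_all
  obtain S where S0: "S \<ge> 0" and S: "\<And>s. s \<in> {0..t} \<Longrightarrow> Lp_norm 2 (u s) \<le> S"
    using solution_norm_bounded[OF p sol, of t] by blast
  define d where "d n = 1 / real (Suc n)" for n
  have d: "d n > 0" for n by (simp add: d_def)
  have d0: "d \<longlonglongrightarrow> 0" unfolding d_def[abs_def] by (rule lim_inverse_n'[THEN LIMSEQ_Suc, unfolded One_nat_def])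
  define I where "I n \<xi> = integral {0..t} (\<lambda>s. remainder (d n) u s \<xi>)" for n \<xi>
  have R: "integrable lborel (remainder (d n) u s)" "(\<integral>\<xi>. remainder (d n) u s \<xi> \<partial>lborel) \<le> 34 * pi * S\<^sup>2 * d n"
    if s: "s \<in> {0..t}" for n s
  proof -
    have m: "max 0 s = s" using s by simp
    have us: "in_Lp 2 (u s)" using s by (intro uL) simp
    note i = cutoff_L2[OF us d[of n]]
    have c: "Lp_norm 2 (\<lambda>x. cutoff (d n) x *\<^sub>R u s x) \<le> S"
    proof -
      have "Lp_norm 2 (\<lambda>x. cutoff (d n) x *\<^sub>R u s x) \<le> Lp_norm 2 (u s)"
      proof (rule Lp_norm_2_mono[OF us])
        show "(\<lambda>x. cutoff (d n) x *\<^sub>R u s x) \<in> borel_measurable lborel" by (rule L2_measurable[OF i(3)])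
        show "norm (cutoff (d n) x *\<^sub>R u s x) \<le> norm (u s x)" for x
          using mult_right_mono[OF cutoff_bounds(3)[of "d n" x], of "norm (u s x)"] by simp
      qed
      also have "\<dots> \<le> S" by (rule S[OF s])
      finally show ?thesis .
    qed
    have c': "Lp_norm 2 (\<lambda>x. cutoff' (d n) x *\<^sub>R u s x) \<le> 4 * d n * S"
    proof -
      have "Lp_norm 2 (\<lambda>x. cutoff' (d n) x *\<^sub>R u s x) \<le> 4 * d n * Lp_norm 2 (u s)" by (rule cutoff'_L2_norm[OF us d])
      also have "\<dots> \<le> 4 * d n * S" using d[of n] by (intro mult_left_mono S s) simp
      finally show ?thesis .
    qed
    have Y: "in_Lp 2 (window (cutoff (d n)) u s)" "(\<integral>\<xi>. (norm (window (cutoff (d n)) u s \<xi>))\<^sup>2 \<partial>lborel) \<le> 2 * pi * S\<^sup>2"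
    proof -
      have e: "window (cutoff (d n)) u s = fourier (\<lambda>x. cutoff (d n) x *\<^sub>R u s x)" by (simp add: fun_eq_iff window_def m)
      show "in_Lp 2 (window (cutoff (d n)) u s)" unfolding e by (rule plancherel(1)[OF i(1,3)])
      show "(\<integral>\<xi>. (norm (window (cutoff (d n)) u s \<xi>))\<^sup>2 \<partial>lborel) \<le> 2 * pi * S\<^sup>2"
        unfolding e Lp_norm_2_sq[symmetric] plancherel(2)[OF i(1,3)] power_mult_distrib
        using power_mono[OF c, of 2] by simp
    qed
    have E: "in_Lp 2 (window (cutoff' (d n)) u s)" "(\<integral>\<xi>. (norm (window (cutoff' (d n)) u s \<xi>))\<^sup>2 \<partial>lborel) \<le> 2 * pi * (4 * d n * S)\<^sup>2"
    proof -
      have e: "window (cutoff' (d n)) u s = fourier (\<lambda>x. cutoff' (d n) x *\<^sub>R u s x)" by (simp add: fun_eq_iff window_def m)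
      show "in_Lp 2 (window (cutoff' (d n)) u s)" unfolding e by (rule plancherel(1)[OF i(2,4)])
      have "(Lp_norm 2 (\<lambda>x. cutoff' (d n) x *\<^sub>R u s x))\<^sup>2 \<le> (4 * d n * S)\<^sup>2" by (intro power_mono c') simp
      then show "(\<integral>\<xi>. (norm (window (cutoff' (d n)) u s \<xi>))\<^sup>2 \<partial>lborel) \<le> 2 * pi * (4 * d n * S)\<^sup>2"
        unfolding e Lp_norm_2_sq[symmetric] plancherel(2)[OF i(2,4)] power_mult_distrib[of "sqrt (2 * pi)"] by simp
    qed
    have iY: "integrable lborel (\<lambda>\<xi>. d n * (norm (window (cutoff (d n)) u s \<xi>))\<^sup>2)"
      and iE: "integrable lborel (\<lambda>\<xi>. (norm (window (cutoff' (d n)) u s \<xi>))\<^sup>2 / d n)"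
      using Y(1) E(1) by (simp_all add: in_L2_iff)
    show "integrable lborel (remainder (d n) u s)"
      unfolding remainder_def[abs_def] by (intro Bochner_Integration.integrable_add iY iE)
    have "(\<integral>\<xi>. remainder (d n) u s \<xi> \<partial>lborel)
       = d n * (\<integral>\<xi>. (norm (window (cutoff (d n)) u s \<xi>))\<^sup>2 \<partial>lborel) + (\<integral>\<xi>. (norm (window (cutoff' (d n)) u s \<xi>))\<^sup>2 \<partial>lborel) / d n"
      unfolding remainder_def Bochner_Integration.integral_add[OF iY iE] by simp
    also have "\<dots> \<le> d n * (2 * pi * S\<^sup>2) + 2 * pi * (4 * d n * S)\<^sup>2 / d n"
      using d[of n] by (intro add_mono mult_left_mono divide_right_mono Y(2) E(2)) auto
    also have "\<dots> = 34 * pi * S\<^sup>2 * d n" using d[of n] by (simp add: field_simps power2_eq_square)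
    finally show "(\<integral>\<xi>. remainder (d n) u s \<xi> \<partial>lborel) \<le> 34 * pi * S\<^sup>2 * d n" .
  qed
  note P = integral_in_parameter_L1[OF windows_continuous(3)[OF p sol d] remainder_nonneg[OF d] t R, folded I_def]
  have "(\<lambda>n. \<integral>\<xi>. norm (I n \<xi>) \<partial>lborel) \<longlonglongrightarrow> 0"
  proof (rule tendsto_sandwich[where f = "\<lambda>_. 0" and h = "\<lambda>n. 34 * pi * S\<^sup>2 * d n * t"])
    show "\<forall>\<^sub>F n in sequentially. (\<integral>\<xi>. norm (I n \<xi>) \<partial>lborel) \<le> 34 * pi * S\<^sup>2 * d n * t"
      using P(2,3) by (intro always_eventually allI) simp
    have "(\<lambda>n. 34 * pi * S\<^sup>2 * d n * t) \<longlonglongrightarrow> 34 * pi * S\<^sup>2 * 0 * t" by (intro tendsto_intros d0)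
    then show "(\<lambda>n. 34 * pi * S\<^sup>2 * d n * t) \<longlonglongrightarrow> 0" by simp
  qed simp_all
  from tendsto_L1_AE_subseq[OF P(1) this] obtain r1 where r1: "strict_mono r1"
    and c1: "AE \<xi> in lborel. (\<lambda>n. I (r1 n) \<xi>) \<longlonglongrightarrow> 0" by blast
  define Y where "Y n \<xi> = fourier (\<lambda>x. cutoff (d n) x *\<^sub>R u t x) \<xi>" for n \<xi>
  define Z where "Z n \<xi> = fourier (\<lambda>x. cutoff (d n) x *\<^sub>R u0 x) \<xi>" for n \<xi>
  have L2lim: "in_Lp 2 (fourier (\<lambda>x. cutoff (d n) x *\<^sub>R v x))"
    "(\<lambda>n. Lp_norm 2 (\<lambda>\<xi>. fourier (\<lambda>x. cutoff (d n) x *\<^sub>R v x) \<xi> - fourier_L2 v \<xi>)) \<longlonglongrightarrow> 0"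
    if v: "in_Lp 2 v" for v :: "real \<Rightarrow> real ^ 'n" and n
  proof -
    note i = cutoff_L2[OF v d]
    show "in_Lp 2 (fourier (\<lambda>x. cutoff (d n) x *\<^sub>R v x))" by (rule plancherel(1)[OF i(1,3)])
    have "(\<lambda>n. sqrt (2 * pi) * Lp_norm 2 (\<lambda>x. cutoff (d n) x *\<^sub>R v x - v x)) \<longlonglongrightarrow> sqrt (2 * pi) * 0"
      by (intro tendsto_mult tendsto_const cutoff_L2_tendsto v d0)
    then show "(\<lambda>n. Lp_norm 2 (\<lambda>\<xi>. fourier (\<lambda>x. cutoff (d n) x *\<^sub>R v x) \<xi> - fourier_L2 v \<xi>)) \<longlonglongrightarrow> 0"
      unfolding fourier_L2_dist_fourier[OF v i(1,3)] by simp
  qed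
  have Yc: "(\<lambda>n. Lp_norm 2 (\<lambda>\<xi>. Y (r1 n) \<xi> - fourier_L2 (u t) \<xi>)) \<longlonglongrightarrow> 0"
    using LIMSEQ_subseq_LIMSEQ[OF L2lim(2)[OF uL[OF t]] r1] by (simp add: Y_def o_def)
  have YL: "in_Lp 2 (Y n)" for n using L2lim(1)[OF uL[OF t], of n] by (simp add: Y_def[abs_def])
  obtain r2 where r2: "strict_mono r2" and c2: "AE \<xi> in lborel. (\<lambda>n. Y (r1 (r2 n)) \<xi>) \<longlonglongrightarrow> fourier_L2 (u t) \<xi>"
    using L2_AE_subseq[OF YL fourier_L2(1)[OF uL[OF t]] Yc] by blast
  have r12: "strict_mono (r1 \<circ> r2)" by (rule strict_mono_o[OF r1 r2])
  have Zc: "(\<lambda>n. Lp_norm 2 (\<lambda>\<xi>. Z (r1 (r2 n)) \<xi> - fourier_L2 u0 \<xi>)) \<longlonglongrightarrow> 0"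
    using LIMSEQ_subseq_LIMSEQ[OF L2lim(2)[OF u0L] r12] by (simp add: Z_def o_def)
  have ZL: "in_Lp 2 (Z n)" for n using L2lim(1)[OF u0L, of n] by (simp add: Z_def[abs_def])
  obtain r3 where r3: "strict_mono r3" and c3: "AE \<xi> in lborel. (\<lambda>n. Z (r1 (r2 (r3 n))) \<xi>) \<longlonglongrightarrow> fourier_L2 u0 \<xi>"
    using L2_AE_subseq[OF ZL fourier_L2(1)[OF u0L] Zc] by blast
  have r23: "strict_mono (r2 \<circ> r3)" by (rule strict_mono_o[OF r2 r3])
  have b: "(norm (Y n \<xi>))\<^sup>2 \<le> 4 * exp (- \<rho> \<xi> * t) * (norm (Z n \<xi>))\<^sup>2 + C * I n \<xi>" for n \<xi>
  proof -
    have m: "max 0 t = t" "max 0 0 = (0::real)" using t by simp_all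
    have m0: "(\<lambda>x. cutoff (d n) x *\<^sub>R u 0 x) \<in> borel_measurable lborel" "(\<lambda>x. cutoff (d n) x *\<^sub>R u0 x) \<in> borel_measurable lborel"
      using cutoff_L2(1)[OF uL[of 0] d[of n]] cutoff_L2(1)[OF u0L d[of n]]
      by (simp_all add: borel_measurable_integrable)
    have "fourier (\<lambda>x. cutoff (d n) x *\<^sub>R u 0 x) \<xi> = Z n \<xi>"
      unfolding Z_def by (rule fourier_cong_AE[OF m0]) (use u00 in auto)
    then show ?thesis using truncated_estimate[OF p sol F d[of n] t, of \<xi>] unfolding window_def m I_def Y_def by simp
  qed
  \<comment> \<open>the subsequences are nested, so that all three limits hold along the last one\<close>
  show ?thesis using c1 c2 c3
  proof eventually_elim
    case (elim \<xi>)
    have l1: "(\<lambda>n. I (r1 (r2 (r3 n))) \<xi>) \<longlonglongrightarrow> 0"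
      using LIMSEQ_subseq_LIMSEQ[OF elim(1) r23] by (simp add: o_def)
    have l2: "(\<lambda>n. Y (r1 (r2 (r3 n))) \<xi>) \<longlonglongrightarrow> fourier_L2 (u t) \<xi>"
      using LIMSEQ_subseq_LIMSEQ[OF elim(2) r3] by (simp add: o_def)
    have "(norm (fourier_L2 (u t) \<xi>))\<^sup>2 \<le> 4 * exp (- \<rho> \<xi> * t) * (norm (fourier_L2 u0 \<xi>))\<^sup>2 + C * 0"
      by (rule LIMSEQ_le[OF tendsto_power[OF tendsto_norm[OF l2]] tendsto_add[OF
            tendsto_mult[OF tendsto_const tendsto_power[OF tendsto_norm[OF elim(3)]]] tendsto_mult[OF tendsto_const l1]]])
        (use b in blast)
    then show ?case by simp
  qed
qed

section \<open>Decay in time\<close>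

lemma rate_low_frequency:
  assumes "even m" "\<bar>\<xi>\<bar> \<le> 1"
  shows "\<bar>\<xi>\<bar> ^ (3 * m - 10) / 2 ^ (2 * (m - 3)) \<le> rate m \<xi>"
proof -
  have e: "\<xi> ^ (3 * m - 10) = \<bar>\<xi>\<bar> ^ (3 * m - 10)" using assms(1) by (simp add: power_even_abs)
  have "\<xi>\<^sup>2 \<le> 1" using power_mono[OF assms(2), of 2] by simp
  then have "(1 + \<xi>\<^sup>2) ^ (2 * (m - 3)) \<le> 2 ^ (2 * (m - 3))" by (intro power_mono) auto
  then show ?thesis unfolding rate_def e
    by (intro divide_left_mono zero_le_power mult_pos_pos zero_less_power) (auto simp: add_pos_nonneg)
qed

lemma rate_high_frequency:
  assumes "even m" "m \<ge> 4" "\<bar>\<xi>\<bar> \<ge> 1"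
  shows "1 / 2 ^ (2 * (m - 3)) / \<bar>\<xi>\<bar> ^ (m - 2) \<le> rate m \<xi>"
proof -
  have e: "\<xi> ^ (3 * m - 10) = \<bar>\<xi>\<bar> ^ (3 * m - 10)" using assms(1) by (simp add: power_even_abs)
  have "1 \<le> \<xi>\<^sup>2" using power_mono[OF assms(3), of 2] by simp
  then have "(1 + \<xi>\<^sup>2) ^ (2 * (m - 3)) \<le> (2 * \<xi>\<^sup>2) ^ (2 * (m - 3))" by (intro power_mono) auto
  also have "\<dots> = 2 ^ (2 * (m - 3)) * (\<bar>\<xi>\<bar>\<^sup>2) ^ (2 * (m - 3))" by (simp add: power_mult_distrib)
  also have "(\<bar>\<xi>\<bar>\<^sup>2) ^ (2 * (m - 3)) = \<bar>\<xi>\<bar> ^ (3 * m - 10) * \<bar>\<xi>\<bar> ^ (m - 2)"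
    unfolding power_mult[symmetric] power_add[symmetric] using assms(2) by (intro arg_cong[where f = "\<lambda>n. _ ^ n"]) simp
  finally have le: "(1 + \<xi>\<^sup>2) ^ (2 * (m - 3)) \<le> 2 ^ (2 * (m - 3)) * (\<bar>\<xi>\<bar> ^ (3 * m - 10) * \<bar>\<xi>\<bar> ^ (m - 2))" .
  have x: "\<bar>\<xi>\<bar> > 0" using assms(3) by linarith
  have p: "(1 + \<xi>\<^sup>2) ^ (2 * (m - 3)) > 0" by (intro zero_less_power add_pos_nonneg) auto
  have "1 / 2 ^ (2 * (m - 3)) / \<bar>\<xi>\<bar> ^ (m - 2)
      = \<bar>\<xi>\<bar> ^ (3 * m - 10) / (2 ^ (2 * (m - 3)) * (\<bar>\<xi>\<bar> ^ (3 * m - 10) * \<bar>\<xi>\<bar> ^ (m - 2)))"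
    using x by simp
  also have "\<dots> \<le> \<bar>\<xi>\<bar> ^ (3 * m - 10) / (1 + \<xi>\<^sup>2) ^ (2 * (m - 3))"
    using x by (intro divide_left_mono le mult_pos_pos p) auto
  finally show ?thesis unfolding rate_def e .
qed

definition low_profile :: "real \<Rightarrow> nat \<Rightarrow> nat \<Rightarrow> real \<Rightarrow> real" where
  "low_profile \<kappa> N k \<xi> = \<bar>\<xi>\<bar> ^ (2 * k) * exp (- \<kappa> * \<bar>\<xi>\<bar> ^ N)"

text \<open>
  Since \<open>|x| ^ N \<ge> x\<^sup>2 - 1\<close>, the function is dominated by a Gaussian
  moment.
\<close>

lemma low_profile_integrable:
  assumes k: "\<kappa> > 0" and N: "N \<ge> 2"
  shows "integrable lborel (low_profile \<kappa> N k)"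
proof -
  define c where "c = sqrt (2 * \<kappa>)"
  have c: "c > 0" "c\<^sup>2 = 2 * \<kappa>" using k by (simp_all add: c_def)
  have "integrable lborel (\<lambda>x. std_normal_density x * x ^ (2 * k))" by (rule integrable_std_normal_moment)
  from lborel_integrable_real_affine[OF this, of c 0] c(1)
  have "integrable lborel (\<lambda>x. std_normal_density (c * x) * (c * x) ^ (2 * k))" by simp
  then have i: "integrable lborel (\<lambda>x. (exp \<kappa> * sqrt (2 * pi) / c ^ (2 * k)) * (std_normal_density (c * x) * (c * x) ^ (2 * k)))"
    by simp
  have b: "norm (low_profile \<kappa> N k x) \<le> (exp \<kappa> * sqrt (2 * pi) / c ^ (2 * k)) * (std_normal_density (c * x) * (c * x) ^ (2 * k))" for x
  proof -
    have "\<bar>x\<bar> ^ N \<ge> x\<^sup>2 - 1"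
    proof (cases "\<bar>x\<bar> \<le> 1")
      case True
      then have "x\<^sup>2 \<le> 1" using power_mono[OF True, of 2] by simp
      moreover have "0 \<le> \<bar>x\<bar> ^ N" by simp
      ultimately show ?thesis by linarith
    next
      case False
      then have "\<bar>x\<bar> ^ 2 \<le> \<bar>x\<bar> ^ N" using N by (intro power_increasing) auto
      then show ?thesis by simp
    qed
    then have "\<kappa> * (x\<^sup>2 - 1) \<le> \<kappa> * \<bar>x\<bar> ^ N" using k by (intro mult_left_mono) auto
    then have "- \<kappa> * \<bar>x\<bar> ^ N \<le> \<kappa> + - (c * x)\<^sup>2 / 2" by (simp add: power_mult_distrib c(2) algebra_simps)
    then have "exp (- \<kappa> * \<bar>x\<bar> ^ N) \<le> exp \<kappa> * exp (- (c * x)\<^sup>2 / 2)" unfolding exp_add[symmetric] by simp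
    then have "\<bar>x\<bar> ^ (2 * k) * exp (- \<kappa> * \<bar>x\<bar> ^ N) \<le> \<bar>x\<bar> ^ (2 * k) * (exp \<kappa> * exp (- (c * x)\<^sup>2 / 2))"
      by (intro mult_left_mono) auto
    also have "\<dots> = (exp \<kappa> * sqrt (2 * pi) / c ^ (2 * k)) * (std_normal_density (c * x) * (c * x) ^ (2 * k))"
      using c(1) by (simp add: std_normal_density_def power_mult_distrib power_even_abs)
    finally show ?thesis by (simp add: low_profile_def)
  qed
  show ?thesis
  proof (rule Bochner_Integration.integrable_bound[OF i])
    show "low_profile \<kappa> N k \<in> borel_measurable lborel" unfolding low_profile_def[abs_def] by measurable
    show "AE x in lborel. norm (low_profile \<kappa> N k x)
        \<le> norm ((exp \<kappa> * sqrt (2 * pi) / c ^ (2 * k)) * (std_normal_density (c * x) * (c * x) ^ (2 * k)))"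
      by (rule AE_I2, rule order_trans[OF b]) (simp only: real_norm_def abs_ge_self)
  qed
qed

text \<open>
  Substitute \<open>\<xi> = \<tau> powr (- 1 / N) * \<eta>\<close>.
\<close>

lemma low_profile_scaling:
  assumes k: "\<kappa> > 0" and N: "N \<ge> 2" and \<tau>: "\<tau> \<ge> 1"
  shows "integrable lborel (low_profile (\<kappa> * \<tau>) N k)"
    "(\<integral>\<xi>. low_profile (\<kappa> * \<tau>) N k \<xi> \<partial>lborel)
       = \<tau> powr (- (1 / real N) * (1 + 2 * real k)) * (\<integral>\<xi>. low_profile \<kappa> N k \<xi> \<partial>lborel)"
proof -
  show "integrable lborel (low_profile (\<kappa> * \<tau>) N k)" by (rule low_profile_integrable) (use k \<tau> N in auto)
  define c where "c = \<tau> powr (- (1 / real N))"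
  have c: "c > 0" using \<tau> by (simp add: c_def)
  have cN: "c ^ N = 1 / \<tau>"
  proof -
    have "c ^ N = \<tau> powr (- (1 / real N) * real N)" unfolding c_def powr_powr[symmetric] by (rule powr_realpow[symmetric]) (use \<tau> in simp)
    also have "- (1 / real N) * real N = -1" using N by simp
    finally show ?thesis using \<tau> by (simp add: powr_minus_divide)
  qed
  have ck: "c * c ^ (2 * k) = \<tau> powr (- (1 / real N) * (1 + 2 * real k))"
  proof -
    have "c * c ^ (2 * k) = c ^ (1 + 2 * k)" by simp
    also have "\<dots> = \<tau> powr (- (1 / real N) * real (1 + 2 * k))"
      unfolding c_def powr_powr[symmetric] by (rule powr_realpow[symmetric]) (use \<tau> in simp)
    finally show ?thesis by simp
  qed
  have s: "low_profile (\<kappa> * \<tau>) N k (0 + c * x) = c ^ (2 * k) * low_profile \<kappa> N k x" for x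
    using c \<tau> by (simp add: low_profile_def abs_mult power_mult_distrib cN)
  have "(\<integral>\<xi>. low_profile (\<kappa> * \<tau>) N k \<xi> \<partial>lborel) = \<bar>c\<bar> *\<^sub>R (\<integral>x. low_profile (\<kappa> * \<tau>) N k (0 + c * x) \<partial>lborel)"
    using c by (intro lborel_integral_real_affine) simp
  also have "\<dots> = c * c ^ (2 * k) * (\<integral>\<xi>. low_profile \<kappa> N k \<xi> \<partial>lborel)" unfolding s using c by simp
  finally show "(\<integral>\<xi>. low_profile (\<kappa> * \<tau>) N k \<xi> \<partial>lborel)
       = \<tau> powr (- (1 / real N) * (1 + 2 * real k)) * (\<integral>\<xi>. low_profile \<kappa> N k \<xi> \<partial>lborel)" unfolding ck .
qed

lemma powr_exp_bounded:
  fixes z r \<kappa> :: real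
  assumes z: "z > 0" and \<kappa>: "\<kappa> > 0" and r: "0 \<le> r" "r \<le> real n"
  shows "z powr r * exp (- \<kappa> * z) \<le> 1 + fact n / \<kappa> ^ n"
proof -
  have pz: "z ^ n \<le> fact n / \<kappa> ^ n * exp (\<kappa> * z)"
  proof -
    have "(\<Sum>i\<in>{n}. (\<kappa> * z) ^ i /\<^sub>R fact i) \<le> exp (\<kappa> * z)"
      unfolding exp_def using \<kappa> z by (intro sum_le_suminf summable_exp_generic) auto
    then have "(\<kappa> * z) ^ n \<le> exp (\<kappa> * z) * fact n" by (simp add: field_simps)
    then show ?thesis using \<kappa> by (simp add: field_simps power_mult_distrib)
  qed
  have "z powr r \<le> 1 + z ^ n"
  proof (cases "z \<le> 1")
    case True
    then have "z powr r \<le> 1" using z r by (simp add: powr_le1)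
    then show ?thesis using z by (simp add: add_increasing2)
  next
    case False
    then have "z powr r \<le> z powr real n" using r by (intro powr_mono) auto
    then show ?thesis using z by (simp add: powr_realpow)
  qed
  also have "\<dots> \<le> exp (\<kappa> * z) + fact n / \<kappa> ^ n * exp (\<kappa> * z)" using pz \<kappa> z by (intro add_mono) auto
  finally have "z powr r * exp (- \<kappa> * z) \<le> (exp (\<kappa> * z) + fact n / \<kappa> ^ n * exp (\<kappa> * z)) * exp (- \<kappa> * z)"
    by (intro mult_right_mono) auto
  also have "\<dots> = 1 + fact n / \<kappa> ^ n" by (simp add: exp_minus field_simps)
  finally show ?thesis .
qed

definition high_const :: "real \<Rightarrow> nat \<Rightarrow> real" where
  "high_const \<kappa> l = exp \<kappa> * (1 + fact (2 * l) / \<kappa> ^ (2 * l))"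

text \<open>
  With \<open>z = (1 + t) / x ^ q\<close> the exponential is at most a constant times
  \<open>z powr (- 2 l / q)\<close>; so a power of \<open>1 + t\<close> is gained at the price
  of a power of \<open>x\<close>.
\<close>

lemma high_frequency_decay:
  fixes x t \<kappa> :: real
  assumes x: "x \<ge> 1" and t: "t \<ge> 0" and \<kappa>: "\<kappa> > 0" and q: "q \<ge> 1"
  shows "exp (- (\<kappa> / x ^ q) * t) \<le> high_const \<kappa> l * (1 + t) powr (- (2 * real l / real q)) * x ^ (2 * l)"
proof -
  define r where "r = 2 * real l / real q"
  have r: "0 \<le> r" "r \<le> real (2 * l)" using q by (simp_all add: r_def field_simps mult_mono mult_le_cancel_left1)
  define z where "z = (1 + t) / x ^ q"
  have x0: "x > 0" using x by simp
  have z: "z > 0" using x0 t by (simp add: z_def)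
  have zr: "z powr r = (1 + t) powr r / x ^ (2 * l)"
  proof -
    have "z powr r = (1 + t) powr r / (x ^ q) powr r" unfolding z_def by (rule powr_divide)
    also have "(x ^ q) powr r = x powr (real q * r)" using x0 by (simp add: powr_realpow[symmetric] powr_powr)
    also have "real q * r = real (2 * l)" using q by (simp add: r_def)
    also have "x powr real (2 * l) = x ^ (2 * l)" using x0 by (rule powr_realpow)
    finally show ?thesis .
  qed
  have "\<kappa> * z = \<kappa> / x ^ q + \<kappa> / x ^ q * t" by (simp add: z_def distrib_left add_divide_distrib)
  moreover have "\<kappa> / x ^ q \<le> \<kappa>" using \<kappa> x by (simp add: divide_le_eq mult_le_cancel_left1 one_le_power)
  ultimately have "- (\<kappa> / x ^ q) * t \<le> \<kappa> + - \<kappa> * z" by linarith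
  then have "exp (- (\<kappa> / x ^ q) * t) \<le> exp \<kappa> * exp (- \<kappa> * z)" unfolding exp_add[symmetric] by simp
  moreover have "exp \<kappa> * (z powr r * exp (- \<kappa> * z)) \<le> high_const \<kappa> l"
    unfolding high_const_def by (intro mult_left_mono powr_exp_bounded z \<kappa> r) simp
  ultimately have "z powr r * exp (- (\<kappa> / x ^ q) * t) \<le> high_const \<kappa> l"
    using mult_left_mono[of "exp (- (\<kappa> / x ^ q) * t)" "exp \<kappa> * exp (- \<kappa> * z)" "z powr r"]
    by (simp add: mult.left_commute)
  then have "exp (- (\<kappa> / x ^ q) * t) \<le> high_const \<kappa> l / z powr r"
    using z by (simp add: pos_le_divide_eq mult.commute)
  also have "\<dots> = high_const \<kappa> l * (1 + t) powr (- r) * x ^ (2 * l)"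
    unfolding zr using x0 t by (simp add: powr_minus_divide)
  finally show ?thesis unfolding r_def .
qed

text \<open>
  The profile at low frequency uses \<open>1 + t\<close> instead of \<open>t\<close>, which
  costs the bounded factor \<open>exp \<kappa>\<close> for \<open>|\<xi>| \<le> 1\<close> and
  avoids the singularity of the powers at \<open>t = 0\<close>.
\<close>

lemma moment_decay_pointwise:
  assumes ev: "even m" and m4: "m \<ge> 4" and c: "c > 0" and t: "t \<ge> 0"
    and W: "W \<le> 4 * exp (- (c * rate m \<xi>) * t) * w\<^sup>2" and w: "0 \<le> w" "w \<le> M"
    and \<kappa>: "\<kappa> = c / 2 ^ (2 * (m - 3))"
  shows "\<bar>\<xi>\<bar> ^ (2 * k) * W \<le> 4 * exp \<kappa> * M\<^sup>2 * low_profile (\<kappa> * (1 + t)) (3 * m - 10) k \<xi>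
    + 4 * high_const \<kappa> l * (1 + t) powr (- (2 * real l / real (m - 2))) * (\<bar>\<xi>\<bar> ^ (2 * (k + l)) * w\<^sup>2)"
proof -
  have \<kappa>0: "\<kappa> > 0" using c \<kappa> by simp
  have h0: "0 \<le> high_const \<kappa> l" using \<kappa>0 by (simp add: high_const_def)
  have wM: "w\<^sup>2 \<le> M\<^sup>2" using w by (intro power_mono) auto
  have "\<bar>\<xi>\<bar> ^ (2 * k) * W \<le> \<bar>\<xi>\<bar> ^ (2 * k) * (4 * exp (- (c * rate m \<xi>) * t) * w\<^sup>2)" by (intro mult_left_mono W) simp
  also have "\<dots> \<le> 4 * exp \<kappa> * M\<^sup>2 * low_profile (\<kappa> * (1 + t)) (3 * m - 10) k \<xi>
    + 4 * high_const \<kappa> l * (1 + t) powr (- (2 * real l / real (m - 2))) * (\<bar>\<xi>\<bar> ^ (2 * (k + l)) * w\<^sup>2)"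
  proof (cases "\<bar>\<xi>\<bar> \<le> 1")
    case True
    define y where "y = \<bar>\<xi>\<bar> ^ (3 * m - 10)"
    have y: "0 \<le> y" "y \<le> 1" using True by (simp_all add: y_def power_le_one)
    have "\<kappa> * y \<le> c * rate m \<xi>"
      using mult_left_mono[OF rate_low_frequency[OF ev True], of c] c by (simp add: \<kappa> y_def)
    then have "\<kappa> * y * t \<le> c * rate m \<xi> * t" by (rule mult_right_mono[OF _ t])
    moreover have "\<kappa> * y \<le> \<kappa>" using y \<kappa>0 by simp
    ultimately have "- (c * rate m \<xi>) * t \<le> \<kappa> + - (\<kappa> * (1 + t)) * y" by (simp add: algebra_simps)
    then have "exp (- (c * rate m \<xi>) * t) \<le> exp \<kappa> * exp (- (\<kappa> * (1 + t)) * y)" unfolding exp_add[symmetric] by simp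
    then have "exp (- (c * rate m \<xi>) * t) * w\<^sup>2 \<le> exp \<kappa> * exp (- (\<kappa> * (1 + t)) * y) * M\<^sup>2"
      by (intro mult_mono wM) auto
    then have "\<bar>\<xi>\<bar> ^ (2 * k) * (4 * (exp (- (c * rate m \<xi>) * t) * w\<^sup>2)) \<le> \<bar>\<xi>\<bar> ^ (2 * k) * (4 * (exp \<kappa> * exp (- (\<kappa> * (1 + t)) * y) * M\<^sup>2))"
      by (intro mult_left_mono) auto
    also have "\<dots> = 4 * exp \<kappa> * M\<^sup>2 * low_profile (\<kappa> * (1 + t)) (3 * m - 10) k \<xi>"
      by (simp add: low_profile_def y_def)
    also have "\<dots> \<le> \<dots> + 4 * high_const \<kappa> l * (1 + t) powr (- (2 * real l / real (m - 2))) * (\<bar>\<xi>\<bar> ^ (2 * (k + l)) * w\<^sup>2)"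
      using h0 by simp
    finally show ?thesis by (simp only: mult.assoc)
  next
    case False
    then have x: "1 \<le> \<bar>\<xi>\<bar>" by simp
    have "\<kappa> / \<bar>\<xi>\<bar> ^ (m - 2) \<le> c * rate m \<xi>"
      using mult_left_mono[OF rate_high_frequency[OF ev m4 x], of c] c by (simp add: \<kappa>)
    then have "\<kappa> / \<bar>\<xi>\<bar> ^ (m - 2) * t \<le> c * rate m \<xi> * t" by (rule mult_right_mono[OF _ t])
    then have "exp (- (c * rate m \<xi>) * t) \<le> exp (- (\<kappa> / \<bar>\<xi>\<bar> ^ (m - 2)) * t)" by simp
    also have "\<dots> \<le> high_const \<kappa> l * (1 + t) powr (- (2 * real l / real (m - 2))) * \<bar>\<xi>\<bar> ^ (2 * l)"
      by (rule high_frequency_decay[OF x t \<kappa>0]) (use m4 in simp)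
    finally have e: "exp (- (c * rate m \<xi>) * t) \<le> high_const \<kappa> l * (1 + t) powr (- (2 * real l / real (m - 2))) * \<bar>\<xi>\<bar> ^ (2 * l)" .
    have "\<bar>\<xi>\<bar> ^ (2 * k) * (4 * exp (- (c * rate m \<xi>) * t) * w\<^sup>2)
        \<le> \<bar>\<xi>\<bar> ^ (2 * k) * (4 * (high_const \<kappa> l * (1 + t) powr (- (2 * real l / real (m - 2))) * \<bar>\<xi>\<bar> ^ (2 * l)) * w\<^sup>2)"
      by (intro mult_left_mono mult_right_mono e) auto
    also have "\<dots> = 4 * high_const \<kappa> l * (1 + t) powr (- (2 * real l / real (m - 2))) * (\<bar>\<xi>\<bar> ^ (2 * (k + l)) * w\<^sup>2)"
      by (simp add: distrib_left power_add)
    also have "\<dots> \<le> 4 * exp \<kappa> * M\<^sup>2 * low_profile (\<kappa> * (1 + t)) (3 * m - 10) k \<xi> + \<dots>"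
      by (simp add: low_profile_def)
    finally show ?thesis .
  qed
  finally show ?thesis .
qed

lemma moment_decay:
  fixes u0 v :: "real \<Rightarrow> real ^ 'n"
  assumes ev: "even m" and m4: "m \<ge> 4" and c: "c > 0" and t: "t \<ge> 0"
    and u0: "in_Lp 2 u0" "in_Lp 1 u0" and v: "in_Lp 2 v"
    and ae: "AE \<xi> in lborel. (norm (fourier_L2 v \<xi>))\<^sup>2 \<le> 4 * exp (- (c * rate m \<xi>) * t) * (norm (fourier_L2 u0 \<xi>))\<^sup>2"
    and \<kappa>: "\<kappa> = c / 2 ^ (2 * (m - 3))"
    and i: "integrable lborel (fourier_moment (k + l) u0)"
  shows "integrable lborel (fourier_moment k v)"
    "(\<integral>\<xi>. fourier_moment k v \<xi> \<partial>lborel)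
      \<le> 4 * exp \<kappa> * (real CARD('n) * Lp_norm 1 u0)\<^sup>2 * ((1 + t) powr (- (1 / real (3 * m - 10)) * (1 + 2 * real k))
            * (\<integral>\<xi>. low_profile \<kappa> (3 * m - 10) k \<xi> \<partial>lborel))
        + 4 * high_const \<kappa> l * (1 + t) powr (- (2 * real l / real (m - 2))) * (\<integral>\<xi>. fourier_moment (k + l) u0 \<xi> \<partial>lborel)"
proof -
  have \<kappa>0: "\<kappa> > 0" using c \<kappa> by simp
  have N: "3 * m - 10 \<ge> 2" and \<tau>: "1 + t \<ge> 1" using m4 t by simp_all
  define M where "M = real CARD('n) * Lp_norm 1 u0"
  have u01: "integrable lborel u0" using u0 by (simp add: in_L1_iff)
  have wM: "AE \<xi> in lborel. norm (fourier_L2 u0 \<xi>) \<le> M"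
    using fourier_L2_eq_fourier[OF u01 u0(1)]
  proof eventually_elim
    case (elim \<xi>)
    show ?case using norm_fourier_le[OF u01, of \<xi>] unfolding M_def Lp_norm_1 elim .
  qed
  define P where "P \<xi> = 4 * exp \<kappa> * M\<^sup>2 * low_profile (\<kappa> * (1 + t)) (3 * m - 10) k \<xi>" for \<xi>
  define Q where "Q \<xi> = 4 * high_const \<kappa> l * (1 + t) powr (- (2 * real l / real (m - 2))) * fourier_moment (k + l) u0 \<xi>" for \<xi>
  have iP: "integrable lborel P" unfolding P_def[abs_def] by (intro integrable_mult_right low_profile_scaling(1) \<kappa>0 N \<tau>)
  have iQ: "integrable lborel Q" unfolding Q_def[abs_def] by (intro integrable_mult_right i)
  have iPQ: "integrable lborel (\<lambda>\<xi>. P \<xi> + Q \<xi>)" by (intro Bochner_Integration.integrable_add iP iQ)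
  have b: "AE \<xi> in lborel. fourier_moment k v \<xi> \<le> P \<xi> + Q \<xi>"
    using ae wM
  proof eventually_elim
    case (elim \<xi>)
    show ?case unfolding fourier_moment_def P_def Q_def
      by (rule moment_decay_pointwise[OF ev m4 c t elim(1) norm_ge_zero elim(2) \<kappa>])
  qed
  have f0: "0 \<le> fourier_moment k v \<xi>" for \<xi> by (simp add: fourier_moment_def)
  show iv: "integrable lborel (fourier_moment k v)"
  proof (rule Bochner_Integration.integrable_bound[OF iPQ fourier_moment_measurable[OF v]])
    show "AE \<xi> in lborel. norm (fourier_moment k v \<xi>) \<le> norm (P \<xi> + Q \<xi>)"
      using b
    proof eventually_elim
      case (elim \<xi>)
      then show ?case using f0[of \<xi>] by simp
    qed
  qed
  have "(\<integral>\<xi>. fourier_moment k v \<xi> \<partial>lborel) \<le> (\<integral>\<xi>. P \<xi> + Q \<xi> \<partial>lborel)" by (rule integral_mono_AE[OF iv iPQ b])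
  also have "\<dots> = (\<integral>\<xi>. P \<xi> \<partial>lborel) + (\<integral>\<xi>. Q \<xi> \<partial>lborel)" by (rule Bochner_Integration.integral_add[OF iP iQ])
  also have "(\<integral>\<xi>. P \<xi> \<partial>lborel) = 4 * exp \<kappa> * M\<^sup>2 * ((1 + t) powr (- (1 / real (3 * m - 10)) * (1 + 2 * real k))
            * (\<integral>\<xi>. low_profile \<kappa> (3 * m - 10) k \<xi> \<partial>lborel))"
    unfolding P_def integral_mult_right_zero low_profile_scaling(2)[OF \<kappa>0 N \<tau>] ..
  also have "(\<integral>\<xi>. Q \<xi> \<partial>lborel) = 4 * high_const \<kappa> l * (1 + t) powr (- (2 * real l / real (m - 2))) * (\<integral>\<xi>. fourier_moment (k + l) u0 \<xi> \<partial>lborel)"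
    unfolding Q_def integral_mult_right_zero ..
  finally show "(\<integral>\<xi>. fourier_moment k v \<xi> \<partial>lborel)
      \<le> 4 * exp \<kappa> * (real CARD('n) * Lp_norm 1 u0)\<^sup>2 * ((1 + t) powr (- (1 / real (3 * m - 10)) * (1 + 2 * real k))
            * (\<integral>\<xi>. low_profile \<kappa> (3 * m - 10) k \<xi> \<partial>lborel))
        + 4 * high_const \<kappa> l * (1 + t) powr (- (2 * real l / real (m - 2))) * (\<integral>\<xi>. fourier_moment (k + l) u0 \<xi> \<partial>lborel)"
    unfolding M_def .
qed

text \<open>
  Insert the pointwise bound into the moment of order \<open>k\<close>, integrate, and take
  square roots.
\<close>

theorem sobolev_decay:
  fixes u0 v :: "real \<Rightarrow> real ^ 'n" and C :: real
  assumes ev: "even m" and m4: "m \<ge> 4" and c: "c > 0" and t: "t \<ge> 0"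
    and s: "sobolev s u0" and u01: "in_Lp 1 u0" and v: "in_Lp 2 v"
    and ae: "AE \<xi> in lborel. (norm (fourier_L2 v \<xi>))\<^sup>2 \<le> 4 * exp (- (c * rate m \<xi>) * t) * (norm (fourier_L2 u0 \<xi>))\<^sup>2"
    and \<kappa>: "\<kappa> = c / 2 ^ (2 * (m - 3))"
    and C: "C \<ge> 1" "\<And>k. k \<le> s \<Longrightarrow> 4 * exp \<kappa> * (real CARD('n))\<^sup>2 * (\<integral>\<xi>. low_profile \<kappa> (3 * m - 10) k \<xi> \<partial>lborel) \<le> C"
      "\<And>l. l \<le> s \<Longrightarrow> 4 * high_const \<kappa> l \<le> C"
  shows "sobolev s v"
    "k + l \<le> s \<Longrightarrow> Lp_norm 2 ((weak_deriv ^^ k) v)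
      \<le> C * (1 + t) powr (- (1 / (3 * real m - 10)) * (1 / 2 + real k)) * Lp_norm 1 u0
        + C * (1 + t) powr (- (real l / (real m - 2))) * Lp_norm 2 ((weak_deriv ^^ (k + l)) u0)"
proof -
  have u02: "in_Lp 2 u0" and iu: "integrable lborel (fourier_moment s u0)"
    using s unfolding sobolev_iff_fourier by simp_all
  note D = moment_decay[OF ev m4 c t u02 u01 v ae \<kappa>]
  have "integrable lborel (fourier_moment s v)" by (rule D(1)[where l = 0]) (simp add: iu)
  then show sv: "sobolev s v" unfolding sobolev_iff_fourier using v by simp
  assume kl: "k + l \<le> s"
  define \<alpha> where "\<alpha> = (1 + t) powr (- (1 / (3 * real m - 10)) * (1 / 2 + real k)) * Lp_norm 1 u0"
  define \<beta> where "\<beta> = (1 + t) powr (- (real l / (real m - 2))) * Lp_norm 2 ((weak_deriv ^^ (k + l)) u0)"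
  define G where "G = (\<integral>\<xi>. low_profile \<kappa> (3 * m - 10) k \<xi> \<partial>lborel)"
  have \<alpha>\<beta>: "0 \<le> \<alpha>" "0 \<le> \<beta>" by (simp_all add: \<alpha>_def \<beta>_def)
  have sq: "((1 + t) powr x)\<^sup>2 = (1 + t) powr (2 * x)" for x
    unfolding power2_eq_square powr_add[symmetric] by simp
  have rN: "real (3 * m - 10) = 3 * real m - 10" and rq: "real (m - 2) = real m - 2" using m4 by auto
  have \<alpha>2: "\<alpha>\<^sup>2 = (1 + t) powr (- (1 / real (3 * m - 10)) * (1 + 2 * real k)) * (Lp_norm 1 u0)\<^sup>2"
    unfolding \<alpha>_def power_mult_distrib sq rN by (simp add: algebra_simps)
  have \<beta>2: "2 * pi * \<beta>\<^sup>2 = (1 + t) powr (- (2 * real l / real (m - 2))) * (\<integral>\<xi>. fourier_moment (k + l) u0 \<xi> \<partial>lborel)"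
    unfolding \<beta>_def power_mult_distrib sq rq iterated_weak_deriv_norm[OF s kl, symmetric] by simp
  have C1: "4 * exp \<kappa> * (real CARD('n))\<^sup>2 * G \<le> C" unfolding G_def by (rule C(2)) (use kl in simp)
  have C2: "4 * high_const \<kappa> l \<le> C" by (rule C(3)) (use kl in simp)
  have "2 * pi * (Lp_norm 2 ((weak_deriv ^^ k) v))\<^sup>2 = (\<integral>\<xi>. fourier_moment k v \<xi> \<partial>lborel)"
    by (rule iterated_weak_deriv_norm[OF sv]) (use kl in simp)
  also have "\<dots> \<le> 4 * exp \<kappa> * (real CARD('n) * Lp_norm 1 u0)\<^sup>2 * ((1 + t) powr (- (1 / real (3 * m - 10)) * (1 + 2 * real k)) * G)
        + 4 * high_const \<kappa> l * (1 + t) powr (- (2 * real l / real (m - 2))) * (\<integral>\<xi>. fourier_moment (k + l) u0 \<xi> \<partial>lborel)"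
    unfolding G_def by (rule D(2)[OF fourier_moment_interpolate[OF u02 iu kl]])
  also have "\<dots> = 4 * exp \<kappa> * (real CARD('n))\<^sup>2 * G * \<alpha>\<^sup>2 + 4 * high_const \<kappa> l * (2 * pi * \<beta>\<^sup>2)"
    unfolding \<alpha>2 \<beta>2 power_mult_distrib by (simp only: mult_ac)
  also have "\<dots> \<le> C * \<alpha>\<^sup>2 + C * (2 * pi * \<beta>\<^sup>2)" by (intro add_mono mult_right_mono C1 C2) auto
  also have "C * \<alpha>\<^sup>2 \<le> C * (2 * pi * \<alpha>\<^sup>2)"
    using C(1) pi_ge_two mult_right_mono[of 1 "2 * pi" "\<alpha>\<^sup>2"] by (intro mult_left_mono) auto
  finally have "2 * pi * (Lp_norm 2 ((weak_deriv ^^ k) v))\<^sup>2 \<le> 2 * pi * (C * (\<alpha>\<^sup>2 + \<beta>\<^sup>2))" by (simp add: algebra_simps)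
  then have "(Lp_norm 2 ((weak_deriv ^^ k) v))\<^sup>2 \<le> C * (\<alpha>\<^sup>2 + \<beta>\<^sup>2)" by simp
  also have "\<dots> \<le> C\<^sup>2 * (\<alpha> + \<beta>)\<^sup>2"
  proof (rule mult_mono)
    show "C \<le> C\<^sup>2" using C(1) by (simp add: power2_eq_square)
    show "\<alpha>\<^sup>2 + \<beta>\<^sup>2 \<le> (\<alpha> + \<beta>)\<^sup>2" using \<alpha>\<beta> by (simp add: power2_sum)
  qed (use C(1) in auto)
  finally have "(Lp_norm 2 ((weak_deriv ^^ k) v))\<^sup>2 \<le> (C * (\<alpha> + \<beta>))\<^sup>2" unfolding power_mult_distrib .
  then have "Lp_norm 2 ((weak_deriv ^^ k) v) \<le> C * (\<alpha> + \<beta>)"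
    by (rule power2_le_imp_le) (use C(1) \<alpha>\<beta> in simp)
  then show "Lp_norm 2 ((weak_deriv ^^ k) v)
      \<le> C * (1 + t) powr (- (1 / (3 * real m - 10)) * (1 / 2 + real k)) * Lp_norm 1 u0
        + C * (1 + t) powr (- (real l / (real m - 2))) * Lp_norm 2 ((weak_deriv ^^ (k + l)) u0)"
    unfolding \<alpha>_def \<beta>_def by (simp only: distrib_left mult.assoc)
qed

section \<open>The decay theorem\<close>

lemma norm_le_of_sq_le:
  fixes W w r t :: real
  assumes "W\<^sup>2 \<le> 4 * exp (- (c * r) * t) * w\<^sup>2" "0 \<le> w"
  shows "W \<le> 2 * exp (- (c / 2) * r * t) * w"
proof (rule power2_le_imp_le)
  have "(exp (- (c / 2) * r * t))\<^sup>2 = exp (- (c * r) * t)" unfolding exp_double[symmetric] by simp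
  then show "W\<^sup>2 \<le> (2 * exp (- (c / 2) * r * t) * w)\<^sup>2" using assms(1) by (simp add: power_mult_distrib)
qed (use assms(2) in simp)

theorem theorem3p1:
  fixes m :: nat and \<gamma> :: real and a :: "nat \<Rightarrow> real"
    and A L :: "((real, 'n::{finite,linorder}) vec, 'n) vec"
  assumes m_def: "m = CARD('n)"
    and m_even: "even m" and m_ge: "m \<ge> 4"
    and gamma_pos: "\<gamma> > 0"
    and a_nz: "\<And>i. 4 \<le> i \<Longrightarrow> i \<le> m \<Longrightarrow> a i \<noteq> 0"
    and A_def: "A = matA a"
    and L_def: "L = matL \<gamma> a"
  shows
    "(\<exists>C>0. \<exists>c>0.
        (\<forall>u0 u. cauchy_solution 1 A L u0 u \<longrightarrow>
          (\<forall>t\<ge>0. \<forall>\<xi>.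
            norm (fourier (u t) \<xi>) \<le> C * exp (- c * rate m \<xi> * t) * norm (fourier u0 \<xi>))) \<and>
        (\<forall>u0 u. cauchy_solution 2 A L u0 u \<longrightarrow>
          (\<forall>t\<ge>0. AE \<xi> in lborel.
            norm (fourier_L2 (u t) \<xi>) \<le> C * exp (- c * rate m \<xi> * t) * norm (fourier_L2 u0 \<xi>)))) \<and>
     (\<forall>s. \<exists>C>0. \<forall>u0 u.
        sobolev s u0 \<and> in_Lp 1 u0 \<and> cauchy_solution 2 A L u0 u \<longrightarrow>
        (\<forall>t\<ge>0. sobolev s (u t) \<and>
          (\<forall>k l. k + l \<le> s \<longrightarrow>
            Lp_norm 2 ((weak_deriv ^^ k) (u t)) \<le>
              C * (1 + t) powr (- (1 / (3 * real m - 10)) * (1 / 2 + real k)) * Lp_norm 1 u0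
              + C * (1 + t) powr (- (real l / (real m - 2)))
                  * Lp_norm 2 ((weak_deriv ^^ (k + l)) u0))))"
proof -
  obtain K c where K: "K > 0" and c: "c > 0" and F: "forced_estimate A L K (\<lambda>\<xi>. c * rate m \<xi>)"
    using forced_energy_estimate[where a = a, OF m_def m_even m_ge gamma_pos a_nz]
    unfolding forced_estimate_def A_def L_def mult_minus_left[symmetric] by blast
  have c2: "c / 2 > 0" using c by simp
  have P1: "norm (fourier (u t) \<xi>) \<le> 2 * exp (- (c / 2) * rate m \<xi> * t) * norm (fourier u0 \<xi>)"
    if "cauchy_solution 1 A L u0 u" "t \<ge> 0" for u0 u t \<xi>
    by (rule norm_le_of_sq_le[OF pointwise_L1[OF that(1) F K that(2)]]) simp
  have P2: "AE \<xi> in lborel. norm (fourier_L2 (u t) \<xi>) \<le> 2 * exp (- (c / 2) * rate m \<xi> * t) * norm (fourier_L2 u0 \<xi>)"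
    if "cauchy_solution 2 A L u0 u" "t \<ge> 0" for u0 u t
    using pointwise_L2[OF that(1) F K that(2)]
  proof eventually_elim
    case (elim \<xi>)
    show ?case by (rule norm_le_of_sq_le[OF elim]) simp
  qed
  define \<kappa> where "\<kappa> = c / 2 ^ (2 * (m - 3))"
  have \<kappa>0: "\<kappa> > 0" using c by (simp add: \<kappa>_def)
  have decay: "\<exists>C>0. \<forall>u0 u. sobolev s u0 \<and> in_Lp 1 u0 \<and> cauchy_solution 2 A L u0 u \<longrightarrow>
        (\<forall>t\<ge>0. sobolev s (u t) \<and>
          (\<forall>k l. k + l \<le> s \<longrightarrow>
            Lp_norm 2 ((weak_deriv ^^ k) (u t)) \<le>
              C * (1 + t) powr (- (1 / (3 * real m - 10)) * (1 / 2 + real k)) * Lp_norm 1 u0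
              + C * (1 + t) powr (- (real l / (real m - 2)))
                  * Lp_norm 2 ((weak_deriv ^^ (k + l)) u0)))" for s
  proof -
    define lo where "lo k = 4 * exp \<kappa> * (real CARD('n))\<^sup>2 * (\<integral>\<xi>. low_profile \<kappa> (3 * m - 10) k \<xi> \<partial>lborel)" for k
    define hi where "hi l = 4 * high_const \<kappa> l" for l
    have lo: "0 \<le> lo k" for k
      unfolding lo_def by (intro mult_nonneg_nonneg Bochner_Integration.integral_nonneg) (auto simp: low_profile_def)
    have hi: "0 \<le> hi l" for l using \<kappa>0 by (simp add: hi_def high_const_def)
    \<comment> \<open>one constant for the finitely many orders \<open>k, l \<le> s\<close>\<close>
    define C where "C = 1 + (\<Sum>k\<le>s. lo k) + (\<Sum>l\<le>s. hi l)"
    have sums: "0 \<le> (\<Sum>k\<le>s. lo k)" "0 \<le> (\<Sum>l\<le>s. hi l)" by (intro sum_nonneg lo hi)+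
    have C1: "C \<ge> 1" using sums unfolding C_def by linarith
    have Clo: "lo k \<le> C" if "k \<le> s" for k
    proof -
      have "lo k \<le> (\<Sum>k\<le>s. lo k)" by (rule member_le_sum) (use that lo in auto)
      then show ?thesis using sums(2) unfolding C_def by linarith
    qed
    have Chi: "hi l \<le> C" if "l \<le> s" for l
    proof -
      have "hi l \<le> (\<Sum>l\<le>s. hi l)" by (rule member_le_sum) (use that hi in auto)
      then show ?thesis using sums(1) unfolding C_def by linarith
    qed
    show ?thesis
    proof (intro exI[of _ C] conjI allI impI; (elim conjE)?)
      show "C > 0" using C1 by linarith
    next
      fix u0 :: "real \<Rightarrow> (real, 'n) vec" and u t
      assume s: "sobolev s u0" and u01: "in_Lp 1 u0" and sol: "cauchy_solution 2 A L u0 u" and t: "t \<ge> (0::real)"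
      have v: "in_Lp 2 (u t)" using sol t unfolding cauchy_solution_def by simp
      note D = sobolev_decay[OF m_even m_ge c t s u01 v pointwise_L2[OF sol F K t] \<kappa>_def C1 Clo[unfolded lo_def] Chi[unfolded hi_def]]
      show "sobolev s (u t)" by (rule D(1))
      fix k l assume kl: "k + l \<le> s"
      show "Lp_norm 2 ((weak_deriv ^^ k) (u t)) \<le>
              C * (1 + t) powr (- (1 / (3 * real m - 10)) * (1 / 2 + real k)) * Lp_norm 1 u0
              + C * (1 + t) powr (- (real l / (real m - 2))) * Lp_norm 2 ((weak_deriv ^^ (k + l)) u0)"
        by (rule D(2)) (assumption | rule kl)+
    qed
  qed
  have pointwise: "\<exists>C>0. \<exists>c>0.
        (\<forall>u0 u. cauchy_solution 1 A L u0 u \<longrightarrow>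
          (\<forall>t\<ge>0. \<forall>\<xi>.
            norm (fourier (u t) \<xi>) \<le> C * exp (- c * rate m \<xi> * t) * norm (fourier u0 \<xi>))) \<and>
        (\<forall>u0 u. cauchy_solution 2 A L u0 u \<longrightarrow>
          (\<forall>t\<ge>0. AE \<xi> in lborel.
            norm (fourier_L2 (u t) \<xi>) \<le> C * exp (- c * rate m \<xi> * t) * norm (fourier_L2 u0 \<xi>)))"
    by (rule exI[of _ 2], intro conjI, simp, rule exI[of _ "c / 2"], intro conjI c2 allI impI)
      (simp_all only: P1 P2)
  show ?thesis by (intro conjI allI pointwise decay)
qed

end
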